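(* Consider the iterates of Algorithm SPSA1-A (described in the context), with $a_k=a/k^\alpha$ and $c_k=c/k^\gamma$ where $a,c,\alpha,\gamma>0$, and with noise satisfying $E[\varepsilon_k^{+}-\varepsilon_k^{-}\mid\mathscr{F}_k,\xi_k]=0$ almost surely for all $k$. Let $x^*\in\mathbb{R}^n$ and assume: (1) $a_k\to0$ and $c_k\to 0$ as $k\to\infty$; $\sum_k a_k=\infty$ and $\sum_k (a_k/c_k)^2<\infty$. (2) There exist $\delta>0$, $\alpha_0>0$, $\alpha_1>0$ such that for all $k$, $E|\varepsilon_k^{\pm}|^{2+\delta}\le\alpha_0$ and $E|f(\hat x_k\pm c_k\xi_k)|^{2+\delta}\le\alpha_1$. (3) $\sup_k\|\hat x_k\|<\infty$ almost surely. (4) $x^*$ is an asymptotically stable solution of the differential equation $d\phi(t)/dt=-g(\phi)$. (5) Let $D(x^* )=\{\phi_0:\lim_{t\to\infty}\phi(t|\phi_0)=x^*\}$, where $\phi(t|\phi_0)$ denotes the solution of the differential equation in (4) with initial condition $\phi_0$. There exists a compact set $S\subseteq D(x^* )$ such that $\hat x_k\in S$ infinitely often for almost all sample points. (6) There is an index $K<\infty$ and a constant $r>0$ such that $f^{(3)}(x)=\partial^3 f/(\partial x^T)^3$ is continuous and element-wise bounded in $\{x:\|x-\hat x_k\|<r\}$ for all $k\ge K$. (7) $\sigma^2$ is such that $E[(\varepsilon_k^{+}-\varepsilon_k^{-})^2\mid\mathscr{F}_k]\to\sigma^2$ almost surely as $k\to\infty$. (8) For sufficiently large $k$ and almost all $\omega$,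 the sequence $E[(\varepsilon_k^{+}-\varepsilon_k^{-})^2\mid\mathscr{F}_k,\ c_k\xi_k=\eta]$ is equicontinuous at $\eta=0$ and continuous with respect to $\eta$ in a compact, connected set containing $c_k\xi_k$ almost surely. (9) $\beta:=\alpha-2\gamma>0$ and $3\gamma-\alpha/2\ge0$. (10) $P$ is an orthogonal matrix with $PH(x^* )P^T=a^{-1}\,\mathrm{diag}(\lambda_1,\dots,\lambda_n)$; set $\beta_+=\beta$ if $\alpha=1$, in which case it is assumed that $\beta<2\min_i\lambda_i$, and $\beta_+=0$ if $\alpha<1$. Then $$k^{\beta/2}(\hat x_k-x^* )\stackrel{w}{\longrightarrow}\mathscr{N},\qquad k\to\infty,$$ where $\mathscr{N}$ is a Gaussian random vector with mean $E\mathscr{N}=\mu$ and covariance matrix $\mathrm{Cov}(\mathscr{N},\mathscr{N})=P^TMP$, with $$M=\tfrac14a^2c^{-2}\sigma^2\,\mathrm{diag}\left[(2\lambda_1-\beta_+)^{-1},\dots,(2\lambda_n-\beta_+)^{-1}\right],$$ $$\mu=\begin{cases}0, & 3\gamma-\alpha/2>0,\\ \left(aH(x^* )-\tfrac12\beta_+I\right)^{-1}T, & 3\gamma-\alpha/2=0,\end{cases}$$ and the $l$-th element of the vector $T$ is $$-\frac16ac^2\Bigg[f^{(3)}_{lll}(x^* )+3\sum_{\substack{i=1\\ i\ne l}}^nf^{(3)}_{iil}(x^* )\Bigg].$$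
   Context: Setting. $f:\mathbb{R}^n\to\mathbb{R}$ is differentiable with gradient $g$ and Hessian matrix $H$, and only noisy measurements of its values are available; $f^{(3)}_{ijl}$ denotes the third partial derivative of $f$ with respect to the $i$-th, $j$-th and $l$-th variables. $\|\cdot\|$ is the Euclidean norm, $I$ the identity matrix, $\stackrel{w}{\longrightarrow}$ denotes convergence in distribution, and $C_m^j$ denotes the binomial coefficient "$m$ choose $j$". Set $$\rho=\begin{cases} C_{n-1}^{n/2}\big/\left(2^{n-1}+\tfrac12 C_n^{n/2}\right), & n \text{ even},\\[2pt] C_{n-1}^{(n-1)/2}\big/2^{n-1}, & n\text{ odd}.\end{cases}$$ Algorithm SPSA1-A. Given an initial point and positive scalars $a_k,c_k$, for successive $k$ (run indefinitely; with $a_k=a/k^\alpha$, $c_k=c/k^\gamma$ these formulas are used for $k\ge1$): 1. Generate $\xi_k$ uniformly in $\{-1,1\}^n$, independently of $\hat x_0,\dots,\hat x_k$. 2. Measure $\widetilde f(\hat x_k\pm c_k\xi_k)=f(\hat x_k\pm c_k\xi_k)+\varepsilon_k^{\pm}$, where $\varepsilon_k^+,\varepsilon_k^-$ are real random measurement noises, and put $$\hat g_k=\frac{\widetilde f(\hat x_k+c_k\xi_k)-\widetilde f(\hat x_k-c_k\xi_k)}{2c_k}\,\xi_k^{-1},$$ where $\xi_k^{-1}$ is the vector of componentwise inverses of $\xi_k$. Put $\rho_k=\rho/\|\hat g_k\|_\infty$ (it is understood that $\hat g_k\neq 0$ almost surely, so that $\rho_k$ is defined). 3. Generate $\hat\xi_k$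 uniformly (conditionally on everything generated so far, in particular on $\hat x_k$ and $\hat g_k$) in the set $\{d\in\{-1,1\}^n:\ d^T\hat g_k\ge 0\}$. 4. Set $\hat x_{k+1}=\hat x_k-a_k\dfrac{\hat g_k+\hat\xi_k}{1+\rho_k}$. Here $\mathscr{F}_k=\{\hat x_0,\hat x_1,\dots,\hat x_k\}$ (conditioning on $\mathscr F_k$ means conditioning on these variables), and $\omega$ ranges over the sample space $\Omega$ generating the sequence $\hat x_1,\hat x_2,\dots$. *)

theory Defs
  imports "HOL-Analysis.Analysis" "HOL-Probability.Probability"
begin

definition partial_differentiable :: "'n::finite \<Rightarrow> (real^'n \<Rightarrow> real) \<Rightarrow> real^'n \<Rightarrow> bool" where
  "partial_differentiable i f x \<longleftrightarrow> (\<lambda>t. f (x + t *\<^sub>R axis i 1)) differentiable (at 0)"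

definition partial :: "'n::finite \<Rightarrow> (real^'n \<Rightarrow> real) \<Rightarrow> real^'n \<Rightarrow> real" where
  "partial i f x = deriv (\<lambda>t. f (x + t *\<^sub>R axis i 1)) 0"

definition gradient :: "(real^'n::finite \<Rightarrow> real) \<Rightarrow> real^'n \<Rightarrow> real^'n" where
  "gradient f x = (\<chi> i. partial i f x)"

definition hessian :: "(real^'n::finite \<Rightarrow> real) \<Rightarrow> real^'n \<Rightarrow> real^'n^'n" where
  "hessian f x = (\<chi> i j. partial j (partial i f) x)"

definition third_partial ::
  "(real^'n::finite \<Rightarrow> real) \<Rightarrow> 'n \<Rightarrow> 'n \<Rightarrow> 'n \<Rightarrow> real^'n \<Rightarrow> real" where
  "third_partial f i j l = partial l (partial j (partial i f))"

definition diag_matrix :: "('n::finite \<Rightarrow> real) \<Rightarrow> real^'n^'n" where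
  "diag_matrix d = (\<chi> i j. if i = j then d i else 0)"

definition ode_solution :: "(real^'n::finite \<Rightarrow> real^'n) \<Rightarrow> real set \<Rightarrow> (real \<Rightarrow> real^'n) \<Rightarrow> bool" where
  "ode_solution F J \<phi> \<longleftrightarrow> (\<forall>t\<in>J. (\<phi> has_vector_derivative F (\<phi> t)) (at t within J))"

text \<open>Solutions need not be unique when the field is not locally Lipschitz.  A point is attracted
  to \<open>xs\<close> if it starts some solution on the half line and every such solution tends to \<open>xs\<close>;
  under uniqueness this says that the solution exists on the half line and tends to \<open>xs\<close>.\<close>

definition attraction_domain :: "(real^'n::finite \<Rightarrow> real^'n) \<Rightarrow> real^'n \<Rightarrow> (real^'n) set" where
  "attraction_domain F xs =
    {p. (\<exists>\<phi>. ode_solution F {0..} \<phi> \<and> \<phi> 0 = p) \<and>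
        (\<forall>\<phi>. ode_solution F {0..} \<phi> \<and> \<phi> 0 = p \<longrightarrow> (\<phi> \<longlongrightarrow> xs) at_top)}"

text \<open>Stability is required of solutions on every compact time interval, so that solutions
  exploding in finite time are not ignored.\<close>

definition asymptotically_stable :: "(real^'n::finite \<Rightarrow> real^'n) \<Rightarrow> real^'n \<Rightarrow> bool" where
  "asymptotically_stable F xs \<longleftrightarrow>
    ode_solution F UNIV (\<lambda>t. xs) \<and>
    (\<forall>e>0. \<exists>d>0. \<forall>\<phi> T. T > 0 \<and> ode_solution F {0..T} \<phi> \<and> dist (\<phi> 0) xs < d \<longrightarrow>
        (\<forall>t\<in>{0..T}. dist (\<phi> t) xs < e)) \<and>
    (\<exists>d>0. ball xs d \<subseteq> attraction_domain F xs)"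

text \<open>A Gaussian law is one all of whose one-dimensional linear images are normal; \<open>s = 0\<close>
  covers the degenerate normal laws, i.e. point masses.\<close>

definition gaussian_law :: "(real^'n::finite) measure \<Rightarrow> bool" where
  "gaussian_law N \<longleftrightarrow> prob_space N \<and> sets N = sets borel \<and>
    (\<forall>u. \<exists>m s. s \<ge> 0 \<and>
      distr N borel (\<lambda>x. u \<bullet> x) =
        (if s = 0 then return borel m else density lborel (\<lambda>y. ennreal (normal_density m s y))))"

definition mean_vector :: "(real^'n::finite) measure \<Rightarrow> real^'n" where
  "mean_vector N = (\<chi> i. \<integral>x. x $ i \<partial>N)"

definition covariance_matrix :: "(real^'n::finite) measure \<Rightarrow> real^'n^'n" where
  "covariance_matrix N =
    (\<chi> i j. \<integral>x. (x $ i - mean_vector N $ i) * (x $ j - mean_vector N $ j) \<partial>N)"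

definition weak_conv_vec :: "(nat \<Rightarrow> (real^'n::finite) measure) \<Rightarrow> (real^'n) measure \<Rightarrow> bool" where
  "weak_conv_vec Ns N \<longleftrightarrow>
    (\<forall>h :: real^'n \<Rightarrow> real. continuous_on UNIV h \<and> bounded (range h) \<longrightarrow>
      (\<lambda>k. \<integral>x. h x \<partial>(Ns k)) \<longlonglongrightarrow> (\<integral>x. h x \<partial>N))"

definition cube :: "(real^'n::finite) set" where
  "cube = {v. \<forall>i. v $ i \<in> {-1, 1}}"

text \<open>The common value of \<open>E d\<^sub>i\<close> for \<open>d\<close> uniform on the sign vectors with nonnegative coordinate sum.\<close>

definition spsa_rho :: "nat \<Rightarrow> real" where
  "spsa_rho n =
    (if even n
     then real ((n - 1) choose (n div 2)) / (2 ^ (n - 1) + real (n choose (n div 2)) / 2)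
     else real ((n - 1) choose ((n - 1) div 2)) / 2 ^ (n - 1))"

definition sigma_iter :: "'s measure \<Rightarrow> (nat \<Rightarrow> 's \<Rightarrow> real^'n::finite) \<Rightarrow> nat \<Rightarrow> 's measure" where
  "sigma_iter M X k =
    vimage_algebra (space M) (\<lambda>\<omega>. \<lambda>j\<in>{..k}. X j \<omega>) (\<Pi>\<^sub>M j\<in>{..k}. borel)"

definition sigma_iter_dir ::
  "'s measure \<Rightarrow> (nat \<Rightarrow> 's \<Rightarrow> real^'n::finite) \<Rightarrow> (nat \<Rightarrow> 's \<Rightarrow> real^'n) \<Rightarrow> nat \<Rightarrow> 's measure" where
  "sigma_iter_dir M X \<xi> k =
    vimage_algebra (space M) (\<lambda>\<omega>. (\<lambda>j\<in>{..k}. X j \<omega>, \<xi> k \<omega>)) ((\<Pi>\<^sub>M j\<in>{..k}. borel) \<Otimes>\<^sub>M borel)"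

text \<open>All that is generated before the second direction \<open>\<xi>' k\<close> is drawn; the gradient estimate at \<open>k\<close> is a
  function of these variables.\<close>

definition sigma_past ::
  "'s measure \<Rightarrow> (nat \<Rightarrow> 's \<Rightarrow> real^'n::finite) \<Rightarrow> (nat \<Rightarrow> 's \<Rightarrow> real^'n) \<Rightarrow>
   (nat \<Rightarrow> 's \<Rightarrow> real) \<Rightarrow> (nat \<Rightarrow> 's \<Rightarrow> real) \<Rightarrow> (nat \<Rightarrow> 's \<Rightarrow> real^'n) \<Rightarrow> nat \<Rightarrow> 's measure" where
  "sigma_past M X \<xi> ep em \<xi>' k =
    vimage_algebra (space M)
      (\<lambda>\<omega>. (\<lambda>j\<in>{..k}. X j \<omega>, \<lambda>j\<in>{..k}. \<xi> j \<omega>,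
            \<lambda>j\<in>{..k}. ep j \<omega>, \<lambda>j\<in>{..k}. em j \<omega>, \<lambda>j\<in>{..<k}. \<xi>' j \<omega>))
      ((\<Pi>\<^sub>M j\<in>{..k}. borel) \<Otimes>\<^sub>M (\<Pi>\<^sub>M j\<in>{..k}. borel) \<Otimes>\<^sub>M (\<Pi>\<^sub>M j\<in>{..k}. borel) \<Otimes>\<^sub>M
       (\<Pi>\<^sub>M j\<in>{..k}. borel) \<Otimes>\<^sub>M (\<Pi>\<^sub>M j\<in>{..<k}. borel))"

definition grad_estimate ::
  "(real^'n::finite \<Rightarrow> real) \<Rightarrow> (nat \<Rightarrow> real) \<Rightarrow> (nat \<Rightarrow> 's \<Rightarrow> real^'n) \<Rightarrow> (nat \<Rightarrow> 's \<Rightarrow> real^'n) \<Rightarrow>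
   (nat \<Rightarrow> 's \<Rightarrow> real) \<Rightarrow> (nat \<Rightarrow> 's \<Rightarrow> real) \<Rightarrow> nat \<Rightarrow> 's \<Rightarrow> real^'n" where
  "grad_estimate f c X \<xi> ep em k \<omega> =
    (((f (X k \<omega> + c k *\<^sub>R \<xi> k \<omega>) + ep k \<omega>) - (f (X k \<omega> - c k *\<^sub>R \<xi> k \<omega>) + em k \<omega>)) / (2 * c k))
      *\<^sub>R (\<chi> i. inverse (\<xi> k \<omega> $ i))"

locale spsa1a = prob_space M
  for M :: "'s measure" +
  fixes f :: "real^'n::finite \<Rightarrow> real"
    and a c :: "nat \<Rightarrow> real"
    and X \<xi> :: "nat \<Rightarrow> 's \<Rightarrow> real^'n"
    and ep em :: "nat \<Rightarrow> 's \<Rightarrow> real"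
    and \<xi>' :: "nat \<Rightarrow> 's \<Rightarrow> real^'n"
  assumes gains_pos: "\<And>k. a k > 0" "\<And>k. c k > 0"
    and rv: "\<And>k. X k \<in> borel_measurable M" "\<And>k. \<xi> k \<in> borel_measurable M"
      "\<And>k. ep k \<in> borel_measurable M" "\<And>k. em k \<in> borel_measurable M"
      "\<And>k. \<xi>' k \<in> borel_measurable M"
    and direction_uniform:
      "\<And>k v. v \<in> cube \<Longrightarrow> prob {\<omega> \<in> space M. \<xi> k \<omega> = v} = 1 / real (card (cube :: (real^'n) set))"
    and direction_indep:
      "\<And>k. indep_set (sets (sigma_iter M X k)) (sets (vimage_algebra (space M) (\<xi> k) borel))"
    and estimate_nonzero: "\<And>k. AE \<omega> in M. grad_estimate f c X \<xi> ep em k \<omega> \<noteq> 0"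
    and second_direction_uniform:
      "\<And>k d. AE \<omega> in M.
        real_cond_exp M (sigma_past M X \<xi> ep em \<xi>' k) (indicator {\<omega> \<in> space M. \<xi>' k \<omega> = d}) \<omega> =
        (let A = {v \<in> cube. v \<bullet> grad_estimate f c X \<xi> ep em k \<omega> \<ge> 0}
         in if d \<in> A then 1 / real (card A) else 0)"
    and update: "\<And>k. AE \<omega> in M.
        X (Suc k) \<omega> =
          X k \<omega> - (a k / (1 + spsa_rho CARD('n) / infnorm (grad_estimate f c X \<xi> ep em k \<omega>)))
            *\<^sub>R (grad_estimate f c X \<xi> ep em k \<omega> + \<xi>' k \<omega>)"

end

theory Submission
  imports Defs "HOL-Real_Asymp.Real_Asymp"
begin

text \<open>One step of the algorithm is a stochastic gradient step in disguise.  The estimate \<open>ghat\<close> is a number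
\<open>slope\<close> times the sign vector \<open>\<xi> k\<close>.  Given the past, \<open>\<xi>' k\<close> is uniform on the half of the cube that faces
\<open>ghat\<close> and has mean \<open>spsa_rho\<close> times \<open>sgn slope\<close> times \<open>\<xi> k\<close> (\<open>half_cube_mean\<close>).  So \<open>ghat + \<xi>' k\<close> has mean
\<open>(\<bar>slope\<bar> + spsa_rho) * sgn slope\<close> times \<open>\<xi> k\<close>, and division by \<open>1 + spsa_rho / \<bar>slope\<bar>\<close> returns \<open>ghat\<close> (\<open>increment\<close>).
Hence \<open>X (k+1) = X k - a k (mean_step k + err k)\<close>, where \<open>mean_step k\<close> averages the symmetric difference
quotients of \<open>f\<close> over the cube and differs from the gradient by about \<open>(c k)^2\<close> times a vector of third
derivatives (\<open>spsa_mean_bias_limit\<close>), and where \<open>err k\<close> is centred given \<open>X 0, ..., X k\<close> (\<open>err_centred\<close>).  The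
vectors \<open>c k err k\<close> have bounded moments of an order above 2, and their conditional covariance is
asymptotically \<open>\<sigma>^2 / 4\<close> times the identity (\<open>err_moment\<close>, \<open>err_variance\<close>).

Consistency.  The martingale with increments \<open>a k err k\<close> converges almost surely, so that almost every path,
shifted by the tail of this series, is an Euler scheme for the gradient flow with vanishing perturbation.
The scheme tracks the solution that starts at one of its limit points in \<open>S\<close>
(\<open>euler_scheme_tracks_solution\<close>) and so returns to every neighbourhood of \<open>xs\<close>.  There it is trapped
(\<open>euler_scheme_absorbed\<close>) because the Hessian at \<open>xs\<close> is positive definite: it is nonnegative since \<open>f\<close> decreases
along the flow, and the assumptions under which the limiting variances exist exclude the eigenvalue zero.

Limit law.  In the eigenbasis of the Hessian, \<open>W k = k^(\<beta>/2) P (X k - xs)\<close> satisfies a linear recursion whose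
\<open>i\<close>-th coordinate contracts at rate \<open>\<kappa> i\<close> per unit of \<open>h k = k^(-\<alpha>)\<close>, with a drift \<open>h k T\<close>, a noise of variance
\<open>h k v\<close>, and a remainder that is small compared with \<open>W k\<close>.  Up to \<open>o(h k)\<close>, one step acts on the characteristic
function by \<open>u \<mapsto> \<phi> (B u) exp (h (i u T - v u^2 / 2))\<close>.  The Gaussian characteristic function with means \<open>T i / \<kappa> i\<close>
and variances \<open>v / (2 \<kappa> i)\<close> is invariant under this action up to \<open>o(h k)\<close>, and the distance to it, measured by
the supremum of \<open>\<bar>difference\<bar> / \<bar>u\<bar>\<close> over a ball, contracts by a factor \<open>1 - p h k\<close>.  As the sum of the \<open>h k\<close> diverges,
the distance tends to zero (\<open>charfun_limit\<close>).  Together with bounded second moments and the continuity theorem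
(\<open>levy_continuity_vec\<close>) this is convergence in law.  Since nothing is known about moments of \<open>X k\<close>, and the
linearisation holds near \<open>xs\<close> only, the recursion is applied to a process \<open>U\<close> from which the nonlinear terms are
removed after the iterates leave a small ball; it agrees with \<open>X k - xs\<close> outside an event of small probability.\<close>

section \<open>Measurability of vectors and real recursions\<close>

lemma borel_measurable_vec_nth [measurable (raw)]:
 fixes f :: "'a => real^'n::finite"
 assumes "f \<in> borel_measurable M"
 shows "(%x. f x $ i) \<in> borel_measurable M"
proof -
 have "(%v::real^'n. v $ i) \<in> borel_measurable borel"
  by (intro borel_measurable_continuous_onI continuous_intros)
 from measurable_compose[OF assms this] show ?thesis .
qed

lemma borel_measurable_vec_lambda [measurable (raw)]:
 fixes f :: "'n::finite => 'a => real"
 assumes "!!i. f i \<in> borel_measurable M"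
 shows "(%x. \<chi> i. f i x) \<in> borel_measurable M"
proof -
 have "(%x. \<chi> i. f i x) = (%x. \<Sum>i\<in>UNIV. f i x *\<^sub>R axis i 1)"
  by (auto simp: vec_eq_iff sum_component axis_def if_distrib cong: if_cong)
 moreover have "(%x. \<Sum>i\<in>UNIV. f i x *\<^sub>R (axis i 1 :: real^'n)) \<in> borel_measurable M"
  using assms by measurable
 ultimately show ?thesis by simp
qed

lemma nonsummable_partial_sums:
 fixes p :: "nat => real"
 assumes "!!n. n >= N ==> 0 <= p n" "\<not> summable p"
 shows "filterlim (%m. \<Sum>j<m. p (N + j)) at_top sequentially"
proof -
 have ns: "\<not> summable (%j. p (N + j))"
  using assms(2) summable_iff_shift[of p N] by (simp add: add.commute)
 show ?thesis
 proof (rule filterlim_at_top_mono[OF _ always_eventually])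
  show "filterlim (%m. \<Sum>j<m. p (N + j)) at_top sequentially"
   unfolding filterlim_at_top
  proof
   fix Z :: real
   have "\<exists>m. Z < (\<Sum>j<m. p (N + j))"
   proof (rule ccontr)
    assume "\<nexists>m. Z < (\<Sum>j<m. p (N + j))"
    hence "!!m. (\<Sum>j<m. p (N + j)) <= Z" by (simp add: not_less)
    hence "summable (%j. p (N + j))"
     using assms(1) by (intro summableI_nonneg_bounded[where x = Z]) auto
    with ns show False by simp
   qed
   then obtain m where m: "Z < (\<Sum>j<m. p (N + j))" by blast
   have "Z <= (\<Sum>j<m'. p (N + j))" if "m' >= m" for m'
   proof -
    have "(\<Sum>j<m. p (N + j)) <= (\<Sum>j<m'. p (N + j))"
     by (rule sum_mono2) (use that assms(1) in auto)
    with m show ?thesis by simp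
   qed
   thus "\<forall>\<^sub>F m in sequentially. Z <= (\<Sum>j<m. p (N + j))"
    unfolding eventually_sequentially by blast
  qed
 qed simp
qed

text \<open>A Robbins--Monro type comparison: past contributions are damped by products of \<open>1 - p n\<close>, which tend to zero
since \<open>p\<close> is not summable, while each new contribution is a convex combination with the vanishing \<open>d n\<close>.\<close>

lemma contraction_limit:
 fixes z p d :: "nat => real"
 assumes step: "!!n. n >= N ==> z (Suc n) <= (1 - p n) * z n + p n * d n"
  and p: "!!n. n >= N ==> 0 <= p n \<and> p n <= 1" "\<not> summable p"
  and d: "d \<longlonglongrightarrow> 0"
  and nonneg: "!!n. n >= N ==> 0 <= z n"
 shows "z \<longlonglongrightarrow> 0"
proof (rule LIMSEQ_I)
 fix e :: real assume "e > 0"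
 define e' where "e' = e / 2"
 have e': "e' > 0" using \<open>e > 0\<close> by (simp add: e'_def)
 from d e' have "\<forall>\<^sub>F n in sequentially. d n < e'"
  by (auto dest: order_tendstoD)
 then obtain N1 where N1: "!!n. n >= N1 ==> d n < e'"
  unfolding eventually_sequentially by blast
 define K where "K = max N N1"
 define x where "x n = max (z n - e') 0" for n
 have xs: "x (Suc n) <= (1 - p n) * x n" if "n >= K" for n
 proof -
  have n: "n >= N" "n >= N1" using that by (auto simp: K_def)
  have "p n * d n <= p n * e'" using p(1)[OF n(1)] N1[OF n(2)] by (intro mult_left_mono) auto
  hence "z (Suc n) - e' <= (1 - p n) * (z n - e')"
   using step[OF n(1)] by (simp add: algebra_simps)
  also have "... <= (1 - p n) * x n"
   using p(1)[OF n(1)] by (intro mult_left_mono) (auto simp: x_def)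
  finally have "z (Suc n) - e' <= (1 - p n) * x n" .
  moreover have "0 <= (1 - p n) * x n" using p(1)[OF n(1)] by (simp add: x_def)
  ultimately show ?thesis by (simp add: x_def)
 qed
 have xb: "x (K + m) <= x K * exp (- (\<Sum>j<m. p (K + j)))" for m
 proof (induction m)
  case (Suc m)
  have "x (K + Suc m) <= (1 - p (K + m)) * x (K + m)" using xs[of "K + m"] by simp
  also have "... <= exp (- p (K + m)) * (x K * exp (- (\<Sum>j<m. p (K + j))))"
   using Suc exp_ge_add_one_self[of "- p (K + m)"] p(1)[of "K + m"]
   by (intro mult_mono) (auto simp: x_def K_def)
  also have "... = x K * exp (- (\<Sum>j<Suc m. p (K + j)))"
   by (simp add: exp_add[symmetric] algebra_simps mult_exp_exp)
  finally show ?case .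
 qed simp
 have "filterlim (%m. \<Sum>j<m. p (K + j)) at_top sequentially"
  by (rule nonsummable_partial_sums) (use p in \<open>auto simp: K_def\<close>)
 hence "(%m. exp (- (\<Sum>j<m. p (K + j)))) \<longlonglongrightarrow> 0"
  by (rule filterlim_compose[OF exp_at_bot, unfolded o_def, OF filterlim_compose[OF filterlim_uminus_at_bot_at_top]])
 hence "(%m. x K * exp (- (\<Sum>j<m. p (K + j)))) \<longlonglongrightarrow> x K * 0"
  by (rule tendsto_mult_left)
 hence "\<forall>\<^sub>F m in sequentially. x K * exp (- (\<Sum>j<m. p (K + j))) < e'"
  using e' by (auto dest: order_tendstoD)
 then obtain m0 where m0: "!!m. m >= m0 ==> x K * exp (- (\<Sum>j<m. p (K + j))) < e'"
  unfolding eventually_sequentially by blast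
 show "\<exists>no. \<forall>n\<ge>no. norm (z n - 0) < e"
 proof (intro exI allI impI)
  fix n assume n: "n >= K + m0"
  hence "m0 <= n - K" by simp
  hence "x n < e'" using n xb[of "n - K"] m0[of "n - K"] by simp
  hence "z n - e' < e'" by (simp add: x_def)
  hence "z n < e" by (simp add: e'_def)
  moreover have "0 <= z n" using nonneg n by (simp add: K_def)
  ultimately show "norm (z n - 0) < e" by simp
 qed
qed

lemma contraction_bounded:
 fixes z p :: "nat => real"
 assumes "!!n. n >= N ==> z (Suc n) <= (1 - p n) * z n + p n * C"
  and "!!n. n >= N ==> 0 <= p n \<and> p n <= 1"
  and "n >= N"
 shows "z n <= max (z N) C"
 using assms(3)
proof (induction n rule: dec_induct)
 case (step n)
 have "z (Suc n) <= (1 - p n) * z n + p n * C" using assms(1) step by simp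
 also have "... <= (1 - p n) * max (z N) C + p n * max (z N) C"
  using assms(2)[of n] step by (intro add_mono mult_left_mono) auto
 finally show ?case by (simp add: algebra_simps)
qed simp

text \<open>The expansion of \<open>((n + 1) / n)^b\<close> is \<open>1 + b / n\<close>; multiplied by \<open>n^\<alpha>\<close>, the term \<open>b / n\<close> survives only if
\<open>\<alpha> = 1\<close>.  This is the origin of the correction \<open>\<beta>p\<close> to the eigenvalues.\<close>

lemma step_factor_asymptotics:
 fixes \<alpha> b l :: real
 assumes "0 < \<alpha>" "\<alpha> <= 1"
 shows "(%n. real n powr \<alpha> * (1 - (real (Suc n) / real n) powr b * (1 - l * real n powr (- \<alpha>))))
  \<longlonglongrightarrow> l - (if \<alpha> = 1 then b else 0)"
proof (cases "\<alpha> = 1")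
 case True
 show ?thesis unfolding True by simp real_asymp
next
 case False
 hence "\<alpha> < 1" using assms by simp
 thus ?thesis using assms(1) by simp real_asymp
qed

lemma ratio_asymptotics:
 fixes b :: real
 shows "(%n. (real (Suc n) / real n) powr b) \<longlonglongrightarrow> 1"
 by simp real_asymp

lemma powr_not_summable:
 fixes \<alpha> c :: real
 assumes "\<alpha> <= 1" "c > 0"
 shows "\<not> summable (%n. c * real n powr (- \<alpha>))"
proof
 assume "summable (%n. c * real n powr (- \<alpha>))"
 hence "summable (%n. real n powr (- \<alpha>))" using assms by simp
 thus False using assms summable_real_powr_iff[of "-\<alpha>"] by simp
qed

section \<open>Euler schemes and their flow\<close>

text \<open>One Euler step of size \<open>h\<close> misses the solution by \<open>h\<close> times the oscillation of the field along the step.\<close>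

lemma euler_step_remainder:
 fixes \<phi> g :: "_ => 'a::euclidean_space"
 assumes sol: "!!t. t >= 0 ==> (\<phi> has_vector_derivative - g (\<phi> t)) (at t within {0..})"
  and t: "0 <= t" "0 <= h"
  and osc: "!!s. t <= s ==> s <= t + h ==> norm (g (\<phi> s) - g (\<phi> t)) <= \<tau>"
 shows "norm (\<phi> (t + h) - (\<phi> t - h *\<^sub>R g (\<phi> t))) <= h * \<tau>"
proof -
 have "norm (\<phi> (t + h) - \<phi> t - (t + h - t) *\<^sub>R (- g (\<phi> t))) <= norm (t + h - t) * \<tau>"
 proof (rule vector_differentiable_bound_linearization[where S = "{t..t + h}"])
  fix s assume s: "s \<in> {t..t + h}"
  show "(\<phi> has_vector_derivative - g (\<phi> s)) (at s within {t..t + h})"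
   by (rule has_vector_derivative_within_subset[OF sol]) (use s t in auto)
  show "norm (- g (\<phi> s) - (- g (\<phi> t))) <= \<tau>"
   using osc[of s] s by (simp add: norm_minus_commute)
 qed (use t in \<open>auto simp: closed_segment_eq_real_ivl\<close>)
 thus ?thesis using t by (simp add: algebra_simps)
qed

text \<open>A discrete Gronwall argument on the time interval from 0 to \<open>T\<close>, started at an index where \<open>y k\<close> is close to
\<open>\<phi> 0\<close>.  The Lipschitz bound is required only near the iterates: the induction keeps the solution within \<open>r\<close> of them.\<close>

lemma euler_scheme_tracks_solution:
 fixes y b :: "nat => 'a::euclidean_space" and g :: "'a => 'a" and \<phi> :: "real => 'a"
 assumes step: "!!k. k >= K ==> y (Suc k) = y k - a k *\<^sub>R (g (y k) + b k)"
  and a: "!!k. a k > 0" "a \<longlonglongrightarrow> 0" "\<not> summable a"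
  and b: "b \<longlonglongrightarrow> 0"
  and r: "r > 0" and lip: "!!k. k >= K ==> L-lipschitz_on (cball (y k) r) g"
  and g: "continuous_on UNIV g"
  and sol: "!!t. t >= 0 ==> (\<phi> has_vector_derivative - g (\<phi> t)) (at t within {0..})"
  and start: "!!e. e > 0 ==> \<exists>\<^sub>\<infinity>k. dist (y k) (\<phi> 0) < e"
  and T: "T >= 0" and e: "e > 0"
 shows "\<exists>\<^sub>\<infinity>k. dist (y k) (\<phi> T) < e"
proof -
 have L: "L >= 0" using lip[of K] lipschitz_on_nonneg by blast
 define e' where "e' = min e r"
 have e': "e' > 0" "e' <= e" "e' <= r" using e r by (auto simp: e'_def)
 \<comment> \<open>the Gronwall factor exp (L T) turns the initial error d0 and local errors of 2 \<tau> per unit of time into less than half of the tolerance\<close>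
 define d0 where "d0 = e' / (8 * exp (L * T))"
 define \<tau> where "\<tau> = e' / (16 * exp (L * T) * (T + 1))"
 have pos: "d0 > 0" "\<tau> > 0" using e' T by (auto simp: d0_def \<tau>_def)
 have small: "exp (L * t) * (d0 + 2 * \<tau> * t) < e' / 2" if "0 <= t" "t <= T" for t
 proof -
  have "exp (L * t) * (d0 + 2 * \<tau> * t) <= exp (L * T) * (d0 + 2 * \<tau> * (T + 1))"
   using that L pos by (intro mult_mono add_mono) (auto intro: mult_left_mono)
  also have "... = exp (L * T) * d0 + 2 * (exp (L * T) * (T + 1) * \<tau>)" by (simp add: algebra_simps)
  also have "exp (L * T) * d0 = e' / 8" by (simp add: d0_def)
  also have "exp (L * T) * (T + 1) * \<tau> = e' / 16"
  proof -
   have gen: "u * w * (e' / (16 * u * w)) = e' / 16" if "u \<noteq> 0" "w \<noteq> 0" for u w :: real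
    using that by simp
   show ?thesis unfolding \<tau>_def by (rule gen) (use T in auto)
  qed
  finally have "exp (L * t) * (d0 + 2 * \<tau> * t) <= e' / 8 + 2 * (e' / 16)" .
  thus ?thesis using e' by simp
 qed
 have cphi: "continuous_on {0..} \<phi>"
  unfolding continuous_on_eq_continuous_within
  using has_vector_derivative_continuous[OF sol] by auto
 have c1: "continuous_on {0..T + 1} \<phi>" by (rule continuous_on_subset[OF cphi]) auto
 have c2: "continuous_on {0..T + 1} (%t. g (\<phi> t))"
  by (rule continuous_on_compose2[OF g c1]) auto
 have u1: "uniformly_continuous_on {0..T + 1} \<phi>"
  by (rule compact_uniformly_continuous[OF c1]) simp
 have u2: "uniformly_continuous_on {0..T + 1} (%t. g (\<phi> t))"
  by (rule compact_uniformly_continuous[OF c2]) simp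
 from u1 e' obtain h1 where h1: "h1 > 0"
   "!!s t. s \<in> {0..T + 1} ==> t \<in> {0..T + 1} ==> dist s t < h1 ==> dist (\<phi> s) (\<phi> t) < e' / 2"
  unfolding uniformly_continuous_on_def by (metis half_gt_zero)
 from u2 pos obtain h0 where h0: "h0 > 0"
   "!!s t. s \<in> {0..T + 1} ==> t \<in> {0..T + 1} ==> dist s t < h0 ==> dist (g (\<phi> s)) (g (\<phi> t)) < \<tau>"
  unfolding uniformly_continuous_on_def by metis
 have "\<forall>\<^sub>F k in sequentially. a k < min (min h0 h1) 1"
  using h0(1) h1(1) by (intro order_tendstoD(2)[OF a(2)]) auto
 moreover have "\<forall>\<^sub>F k in sequentially. norm (b k) < \<tau>"
  using tendsto_norm_zero[OF b] pos by (auto dest: order_tendstoD)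
 ultimately have "\<forall>\<^sub>F k in sequentially. a k < min (min h0 h1) 1 \<and> norm (b k) < \<tau>"
  by eventually_elim auto
 then obtain M where M: "!!k. k >= M ==> a k < min (min h0 h1) 1" "!!k. k >= M ==> norm (b k) < \<tau>"
  unfolding eventually_sequentially by blast
 show ?thesis
  unfolding INFM_nat_le
 proof
  fix N0
  have "\<exists>m\<ge>max (max M N0) K. dist (y m) (\<phi> 0) < d0"
   using start[OF pos(1)] unfolding INFM_nat_le by blast
  then obtain m where m: "m >= M" "m >= N0" "m >= K" "dist (y m) (\<phi> 0) < d0" by auto
  define t where "t j = (\<Sum>i<j. a (m + i))" for j
  have t0: "t 0 = 0" and tS: "t (Suc j) = t j + a (m + j)" for j by (auto simp: t_def)
  have tn: "t j >= 0" for j unfolding t_def by (intro sum_nonneg) (simp add: a(1) less_imp_le)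
  have err: "t j <= T ==> dist (y (m + j)) (\<phi> (t j)) <= exp (L * t j) * (d0 + 2 * \<tau> * t j)" for j
  proof (induction j)
   case 0
   thus ?case using m by (simp add: t0)
  next
   case (Suc j)
   define h where "h = a (m + j)"
   have h: "0 < h" "h < h0" "h < 1" using a(1)[of "m + j"] M(1)[of "m + j"] m by (auto simp: h_def)
   have tj: "t j <= T" using Suc(2) h by (simp add: tS h_def)
   note IH = Suc(1)[OF tj]
   have "dist (y (m + j)) (\<phi> (t j)) < r" using IH small[OF tn tj] e' by linarith
   hence l: "dist (g (y (m + j))) (g (\<phi> (t j))) <= L * dist (y (m + j)) (\<phi> (t j))"
    using r by (intro lipschitz_onD[OF lip[of "m + j"]]) (use m in auto)
   have rem: "norm (\<phi> (t j + h) - (\<phi> (t j) - h *\<^sub>R g (\<phi> (t j)))) <= h * \<tau>"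
   proof (rule euler_step_remainder[OF sol])
    fix s assume s: "t j <= s" "s <= t j + h"
    have "dist (g (\<phi> s)) (g (\<phi> (t j))) < \<tau>"
     by (rule h0(2)) (use s tn[of j] tj h in \<open>auto simp: dist_real_def\<close>)
    thus "norm (g (\<phi> s) - g (\<phi> (t j))) <= \<tau>" by (simp add: dist_norm)
   qed (use tn h in auto)
   have split: "y (m + Suc j) - \<phi> (t (Suc j)) =
     (y (m + j) - \<phi> (t j)) - h *\<^sub>R (g (y (m + j)) - g (\<phi> (t j))) - h *\<^sub>R b (m + j)
      - (\<phi> (t j + h) - (\<phi> (t j) - h *\<^sub>R g (\<phi> (t j))))"
    using step[of "m + j"] m by (simp add: tS h_def algebra_simps)
   let ?D = "dist (y (m + j)) (\<phi> (t j))"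
   have tri: "norm (A - B - C - D) <= norm A + norm B + norm C + norm D" for A B C D :: 'a
    using norm_triangle_ineq4[of "A - B - C" D] norm_triangle_ineq4[of "A - B" C]
     norm_triangle_ineq4[of A B] by linarith
   have n1: "norm (h *\<^sub>R (g (y (m + j)) - g (\<phi> (t j)))) <= h * (L * ?D)"
    using l h by (simp add: dist_norm mult_left_mono)
   have n2: "norm (h *\<^sub>R b (m + j)) <= h * \<tau>"
    using M(2)[of "m + j"] m h by (simp add: mult_left_mono)
   have "dist (y (m + Suc j)) (\<phi> (t (Suc j))) = norm (y (m + Suc j) - \<phi> (t (Suc j)))"
    by (rule dist_norm)
   also have "... <= ?D + norm (h *\<^sub>R (g (y (m + j)) - g (\<phi> (t j)))) + norm (h *\<^sub>R b (m + j))
     + norm (\<phi> (t j + h) - (\<phi> (t j) - h *\<^sub>R g (\<phi> (t j))))"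
    unfolding split dist_norm by (rule tri)
   also have "... <= ?D + h * (L * ?D) + h * \<tau> + h * \<tau>"
    using n1 n2 rem by (intro add_mono) auto
   also have "... = (1 + h * L) * ?D + 2 * \<tau> * h" by (simp add: algebra_simps)
   also have "... <= exp (h * L) * (exp (L * t j) * (d0 + 2 * \<tau> * t j))
     + exp (L * t (Suc j)) * (2 * \<tau> * h)"
   proof (rule add_mono)
    show "(1 + h * L) * ?D <= exp (h * L) * (exp (L * t j) * (d0 + 2 * \<tau> * t j))"
     using IH by (intro mult_mono exp_ge_add_one_self) auto
    show "2 * \<tau> * h <= exp (L * t (Suc j)) * (2 * \<tau> * h)"
     using L tn[of "Suc j"] pos h by simp
   qed
   also have "... = exp (L * t (Suc j)) * (d0 + 2 * \<tau> * t (Suc j))"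
   proof -
    have "t (Suc j) = t j + h" by (simp add: tS h_def)
    thus ?thesis by (simp add: exp_add algebra_simps)
   qed
   finally show ?case .
  qed
  have lim: "filterlim t at_top sequentially"
   unfolding t_def by (rule nonsummable_partial_sums) (use a in \<open>auto simp: less_imp_le\<close>)
  then obtain j1 where "T < t j1"
   unfolding filterlim_at_top_dense eventually_sequentially by blast
  hence ex: "\<exists>j. T < t (Suc j)" using t0 T by (metis not0_implies_Suc not_less)
  define j where "j = (LEAST j. T < t (Suc j))"
  have j1: "T < t (Suc j)" unfolding j_def using ex by (rule LeastI_ex)
  have j2: "t j <= T"
  proof (cases j)
   case (Suc i)
   hence "\<not> T < t (Suc i)" using not_less_Least[of i "%j. T < t (Suc j)"] by (simp add: j_def[symmetric])
   thus ?thesis using Suc by simp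
  qed (use t0 T in simp)
  have "dist (\<phi> (t j)) (\<phi> T) < e' / 2"
   by (rule h1(2)) (use j1 j2 tn[of j] T M(1)[of "m + j"] m in \<open>auto simp: tS dist_real_def\<close>)
  moreover have "dist (y (m + j)) (\<phi> (t j)) < e' / 2"
   using err[OF j2] small[OF tn j2] by linarith
  ultimately have "dist (y (m + j)) (\<phi> T) < e"
   using dist_triangle[of "y (m + j)" "\<phi> T" "\<phi> (t j)"] e' by linarith
  thus "\<exists>n\<ge>N0. dist (y n) (\<phi> T) < e" using m by (intro exI[of _ "m + j"]) auto
 qed
qed

text \<open>A small ball around \<open>z\<close> cannot be left once the steps and the perturbation are small: from its inner half a step is too
short to leave it, and in its outer half strong monotonicity dominates the perturbation and the second order terms, so
that the distance to \<open>z\<close> does not increase.\<close>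

lemma euler_scheme_absorbed:
 fixes y b :: "nat => 'a::euclidean_space" and g :: "'a => 'a"
 assumes step: "!!k. k >= K ==> y (Suc k) = y k - a k *\<^sub>R (g (y k) + b k)"
  and a: "!!k. a k > 0" "a \<longlonglongrightarrow> 0"
  and b: "b \<longlonglongrightarrow> 0"
  and g: "continuous_on UNIV g"
  and mono: "\<kappa> > 0" "\<rho> > 0" "!!x. dist x z <= \<rho> ==> \<kappa> * (norm (x - z))^2 <= g x \<bullet> (x - z)"
  and near: "!!e. e > 0 ==> \<exists>\<^sub>\<infinity>k. dist (y k) z < e"
 shows "y \<longlonglongrightarrow> z"
proof (rule metric_LIMSEQ_I)
 fix e0 :: real assume "e0 > 0"
 define e where "e = min (e0 / 2) \<rho>"
 have e: "e > 0" "e < e0" "e <= \<rho>" using \<open>e0 > 0\<close> mono by (auto simp: e_def)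
 have "bounded (g ` cball z \<rho>)"
  by (intro compact_imp_bounded compact_continuous_image continuous_on_subset[OF g]) auto
 then obtain C0 where C0: "!!x. dist x z <= \<rho> ==> norm (g x) <= C0"
  unfolding bounded_iff by (metis dist_commute image_eqI mem_cball)
 define C where "C = C0 + 1"
 have C: "C > 0" using C0[of z] mono(2) norm_ge_zero[of "g z"] unfolding C_def by (simp del: norm_ge_zero)
 have "\<forall>\<^sub>F k in sequentially. norm (b k) < min 1 (\<kappa> * e / 4)"
  using mono e by (intro order_tendstoD(2)[OF tendsto_norm_zero[OF b]]) auto
 moreover have "\<forall>\<^sub>F k in sequentially. a k < min (e / (2 * C)) (\<kappa> * e^2 / (4 * C^2))"
  using mono e C by (intro order_tendstoD(2)[OF a(2)]) auto
 ultimately have "\<forall>\<^sub>F k in sequentially. norm (b k) < min 1 (\<kappa> * e / 4) \<and>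
   a k < min (e / (2 * C)) (\<kappa> * e^2 / (4 * C^2))" by eventually_elim simp
 then obtain M where M: "!!k. k >= M ==> norm (b k) < min 1 (\<kappa> * e / 4) \<and>
   a k < min (e / (2 * C)) (\<kappa> * e^2 / (4 * C^2))"
  unfolding eventually_sequentially by blast
 \<comment> \<open>the inner half of the ball is treated first, then the outer half\<close>
 have stay: "dist (y (Suc k)) z <= e" if k: "k >= M" "k >= K" and d: "dist (y k) z <= e" for k
 proof -
  let ?d = "norm (y k - z)"
  have de: "?d <= e" using d by (simp add: dist_norm)
  have bk: "norm (b k) <= 1" "norm (b k) <= \<kappa> * e / 4" using M[OF k(1)] by auto
  have ak: "a k * C <= e / 2" "a k * C^2 <= \<kappa> * e^2 / 4" "0 < a k"
   using M[OF k(1)] C a(1)[of k] by (auto simp: field_simps)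
  let ?v = "g (y k) + b k"
  have nv: "norm ?v <= C"
   using norm_triangle_ineq[of "g (y k)" "b k"] C0[of "y k"] d e bk by (simp add: C_def)
  have eq: "y (Suc k) - z = (y k - z) - a k *\<^sub>R ?v" using step[OF k(2)] by simp
  show ?thesis
  proof (cases "?d <= e / 2")
   case True
   have "norm (y (Suc k) - z) <= ?d + a k * norm ?v"
    unfolding eq using norm_triangle_ineq4[of "y k - z" "a k *\<^sub>R ?v"] ak by simp
   also have "... <= e / 2 + e / 2"
    using True ak nv by (intro add_mono order_trans[OF mult_left_mono[OF nv]]) auto
   finally show ?thesis by (simp add: dist_norm)
  next
   case False
   have "\<kappa> * ?d^2 - norm (b k) * ?d <= ?v \<bullet> (y k - z)"
    using mono(3)[of "y k"] d e Cauchy_Schwarz_ineq2[of "b k" "y k - z"]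
    by (simp add: inner_add_left)
   moreover have "\<kappa> * e^2 / 8 <= \<kappa> * ?d^2 - norm (b k) * ?d"
   proof -
    have "e / 2 * (\<kappa> * e / 4) <= ?d * (\<kappa> * ?d - norm (b k))"
    proof (rule mult_mono)
     have "\<kappa> * (e / 2) <= \<kappa> * ?d" using False mono by (intro mult_left_mono) auto
     thus "\<kappa> * e / 4 <= \<kappa> * ?d - norm (b k)" using bk by simp
    qed (use False e mono in auto)
    thus ?thesis by (simp add: power2_eq_square algebra_simps)
   qed
   ultimately have low: "\<kappa> * e^2 / 8 <= ?v \<bullet> (y k - z)" by linarith
   have "(norm (y (Suc k) - z))^2 = ?d^2 - 2 * a k * (?v \<bullet> (y k - z)) + (a k)^2 * (norm ?v)^2"
    unfolding eq power2_norm_eq_inner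
    by (simp add: inner_diff_left inner_diff_right inner_commute algebra_simps power2_eq_square)
   also have "... <= ?d^2 - 2 * a k * (\<kappa> * e^2 / 8) + a k * (\<kappa> * e^2 / 4)"
   proof (intro add_mono diff_mono mult_left_mono low)
    have "(norm ?v)^2 <= C^2" using nv by (intro power_mono) auto
    hence "(a k)^2 * (norm ?v)^2 <= a k * (a k * C^2)"
     using ak by (simp add: power2_eq_square mult_left_mono mult.assoc)
    also have "... <= a k * (\<kappa> * e^2 / 4)" using ak by (intro mult_left_mono) auto
    finally show "(a k)^2 * (norm ?v)^2 <= a k * (\<kappa> * e^2 / 4)" .
   qed (use ak in auto)
   also have "... = ?d^2" by simp
   finally have "norm (y (Suc k) - z) <= ?d" by (simp add: power2_le_iff_abs_le)
   thus ?thesis using de by (simp add: dist_norm)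
  qed
 qed
 have "\<exists>m\<ge>max M K. dist (y m) z < e" using near[OF e(1)] unfolding INFM_nat_le by blast
 then obtain m where m: "m >= M" "m >= K" "dist (y m) z < e" by auto
 have "dist (y k) z <= e" if "k >= m" for k
  using that by (induction k rule: dec_induct) (use m stay in auto)
 thus "\<exists>N. \<forall>n\<ge>N. dist (y n) z < e0" using e by (meson le_less_trans)
qed

section \<open>Partial derivatives\<close>

lemma line_has_derivative:
 fixes f :: "'a::real_normed_vector => real"
 assumes "(f has_derivative D) (at (x + t *\<^sub>R v))"
 shows "((%t. f (x + t *\<^sub>R v)) has_real_derivative D v) (at t)"
proof -
 have "((%t. x + t *\<^sub>R v) has_derivative (%s. s *\<^sub>R v)) (at t)"
  by (auto intro!: derivative_eq_intros)
 from has_derivative_compose[OF this assms]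
 have "((%t. f (x + t *\<^sub>R v)) has_derivative (%s. D (s *\<^sub>R v))) (at t)" by simp
 moreover have "D (s *\<^sub>R v) = s * D v" for s
  using linear_scale[OF has_derivative_linear[OF assms]] by simp
 ultimately show ?thesis by (simp add: has_field_derivative_def mult_commute_abs)
qed

lemma partial_eq_derivative:
 assumes "(f has_derivative D) (at x)"
 shows "partial i f x = D (axis i 1)"
 using line_has_derivative[of f D x 0 "axis i 1"] assms
 unfolding partial_def by (auto intro!: DERIV_imp_deriv)

text \<open>The definitions speak of the derivative at parameter 0 only; translation gives it at every point of the line.\<close>

lemma partial_differentiable_has_derivative:
 assumes "partial_differentiable i f (x + t *\<^sub>R axis i 1)"
 shows "((%t. f (x + t *\<^sub>R axis i 1)) has_real_derivative partial i f (x + t *\<^sub>R axis i 1)) (at t)"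
proof -
 let ?h = "%s. f (x + t *\<^sub>R axis i 1 + s *\<^sub>R axis i 1)"
 have "(?h has_real_derivative partial i f (x + t *\<^sub>R axis i 1)) (at 0)"
  using assms unfolding partial_differentiable_def partial_def
  by (metis DERIV_deriv_iff_real_differentiable)
 moreover have "?h = (%s. f (x + (s + t) *\<^sub>R axis i 1))" by (auto simp: algebra_simps)
 ultimately show ?thesis
  using DERIV_shift[of "%t. f (x + t *\<^sub>R axis i 1)" _ 0 t] by simp
qed

lemma has_derivative_gradient:
 assumes "f differentiable (at x)"
 shows "(f has_derivative (%h. gradient f x \<bullet> h)) (at x)"
proof -
 obtain D where D: "(f has_derivative D) (at x)" using assms unfolding differentiable_def by blast
 have "D h = gradient f x \<bullet> h" for h
 proof -
  have "D h = D (\<Sum>i\<in>UNIV. h $ i *\<^sub>R axis i 1)"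
   using basis_expansion[of h] by (simp add: scalar_mult_eq_scaleR)
  also have "... = (\<Sum>i\<in>UNIV. h $ i * D (axis i 1))"
   using has_derivative_linear[OF D] by (simp add: linear_sum linear_scale)
  also have "... = gradient f x \<bullet> h"
   by (simp add: inner_vec_def gradient_def partial_eq_derivative[OF D] mult.commute)
  finally show ?thesis .
 qed
 hence "D = (%h. gradient f x \<bullet> h)" by auto
 with D show ?thesis by simp
qed

lemma line_has_derivative_gradient:
 assumes "f differentiable (at (x + t *\<^sub>R v))"
 shows "((%t. f (x + t *\<^sub>R v)) has_real_derivative gradient f (x + t *\<^sub>R v) \<bullet> v) (at t)"
 by (rule line_has_derivative[OF has_derivative_gradient[OF assms]])

lemma partial_differentiable_if_gradient_differentiable:
 assumes "gradient f differentiable (at x)"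
 shows "partial i f differentiable (at x)"
proof -
 have "(%y. gradient f y $ i) differentiable (at x)"
  using assms unfolding differentiable_def
  by (blast intro: bounded_linear.has_derivative[OF bounded_linear_vec_nth])
 thus ?thesis by (simp add: gradient_def)
qed

text \<open>The increment of \<open>f\<close> is split into increments along the coordinate axes, each of which is controlled by the mean
value theorem and the continuity of one partial derivative.\<close>

lemma differentiable_if_continuous_partials:
 fixes f :: "real^'n::finite => real"
 assumes S: "open S" "x \<in> S"
  and pd: "!!i y. y \<in> S ==> partial_differentiable i f y"
  and cont: "!!i. continuous_on S (partial i f)"
 shows "f differentiable (at x)"
proof -
 have "(f has_derivative (%h. gradient f x \<bullet> h)) (at x)"
  unfolding has_derivative_at_alt
 proof (intro conjI allI impI bounded_linear_inner_right)
  fix e0 :: real assume "e0 > 0"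
  define e where "e = e0 / real CARD('n)"
  have e: "e > 0" using \<open>e0 > 0\<close> by (simp add: e_def)
  have "\<forall>\<^sub>F y in nhds x. y \<in> S \<and> (\<forall>i. dist (partial i f y) (partial i f x) < e)"
  proof (intro eventually_conj eventually_nhds_in_open S)
   have "\<forall>\<^sub>F y in nhds x. dist (partial i f y) (partial i f x) < e" for i
   proof -
    have "isCont (partial i f) x" using cont S by (simp add: continuous_on_eq_continuous_at)
    thus ?thesis using e unfolding isCont_def tendsto_iff
     by (auto simp: eventually_nhds_conv_at)
   qed
   thus "\<forall>\<^sub>F y in nhds x. \<forall>i. dist (partial i f y) (partial i f x) < e"
    by (rule eventually_all_finite)
  qed
  then obtain d where d: "d > 0"
    "!!y. dist y x < d ==> y \<in> S" "!!y i. dist y x < d ==> \<bar>partial i f y - partial i f x\<bar> < e"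
   unfolding eventually_nhds_metric dist_real_def by blast
  define s where "s J h = (\<Sum>j\<in>J. h $ j *\<^sub>R (axis j 1 :: real^'n))" for J h
  have ns: "norm (s J h) <= (\<Sum>j\<in>J. \<bar>h $ j\<bar>)" for J h
   unfolding s_def by (rule sum_norm_le) simp
  have tele: "\<bar>f (x + s J h) - f x - (\<Sum>j\<in>J. h $ j * partial j f x)\<bar> <= e * (\<Sum>j\<in>J. \<bar>h $ j\<bar>)"
   if h: "(\<Sum>j\<in>UNIV. \<bar>h $ j\<bar>) < d" and J: "finite J" for J h
   using J
  proof (induction J rule: finite_induct)
   case (insert i J)
   let ?p = "x + s J h"
   let ?F = "%t. f (?p + t *\<^sub>R axis i 1)"
   have near: "dist (?p + t *\<^sub>R axis i 1) x < d" if t: "\<bar>t\<bar> <= \<bar>h $ i\<bar>" for t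
   proof -
    have "norm (s J h + t *\<^sub>R axis i 1) <= (\<Sum>j\<in>J. \<bar>h $ j\<bar>) + \<bar>h $ i\<bar>"
     using ns[of J h] t norm_triangle_ineq[of "s J h" "t *\<^sub>R axis i 1"] by simp
    also have "... = (\<Sum>j\<in>insert i J. \<bar>h $ j\<bar>)" using insert by simp
    also have "... <= (\<Sum>j\<in>UNIV. \<bar>h $ j\<bar>)" by (rule sum_mono2) auto
    finally show ?thesis using h by (simp add: dist_norm)
   qed
   have "norm (?F (h $ i) - ?F 0 - (h $ i - 0) * partial i f x) <= norm (h $ i - 0) * e"
   proof -
    define G where "G t = ?F t - t * partial i f x" for t
    have "norm (G (h $ i) - G 0) <= e * norm (h $ i - 0)"
    proof (rule field_differentiable_bound[where S = "closed_segment 0 (h $ i)"])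
     fix t assume t: "t \<in> closed_segment 0 (h $ i)"
     hence t': "\<bar>t\<bar> <= \<bar>h $ i\<bar>" by (auto simp: closed_segment_eq_real_ivl split: if_splits)
     have "(?F has_real_derivative partial i f (?p + t *\<^sub>R axis i 1)) (at t)"
      by (rule partial_differentiable_has_derivative) (rule pd, rule d(2), rule near[OF t'])
     thus "(G has_field_derivative partial i f (?p + t *\<^sub>R axis i 1) - partial i f x)
       (at t within closed_segment 0 (h $ i))"
      unfolding G_def by (auto intro!: derivative_eq_intros intro: DERIV_subset)
     show "norm (partial i f (?p + t *\<^sub>R axis i 1) - partial i f x) <= e"
      using d(3)[OF near[OF t'], of i] by simp
    qed auto
    thus ?thesis by (simp add: G_def algebra_simps)
   qed
   moreover have "f (x + s (insert i J) h) = ?F (h $ i)"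
    using insert by (simp add: s_def algebra_simps)
   ultimately show ?case using insert by (simp add: algebra_simps abs_le_iff)
  qed (simp add: s_def)
  show "\<exists>d>0. \<forall>y. norm (y - x) < d --> norm (f y - f x - gradient f x \<bullet> (y - x)) <= e0 * norm (y - x)"
  proof (intro exI[of _ "d / real CARD('n)"] conjI allI impI)
   fix y assume y: "norm (y - x) < d / real CARD('n)"
   have su: "(\<Sum>j\<in>UNIV. \<bar>(y - x) $ j\<bar>) <= real CARD('n) * norm (y - x)"
    using sum_mono[of UNIV "%j. \<bar>(y - x) $ j\<bar>" "%_. norm (y - x)"] component_le_norm_cart by fastforce
   have "s UNIV (y - x) = y - x"
    unfolding s_def using basis_expansion[of "y - x"] by (simp add: scalar_mult_eq_scaleR)
   hence "\<bar>f y - f x - gradient f x \<bullet> (y - x)\<bar> <= e * (\<Sum>j\<in>UNIV. \<bar>(y - x) $ j\<bar>)"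
    using tele[of "y - x" UNIV] su y
    by (simp add: field_simps inner_vec_def gradient_def)
   also have "... <= e * (real CARD('n) * norm (y - x))" using e su by (intro mult_left_mono) auto
   finally show "norm (f y - f x - gradient f x \<bullet> (y - x)) <= e0 * norm (y - x)"
    by (simp add: e_def)
  qed (use d in simp)
 qed
 thus ?thesis unfolding differentiable_def by blast
qed

lemma second_difference_quotient:
 fixes f :: "real^'n::finite => real"
 assumes r: "r > 0" and f: "!!y. dist y x < r ==> f differentiable (at y)"
  and pf: "partial i f differentiable (at x)"
 shows "((%h. (f (x + h *\<^sub>R axis i 1 + h *\<^sub>R axis j 1) - f (x + h *\<^sub>R axis i 1)
   - f (x + h *\<^sub>R axis j 1) + f x) / h^2) \<longlongrightarrow> partial j (partial i f) x) (at_right 0)"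
  (is "(?q \<longlongrightarrow> _) _")
proof (rule tendstoI)
 fix e0 :: real assume "e0 > 0"
 define e where "e = e0 / 8"
 have e: "e > 0" using \<open>e0 > 0\<close> by (simp add: e_def)
 define D where "D h = gradient (partial i f) x \<bullet> h" for h
 have "(partial i f has_derivative D) (at x)"
  unfolding D_def by (rule has_derivative_gradient[OF pf])
 then obtain d where d: "d > 0"
   "!!y. norm (y - x) < d ==> norm (partial i f y - partial i f x - D (y - x)) <= e * norm (y - x)"
  unfolding has_derivative_at_alt using e by blast
 define d' where "d' = min d r / 2"
 have d': "d' > 0" using d r by (simp add: d'_def)
 have "dist (?q h) (partial j (partial i f) x) < e0" if h: "0 < h" "h < d'" for h
 proof -
  let ?F = "%s. f ((x + h *\<^sub>R axis j 1) + s *\<^sub>R axis i 1) - f (x + s *\<^sub>R axis i 1)"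
  let ?F' = "%s. partial i f (x + h *\<^sub>R axis j 1 + s *\<^sub>R axis i 1) - partial i f (x + s *\<^sub>R axis i 1)"
  have n1: "norm (h *\<^sub>R axis j 1 + s *\<^sub>R axis i 1 :: real^'n) <= 2 * h"
   and n2: "norm (s *\<^sub>R axis i 1 :: real^'n) <= h" if "0 <= s" "s <= h" for s
   using that h norm_triangle_ineq[of "h *\<^sub>R axis j 1" "s *\<^sub>R (axis i 1 :: real^'n)"] by auto
  have der: "(?F has_real_derivative ?F' s) (at s)" if s: "0 <= s" "s <= h" for s
  proof (intro DERIV_diff)
   have "dist (x + h *\<^sub>R axis j 1 + s *\<^sub>R axis i 1) x < r" "dist (x + s *\<^sub>R axis i 1) x < r"
    using n1[OF s] n2[OF s] h d' by (auto simp: dist_norm d'_def add.assoc)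
   from this[THEN f]
   show "((%s. f (x + h *\<^sub>R axis j 1 + s *\<^sub>R axis i 1)) has_real_derivative
     partial i f (x + h *\<^sub>R axis j 1 + s *\<^sub>R axis i 1)) (at s)"
    "((%s. f (x + s *\<^sub>R axis i 1)) has_real_derivative partial i f (x + s *\<^sub>R axis i 1)) (at s)"
    using line_has_derivative_gradient by (auto simp: gradient_def inner_axis dest!: line_has_derivative_gradient)
  qed
  obtain s where s: "0 < s" "s < h" "?F h - ?F 0 = (h - 0) * ?F' s"
   using MVT2[of 0 h ?F ?F'] h der by auto
  have "?q h = (?F h - ?F 0) / h^2" by (simp add: algebra_simps)
  also have "... = ?F' s / h" using s(3) h by (simp add: power2_eq_square)
  finally have q: "?q h = ?F' s / h" .
  let ?y1 = "x + h *\<^sub>R axis j 1 + s *\<^sub>R axis i 1" and ?y2 = "x + s *\<^sub>R axis i 1"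
  have b1: "norm (partial i f ?y1 - partial i f x - D (?y1 - x)) <= e * (2 * h)"
  proof (rule order_trans[OF d(2)])
   show "norm (?y1 - x) < d" "e * norm (?y1 - x) <= e * (2 * h)"
    using n1[of s] s h e d' by (auto simp: d'_def add.assoc mult_left_mono)
  qed
  have b2: "norm (partial i f ?y2 - partial i f x - D (?y2 - x)) <= e * (2 * h)"
  proof (rule order_trans[OF d(2)])
   show "norm (?y2 - x) < d" "e * norm (?y2 - x) <= e * (2 * h)"
    using n2[of s] s h e d' by (auto simp: d'_def add.assoc mult_left_mono)
  qed
  have "D (?y1 - x) - D (?y2 - x) = h * partial j (partial i f) x"
   by (simp add: D_def inner_add_right inner_axis gradient_def algebra_simps)
  hence "\<bar>?F' s - h * partial j (partial i f) x\<bar> <= 4 * e * h" using b1 b2 by (simp add: abs_le_iff) 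
  hence "\<bar>?q h - partial j (partial i f) x\<bar> <= 4 * e"
   unfolding q using h by (simp add: field_simps abs_le_iff)
  thus ?thesis using e by (simp add: dist_real_def e_def)
 qed
 thus "\<forall>\<^sub>F h in at_right 0. dist (?q h) (partial j (partial i f) x) < e0"
  unfolding eventually_at_right_field using d' by auto
qed

text \<open>Both iterated derivatives are limits of the same second difference quotient, which is symmetric in the two
directions.\<close>

lemma second_partials_symmetric:
 fixes f :: "real^'n::finite => real"
 assumes "r > 0" "!!y. dist y x < r ==> f differentiable (at y)"
  and "!!i. partial i f differentiable (at x)"
 shows "partial j (partial i f) x = partial i (partial j f) x"
proof (rule tendsto_unique[OF _ second_difference_quotient[OF assms(1,2,3)]])
 show "((%h. (f (x + h *\<^sub>R axis i 1 + h *\<^sub>R axis j 1) - f (x + h *\<^sub>R axis i 1)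
   - f (x + h *\<^sub>R axis j 1) + f x) / h^2) \<longlongrightarrow> partial i (partial j f) x) (at_right 0)"
  using second_difference_quotient[where i = j and j = i, OF assms(1,2,3)] by (simp add: algebra_simps)
qed auto

section \<open>Averages over sign vectors\<close>

lemma finite_cube: "finite (cube :: (real^'n::finite) set)"
 and card_cube: "card (cube :: (real^'n::finite) set) = 2 ^ CARD('n)"
proof -
 let ?s = "%A. (\<chi> i. if i \<in> A then 1 else -1) :: real^'n"
 have "bij_betw ?s (Pow UNIV) cube"
  unfolding bij_betw_def
 proof
  show "inj_on ?s (Pow UNIV)"
   by (auto simp: inj_on_def vec_eq_iff split: if_splits)
  have "v \<in> ?s ` Pow UNIV" if "v \<in> cube" for v :: "real^'n"
   by (rule image_eqI[where x = "{i. v $ i = 1}"]) (use that in \<open>auto simp: cube_def vec_eq_iff\<close>)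
  thus "?s ` Pow UNIV = cube" by (auto simp: cube_def)
 qed
 thus "finite (cube :: (real^'n) set)" "card (cube :: (real^'n) set) = 2 ^ CARD('n)"
  using bij_betw_finite bij_betw_same_card by (fastforce simp: card_Pow)+
qed

lemma cube_sq: "v \<in> cube ==> v $ i * v $ i = 1"
 by (auto simp: cube_def dest!: spec[of _ i])

lemma cube_norm: "(v :: real^'n::finite) \<in> cube ==> norm v = sqrt (real CARD('n))"
 by (simp add: norm_eq_sqrt_inner inner_vec_def cube_sq)

definition flip :: "'n => real^'n::finite => real^'n" where
 "flip k v = (\<chi> i. if i = k then - v $ i else v $ i)"

lemma flip_nth: "flip k v $ i = (if i = k then - v $ i else v $ i)"
 by (simp add: flip_def)

text \<open>Flipping one sign is an involution of the cube; odd moments vanish by this symmetry.\<close>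

lemma sum_cube_odd:
 fixes F :: "real^'n::finite => real"
 assumes "!!v. F (flip k v) = - F v"
 shows "(\<Sum>v\<in>cube. F v) = 0"
proof -
 have ff: "flip k (flip k v) = v" for v :: "real^'n" by (simp add: vec_eq_iff flip_nth)
 have fc: "flip k v \<in> cube" if "v \<in> cube" for v :: "real^'n" using that by (auto simp: cube_def flip_nth)
 have "bij_betw (flip k) (cube :: (real^'n) set) cube"
  by (rule bij_betw_byWitness[where f' = "flip k"]) (auto simp: ff fc)
 hence "(\<Sum>v\<in>cube. F v) = (\<Sum>v\<in>cube. F (flip k v))"
  by (simp add: sum.reindex_bij_betw)
 thus ?thesis by (simp add: assms sum_negf)
qed

lemma cube_second_moment:
 "(\<Sum>v\<in>(cube :: (real^'n::finite) set). v $ i * v $ j) = (if i = j then 2 ^ CARD('n) else 0)"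
proof (cases "i = j")
 case True
 thus ?thesis by (simp add: cube_sq card_cube)
next
 case False
 thus ?thesis by (simp add: sum_cube_odd[where k = i] flip_nth)
qed

lemma cube_fourth_moment:
 "(\<Sum>v\<in>(cube :: (real^'n::finite) set). v $ l * (v $ i * v $ j * v $ m)) =
  (if (i = l \<and> j = m) \<or> (j = l \<and> i = m) \<or> (m = l \<and> i = j) then 2 ^ CARD('n) else 0)"
proof (cases "(i = l \<and> j = m) \<or> (j = l \<and> i = m) \<or> (m = l \<and> i = j)")
 case True
 have "v $ l * (v $ i * v $ j * v $ m) = 1" if "v \<in> cube" for v :: "real^'n"
 proof -
  have sq: "v $ k * v $ k = 1" for k using that by (rule cube_sq)
  have *: "v $ l * (v $ i * v $ j * v $ m) = (v $ l * v $ i) * (v $ j * v $ m)"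
   "v $ l * (v $ i * v $ j * v $ m) = (v $ l * v $ j) * (v $ i * v $ m)"
   "v $ l * (v $ i * v $ j * v $ m) = (v $ l * v $ m) * (v $ i * v $ j)" by (simp_all only: mult_ac)
  from True show ?thesis
  proof (elim disjE conjE)
   assume "i = l" "j = m" thus ?thesis by (subst *(1)) (simp add: sq)
  next
   assume "j = l" "i = m" thus ?thesis by (subst *(2)) (simp add: sq)
  next
   assume "m = l" "i = j" thus ?thesis by (subst *(3)) (simp add: sq)
  qed
 qed
 thus ?thesis using True by (simp add: card_cube)
next
 case False
 have "\<exists>k. \<forall>v :: real^'n. flip k v $ l * (flip k v $ i * flip k v $ j * flip k v $ m) =
   - (v $ l * (v $ i * v $ j * v $ m))"
 proof -
  consider "l \<noteq> i" "l \<noteq> j" "l \<noteq> m" | "l = i" "j \<noteq> m" "j \<noteq> l" | "l = i" "j \<noteq> m" "m \<noteq> l"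
   | "l = j" "i \<noteq> m" "i \<noteq> l" | "l = j" "i \<noteq> m" "m \<noteq> l"
   | "l = m" "i \<noteq> j" "i \<noteq> l" | "l = m" "i \<noteq> j" "j \<noteq> l"
   using False by auto
  thus ?thesis
  proof cases
   case 1 thus ?thesis by (intro exI[of _ l]) (auto simp: flip_nth)
  next
   case 2 thus ?thesis by (intro exI[of _ j]) (auto simp: flip_nth)
  next
   case 3 thus ?thesis by (intro exI[of _ m]) (auto simp: flip_nth)
  next
   case 4 thus ?thesis by (intro exI[of _ i]) (auto simp: flip_nth)
  next
   case 5 thus ?thesis by (intro exI[of _ m]) (auto simp: flip_nth)
  next
   case 6 thus ?thesis by (intro exI[of _ i]) (auto simp: flip_nth)
  next
   case 7 thus ?thesis by (intro exI[of _ j]) (auto simp: flip_nth)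
  qed
 qed
 then obtain k where "!!v :: real^'n. flip k v $ l * (flip k v $ i * flip k v $ j * flip k v $ m) =
   - (v $ l * (v $ i * v $ j * v $ m))" by blast
 hence "(\<Sum>v\<in>(cube :: (real^'n) set). v $ l * (v $ i * v $ j * v $ m)) = 0"
  by (rule sum_cube_odd)
 thus ?thesis using False by simp
qed

lemma cube_mean_inner:
 fixes g :: "real^'n::finite"
 shows "(\<Sum>v\<in>cube. (g \<bullet> v) *\<^sub>R v) = 2 ^ CARD('n) *\<^sub>R g"
proof -
 have "(\<Sum>v\<in>cube. (g \<bullet> v) * v $ l) = 2 ^ CARD('n) * g $ l" for l
 proof -
  have "(\<Sum>v\<in>cube. (g \<bullet> v) * v $ l) = (\<Sum>v\<in>(cube::(real^'n) set). \<Sum>i\<in>UNIV. g $ i * (v $ i * v $ l))"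
   by (simp add: inner_vec_def sum_distrib_right mult.assoc)
  also have "... = (\<Sum>i\<in>UNIV. g $ i * (\<Sum>v\<in>(cube::(real^'n) set). v $ i * v $ l))"
   by (subst sum.swap) (simp add: sum_distrib_left)
  also have "... = 2 ^ CARD('n) * g $ l"
   by (simp add: cube_second_moment if_distrib cong: if_cong)
  finally show ?thesis .
 qed
 thus ?thesis by (simp add: vec_eq_iff sum_component)
qed

text \<open>The expectation of the noiseless estimate at \<open>x\<close> over a uniform sign vector.\<close>

definition spsa_mean :: "(real^'n::finite => real) => real => real^'n => real^'n" where
 "spsa_mean f c x = (1 / 2 ^ CARD('n)) *\<^sub>R (\<Sum>v\<in>cube. ((f (x + c *\<^sub>R v) - f (x - c *\<^sub>R v)) / (2 * c)) *\<^sub>R v)"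

text \<open>Since the second moments of the sign vectors form the identity matrix, a fixed vector \<open>g\<close> is the average of
\<open>(g \<bullet> v) v\<close>; so the error of the estimate is an average of errors of difference quotients.\<close>

lemma spsa_mean_minus_gradient:
 fixes f :: "real^'n::finite => real"
 shows "spsa_mean f c x - g =
  (1 / 2 ^ CARD('n)) *\<^sub>R (\<Sum>v\<in>cube. ((f (x + c *\<^sub>R v) - f (x - c *\<^sub>R v)) / (2 * c) - g \<bullet> v) *\<^sub>R v)"
 by (simp add: spsa_mean_def scaleR_diff_left sum_subtractf cube_mean_inner scaleR_diff_right)

lemma spsa_mean_error_lipschitz:
 fixes f :: "real^'n::finite => real"
 assumes f: "!!x. f differentiable (at x)" and c: "c > 0"
  and lip: "L-lipschitz_on (cball x r) (gradient f)" and r: "c * sqrt (real CARD('n)) <= r"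
 shows "norm (spsa_mean f c x - gradient f x) <= L * c * real CARD('n) * sqrt (real CARD('n))"
proof -
 let ?n = "real CARD('n)"
 have r0: "r >= 0" using r c by (meson mult_nonneg_nonneg less_imp_le order_trans real_sqrt_ge_zero of_nat_0_le_iff)
 have L: "L >= 0" using lip lipschitz_on_nonneg by blast
 have b: "\<bar>(f (x + c *\<^sub>R v) - f (x - c *\<^sub>R v)) / (2 * c) - gradient f x \<bullet> v\<bar> <= L * c * ?n"
  if v: "v \<in> cube" for v
 proof -
  have nv: "norm v = sqrt ?n" using v by (rule cube_norm)
  obtain s where s: "-c < s" "s < c"
    "f (x + c *\<^sub>R v) - f (x + (- c) *\<^sub>R v) = (c - (-c)) * (gradient f (x + s *\<^sub>R v) \<bullet> v)"
   using MVT2[of "-c" c "%t. f (x + t *\<^sub>R v)" "%t. gradient f (x + t *\<^sub>R v) \<bullet> v"]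
    line_has_derivative_gradient[OF f] c by auto
  have q: "(f (x + c *\<^sub>R v) - f (x - c *\<^sub>R v)) / (2 * c) = gradient f (x + s *\<^sub>R v) \<bullet> v"
   using s(3) c by (simp add: field_simps)
  have "\<bar>s\<bar> * sqrt ?n <= c * sqrt ?n" using s by (intro mult_right_mono) auto
  hence d: "dist (x + s *\<^sub>R v) x <= c * sqrt ?n" using nv by (simp add: dist_norm)
  have "dist (gradient f (x + s *\<^sub>R v)) (gradient f x) <= L * dist (x + s *\<^sub>R v) x"
   by (rule lipschitz_onD[OF lip]) (use d r r0 in \<open>auto simp: dist_commute\<close>)
  also have "... <= L * (c * sqrt ?n)" using d L by (rule mult_left_mono)
  finally have g: "norm (gradient f (x + s *\<^sub>R v) - gradient f x) <= L * (c * sqrt ?n)" by (simp add: dist_norm)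
  have "\<bar>(gradient f (x + s *\<^sub>R v) - gradient f x) \<bullet> v\<bar> <= norm (gradient f (x + s *\<^sub>R v) - gradient f x) * norm v"
   by (rule Cauchy_Schwarz_ineq2)
  also have "... <= L * (c * sqrt ?n) * sqrt ?n" unfolding nv using g by (intro mult_right_mono) auto
  also have "... = L * c * ?n" by simp
  finally show ?thesis unfolding q by (simp add: inner_diff_left)
 qed
 have "norm (\<Sum>v\<in>(cube::(real^'n) set). ((f (x + c *\<^sub>R v) - f (x - c *\<^sub>R v)) / (2 * c) - gradient f x \<bullet> v) *\<^sub>R v)
   <= (\<Sum>v\<in>(cube::(real^'n) set). L * c * ?n * sqrt ?n)"
 proof (rule sum_norm_le)
  fix v :: "real^'n" assume v: "v \<in> cube"
  show "norm (((f (x + c *\<^sub>R v) - f (x - c *\<^sub>R v)) / (2 * c) - gradient f x \<bullet> v) *\<^sub>R v) <= L * c * ?n * sqrt ?n"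
   using mult_right_mono[OF b[OF v], of "sqrt ?n"] by (simp add: cube_norm[OF v])
 qed
 thus ?thesis by (simp add: spsa_mean_minus_gradient card_cube field_simps)
qed

definition third_form :: "(real^'n::finite => real) => real^'n => real^'n => real" where
 "third_form f v x = (\<Sum>i\<in>UNIV. \<Sum>j\<in>UNIV. \<Sum>l\<in>UNIV. v $ i * v $ j * v $ l * third_partial f i j l x)"

lemma third_form_eq:
 "third_form f v x = (\<Sum>i\<in>UNIV. \<Sum>j\<in>UNIV. v $ i * v $ j * (gradient (partial j (partial i f)) x \<bullet> v))"
 by (simp add: third_form_def third_partial_def inner_vec_def gradient_def sum_distrib_left mult_ac)

text \<open>The expansion of the bias at the limit point \<open>z\<close> takes three derivatives of \<open>f\<close>, in a neighbourhood of \<open>z\<close>.\<close>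

locale C3_near =
 fixes f :: "real^'n::finite => real" and z :: "real^'n" and r :: real
 assumes r: "r > 0"
  and f_diff: "!!x. f differentiable (at x)"
  and grad_diff: "!!x. gradient f differentiable (at x)"
  and third_exists: "!!x i j l. x \<in> ball z r ==> partial_differentiable l (partial j (partial i f)) x"
  and third_cont: "!!i j l. continuous_on (ball z r) (third_partial f i j l)"
begin

lemma partial_diff: "partial i f differentiable (at x)"
 by (rule partial_differentiable_if_gradient_differentiable[OF grad_diff])

lemma second_partial_diff:
 assumes "x \<in> ball z r" shows "partial j (partial i f) differentiable (at x)"
 by (rule differentiable_if_continuous_partials[where S = "ball z r"])
  (use assms third_exists third_cont in \<open>auto simp: third_partial_def[abs_def]\<close>)

lemma third_partial_symmetric:
 "third_partial f i l i z = third_partial f i i l z" "third_partial f l i i z = third_partial f i i l z"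
proof -
 have z: "z \<in> ball z r" using r by simp
 show 1: "third_partial f i l i z = third_partial f i i l z"
  unfolding third_partial_def
  by (rule second_partials_symmetric[where r = 1]) (auto simp: partial_diff second_partial_diff[OF z])
 have "partial i (partial l f) x = partial l (partial i f) x" for x
  by (rule second_partials_symmetric[where r = 1]) (auto simp: f_diff partial_diff)
 hence "partial i (partial l f) = partial l (partial i f)" by blast
 thus "third_partial f l i i z = third_partial f i i l z"
  using 1 by (simp add: third_partial_def)
qed

text \<open>Along a line, two derivatives of \<open>f\<close> exist everywhere and a third one near \<open>z\<close>: Taylor's formula of order three
with the third derivative at an intermediate point.\<close>

lemma taylor_one_sided:
 assumes c: "c > 0" and seg: "!!t. 0 <= t ==> t <= c ==> x + t *\<^sub>R v \<in> ball z r"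
 obtains t where "0 < t" "t < c" "f (x + c *\<^sub>R v) = f x + c * (gradient f x \<bullet> v)
  + c^2 / 2 * (\<Sum>i\<in>UNIV. v $ i * (gradient (partial i f) x \<bullet> v)) + c ^ 3 / 6 * third_form f v (x + t *\<^sub>R v)"
proof -
 define d :: "nat => real => real" where
  "d m t = (if m = 0 then f (x + t *\<^sub>R v)
   else if m = 1 then gradient f (x + t *\<^sub>R v) \<bullet> v
   else if m = 2 then (\<Sum>i\<in>UNIV. v $ i * (gradient (partial i f) (x + t *\<^sub>R v) \<bullet> v))
   else third_form f v (x + t *\<^sub>R v))" for m t
 have g: "gradient h y \<bullet> v = (\<Sum>i\<in>UNIV. v $ i * partial i h y)" for h y
  by (simp add: inner_vec_def gradient_def mult.commute)
 have der: "\<forall>m t. m < 3 \<and> 0 <= t \<and> t <= c --> (d m has_real_derivative d (Suc m) t) (at t)"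
 proof (intro allI impI)
  fix m :: nat and t assume mt: "m < 3 \<and> 0 <= t \<and> t <= c"
  then consider "m = 0" | "m = 1" | "m = 2" by linarith
  thus "(d m has_real_derivative d (Suc m) t) (at t)"
  proof cases
   case 1
   thus ?thesis using line_has_derivative_gradient[OF f_diff] by (simp add: d_def[abs_def])
  next
   case 2
   have "((%t. \<Sum>i\<in>UNIV. v $ i * partial i f (x + t *\<^sub>R v)) has_real_derivative
     (\<Sum>i\<in>UNIV. v $ i * (gradient (partial i f) (x + t *\<^sub>R v) \<bullet> v))) (at t)"
    by (intro DERIV_sum DERIV_cmult line_has_derivative_gradient partial_diff)
   thus ?thesis using 2 by (simp add: d_def[abs_def] g[of f])
  next
   case 3
   have "((%t. \<Sum>i\<in>UNIV. v $ i * (\<Sum>j\<in>UNIV. v $ j * partial j (partial i f) (x + t *\<^sub>R v))) has_real_derivative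
     (\<Sum>i\<in>UNIV. v $ i * (\<Sum>j\<in>UNIV. v $ j * (gradient (partial j (partial i f)) (x + t *\<^sub>R v) \<bullet> v)))) (at t)"
    using mt by (intro DERIV_sum DERIV_cmult line_has_derivative_gradient second_partial_diff seg) auto
   thus ?thesis using 3
    by (simp add: d_def[abs_def] third_form_eq g[of "partial _ f"] sum_distrib_left mult.assoc)
  qed
 qed
 have "\<exists>t>0. t < c \<and> d 0 c = (\<Sum>m<3. d m 0 / fact m * c ^ m) + d 3 t / fact 3 * c ^ 3"
  by (rule Maclaurin[OF c _ refl der]) simp
 then obtain t where t: "t > 0" "t < c" "d 0 c = (\<Sum>m<3. d m 0 / fact m * c ^ m) + d 3 t / fact 3 * c ^ 3"
  by blast
 have e: "(\<Sum>m<3. d m 0 / fact m * c ^ m) = d 0 0 + d 1 0 * c + d 2 0 / 2 * c^2"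
  by (simp add: numeral_3_eq_3 numeral_2_eq_2)
 show ?thesis
  by (rule that[OF t(1,2)], use t(3)[unfolded e] in \<open>simp add: d_def fact_numeral algebra_simps\<close>)
qed

lemma taylor_central:
 assumes c: "c > 0" and seg: "cball x (c * norm v) \<subseteq> ball z r"
 obtains s t where "0 < s" "s < c" "0 < t" "t < c"
  "(f (x + c *\<^sub>R v) - f (x - c *\<^sub>R v)) / (2 * c) - gradient f x \<bullet> v =
   c^2 * ((third_form f v (x + s *\<^sub>R v) + third_form f v (x - t *\<^sub>R v)) / 12)"
proof -
 have in_seg: "x + t *\<^sub>R w \<in> ball z r" if "0 <= t" "t <= c" "norm w = norm v" for t w
  using that by (intro subsetD[OF seg]) (auto simp: dist_norm mult_right_mono)
 obtain s where s: "0 < s" "s < c" "f (x + c *\<^sub>R v) = f x + c * (gradient f x \<bullet> v)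
  + c^2 / 2 * (\<Sum>i\<in>UNIV. v $ i * (gradient (partial i f) x \<bullet> v)) + c ^ 3 / 6 * third_form f v (x + s *\<^sub>R v)"
  by (rule taylor_one_sided[OF c in_seg[of _ v]]) auto
 obtain t where t: "0 < t" "t < c" "f (x + c *\<^sub>R (-v)) = f x + c * (gradient f x \<bullet> (-v))
  + c^2 / 2 * (\<Sum>i\<in>UNIV. (-v) $ i * (gradient (partial i f) x \<bullet> (-v))) + c ^ 3 / 6 * third_form f (-v) (x + t *\<^sub>R (-v))"
  by (rule taylor_one_sided[OF c in_seg[of _ "-v"]]) auto
 have "third_form f (-v) y = - third_form f v y" for y by (simp add: third_form_def sum_negf)
 with t(3) s(3) have "f (x + c *\<^sub>R v) - f (x - c *\<^sub>R v) = 2 * c * (gradient f x \<bullet> v)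
   + c ^ 3 / 6 * (third_form f v (x + s *\<^sub>R v) + third_form f v (x - t *\<^sub>R v))"
  by (simp add: algebra_simps)
 hence "(f (x + c *\<^sub>R v) - f (x - c *\<^sub>R v)) / (2 * c) - gradient f x \<bullet> v =
   c^2 * ((third_form f v (x + s *\<^sub>R v) + third_form f v (x - t *\<^sub>R v)) / 12)"
  using c by (simp add: field_simps power2_eq_square power3_eq_cube)
 with s t show ?thesis by (intro that) auto
qed

text \<open>The leading coefficient of the bias.  The fourth moments of sign vectors leave only those third partials whose
indices can be paired with the coordinate \<open>l\<close>, and symmetry of the partials merges the three pairings.\<close>

definition bias :: "real^'n" where
 "bias = (\<chi> l. (1/6) * (third_partial f l l l z + 3 * (\<Sum>i\<in>UNIV - {l}. third_partial f i i l z)))"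

lemma cube_mean_third_form:
 "(1 / 2 ^ CARD('n)) *\<^sub>R (\<Sum>v\<in>cube. (third_form f v z / 6) *\<^sub>R v) = bias"
proof -
 have "(\<Sum>v\<in>cube. third_form f v z * v $ l) =
   2 ^ CARD('n) * (third_partial f l l l z + 3 * (\<Sum>i\<in>UNIV - {l}. third_partial f i i l z))" for l
 proof -
  let ?A = "%i j m. third_partial f i j m z"
  let ?N = "2 ^ CARD('n) :: real"
  have "(\<Sum>v\<in>cube. third_form f v z * v $ l) =
    (\<Sum>v\<in>(cube::(real^'n) set). \<Sum>i\<in>UNIV. \<Sum>j\<in>UNIV. \<Sum>m\<in>UNIV. ?A i j m * (v $ l * (v $ i * v $ j * v $ m)))"
   by (simp add: third_form_def sum_distrib_left sum_distrib_right mult_ac)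
  also have "... = (\<Sum>i\<in>UNIV. \<Sum>j\<in>UNIV. \<Sum>m\<in>UNIV. \<Sum>v\<in>(cube::(real^'n) set). ?A i j m * (v $ l * (v $ i * v $ j * v $ m)))"
   by (subst sum.swap, intro sum.cong refl, subst sum.swap, intro sum.cong refl, rule sum.swap)
  also have "... = (\<Sum>i\<in>UNIV. \<Sum>j\<in>UNIV. \<Sum>m\<in>UNIV. ?A i j m *
    (if (i = l \<and> j = m) \<or> (j = l \<and> i = m) \<or> (m = l \<and> i = j) then ?N else 0))"
   by (simp only: sum_distrib_left[symmetric] cube_fourth_moment)
  also have "... = (\<Sum>i\<in>UNIV. \<Sum>j\<in>UNIV. \<Sum>m\<in>UNIV. ?N * (
     (if i = l then if m = j then ?A l j j else 0 else 0) + (if j = l then if m = i then ?A i l i else 0 else 0)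
    + (if m = l then if j = i then ?A i i l else 0 else 0)
    - 2 * (if i = l then if j = l then if m = l then ?A l l l else 0 else 0 else 0)))"
  proof (intro sum.cong refl)
   fix i j m
   show "?A i j m * (if (i = l \<and> j = m) \<or> (j = l \<and> i = m) \<or> (m = l \<and> i = j) then ?N else 0) = ?N * (
     (if i = l then if m = j then ?A l j j else 0 else 0) + (if j = l then if m = i then ?A i l i else 0 else 0)
    + (if m = l then if j = i then ?A i i l else 0 else 0)
    - 2 * (if i = l then if j = l then if m = l then ?A l l l else 0 else 0 else 0))"
    by (cases "i = l"; cases "j = l"; cases "m = l") auto
  qed
  also have "... = ?N * ((\<Sum>j\<in>UNIV. ?A l j j) + (\<Sum>i\<in>UNIV. ?A i l i) + (\<Sum>i\<in>UNIV. ?A i i l) - 2 * ?A l l l)"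
  proof -
   have i1: "(\<Sum>j\<in>UNIV. if P then F j else 0) = (if P then sum F UNIV else (0::real))" for P and F :: "'n => real"
    by auto
   show ?thesis
    by (simp only: sum_distrib_left[symmetric] sum.distrib sum_subtractf) (simp add: i1)
  qed
  also have "... = ?N * (3 * (\<Sum>i\<in>UNIV. ?A i i l) - 2 * ?A l l l)"
   by (simp add: third_partial_symmetric)
  also have "(\<Sum>i\<in>UNIV. ?A i i l) = ?A l l l + (\<Sum>i\<in>UNIV - {l}. ?A i i l)"
   by (rule sum.remove) auto
  finally show ?thesis by simp
 qed
 thus ?thesis by (simp add: bias_def vec_eq_iff sum_component sum_divide_distrib[symmetric])
qed

lemma spsa_mean_bias_limit:
 fixes x :: "nat => real^'n" and c :: "nat => real"
 assumes x: "x \<longlonglongrightarrow> z" and c: "c \<longlonglongrightarrow> 0" "!!k. c k > 0"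
 shows "(%k. (1 / (c k)^2) *\<^sub>R (spsa_mean f (c k) (x k) - gradient f (x k))) \<longlonglongrightarrow> bias"
proof -
 let ?R = "%v k. ((f (x k + c k *\<^sub>R v) - f (x k - c k *\<^sub>R v)) / (2 * c k) - gradient f (x k) \<bullet> v) / (c k)^2"
 have lim: "?R v \<longlonglongrightarrow> third_form f v z / 6" for v
 proof -
  have "isCont (third_form f v) z"
   unfolding third_form_def[abs_def]
   using third_cont r by (intro continuous_intros) (auto simp: continuous_on_eq_continuous_at)
  hence cont: "(%k. third_form f v (y k)) \<longlonglongrightarrow> third_form f v z" if "y \<longlonglongrightarrow> z" for y :: "nat => real^'n"
   using that by (rule isCont_tendsto_compose)
  have "(%k. dist (x k) z + c k * norm v) \<longlonglongrightarrow> 0 + 0 * norm v"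
   using x c by (intro tendsto_intros) (simp add: tendsto_dist_iff[symmetric])
  hence ev: "\<forall>\<^sub>F k in sequentially. dist (x k) z + c k * norm v < r"
   using r by (auto dest: order_tendstoD)
  have "\<exists>s t. 0 <= s \<and> s <= c k \<and> 0 <= t \<and> t <= c k \<and>
    (dist (x k) z + c k * norm v < r -->
     ?R v k = (third_form f v (x k + s *\<^sub>R v) + third_form f v (x k - t *\<^sub>R v)) / 12)" for k
  proof (cases "dist (x k) z + c k * norm v < r")
   case True
   have "cball (x k) (c k * norm v) \<subseteq> ball z r"
   proof
    fix y assume "y \<in> cball (x k) (c k * norm v)"
    thus "y \<in> ball z r" using True dist_triangle[of z y "x k"] by (simp add: dist_commute)
   qed
   from taylor_central[OF c(2) this] obtain s t where "0 < s" "s < c k" "0 < t" "t < c k"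
    "(f (x k + c k *\<^sub>R v) - f (x k - c k *\<^sub>R v)) / (2 * c k) - gradient f (x k) \<bullet> v =
     (c k)^2 * ((third_form f v (x k + s *\<^sub>R v) + third_form f v (x k - t *\<^sub>R v)) / 12)" .
   thus ?thesis using c(2)[of k] by (intro exI[of _ s] exI[of _ t]) auto
  next
   case False
   thus ?thesis using c(2)[of k] by (intro exI[of _ 0]) auto
  qed
  then obtain s t where st: "!!k. 0 <= s k" "!!k. s k <= c k" "!!k. 0 <= t k" "!!k. t k <= c k"
   "!!k. dist (x k) z + c k * norm v < r ==>
     ?R v k = (third_form f v (x k + s k *\<^sub>R v) + third_form f v (x k - t k *\<^sub>R v)) / 12"
   unfolding choice_iff[symmetric] by metis
  have s0: "s \<longlonglongrightarrow> 0"
   by (rule tendsto_sandwich[OF _ _ tendsto_const c(1)]) (use st(1,2) in auto)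
  have t0: "t \<longlonglongrightarrow> 0"
   by (rule tendsto_sandwich[OF _ _ tendsto_const c(1)]) (use st(3,4) in auto)
  have "(%k. x k + s k *\<^sub>R v) \<longlonglongrightarrow> z + 0 *\<^sub>R v" "(%k. x k - t k *\<^sub>R v) \<longlonglongrightarrow> z - 0 *\<^sub>R v"
   by (rule tendsto_add[OF x tendsto_scaleR[OF s0 tendsto_const]]
     tendsto_diff[OF x tendsto_scaleR[OF t0 tendsto_const]])+
  hence "(%k. (third_form f v (x k + s k *\<^sub>R v) + third_form f v (x k - t k *\<^sub>R v)) / 12)
    \<longlonglongrightarrow> (third_form f v z + third_form f v z) / 12"
   by (intro tendsto_divide tendsto_add tendsto_const cont) auto
  hence "(%k. (third_form f v (x k + s k *\<^sub>R v) + third_form f v (x k - t k *\<^sub>R v)) / 12)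
    \<longlonglongrightarrow> third_form f v z / 6" by simp
  thus ?thesis
   by (rule Lim_transform_eventually) (use ev in \<open>eventually_elim, simp add: st(5)\<close>)
 qed
 have "(%k. (1 / 2 ^ CARD('n)) *\<^sub>R (\<Sum>v\<in>(cube::(real^'n) set). ?R v k *\<^sub>R v))
   \<longlonglongrightarrow> (1 / 2 ^ CARD('n)) *\<^sub>R (\<Sum>v\<in>cube. (third_form f v z / 6) *\<^sub>R v)"
  by (intro tendsto_intros lim)
 moreover have "(1 / 2 ^ CARD('n)) *\<^sub>R (\<Sum>v\<in>(cube::(real^'n) set). ?R v k *\<^sub>R v) =
   (1 / (c k)^2) *\<^sub>R (spsa_mean f (c k) (x k) - gradient f (x k))" for k
  unfolding spsa_mean_minus_gradient by (simp add: scaleR_sum_right mult.commute)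
 ultimately show ?thesis by (simp only: cube_mean_third_form)
qed

text \<open>Otherwise there would be points \<open>x k\<close> and widths \<open>c k\<close> tending to \<open>z\<close> and 0 along which the normalised bias is
unbounded, in contradiction to its convergence.\<close>

lemma spsa_mean_bias_bound:
 obtains B d where "B > 0" "d > 0"
  "!!x c. dist x z <= d ==> 0 < c ==> c <= d ==> norm (spsa_mean f c x - gradient f x) <= B * c^2"
proof -
 define P where "P k x c \<longleftrightarrow> dist x z <= inverse (real (Suc k)) \<and> 0 < c \<and> c <= inverse (real (Suc k)) \<and>
   real (Suc k) * c^2 < norm (spsa_mean f c x - gradient f x)" for k x c
 have "\<exists>k. \<forall>x c. \<not> P k x c"
 proof (rule ccontr)
  assume "\<not> ?thesis"
  hence "\<forall>k. \<exists>x c. P k x c" by blast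
  then obtain x c where P: "!!k. P k (x k) (c k)" by metis
  have xc: "dist (x k) z <= inverse (real (Suc k))" "0 < c k"
   "c k <= inverse (real (Suc k))" 
   "norm (spsa_mean f (c k) (x k) - gradient f (x k)) > real (Suc k) * (c k)^2" for k
   using P[of k] unfolding P_def by blast+
  have nx: "\<forall>k. norm (dist (x k) z) <= inverse (real (Suc k))" using xc(1) by simp
  have nc: "\<forall>k. norm (c k) <= inverse (real (Suc k))"
  proof
   fix k show "norm (c k) <= inverse (real (Suc k))" using xc(2)[of k] xc(3)[of k] by simp
  qed
  have "(%k. dist (x k) z) \<longlonglongrightarrow> 0"
   by (rule Lim_null_comparison[OF always_eventually[OF nx] LIMSEQ_inverse_real_of_nat])
  hence "x \<longlonglongrightarrow> z" unfolding tendsto_dist_iff[symmetric] .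
  moreover have "c \<longlonglongrightarrow> 0"
   by (rule Lim_null_comparison[OF always_eventually[OF nc] LIMSEQ_inverse_real_of_nat])
  ultimately have "(%k. (1 / (c k)^2) *\<^sub>R (spsa_mean f (c k) (x k) - gradient f (x k))) \<longlonglongrightarrow> bias"
   by (rule spsa_mean_bias_limit) (rule xc(2))
  hence "convergent (%k. (1 / (c k)^2) *\<^sub>R (spsa_mean f (c k) (x k) - gradient f (x k)))"
   by (rule convergentI)
  hence "Bseq (%k. (1 / (c k)^2) *\<^sub>R (spsa_mean f (c k) (x k) - gradient f (x k)))"
   by (rule convergent_imp_Bseq)
  then obtain K where K: "!!k. norm ((1 / (c k)^2) *\<^sub>R (spsa_mean f (c k) (x k) - gradient f (x k))) <= K"
   unfolding Bseq_def by blast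
  obtain k where k: "K < real k" using reals_Archimedean2 by blast
  have "norm (spsa_mean f (c k) (x k) - gradient f (x k)) <= K * (c k)^2"
   using K[of k] xc(2)[of k] unfolding norm_scaleR by (simp add: field_simps)
  moreover have "K * (c k)^2 <= real (Suc k) * (c k)^2" using k by (intro mult_right_mono) auto
  ultimately show False using xc(4)[of k] by linarith
 qed
 then obtain k where k: "!!x c. \<not> P k x c" by blast
 show ?thesis
 proof (rule that[of "real (Suc k)" "inverse (real (Suc k))"])
  show "norm (spsa_mean f c x - gradient f x) <= real (Suc k) * c^2"
   if "dist x z <= inverse (real (Suc k))" "0 < c" "c <= inverse (real (Suc k))" for x c
   using k[of x c] that unfolding P_def by linarith
 qed auto
qed

end

section \<open>Characteristic functions of a stochastic linear recursion\<close>

lemma cmod_exp_diff_le: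
 assumes "Re a <= 0" "Re b <= 0"
 shows "cmod (exp a - exp b) <= cmod (a - b)"
proof -
 have "cmod (exp a - exp b) <= 1 * cmod (a - b)"
 proof (rule field_differentiable_bound[where S = "{z. Re z <= 0}"])
  show "convex {z. Re z <= 0}" by (rule convex_halfspace_Re_le)
  show "cmod (exp z) <= 1" if "z \<in> {z. Re z <= 0}" for z using that by simp
 qed (use assms in \<open>auto intro!: has_field_derivative_at_within DERIV_exp\<close>)
 thus ?thesis by simp
qed

lemma cmod_iexp_diff_le: "cmod (iexp x - iexp y) <= \<bar>x - y\<bar>"
proof -
 have "cmod (iexp x - iexp y) <= cmod (\<i> * of_real x - \<i> * of_real y)"
  by (rule cmod_exp_diff_le) auto
 also have "\<i> * of_real x - \<i> * of_real y = \<i> * of_real (x - y)" by (simp add: algebra_simps)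
 finally show ?thesis by (simp only: norm_mult norm_of_real) simp
qed

text \<open>Interpolates between the second and the third order remainder, so that a moment of order \<open>2 + \<delta>\<close> suffices.\<close>

lemma iexp_second_order:
 assumes "0 < \<delta>" "\<delta> <= 1"
 shows "cmod (iexp x - (1 + \<i> * of_real x - of_real (x^2 / 2))) <= \<bar>x\<bar> powr (2 + \<delta>)"
proof -
 have e: "(\<Sum>k\<le>2. (\<i> * complex_of_real x) ^ k / fact k) = 1 + \<i> * of_real x - of_real (x^2 / 2)"
  by (simp add: numeral_2_eq_2 power2_eq_square) (simp add: algebra_simps)
 show ?thesis
 proof (cases "\<bar>x\<bar> <= 1")
  case True
  have "cmod (iexp x - (1 + \<i> * of_real x - of_real (x^2 / 2))) <= \<bar>x\<bar> ^ 3 / 6"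
   using iexp_approx1[of x 2] unfolding e by (simp add: fact_numeral numeral_3_eq_3)
  also have "... <= \<bar>x\<bar> ^ 3" by simp
  also have "... <= \<bar>x\<bar> powr (2 + \<delta>)"
  proof (cases "x = 0")
   case False
   hence "\<bar>x\<bar> ^ 3 = \<bar>x\<bar> powr 3" by simp
   also have "... <= \<bar>x\<bar> powr (2 + \<delta>)" using True assms False by (intro powr_mono') auto
   finally show ?thesis .
  qed simp
  finally show ?thesis .
 next
  case False
  have "cmod (iexp x - (1 + \<i> * of_real x - of_real (x^2 / 2))) <= \<bar>x\<bar> ^ 2"
   using iexp_approx2[of x 2] unfolding e by (simp add: fact_numeral)
  also have "... = \<bar>x\<bar> powr 2" using False by simp
  also have "... <= \<bar>x\<bar> powr (2 + \<delta>)" using False assms by (intro powr_mono) auto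
  finally show ?thesis .
 qed
qed

text \<open>The process \<open>W\<close> is multiplied by the diagonal matrix \<open>B n\<close> with \<open>1 - B n i\<close> close to \<open>\<kappa> i * h n\<close>.  Here \<open>\<zeta>\<close> is the martingale
noise, \<open>t\<close> a drift with limit \<open>T\<close>, and \<open>q\<close> a nonlinear perturbation that is dominated by \<open>\<theta>\<close> times \<open>W\<close>.  The bound
\<open>\<theta>0 < \<kappa> i\<close> keeps the contraction alive and the limit 0 of \<open>\<theta>\<close> makes the perturbation disappear in the limit.  The
variance condition is stated in integrated form, against bounded test functions \<open>Y\<close> of the past.\<close>

locale linear_recursion = prob_space M for M :: "'s measure" +
 fixes F :: "nat => 's measure"
  and W q t \<zeta> :: "nat => 's => real^'n::finite"
  and \<theta> :: "nat => 's => real"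
  and B :: "nat => 'n => real" and h r \<epsilon> :: "nat => real"
  and \<kappa> :: "'n => real" and \<theta>0 \<tau> C \<delta> v :: real and T :: "real^'n" and N :: nat
 assumes sub: "!!n. subalgebra M (F n)"
  and W_meas: "!!n. n >= N ==> W n \<in> borel_measurable (F n)"
  and q_meas: "!!n. n >= N ==> q n \<in> borel_measurable (F n)"
  and t_meas: "!!n. n >= N ==> t n \<in> borel_measurable (F n)"
  and \<zeta>_meas: "!!n. n >= N ==> \<zeta> n \<in> borel_measurable M"
  and \<theta>_meas: "!!n. n >= N ==> \<theta> n \<in> borel_measurable M"
  and step: "!!n om. n >= N ==> om \<in> space M ==>
   W (Suc n) om = (\<chi> i. B n i * W n om $ i) + (r n * h n) *\<^sub>R (q n om + t n om) + (r n * sqrt (h n)) *\<^sub>R \<zeta> n om"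
  and start: "integrable M (%om. (norm (W N om))^2)"
  and h_pos: "!!n. n >= N ==> h n > 0" and h_lim: "h \<longlonglongrightarrow> 0" and h_div: "\<not> summable h"
  and B_lim: "!!i. (%n. (1 - B n i) / h n) \<longlonglongrightarrow> \<kappa> i"
  and r_lim: "r \<longlonglongrightarrow> 1"
  and q_bound: "!!n om. n >= N ==> om \<in> space M ==> norm (q n om) <= \<theta> n om * norm (W n om)"
  and \<theta>_bound: "!!n om. n >= N ==> om \<in> space M ==> 0 <= \<theta> n om \<and> \<theta> n om <= \<theta>0"
  and \<theta>0: "!!i. \<theta>0 < \<kappa> i"
  and \<theta>_lim: "AE om in M. (%n. \<theta> n om) \<longlonglongrightarrow> 0"
  and t_bound: "!!n om. n >= N ==> om \<in> space M ==> norm (t n om) <= \<tau>"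
  and t_lim: "AE om in M. (%n. t n om) \<longlonglongrightarrow> T"
  and \<delta>: "0 < \<delta>" "\<delta> <= 1"
  and \<zeta>_int: "!!n. n >= N ==> integrable M (%om. norm (\<zeta> n om) powr (2 + \<delta>))"
  and \<zeta>_moment: "!!n. n >= N ==> (\<integral>om. norm (\<zeta> n om) powr (2 + \<delta>) \<partial>M) <= C"
  and mart: "!!n i. n >= N ==> AE om in M. real_cond_exp M (F n) (%om. \<zeta> n om $ i) om = 0"
  and variance: "!!n u Y. n >= N ==> Y \<in> borel_measurable (F n) ==> (!!om. \<bar>Y om\<bar> <= 1) ==>
   \<bar>\<integral>om. Y om * ((u \<bullet> \<zeta> n om)^2 - v * (norm u)^2) \<partial>M\<bar> <= \<epsilon> n * (norm u)^2"
  and \<epsilon>_lim: "\<epsilon> \<longlonglongrightarrow> 0" and v: "v >= 0"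
begin

lemma meas [measurable]:
 assumes "n >= N"
 shows "W n \<in> borel_measurable M" "q n \<in> borel_measurable M" "t n \<in> borel_measurable M"
  "\<zeta> n \<in> borel_measurable M" "\<theta> n \<in> borel_measurable M"
 using assms W_meas q_meas t_meas \<zeta>_meas \<theta>_meas measurable_from_subalg[OF sub] by blast+

lemma \<theta>0_nonneg: "0 <= \<theta>0"
 using \<theta>_bound[of N] not_empty by fastforce

lemma \<kappa>_pos: "0 < \<kappa> i"
 using \<theta>0[of i] \<theta>0_nonneg by simp

lemma \<tau>_nonneg: "0 <= \<tau>"
proof -
 obtain om where "om \<in> space M" using not_empty by blast
 thus ?thesis using order_trans[OF norm_ge_zero t_bound[of N om]] by simp
qed

lemma \<zeta>_sq_bound: "(norm (\<zeta> n om))^2 <= 1 + norm (\<zeta> n om) powr (2 + \<delta>)"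
proof (cases "norm (\<zeta> n om) <= 1")
 case True
 hence "(norm (\<zeta> n om))^2 <= 1" by (simp add: power_le_one)
 thus ?thesis by (simp add: add_increasing2)
next
 case False
 hence "(norm (\<zeta> n om))^2 = norm (\<zeta> n om) powr 2" by simp
 also have "... <= norm (\<zeta> n om) powr (2 + \<delta>)" using False \<delta> by (intro powr_mono) auto
 finally show ?thesis by simp
qed

lemma \<zeta>_sq:
 assumes "n >= N"
 shows "integrable M (%om. (norm (\<zeta> n om))^2)" "(\<integral>om. (norm (\<zeta> n om))^2 \<partial>M) <= 1 + C"
proof -
 note [measurable] = meas[OF assms]
 have i: "integrable M (%om. 1 + norm (\<zeta> n om) powr (2 + \<delta>))"
  using \<zeta>_int[OF assms] by simp
 show 1: "integrable M (%om. (norm (\<zeta> n om))^2)"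
  by (rule Bochner_Integration.integrable_bound[OF i]) (use \<zeta>_sq_bound in auto)
 have "(\<integral>om. (norm (\<zeta> n om))^2 \<partial>M) <= (\<integral>om. 1 + norm (\<zeta> n om) powr (2 + \<delta>) \<partial>M)"
  by (rule integral_mono[OF 1 i]) (rule \<zeta>_sq_bound)
 also have "... <= 1 + C" using \<zeta>_int[OF assms] \<zeta>_moment[OF assms] by (simp add: prob_space)
 finally show "(\<integral>om. (norm (\<zeta> n om))^2 \<partial>M) <= 1 + C" .
qed

lemma C_nonneg: "0 <= C"
 using order_trans[OF Bochner_Integration.integral_nonneg \<zeta>_moment[of N]] by simp

lemma \<zeta>_integrable:
 assumes "n >= N" shows "integrable M (%om. norm (\<zeta> n om))"
proof -
 note [measurable] = meas[OF assms]
 have "integrable M (%om. 1 + (norm (\<zeta> n om))^2)" using \<zeta>_sq(1)[OF assms] by simp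
 thus ?thesis
 proof (rule Bochner_Integration.integrable_bound)
  have "x <= 1 + x^2" for x :: real using sum_squares_bound[of x 1] by simp (smt (verit) zero_le_power2)
  thus "AE om in M. norm (norm (\<zeta> n om)) <= norm (1 + (norm (\<zeta> n om))^2)" by simp
 qed simp
qed

text \<open>A centred vector is orthogonal to vectors depending on the past.\<close>

lemma mart_inner:
 assumes n: "n >= N" and Y: "Y \<in> borel_measurable (F n)"
  and int: "!!i. integrable M (%om. Y om $ i * \<zeta> n om $ i)"
 shows "(\<integral>om. Y om \<bullet> \<zeta> n om \<partial>M) = 0"
proof -
 interpret sigma_finite_subalgebra M "F n"
  by (rule finite_measure_subalgebra_is_sigma_finite)
   (simp add: finite_measure_subalgebra_def finite_measure_subalgebra_axioms_def sub finite_measure_axioms)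
 note [measurable] = meas[OF n]
 have "(\<integral>om. Y om $ i * \<zeta> n om $ i \<partial>M) = 0" for i
 proof -
  have [measurable]: "Y \<in> borel_measurable (F n)" by (rule Y)
  have "(\<integral>om. Y om $ i * real_cond_exp M (F n) (%om. \<zeta> n om $ i) om \<partial>M) = (\<integral>om. Y om $ i * \<zeta> n om $ i \<partial>M)"
   by (rule real_cond_exp_intg(2)[OF int]) measurable
  moreover have "(\<integral>om. Y om $ i * real_cond_exp M (F n) (%om. \<zeta> n om $ i) om \<partial>M) = 0"
   by (rule integral_eq_zero_AE) (use mart[OF n, of i] in auto)
  ultimately show ?thesis by simp
 qed
 thus ?thesis by (simp add: inner_vec_def int)
qed

definition drift :: "nat => 's => real^'n" where
 "drift n om = (\<chi> i. B n i * W n om $ i) + (r n * h n) *\<^sub>R (q n om + t n om)"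

lemma step_drift: "n >= N ==> om \<in> space M ==> W (Suc n) om = drift n om + (r n * sqrt (h n)) *\<^sub>R \<zeta> n om"
 using step by (simp add: drift_def)

lemma drift_meas: "n >= N ==> drift n \<in> borel_measurable (F n)"
proof -
 assume n: "n >= N"
 note [measurable] = W_meas[OF n] q_meas[OF n] t_meas[OF n]
 show ?thesis unfolding drift_def[abs_def] by measurable
qed

lemma norm_diag_le:
 fixes w :: "real^'n" and b :: "'n => real"
 assumes "!!i. \<bar>b i\<bar> <= K" "0 <= K"
 shows "norm (\<chi> i. b i * w $ i) <= K * norm w"
proof -
 have "norm (\<chi> i. b i * w $ i) <= norm (K *\<^sub>R w)"
  by (rule norm_le_componentwise_cart) (use assms in \<open>auto simp: abs_mult intro: mult_right_mono\<close>)
 thus ?thesis using assms by simp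
qed

lemma drift_crude:
 assumes n: "n >= N"
 obtains K where "K >= 0" "!!om. om \<in> space M ==> norm (drift n om) <= K * norm (W n om) + K"
proof -
 define b where "b = (\<Sum>i\<in>UNIV. \<bar>B n i\<bar>)"
 define c where "c = \<bar>r n * h n\<bar>"
 have b: "\<bar>B n i\<bar> <= b" for i unfolding b_def by (rule member_le_sum) auto
 have b0: "0 <= b" and c0: "0 <= c" by (auto simp: b_def c_def sum_nonneg)
 show ?thesis
 proof (rule that[of "b + c * \<theta>0 + c * \<tau>"])
  fix om assume o: "om \<in> space M"
  have q: "norm (q n om) <= \<theta>0 * norm (W n om)"
   using q_bound[OF n o] \<theta>_bound[OF n o] by (meson mult_right_mono norm_ge_zero order_trans)
  have "norm (drift n om) <= norm (\<chi> i. B n i * W n om $ i) + c * norm (q n om + t n om)"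
   unfolding drift_def c_def by (rule order_trans[OF norm_triangle_ineq]) simp
  also have "... <= b * norm (W n om) + c * (\<theta>0 * norm (W n om) + \<tau>)"
   using q t_bound[OF n o] c0 b b0
   by (intro add_mono norm_diag_le mult_left_mono order_trans[OF norm_triangle_ineq]) auto
  also have "... <= (b + c * \<theta>0 + c * \<tau>) * norm (W n om) + (b + c * \<theta>0 + c * \<tau>)"
   using b0 c0 \<theta>0_nonneg \<tau>_nonneg by (simp add: algebra_simps add_increasing2)
  finally show "norm (drift n om) <= (b + c * \<theta>0 + c * \<tau>) * norm (W n om) + (b + c * \<theta>0 + c * \<tau>)" .
 qed (use b0 c0 \<theta>0_nonneg \<tau>_nonneg in auto)
qed

lemma drift_sq_integrable:
 assumes n: "n >= N" and W: "integrable M (%om. (norm (W n om))^2)"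
 shows "integrable M (%om. (norm (drift n om))^2)"
proof -
 obtain K where K: "K >= 0" "!!om. om \<in> space M ==> norm (drift n om) <= K * norm (W n om) + K"
  using drift_crude[OF n] by blast
 have [measurable]: "drift n \<in> borel_measurable M" by (rule measurable_from_subalg[OF sub drift_meas[OF n]])
 have "integrable M (%om. 2 * K^2 * (norm (W n om))^2 + 2 * K^2)" using W by simp
 thus ?thesis
 proof (rule Bochner_Integration.integrable_bound)
  have "(norm (drift n om))^2 <= 2 * K^2 * (norm (W n om))^2 + 2 * K^2" if "om \<in> space M" for om
  proof -
   have "(norm (drift n om))^2 <= (K * norm (W n om) + K)^2" using K(2)[OF that] by (intro power_mono) auto
   also have "... <= 2 * (K * norm (W n om))^2 + 2 * K^2"
    using sum_squares_bound[of "K * norm (W n om)" K] by (simp add: power2_sum)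
   finally show ?thesis by (simp add: power_mult_distrib)
  qed
  thus "AE om in M. norm ((norm (drift n om))^2) <= norm (2 * K^2 * (norm (W n om))^2 + 2 * K^2)"
   by (auto intro!: AE_I2)
 qed simp
qed

text \<open>The noise is orthogonal to the drift, so that second moments add up.\<close>

lemma sq_step:
 assumes n: "n >= N" and W: "integrable M (%om. (norm (W n om))^2)"
 shows "integrable M (%om. (norm (W (Suc n) om))^2)"
  "(\<integral>om. (norm (W (Suc n) om))^2 \<partial>M) <= (\<integral>om. (norm (drift n om))^2 \<partial>M) + (r n)^2 * h n * (1 + C)"
proof -
 note [measurable] = meas[OF n]
 have dF[measurable]: "drift n \<in> borel_measurable (F n)" by (rule drift_meas[OF n])
 have [measurable]: "drift n \<in> borel_measurable M" by (rule measurable_from_subalg[OF sub drift_meas[OF n]])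
 let ?s = "r n * sqrt (h n)"
 have s2: "?s^2 = (r n)^2 * h n" using h_pos[OF n] by (simp add: power_mult_distrib)
 note di = drift_sq_integrable[OF n W]
 note zi = \<zeta>_sq(1)[OF n]
 have prod: "integrable M (%om. drift n om $ i * \<zeta> n om $ i)" for i
 proof (rule Bochner_Integration.integrable_bound[OF Bochner_Integration.integrable_add[OF di zi]])
  have "\<bar>drift n om $ i * \<zeta> n om $ i\<bar> <= (norm (drift n om))^2 + (norm (\<zeta> n om))^2" for om
  proof -
   have "\<bar>drift n om $ i * \<zeta> n om $ i\<bar> <= norm (drift n om) * norm (\<zeta> n om)"
    unfolding abs_mult by (intro mult_mono component_le_norm_cart) auto
   also have "... <= (norm (drift n om))^2 + (norm (\<zeta> n om))^2"
    using sum_squares_bound[of "norm (drift n om)" "norm (\<zeta> n om)"]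
     mult_nonneg_nonneg[OF norm_ge_zero[of "drift n om"] norm_ge_zero[of "\<zeta> n om"]] by linarith
   finally show ?thesis .
  qed
  thus "AE om in M. norm (drift n om $ i * \<zeta> n om $ i) <= norm ((norm (drift n om))^2 + (norm (\<zeta> n om))^2)"
   by (auto intro!: AE_I2)
 qed measurable
 have pi: "integrable M (%om. drift n om \<bullet> \<zeta> n om)" unfolding inner_vec_def by (simp add: prod)
 have eq: "(norm (W (Suc n) om))^2 = (norm (drift n om))^2 + 2 * ?s * (drift n om \<bullet> \<zeta> n om) + (r n)^2 * h n * (norm (\<zeta> n om))^2"
  if "om \<in> space M" for om
 proof -
  have "(norm (x + s *\<^sub>R y))^2 = (norm x)^2 + 2 * s * (x \<bullet> y) + s^2 * (norm y)^2" for x y :: "real^'n" and s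
   unfolding power2_norm_eq_inner
   by (simp add: inner_add_left inner_add_right inner_commute) (simp add: power2_eq_square algebra_simps)
  thus ?thesis unfolding step_drift[OF n that] s2[symmetric] .
 qed
 have ri: "integrable M (%om. (norm (drift n om))^2 + 2 * ?s * (drift n om \<bullet> \<zeta> n om) + (r n)^2 * h n * (norm (\<zeta> n om))^2)"
  using di pi zi by simp
 thus "integrable M (%om. (norm (W (Suc n) om))^2)"
  by (subst Bochner_Integration.integrable_cong[OF refl eq])
 have "(\<integral>om. (norm (W (Suc n) om))^2 \<partial>M) =
   (\<integral>om. (norm (drift n om))^2 + 2 * ?s * (drift n om \<bullet> \<zeta> n om) + (r n)^2 * h n * (norm (\<zeta> n om))^2 \<partial>M)"
  by (rule Bochner_Integration.integral_cong[OF refl eq])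
 also have "... = (\<integral>om. (norm (drift n om))^2 \<partial>M) + 2 * ?s * (\<integral>om. drift n om \<bullet> \<zeta> n om \<partial>M)
   + (r n)^2 * h n * (\<integral>om. (norm (\<zeta> n om))^2 \<partial>M)"
  using di pi zi by simp
 also have "(\<integral>om. drift n om \<bullet> \<zeta> n om \<partial>M) = 0" by (rule mart_inner[OF n dF prod])
 also have "(\<integral>om. (norm (drift n om))^2 \<partial>M) + 2 * ?s * 0 + (r n)^2 * h n * (\<integral>om. (norm (\<zeta> n om))^2 \<partial>M)
   <= (\<integral>om. (norm (drift n om))^2 \<partial>M) + (r n)^2 * h n * (1 + C)"
  using \<zeta>_sq(2)[OF n] h_pos[OF n] by (simp add: mult_left_mono)
 finally show "(\<integral>om. (norm (W (Suc n) om))^2 \<partial>M) <= (\<integral>om. (norm (drift n om))^2 \<partial>M) + (r n)^2 * h n * (1 + C)" .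
qed

lemma W_sq_integrable: "n >= N ==> integrable M (%om. (norm (W n om))^2)"
 by (induction n rule: dec_induct) (use start sq_step(1) in auto)

text \<open>A rate \<open>p\<close> strictly between \<open>\<theta>0\<close> and all the \<open>\<kappa> i\<close>.\<close>

lemma contraction_rate:
 obtains p N1 where "\<theta>0 < p" "N1 >= N"
  "!!n i. n >= N1 ==> \<bar>B n i\<bar> <= 1 - p * h n" "!!n. n >= N1 ==> p * h n <= 1"
proof -
 define k where "k = Min (range \<kappa>)"
 have k: "\<theta>0 < k" "!!i. k <= \<kappa> i" using \<theta>0 by (auto simp: k_def)
 define p where "p = (\<theta>0 + k) / 2"
 have p: "\<theta>0 < p" "p < \<kappa> i" for i using k(1) k(2)[of i] by (auto simp: p_def)
 have p0: "p > 0" using p \<theta>0_nonneg by simp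
 have e1: "\<forall>\<^sub>F n in sequentially. \<forall>i. p < (1 - B n i) / h n"
  by (rule eventually_all_finite) (use order_tendstoD(1)[OF B_lim p(2)] in blast)
 have e2: "\<forall>\<^sub>F n in sequentially. \<forall>i. (1 - B n i) / h n < \<kappa> i + 1"
  by (rule eventually_all_finite) (use order_tendstoD(2)[OF B_lim] in auto)
 define m where "m = p + (\<Sum>i\<in>UNIV. \<kappa> i + 1)"
 have m: "\<kappa> i + 1 <= m" for i
  using member_le_sum[of i UNIV "%i. \<kappa> i + 1"] \<kappa>_pos p0 by (simp add: m_def less_imp_le add_increasing)
 have m0: "m >= p" using \<kappa>_pos by (simp add: m_def sum_nonneg less_imp_le add_increasing2)
 have e3: "\<forall>\<^sub>F n in sequentially. h n < 1 / (2 * m)"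
  using m0 p0 by (intro order_tendstoD(2)[OF h_lim]) auto
 have "\<forall>\<^sub>F n in sequentially. n >= N \<and> (\<forall>i. \<bar>B n i\<bar> <= 1 - p * h n) \<and> p * h n <= 1"
  using e1 e2 e3 eventually_ge_at_top[of N]
 proof eventually_elim
  case (elim n)
  have hn: "h n > 0" using h_pos elim by simp
  have "2 * (m * h n) < 1" using elim(3) m0 p0 by (simp add: field_simps)
  moreover have "p * h n <= m * h n" using m0 hn by (intro mult_right_mono) auto
  ultimately have s: "2 * (m * h n) < 1" "p * h n <= m * h n" by auto
  have "\<bar>B n i\<bar> <= 1 - p * h n" for i
  proof -
   have "p * h n <= 1 - B n i" using elim(1) hn by (auto simp: field_simps dest: spec[of _ i])
   moreover have "1 - B n i <= (\<kappa> i + 1) * h n" using elim(2) hn by (auto simp: field_simps dest: spec[of _ i])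
   moreover have "(\<kappa> i + 1) * h n <= m * h n" using m hn by (intro mult_right_mono) auto
   ultimately show ?thesis using s by linarith
  qed
  thus ?case using elim s by auto
 qed
 then obtain N1 where N1: "!!n. n >= N1 ==> n >= N \<and> (\<forall>i. \<bar>B n i\<bar> <= 1 - p * h n) \<and> p * h n <= 1"
  unfolding eventually_sequentially by blast
 show ?thesis by (rule that[OF p(1), of N1]) (use N1 in auto)
qed

text \<open>The drift contracts the norm by \<open>1 - (p - \<theta>0) h\<close> up to a bounded drift term, and the noise adds \<open>O(h)\<close> to the second
moment.\<close>

lemma second_moment_bounded:
 obtains K where "K > 0" "!!n. n >= N ==> (\<integral>om. (norm (W n om))^2 \<partial>M) <= K"
proof -
 obtain p N1 where p: "\<theta>0 < p" "N1 >= N" "!!n i. n >= N1 ==> \<bar>B n i\<bar> <= 1 - p * h n"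
   "!!n. n >= N1 ==> p * h n <= 1"
  using contraction_rate by metis
 define a where "a = (p - \<theta>0) / 2"
 have a: "a > 0" "\<theta>0 + a = p - a" using p by (auto simp: a_def field_simps)
 have "(%n. r n * \<theta>0) \<longlonglongrightarrow> 1 * \<theta>0" by (intro tendsto_intros r_lim)
 hence "\<forall>\<^sub>F n in sequentially. r n * \<theta>0 < \<theta>0 + a" using a by (intro order_tendstoD(2)) auto
 moreover have "\<forall>\<^sub>F n in sequentially. 0 < r n" "\<forall>\<^sub>F n in sequentially. r n < 2"
  using order_tendstoD[OF r_lim] by auto
 ultimately have "\<forall>\<^sub>F n in sequentially. n >= N1 \<and> r n * \<theta>0 < \<theta>0 + a \<and> 0 < r n \<and> r n < 2"
  using eventually_ge_at_top[of N1] by eventually_elim auto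
 then obtain N2 where N2: "!!n. n >= N2 ==> n >= N1 \<and> r n * \<theta>0 < \<theta>0 + a \<and> 0 < r n \<and> r n < 2"
  unfolding eventually_sequentially by blast
 define D where "D = 2 * \<tau> / a"
 have D: "D >= 0" using a \<tau>_nonneg by (simp add: D_def)
 define w where "w n = (\<integral>om. (norm (W n om))^2 \<partial>M)" for n
 define E where "E = D^2 + 4 * (1 + C) / a"
 have rec: "w (Suc n) <= (1 - a * h n) * w n + a * h n * E" if n2: "n >= N2" for n
 proof -
  have n1: "n >= N1" and rn: "r n * \<theta>0 < \<theta>0 + a" "0 < r n" "r n < 2" using N2[OF n2] by auto
  have n: "n >= N" using n1 p by simp
  have hn: "h n > 0" using h_pos n by simp
  have ah: "0 <= a * h n" "a * h n <= 1"
  proof -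
   have "a * h n <= p * h n" using hn a \<theta>0_nonneg by (intro mult_right_mono) auto
   thus "a * h n <= 1" using p(4)[OF n1] by simp
  qed (use a hn in auto)
  have db: "(norm (drift n om))^2 <= (1 - a * h n) * (norm (W n om))^2 + a * h n * D^2" if o: "om \<in> space M" for om
  proof -
   let ?x = "norm (W n om)"
   have q: "norm (q n om) <= \<theta>0 * ?x"
    using q_bound[OF n o] \<theta>_bound[OF n o] by (meson mult_right_mono norm_ge_zero order_trans)
   have "norm (drift n om) <= norm (\<chi> i. B n i * W n om $ i) + (r n * h n) * norm (q n om + t n om)"
    unfolding drift_def by (rule order_trans[OF norm_triangle_ineq]) (use rn hn in simp)
   also have "... <= (1 - p * h n) * ?x + (r n * h n) * (\<theta>0 * ?x + \<tau>)"
    using q t_bound[OF n o] hn rn p(3,4) n1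
    by (intro add_mono norm_diag_le mult_left_mono order_trans[OF norm_triangle_ineq]) auto
   also have "... = (1 - p * h n) * ?x + h n * ((r n * \<theta>0) * ?x) + h n * (r n * \<tau>)" by (simp add: algebra_simps)
   also have "... <= (1 - p * h n) * ?x + h n * ((\<theta>0 + a) * ?x) + h n * (2 * \<tau>)"
    using rn hn \<tau>_nonneg by (intro add_mono mult_left_mono mult_right_mono) auto
   also have "... = (1 - a * h n) * ?x + a * h n * D"
    unfolding a(2) D_def using a(1) by (simp add: field_simps)
   finally have "norm (drift n om) <= (1 - a * h n) * ?x + a * h n * D" .
   hence "(norm (drift n om))^2 <= ((1 - a * h n) * ?x + a * h n * D)^2" by (intro power_mono) auto
   also have "... <= (1 - a * h n) * ?x^2 + a * h n * D^2"
   proof -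
    have "(1 - a * h n) * ?x^2 + a * h n * D^2 - ((1 - a * h n) * ?x + a * h n * D)^2
      = (1 - a * h n) * (a * h n) * (?x - D)^2" by (simp add: power2_eq_square algebra_simps)
    moreover have "... >= 0" using ah by simp
    ultimately show ?thesis by linarith
   qed
   finally show ?thesis .
  qed
  have "w (Suc n) <= (\<integral>om. (norm (drift n om))^2 \<partial>M) + (r n)^2 * h n * (1 + C)"
   unfolding w_def by (rule sq_step(2)[OF n W_sq_integrable[OF n]])
  also have "(\<integral>om. (norm (drift n om))^2 \<partial>M) <= (\<integral>om. (1 - a * h n) * (norm (W n om))^2 + a * h n * D^2 \<partial>M)"
   by (rule integral_mono[OF drift_sq_integrable[OF n W_sq_integrable[OF n]] _ db])
    (use W_sq_integrable[OF n] in simp)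
  also have "... = (1 - a * h n) * w n + a * h n * D^2"
   using W_sq_integrable[OF n] by (simp add: w_def prob_space)
  also have "(r n)^2 * h n * (1 + C) <= 2^2 * h n * (1 + C)"
   using rn hn C_nonneg by (intro mult_right_mono power_mono) auto
  finally have "w (Suc n) <= (1 - a * h n) * w n + a * h n * D^2 + 2^2 * h n * (1 + C)" by simp
  moreover have "a * h n * E = a * h n * D^2 + 2^2 * h n * (1 + C)" using a by (simp add: E_def field_simps)
  ultimately show ?thesis by simp
 qed
 have wb: "w n <= max (w N2) E" if "n >= N2" for n
 proof (rule contraction_bounded[where p = "%n. a * h n", OF _ _ that])
  fix n assume "n >= N2"
  thus "w (Suc n) <= (1 - a * h n) * w n + a * h n * E" by (rule rec)
 next
  fix n assume "n >= N2"
  hence n1: "n >= N1" using N2 by blast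
  hence hn: "h n > 0" using h_pos p by simp
  have "a * h n <= p * h n" using hn a \<theta>0_nonneg by (intro mult_right_mono) auto
  from order_trans[OF this p(4)[OF n1]] show "0 <= a * h n \<and> a * h n <= 1" using a hn by simp
 qed
 have w0: "w n >= 0" for n by (simp add: w_def)
 define K where "K = max (w N2) E + (\<Sum>n\<le>N2. w n) + 1"
 have "w n <= K" for n
 proof (cases "n >= N2")
  case True
  thus ?thesis using wb[OF True] w0 by (simp add: K_def sum_nonneg add_increasing2)
 next
  case False
  hence "w n <= (\<Sum>n\<le>N2. w n)" by (intro member_le_sum) (auto simp: w0)
  thus ?thesis using w0[of N2] by (simp add: K_def max_def)
 qed
 moreover have "K > 0"
 proof -
  have "0 <= max (w N2) E" "0 <= (\<Sum>n\<le>N2. w n)" using w0 by (auto simp: sum_nonneg max_def le_max_iff_disj intro: order_trans)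
  thus ?thesis by (simp add: K_def)
 qed
 ultimately show ?thesis using that unfolding w_def by blast
qed

lemma W_norm_integrable: "n >= N ==> integrable M (%om. norm (W n om))"
proof -
 assume n: "n >= N"
 note [measurable] = meas[OF n]
 have "integrable M (%om. 1 + (norm (W n om))^2)" using W_sq_integrable[OF n] by simp
 thus ?thesis
 proof (rule Bochner_Integration.integrable_bound)
  have "x <= 1 + x^2" for x :: real using sum_squares_bound[of x 1] by simp (smt (verit) zero_le_power2)
  thus "AE om in M. norm (norm (W n om)) <= norm (1 + (norm (W n om))^2)" by simp
 qed simp
qed

lemma q_integrable:
 assumes n: "n >= N"
 shows "integrable M (%om. \<theta> n om * norm (W n om))" "integrable M (%om. norm (q n om))"
  "(\<integral>om. norm (q n om) \<partial>M) <= (\<integral>om. \<theta> n om * norm (W n om) \<partial>M)"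
proof -
 note [measurable] = meas[OF n]
 have "integrable M (%om. \<theta>0 * norm (W n om))" using W_norm_integrable[OF n] by simp
 thus 1: "integrable M (%om. \<theta> n om * norm (W n om))"
  by (rule Bochner_Integration.integrable_bound)
   (use \<theta>_bound[OF n] \<theta>0_nonneg in \<open>auto intro!: AE_I2 mult_right_mono simp: abs_mult\<close>)
 thus 2: "integrable M (%om. norm (q n om))"
  by (rule Bochner_Integration.integrable_bound)
   (use q_bound[OF n] \<theta>_bound[OF n] in \<open>auto intro!: AE_I2 simp: abs_mult\<close>)
 show "(\<integral>om. norm (q n om) \<partial>M) <= (\<integral>om. \<theta> n om * norm (W n om) \<partial>M)"
  by (rule integral_mono[OF 2 1]) (rule q_bound[OF n])
qed

text \<open>Split the product \<open>\<theta> * norm W\<close> by the inequality between arithmetic and geometric means: the square of \<open>\<theta>\<close> vanishes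
by dominated convergence, and the second moment of \<open>W\<close> is bounded.\<close>

lemma perturbation_negligible: "(%n. \<integral>om. norm (q n om) \<partial>M) \<longlonglongrightarrow> 0"
proof (rule LIMSEQ_I)
 fix e :: real assume e: "e > 0"
 obtain K where K: "K > 0" "!!n. n >= N ==> (\<integral>om. (norm (W n om))^2 \<partial>M) <= K"
  using second_moment_bounded by blast
 define m where "m = K / e"
 have m: "m > 0" using K e by (simp add: m_def)
 have "(%n. \<integral>om. (\<theta> (n + N) om)^2 \<partial>M) \<longlonglongrightarrow> (\<integral>om. 0 \<partial>M)"
 proof (rule integral_dominated_convergence[where w = "%_. \<theta>0^2"])
  show "AE om in M. (%n. (\<theta> (n + N) om)^2) \<longlonglongrightarrow> 0"
   using \<theta>_lim
  proof eventually_elim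
   case (elim om)
   from LIMSEQ_ignore_initial_segment[OF elim, of N] have "(%n. (\<theta> (n + N) om)^2) \<longlonglongrightarrow> 0^2"
    by (rule tendsto_power)
   thus ?case by simp
  qed
  show "AE om in M. norm ((\<theta> (n + N) om)^2) <= \<theta>0^2" for n
   using \<theta>_bound[of "n + N"] by (auto intro!: AE_I2 power_mono)
  show "(%om. (\<theta> (n + N) om)^2) \<in> borel_measurable M" for n
   using meas[of "n + N"] by measurable
 qed auto
 hence "\<forall>\<^sub>F n in sequentially. (\<integral>om. (\<theta> (n + N) om)^2 \<partial>M) < e / m"
  using e m by (intro order_tendstoD(2)) auto
 then obtain n0 where n0: "!!n. n >= n0 ==> (\<integral>om. (\<theta> (n + N) om)^2 \<partial>M) < e / m"
  unfolding eventually_sequentially by blast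
 show "\<exists>no. \<forall>n\<ge>no. norm ((\<integral>om. norm (q n om) \<partial>M) - 0) < e"
 proof (intro exI allI impI)
  fix n assume "n >= n0 + N"
  hence n: "n >= N" and s: "(\<integral>om. (\<theta> n om)^2 \<partial>M) < e / m" using n0[of "n - N"] by auto
  note [measurable] = meas[OF n]
  have ti: "integrable M (%om. (\<theta> n om)^2)"
   by (rule integrable_const_bound[where B = "\<theta>0^2"]) (use \<theta>_bound[OF n] in \<open>auto intro!: AE_I2 power_mono\<close>)
  have "(\<integral>om. norm (q n om) \<partial>M) <= (\<integral>om. \<theta> n om * norm (W n om) \<partial>M)" by (rule q_integrable(3)[OF n])
  also have "... <= (\<integral>om. (m * (\<theta> n om)^2 + (norm (W n om))^2 / m) / 2 \<partial>M)"
  proof (rule integral_mono[OF q_integrable(1)[OF n]])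
   fix om
   have "0 <= (m * \<theta> n om - norm (W n om))^2 / m" using m by simp
   thus "\<theta> n om * norm (W n om) <= (m * (\<theta> n om)^2 + (norm (W n om))^2 / m) / 2"
    using m by (simp add: field_simps power2_eq_square)
  qed (use ti W_sq_integrable[OF n] in simp)
  also have "... = (m * (\<integral>om. (\<theta> n om)^2 \<partial>M) + (\<integral>om. (norm (W n om))^2 \<partial>M) / m) / 2"
   using ti W_sq_integrable[OF n] by simp
  also have "... < (e + e) / 2"
  proof -
   have "m * (\<integral>om. (\<theta> n om)^2 \<partial>M) < e" using s m by (simp add: field_simps)
   moreover have "(\<integral>om. (norm (W n om))^2 \<partial>M) / m <= e"
    using K(2)[OF n] m K e by (simp add: m_def field_simps)
   ultimately show ?thesis by simp
  qed
  finally show "norm ((\<integral>om. norm (q n om) \<partial>M) - 0) < e" by simp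
 qed
qed

lemma t_diff_integrable:
 assumes n: "n >= N" shows "integrable M (%om. norm (t n om - T))"
proof -
 note [measurable] = meas[OF n]
 show ?thesis
 proof (rule integrable_const_bound[where B = "\<tau> + norm T"])
  have "norm (t n om - T) <= \<tau> + norm T" if "om \<in> space M" for om
   using t_bound[OF n that] norm_triangle_ineq4[of "t n om" T] by linarith
  thus "AE om in M. norm (norm (t n om - T)) <= \<tau> + norm T" by (auto intro!: AE_I2)
 qed measurable
qed

lemma bias_limit: "(%n. \<integral>om. norm (t n om - T) \<partial>M) \<longlonglongrightarrow> 0"
proof (rule LIMSEQ_offset[where k = N])
 have "(%n. \<integral>om. norm (t (n + N) om - T) \<partial>M) \<longlonglongrightarrow> (\<integral>om. 0 \<partial>M)"
 proof (rule integral_dominated_convergence[where w = "%_. \<tau> + norm T"])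
  show "AE om in M. (%n. norm (t (n + N) om - T)) \<longlonglongrightarrow> 0"
   using t_lim
  proof eventually_elim
   case (elim om)
   from LIMSEQ_ignore_initial_segment[OF elim, of N] show ?case
    by (intro tendsto_norm_zero) (simp add: LIM_zero)
  qed
  fix n
  have "norm (t (n + N) om - T) <= \<tau> + norm T" if "om \<in> space M" for om
   using t_bound[OF _ that, of "n + N"] norm_triangle_ineq4[of "t (n + N) om" T] by simp
  thus "AE om in M. norm (norm (t (n + N) om - T)) <= \<tau> + norm T" by (auto intro!: AE_I2)
  show "(%om. norm (t (n + N) om - T)) \<in> borel_measurable M"
   using meas[of "n + N"] by measurable
 qed auto
 thus "(%n. \<integral>om. norm (t (n + N) om - T) \<partial>M) \<longlonglongrightarrow> 0" by simp
qed

definition \<phi> :: "nat => real^'n => complex" where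
 "\<phi> n u = (\<integral>om. iexp (u \<bullet> W n om) \<partial>M)"

definition \<mu> :: "real^'n" where "\<mu> = (\<chi> i. T $ i / \<kappa> i)"

text \<open>The characteristic function of the Gaussian law with means \<open>T i / \<kappa> i\<close> and variances \<open>v / (2 \<kappa> i)\<close>.\<close>

definition target :: "real^'n => complex" where
 "target u = exp (\<i> * of_real (u \<bullet> \<mu>) - of_real ((\<Sum>i\<in>UNIV. v / (2 * \<kappa> i) * (u $ i)^2) / 2))"

text \<open>The factor by which the drift and the noise of one step multiply the characteristic function.\<close>

definition one_step :: "nat => real^'n => complex" where
 "one_step n u = exp (\<i> * of_real (h n * (u \<bullet> T)) - of_real (h n * v * (norm u)^2 / 2))"

definition push :: "nat => real^'n => real^'n" where
 "push n u = (\<chi> i. B n i * u $ i)"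

lemma push_inner: "u \<bullet> (\<chi> i. B n i * w $ i) = push n u \<bullet> w"
 by (simp add: push_def inner_vec_def mult_ac)

lemma norm_integral_le:
 fixes f g :: "'s => complex"
 assumes "integrable M f" "integrable M g" "integrable M k" "!!om. om \<in> space M ==> cmod (f om - g om) <= k om"
 shows "cmod ((\<integral>om. f om \<partial>M) - (\<integral>om. g om \<partial>M)) <= (\<integral>om. k om \<partial>M)"
proof -
 have "cmod ((\<integral>om. f om \<partial>M) - (\<integral>om. g om \<partial>M)) = cmod (\<integral>om. f om - g om \<partial>M)"
  using assms by simp
 also have "... <= (\<integral>om. cmod (f om - g om) \<partial>M)" by (rule integral_norm_bound)
 also have "... <= (\<integral>om. k om \<partial>M)"
  using assms by (intro integral_mono integrable_norm Bochner_Integration.integrable_diff) auto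
 finally show ?thesis .
qed

text \<open>The martingale property extends to complex test functions by their real and imaginary parts.\<close>

lemma complex_mart:
 assumes n: "n >= N" and Y: "Y \<in> borel_measurable (F n)" and bound: "!!om. cmod (Y om) <= 1"
 shows "integrable M (%om. Y om * of_real (u \<bullet> \<zeta> n om))" "(\<integral>om. Y om * of_real (u \<bullet> \<zeta> n om) \<partial>M) = 0"
proof -
 note [measurable] = meas[OF n]
 have [measurable]: "Y \<in> borel_measurable (F n)" by (rule Y)
 have YM[measurable]: "Y \<in> borel_measurable M" by (rule measurable_from_subalg[OF sub Y])
 have i0: "integrable M (%om. norm u * norm (\<zeta> n om))" using \<zeta>_integrable[OF n] by simp
 show i: "integrable M (%om. Y om * of_real (u \<bullet> \<zeta> n om))"
 proof (rule Bochner_Integration.integrable_bound[OF i0])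
  have "norm (Y om * of_real (u \<bullet> \<zeta> n om)) <= 1 * (norm u * norm (\<zeta> n om))" for om
   unfolding norm_mult norm_of_real using bound[of om] Cauchy_Schwarz_ineq2 by (intro mult_mono) auto
  thus "AE om in M. norm (Y om * of_real (u \<bullet> \<zeta> n om)) <= norm (norm u * norm (\<zeta> n om))"
   by (auto intro!: AE_I2)
 qed measurable
 have part: "(\<integral>om. y om * (u \<bullet> \<zeta> n om) \<partial>M) = 0"
  if [measurable]: "y \<in> borel_measurable (F n)" and b: "!!om. \<bar>y om\<bar> <= 1" for y :: "'s => real"
 proof -
  have [measurable]: "y \<in> borel_measurable M" by (rule measurable_from_subalg[OF sub]) fact
  have "(\<integral>om. (y om *\<^sub>R u) \<bullet> \<zeta> n om \<partial>M) = 0"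
  proof (rule mart_inner[OF n])
   fix i
   show "integrable M (%om. (y om *\<^sub>R u) $ i * \<zeta> n om $ i)"
   proof (rule Bochner_Integration.integrable_bound[OF i0])
    have "\<bar>y om * u $ i * \<zeta> n om $ i\<bar> <= 1 * norm u * norm (\<zeta> n om)" for om
     unfolding abs_mult using b[of om] component_le_norm_cart by (intro mult_mono) auto
    thus "AE om in M. norm ((y om *\<^sub>R u) $ i * \<zeta> n om $ i) <= norm (norm u * norm (\<zeta> n om))"
     by (auto intro!: AE_I2)
   qed measurable
  qed measurable
  thus ?thesis by simp
 qed
 have "Re (\<integral>om. Y om * of_real (u \<bullet> \<zeta> n om) \<partial>M) = (\<integral>om. Re (Y om) * (u \<bullet> \<zeta> n om) \<partial>M)"
  using integral_Re[OF i] by simp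
 also have "... = 0" by (rule part) (measurable, use bound abs_Re_le_cmod order_trans in blast)
 moreover have "Im (\<integral>om. Y om * of_real (u \<bullet> \<zeta> n om) \<partial>M) = (\<integral>om. Im (Y om) * (u \<bullet> \<zeta> n om) \<partial>M)"
  using integral_Im[OF i] by simp
 moreover have "... = 0" by (rule part) (measurable, use bound abs_Im_le_cmod order_trans in blast)
 ultimately show "(\<integral>om. Y om * of_real (u \<bullet> \<zeta> n om) \<partial>M) = 0"
  by (simp add: complex_eq_iff)
qed

lemma u\<zeta>_sq_integrable:
 assumes n: "n >= N" shows "integrable M (%om. (u \<bullet> \<zeta> n om)^2)"
proof -
 note [measurable] = meas[OF n]
 have "integrable M (%om. (norm u)^2 * (norm (\<zeta> n om))^2)" using \<zeta>_sq(1)[OF n] by simp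
 thus ?thesis
 proof (rule Bochner_Integration.integrable_bound)
  have "(u \<bullet> \<zeta> n om)^2 <= (norm u)^2 * (norm (\<zeta> n om))^2" for om
   using Cauchy_Schwarz_ineq by (simp add: power2_norm_eq_inner)
  thus "AE om in M. norm ((u \<bullet> \<zeta> n om)^2) <= norm ((norm u)^2 * (norm (\<zeta> n om))^2)" by simp
 qed measurable
qed

lemma complex_variance:
 assumes n: "n >= N" and Y: "Y \<in> borel_measurable (F n)" and bound: "!!om. cmod (Y om) <= 1"
 shows "cmod (\<integral>om. Y om * of_real ((u \<bullet> \<zeta> n om)^2 - v * (norm u)^2) \<partial>M) <= 2 * (\<epsilon> n * (norm u)^2)"
proof -
 note [measurable] = meas[OF n]
 have [measurable]: "Y \<in> borel_measurable (F n)" by (rule Y)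
 have YM[measurable]: "Y \<in> borel_measurable M" by (rule measurable_from_subalg[OF sub Y])
 let ?g = "%om. (u \<bullet> \<zeta> n om)^2 - v * (norm u)^2"
 have gi: "integrable M ?g" using u\<zeta>_sq_integrable[OF n] by simp
 have i: "integrable M (%om. Y om * of_real (?g om))"
 proof (rule Bochner_Integration.integrable_bound[OF gi])
  have "norm (Y om * of_real (?g om)) <= 1 * norm (?g om)" for om
   unfolding norm_mult norm_of_real using bound[of om] by (intro mult_mono) auto
  thus "AE om in M. norm (Y om * of_real (?g om)) <= norm (?g om)" by simp
 qed measurable
 have "\<bar>Re (\<integral>om. Y om * of_real (?g om) \<partial>M)\<bar> <= \<epsilon> n * (norm u)^2"
 proof -
  have "Re (\<integral>om. Y om * of_real (?g om) \<partial>M) = (\<integral>om. Re (Y om) * ?g om \<partial>M)"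
   using integral_Re[OF i] by simp
  moreover have "\<bar>...\<bar> <= \<epsilon> n * (norm u)^2"
   by (rule variance[OF n]) (measurable, use bound abs_Re_le_cmod order_trans in blast)
  ultimately show ?thesis by simp
 qed
 moreover have "\<bar>Im (\<integral>om. Y om * of_real (?g om) \<partial>M)\<bar> <= \<epsilon> n * (norm u)^2"
 proof -
  have "Im (\<integral>om. Y om * of_real (?g om) \<partial>M) = (\<integral>om. Im (Y om) * ?g om \<partial>M)"
   using integral_Im[OF i] by simp
  moreover have "\<bar>...\<bar> <= \<epsilon> n * (norm u)^2"
   by (rule variance[OF n]) (measurable, use bound abs_Im_le_cmod order_trans in blast)
  ultimately show ?thesis by simp
 qed
 ultimately show ?thesis
  using cmod_le[of "\<integral>om. Y om * of_real (?g om) \<partial>M"] by linarith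
qed

text \<open>Second order expansion of the noise factor: the linear term vanishes by the martingale property and the quadratic
one is given by the variance condition.\<close>

lemma noise_expansion:
 assumes n: "n >= N" and Y: "Y \<in> borel_measurable (F n)" and bound: "!!om. cmod (Y om) <= 1"
 shows "cmod ((\<integral>om. Y om * iexp (x * (u \<bullet> \<zeta> n om)) \<partial>M) - of_real (1 - x^2 * v * (norm u)^2 / 2) * (\<integral>om. Y om \<partial>M))
  <= x^2 * \<epsilon> n * (norm u)^2 + (\<bar>x\<bar> * norm u) powr (2 + \<delta>) * C"
proof -
 note [measurable] = meas[OF n]
 have YM[measurable]: "Y \<in> borel_measurable M" by (rule measurable_from_subalg[OF sub Y])
 let ?z = "%om. u \<bullet> \<zeta> n om"
 have Yi: "integrable M Y" by (rule integrable_const_bound[where B = 1]) (use bound in auto)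
 note m = complex_mart[OF n Y bound, of u]
 have sq: "integrable M (%om. Y om * of_real ((?z om)^2))"
 proof (rule Bochner_Integration.integrable_bound[OF u\<zeta>_sq_integrable[OF n, of u]])
  have "norm (Y om * of_real ((?z om)^2)) <= 1 * norm ((?z om)^2)" for om
   unfolding norm_mult norm_of_real using bound[of om] by (intro mult_mono) auto
  thus "AE om in M. norm (Y om * of_real ((?z om)^2)) <= norm ((?z om)^2)" by simp
 qed measurable
 let ?A = "%om. Y om + (\<i> * of_real x) * (Y om * of_real (?z om)) - of_real (x^2 / 2) * (Y om * of_real ((?z om)^2))"
 have Ai: "integrable M ?A" using Yi m(1) sq by simp
 have A: "(\<integral>om. ?A om \<partial>M) = (\<integral>om. Y om \<partial>M) - of_real (x^2 / 2) * (\<integral>om. Y om * of_real ((?z om)^2) \<partial>M)"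
  using Yi m sq by simp
 have "cmod ((\<integral>om. Y om * iexp (x * ?z om) \<partial>M) - (\<integral>om. ?A om \<partial>M))
   <= (\<integral>om. (\<bar>x\<bar> * norm u) powr (2 + \<delta>) * norm (\<zeta> n om) powr (2 + \<delta>) \<partial>M)"
 proof (rule norm_integral_le[OF _ Ai])
  show "integrable M (%om. Y om * iexp (x * ?z om))"
   by (rule integrable_const_bound[where B = 1]) (use bound in \<open>auto simp: norm_mult\<close>)
  show "integrable M (%om. (\<bar>x\<bar> * norm u) powr (2 + \<delta>) * norm (\<zeta> n om) powr (2 + \<delta>))"
   using \<zeta>_int[OF n] by simp
  fix om
  have "Y om * iexp (x * ?z om) - ?A om =
    Y om * (iexp (x * ?z om) - (1 + \<i> * of_real (x * ?z om) - of_real ((x * ?z om)^2 / 2)))"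
   by (simp add: algebra_simps power_mult_distrib)
  hence "cmod (Y om * iexp (x * ?z om) - ?A om) <= 1 * \<bar>x * ?z om\<bar> powr (2 + \<delta>)"
   unfolding norm_mult by (simp only: norm_mult) (intro mult_mono bound iexp_second_order \<delta>, auto)
  also have "... <= (\<bar>x\<bar> * norm u * norm (\<zeta> n om)) powr (2 + \<delta>)"
   using \<delta> Cauchy_Schwarz_ineq2[of u "\<zeta> n om"] 
   by (simp add: abs_mult mult.assoc) (intro powr_mono2 mult_left_mono, auto)
  also have "... = (\<bar>x\<bar> * norm u) powr (2 + \<delta>) * norm (\<zeta> n om) powr (2 + \<delta>)"
   by (rule powr_mult) 
  finally show "cmod (Y om * iexp (x * ?z om) - ?A om) <= (\<bar>x\<bar> * norm u) powr (2 + \<delta>) * norm (\<zeta> n om) powr (2 + \<delta>)" .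
 qed
 also have "... <= (\<bar>x\<bar> * norm u) powr (2 + \<delta>) * C"
  using \<zeta>_moment[OF n] by (simp add: mult_left_mono)
 finally have 1: "cmod ((\<integral>om. Y om * iexp (x * ?z om) \<partial>M) - (\<integral>om. ?A om \<partial>M)) <= (\<bar>x\<bar> * norm u) powr (2 + \<delta>) * C" .
 have "(\<integral>om. ?A om \<partial>M) - of_real (1 - x^2 * v * (norm u)^2 / 2) * (\<integral>om. Y om \<partial>M)
   = - (of_real (x^2 / 2) * (\<integral>om. Y om * of_real ((?z om)^2 - v * (norm u)^2) \<partial>M))"
 proof -
  have "(\<integral>om. Y om * of_real ((?z om)^2 - v * (norm u)^2) \<partial>M) =
    (\<integral>om. Y om * of_real ((?z om)^2) - of_real (v * (norm u)^2) * Y om \<partial>M)"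
   by (simp add: algebra_simps)
  also have "... = (\<integral>om. Y om * of_real ((?z om)^2) \<partial>M) - of_real (v * (norm u)^2) * (\<integral>om. Y om \<partial>M)"
   using sq Yi by simp
  finally have eq: "(\<integral>om. Y om * of_real ((?z om)^2 - v * (norm u)^2) \<partial>M) = ..." .
  show ?thesis unfolding A eq by (simp add: algebra_simps)
 qed
 hence "cmod ((\<integral>om. ?A om \<partial>M) - of_real (1 - x^2 * v * (norm u)^2 / 2) * (\<integral>om. Y om \<partial>M))
   = x^2 / 2 * cmod (\<integral>om. Y om * of_real ((?z om)^2 - v * (norm u)^2) \<partial>M)"
  by (simp only: norm_minus_cancel norm_mult norm_of_real) simp
 also have "... <= x^2 / 2 * (2 * (\<epsilon> n * (norm u)^2))"
  by (intro mult_left_mono complex_variance[OF n Y bound]) auto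
 finally have 2: "cmod ((\<integral>om. ?A om \<partial>M) - of_real (1 - x^2 * v * (norm u)^2 / 2) * (\<integral>om. Y om \<partial>M))
   <= x^2 * \<epsilon> n * (norm u)^2" by simp
 show ?thesis
  using norm_diff_triangle_le[OF 1 2] by simp
qed

text \<open>The three groups of terms come from replacing the drift by its limit, from expanding the noise, and from comparing the
resulting factor with \<open>one_step\<close>.  Every term has a factor \<open>norm u\<close>, which the contraction argument needs.\<close>

lemma one_step_error:
 assumes n: "n >= N" and small: "(r n)^2 * h n * v * (norm u)^2 <= 2" "0 < r n"
 shows "cmod (\<phi> (Suc n) u - \<phi> n (push n u) * one_step n u) <=
  r n * h n * norm u * ((\<integral>om. norm (q n om) \<partial>M) + (\<integral>om. norm (t n om - T) \<partial>M))
  + ((r n)^2 * h n * \<epsilon> n * (norm u)^2 + (r n * sqrt (h n) * norm u) powr (2 + \<delta>) * C)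
  + (\<bar>r n - 1\<bar> * h n * norm u * norm T + \<bar>(r n)^2 - 1\<bar> * h n * v * (norm u)^2 / 2
    + (h n * v * (norm u)^2)^2)"
  (is "_ <= ?E1 + ?E2 + ?E3")
proof -
 note [measurable] = meas[OF n]
 have hn: "h n > 0" using h_pos n by simp
 let ?x = "r n * sqrt (h n)"
 have x2: "?x^2 = (r n)^2 * h n" using hn by (simp add: power_mult_distrib)
 define Y where "Y om = iexp (push n u \<bullet> W n om)" for om
 have Ym: "Y \<in> borel_measurable (F n)" unfolding Y_def[abs_def] using W_meas[OF n] by measurable
 have YM[measurable]: "Y \<in> borel_measurable M" by (rule measurable_from_subalg[OF sub Ym])
 have Yb: "cmod (Y om) <= 1" for om by (simp add: Y_def)
 define \<psi> where "\<psi> om = iexp (r n * h n * (u \<bullet> (q n om + t n om)))" for om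
 define \<psi>T where "\<psi>T = iexp (r n * h n * (u \<bullet> T))"
 define Z where "Z om = iexp (?x * (u \<bullet> \<zeta> n om))" for om
 have [measurable]: "\<psi> \<in> borel_measurable M" "Z \<in> borel_measurable M"
  unfolding \<psi>_def[abs_def] Z_def[abs_def] by measurable
 have nb: "cmod (\<psi> om) = 1" "cmod (Z om) = 1" "cmod (Y om) = 1" "cmod \<psi>T = 1" for om
  by (simp_all add: \<psi>_def Z_def Y_def \<psi>T_def)
 have c1: "\<phi> (Suc n) u = (\<integral>om. Y om * \<psi> om * Z om \<partial>M)"
  unfolding \<phi>_def
 proof (rule Bochner_Integration.integral_cong[OF refl])
  fix om assume o: "om \<in> space M"
  show "iexp (u \<bullet> W (Suc n) om) = Y om * \<psi> om * Z om"
   unfolding step[OF n o] Y_def \<psi>_def Z_def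
   by (simp add: inner_add_right push_inner exp_add[symmetric] algebra_simps)
 qed
 have c2: "cmod ((\<integral>om. Y om * \<psi> om * Z om \<partial>M) - (\<integral>om. Y om * \<psi>T * Z om \<partial>M))
   <= (\<integral>om. r n * h n * norm u * (norm (q n om) + norm (t n om - T)) \<partial>M)"
 proof (rule norm_integral_le)
  show "integrable M (%om. Y om * \<psi> om * Z om)" "integrable M (%om. Y om * \<psi>T * Z om)"
   by (rule integrable_const_bound[where B = 1]; simp add: norm_mult nb)+
  show "integrable M (%om. r n * h n * norm u * (norm (q n om) + norm (t n om - T)))"
   using q_integrable(2)[OF n] t_diff_integrable[OF n] by simp
  fix om
  have "cmod (Y om * \<psi> om * Z om - Y om * \<psi>T * Z om) = cmod (Y om * (\<psi> om - \<psi>T) * Z om)"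
   by (simp add: algebra_simps)
  also have "... = cmod (\<psi> om - \<psi>T)" by (simp add: norm_mult nb)
  also have "... <= \<bar>r n * h n * (u \<bullet> (q n om + t n om)) - r n * h n * (u \<bullet> T)\<bar>"
   unfolding \<psi>_def \<psi>T_def by (rule cmod_iexp_diff_le)
  also have "... = r n * h n * \<bar>u \<bullet> (q n om + (t n om - T))\<bar>"
   using small hn by (simp add: abs_mult right_diff_distrib[symmetric] inner_diff_right[symmetric] add_diff_eq)
  also have "... <= r n * h n * (norm u * (norm (q n om) + norm (t n om - T)))"
   using small hn
   by (intro mult_left_mono order_trans[OF Cauchy_Schwarz_ineq2] norm_triangle_ineq) auto
  finally show "cmod (Y om * \<psi> om * Z om - Y om * \<psi>T * Z om) <= r n * h n * norm u * (norm (q n om) + norm (t n om - T))"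
   by (simp add: mult.assoc)
 qed
 have c3: "(\<integral>om. r n * h n * norm u * (norm (q n om) + norm (t n om - T)) \<partial>M) = ?E1"
  using q_integrable(2)[OF n] t_diff_integrable[OF n] by simp
 have s1: "cmod (\<phi> (Suc n) u - (\<integral>om. Y om * \<psi>T * Z om \<partial>M)) <= ?E1"
  using c2 unfolding c1 c3 .
 have P: "\<phi> n (push n u) = (\<integral>om. Y om \<partial>M)" by (simp add: \<phi>_def Y_def)
 have Pb: "cmod (\<integral>om. Y om \<partial>M) <= 1"
  using integral_norm_bound[of M Y] by (simp add: nb prob_space)
 define w where "w = 1 - ?x^2 * v * (norm u)^2 / 2"
 have "(\<integral>om. Y om * \<psi>T * Z om \<partial>M) - \<psi>T * (of_real w * (\<integral>om. Y om \<partial>M))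
   = \<psi>T * ((\<integral>om. Y om * Z om \<partial>M) - of_real w * (\<integral>om. Y om \<partial>M))"
 proof -
  have "(\<integral>om. Y om * \<psi>T * Z om \<partial>M) = (\<integral>om. \<psi>T * (Y om * Z om) \<partial>M)" by (simp add: mult_ac)
  also have "... = \<psi>T * (\<integral>om. Y om * Z om \<partial>M)" by simp
  finally show ?thesis by (simp add: algebra_simps)
 qed
 hence "cmod ((\<integral>om. Y om * \<psi>T * Z om \<partial>M) - \<psi>T * (of_real w * (\<integral>om. Y om \<partial>M)))
   = cmod ((\<integral>om. Y om * Z om \<partial>M) - of_real w * (\<integral>om. Y om \<partial>M))"
  by (simp add: norm_mult nb)
 also have "... <= ?x^2 * \<epsilon> n * (norm u)^2 + (\<bar>?x\<bar> * norm u) powr (2 + \<delta>) * C"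
  unfolding w_def Z_def by (rule noise_expansion[OF n Ym Yb])
 also have "... = ?E2" unfolding x2 using small hn by (simp add: abs_mult)
 finally have s2: "cmod ((\<integral>om. Y om * \<psi>T * Z om \<partial>M) - \<psi>T * (of_real w * (\<integral>om. Y om \<partial>M))) <= ?E2" .
 define y where "y = h n * v * (norm u)^2 / 2"
 have y0: "y >= 0" using hn v by (simp add: y_def)
 have os: "one_step n u = iexp (h n * (u \<bullet> T)) * of_real (exp (- y))"
  unfolding one_step_def y_def exp_of_real[symmetric] mult_exp_exp by simp
 have "cmod (\<psi>T * of_real w - one_step n u) <= ?E3"
 proof -
  have w1: "\<bar>w\<bar> <= 1"
  proof -
   have "0 <= ?x^2 * v * (norm u)^2" using v by simp
   moreover have "?x^2 * v * (norm u)^2 <= 2 * 2" unfolding x2 using small(1) by simp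
   ultimately show ?thesis unfolding w_def by linarith
  qed
  have "\<psi>T * of_real w - one_step n u =
    (\<psi>T - iexp (h n * (u \<bullet> T))) * of_real w + iexp (h n * (u \<bullet> T)) * of_real (w - exp (- y))"
   unfolding os by (simp add: algebra_simps)
  hence "cmod (\<psi>T * of_real w - one_step n u) <=
    cmod (\<psi>T - iexp (h n * (u \<bullet> T))) * \<bar>w\<bar> + \<bar>w - exp (- y)\<bar>"
   using norm_triangle_ineq[of "(\<psi>T - iexp (h n * (u \<bullet> T))) * of_real w" "iexp (h n * (u \<bullet> T)) * of_real (w - exp (- y))"]
   by (simp only: norm_mult norm_of_real) simp
  also have "... <= \<bar>r n * h n * (u \<bullet> T) - h n * (u \<bullet> T)\<bar> * 1 + (\<bar>(1 - y) - exp (- y)\<bar> + \<bar>w - (1 - y)\<bar>)"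
   unfolding \<psi>T_def by (intro add_mono mult_mono cmod_iexp_diff_le w1) auto
  also have "\<bar>r n * h n * (u \<bullet> T) - h n * (u \<bullet> T)\<bar> <= \<bar>r n - 1\<bar> * h n * norm u * norm T"
  proof -
   have "r n * h n * (u \<bullet> T) - h n * (u \<bullet> T) = (r n - 1) * h n * (u \<bullet> T)" by (simp add: algebra_simps)
   hence "\<bar>r n * h n * (u \<bullet> T) - h n * (u \<bullet> T)\<bar> = \<bar>r n - 1\<bar> * h n * \<bar>u \<bullet> T\<bar>"
    using hn by (simp add: abs_mult)
   also have "... <= \<bar>r n - 1\<bar> * h n * (norm u * norm T)"
    using hn by (intro mult_left_mono Cauchy_Schwarz_ineq2) auto
   finally show ?thesis by (simp add: mult.assoc)
  qed
  also have "\<bar>(1 - y) - exp (- y)\<bar> <= (h n * v * (norm u)^2)^2"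
  proof -
   have "\<bar>(1 - y) - exp (- y)\<bar> <= y^2"
   proof -
    have "1 - y <= exp (- y)" using exp_ge_add_one_self[of "- y"] by simp
    moreover have "exp (- y) <= 1 - y + y^2"
    proof (cases "y <= 1")
     case True
     have "exp (- y) * (1 + y) <= exp (- y) * exp y"
      by (intro mult_left_mono exp_ge_add_one_self) auto
     hence "exp (- y) * (1 + y) <= 1" by (simp add: exp_minus)
     moreover have "1 <= (1 - y + y^2) * (1 + y)"
      using y0 by (simp add: algebra_simps power2_eq_square)
     ultimately show ?thesis using y0 mult_right_le_imp_le[of "exp (- y)" "1 + y" "1 - y + y^2"] by linarith
    next
     case False
     hence "exp (- y) <= 1" by simp
     also have "1 <= 1 - y + y^2" using False by (simp add: power2_eq_square)
     finally show ?thesis .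
    qed
    ultimately show ?thesis by simp
   qed
   also have "... <= (h n * v * (norm u)^2)^2"
    by (intro power_mono y0) (use y0 y_def in linarith)
   finally show ?thesis .
  qed
  also have "\<bar>w - (1 - y)\<bar> = \<bar>(r n)^2 - 1\<bar> * h n * v * (norm u)^2 / 2"
  proof -
   have "w - (1 - y) = - (((r n)^2 - 1) * (h n * v * (norm u)^2 / 2))"
    unfolding w_def y_def x2 by (simp add: field_simps)
   thus ?thesis using hn v by (simp add: abs_mult)
  qed
  finally show ?thesis by simp
 qed
 hence s3: "cmod (\<psi>T * (of_real w * (\<integral>om. Y om \<partial>M)) - \<phi> n (push n u) * one_step n u) <= ?E3"
 proof -
  assume a: "cmod (\<psi>T * of_real w - one_step n u) <= ?E3"
  have "\<psi>T * (of_real w * (\<integral>om. Y om \<partial>M)) - \<phi> n (push n u) * one_step n u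
    = (\<psi>T * of_real w - one_step n u) * (\<integral>om. Y om \<partial>M)"
   unfolding P by (simp add: algebra_simps)
  hence "cmod (\<psi>T * (of_real w * (\<integral>om. Y om \<partial>M)) - \<phi> n (push n u) * one_step n u)
    <= cmod (\<psi>T * of_real w - one_step n u) * 1"
   by (simp only: norm_mult) (intro mult_left_mono Pb, auto)
  with a show ?thesis by simp
 qed
 show ?thesis using norm_diff_triangle_le[OF norm_diff_triangle_le[OF s1 s2] s3] .
qed

text \<open>The Gaussian law is stationary for the limiting dynamics: with \<open>1 - B = \<kappa> h\<close> the exponents of both sides agree up
to terms of order \<open>h^2\<close>, because \<open>v / (2 \<kappa>) * (1 - B^2)\<close> is close to \<open>h v\<close>.\<close>

lemma target_step_error:
 assumes n: "n >= N" and B: "!!i. \<bar>B n i\<bar> <= 1"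
 shows "cmod (target u - target (push n u) * one_step n u) <=
  h n * norm u * (\<Sum>i\<in>UNIV. \<bar>\<mu> $ i\<bar> * \<bar>(1 - B n i) / h n - \<kappa> i\<bar>)
  + h n * (norm u)^2 * (\<Sum>i\<in>UNIV. v / (2 * \<kappa> i) * \<bar>(1 - B n i) / h n * (1 + B n i) - 2 * \<kappa> i\<bar>)"
  (is "_ <= ?E1 + ?E2")
proof -
 have hn: "h n > 0" using h_pos n by simp
 define S where "S u = (\<Sum>i\<in>UNIV. v / (2 * \<kappa> i) * (u $ i)^2) / 2" for u :: "real^'n"
 have Snn: "S u >= 0" for u
  unfolding S_def using v \<kappa>_pos by (intro divide_nonneg_pos sum_nonneg mult_nonneg_nonneg) (auto simp: less_imp_le)
 define A where "A = push n u \<bullet> \<mu> + h n * (u \<bullet> T) - u \<bullet> \<mu>"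
 define D where "D = S (push n u) + h n * v * (norm u)^2 / 2 - S u"
 have t1: "target u = exp (\<i> * of_real (u \<bullet> \<mu>) - of_real (S u))" by (simp add: target_def S_def)
 have t2: "target (push n u) * one_step n u = exp (\<i> * of_real (push n u \<bullet> \<mu> + h n * (u \<bullet> T)) -
   of_real (S (push n u) + h n * v * (norm u)^2 / 2))"
  unfolding target_def one_step_def S_def mult_exp_exp by (simp add: algebra_simps)
 have "cmod (target u - target (push n u) * one_step n u) <=
   cmod (\<i> * of_real (u \<bullet> \<mu>) - of_real (S u) - (\<i> * of_real (push n u \<bullet> \<mu> + h n * (u \<bullet> T)) -
   of_real (S (push n u) + h n * v * (norm u)^2 / 2)))"
  unfolding t1 t2
 proof (rule cmod_exp_diff_le)
  have "0 <= S (push n u) + h n * v * (norm u)^2 / 2" using Snn hn v by (intro add_nonneg_nonneg) auto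
  thus "Re (\<i> * of_real (push n u \<bullet> \<mu> + h n * (u \<bullet> T)) - of_real (S (push n u) + h n * v * (norm u)^2 / 2)) <= 0"
  proof -
   have "Re (\<i> * of_real a - of_real b) = - b" for a b by simp
   thus ?thesis using \<open>0 <= S (push n u) + h n * v * (norm u)^2 / 2\<close> by (simp only: neg_le_0_iff_le)
  qed
 qed (use Snn in simp)
 also have "\<i> * of_real (u \<bullet> \<mu>) - of_real (S u) - (\<i> * of_real (push n u \<bullet> \<mu> + h n * (u \<bullet> T)) -
   of_real (S (push n u) + h n * v * (norm u)^2 / 2)) = of_real D - \<i> * of_real A"
  by (simp add: A_def D_def algebra_simps)
 also have "cmod (of_real D - \<i> * of_real A) <= \<bar>D\<bar> + \<bar>A\<bar>"
  using norm_triangle_ineq4[of "of_real D" "\<i> * of_real A :: complex"] by (simp add: norm_mult)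
 also have "\<bar>A\<bar> <= ?E1"
 proof -
  have "A = (\<Sum>i\<in>UNIV. - (h n * u $ i * \<mu> $ i * ((1 - B n i) / h n - \<kappa> i)))"
  proof -
   have "\<kappa> i * \<mu> $ i = T $ i" for i using \<kappa>_pos[of i] by (simp add: \<mu>_def)
   hence "B n i * u $ i * \<mu> $ i + h n * (u $ i * T $ i) - u $ i * \<mu> $ i =
     - (h n * u $ i * \<mu> $ i * ((1 - B n i) / h n - \<kappa> i))" for i
    using hn by (simp add: field_simps)
   thus ?thesis unfolding A_def push_def inner_vec_def
    by (simp add: sum_distrib_left sum.distrib[symmetric] sum_subtractf[symmetric])
  qed
  also have "\<bar>...\<bar> <= (\<Sum>i\<in>UNIV. h n * norm u * (\<bar>\<mu> $ i\<bar> * \<bar>(1 - B n i) / h n - \<kappa> i\<bar>))"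
  proof (rule order_trans[OF sum_abs sum_mono])
   fix i
   have "\<bar>- (h n * u $ i * \<mu> $ i * ((1 - B n i) / h n - \<kappa> i))\<bar>
     = h n * \<bar>u $ i\<bar> * (\<bar>\<mu> $ i\<bar> * \<bar>(1 - B n i) / h n - \<kappa> i\<bar>)"
    using hn by (simp add: abs_mult)
   also have "... <= h n * norm u * (\<bar>\<mu> $ i\<bar> * \<bar>(1 - B n i) / h n - \<kappa> i\<bar>)"
    using hn component_le_norm_cart by (intro mult_right_mono mult_left_mono) auto
   finally show "\<bar>- (h n * u $ i * \<mu> $ i * ((1 - B n i) / h n - \<kappa> i))\<bar>
     <= h n * norm u * (\<bar>\<mu> $ i\<bar> * \<bar>(1 - B n i) / h n - \<kappa> i\<bar>)" .
  qed
  finally show ?thesis by (simp add: sum_distrib_left)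
 qed
 also have "\<bar>D\<bar> <= ?E2"
 proof -
  define K where "K i = v / (2 * \<kappa> i) * \<bar>(1 - B n i) / h n * (1 + B n i) - 2 * \<kappa> i\<bar>" for i
  have K: "0 <= K i" for i unfolding K_def using v \<kappa>_pos[of i] by (intro mult_nonneg_nonneg) auto
  have "D = (\<Sum>i\<in>UNIV. - (h n * (u $ i)^2 * (v / (2 * \<kappa> i) * ((1 - B n i) / h n * (1 + B n i) - 2 * \<kappa> i)))) / 2"
  proof -
   have "v / (2 * \<kappa> i) * (B n i * u $ i)^2 + h n * v * (u $ i)^2 - v / (2 * \<kappa> i) * (u $ i)^2
    = - (h n * (u $ i)^2 * (v / (2 * \<kappa> i) * ((1 - B n i) / h n * (1 + B n i) - 2 * \<kappa> i)))" for i
    using hn \<kappa>_pos[of i] by (simp add: field_simps power2_eq_square)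
   moreover have "h n * v * (norm u)^2 = (\<Sum>i\<in>UNIV. h n * v * (u $ i)^2)"
    unfolding power2_norm_eq_inner inner_vec_def by (simp add: power2_eq_square sum_distrib_left)
   ultimately show ?thesis unfolding D_def S_def push_def
    by (simp add: sum.distrib[symmetric] sum_subtractf[symmetric] add_divide_distrib[symmetric] diff_divide_distrib[symmetric])
  qed
  also have "\<bar>...\<bar> <= (\<Sum>i\<in>UNIV. h n * (norm u)^2 * K i) / 2"
  proof -
   have pt: "\<bar>- (h n * (u $ i)^2 * (v / (2 * \<kappa> i) * ((1 - B n i) / h n * (1 + B n i) - 2 * \<kappa> i)))\<bar> <= h n * (norm u)^2 * K i" for i
   proof -
    have gen: "\<bar>- (A * (k * Z))\<bar> = A * (k * \<bar>Z\<bar>)" if "0 <= A" "0 <= k" for A k Z :: real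
     using that by (simp add: abs_mult)
    have k: "v / (2 * \<kappa> i) >= 0" using v \<kappa>_pos[of i] by simp
    have A: "0 <= h n * (u $ i)^2" using hn by simp
    have "\<bar>u $ i\<bar>^2 <= (norm u)^2" by (intro power_mono component_le_norm_cart) auto
    hence "h n * (u $ i)^2 <= h n * (norm u)^2" using hn by simp
    hence "h n * (u $ i)^2 * K i <= h n * (norm u)^2 * K i" by (rule mult_right_mono) (rule K)
    thus ?thesis unfolding gen[OF A k] K_def .
   qed
   have "\<bar>\<Sum>i\<in>UNIV. - (h n * (u $ i)^2 * (v / (2 * \<kappa> i) * ((1 - B n i) / h n * (1 + B n i) - 2 * \<kappa> i)))\<bar>
     <= (\<Sum>i\<in>UNIV. h n * (norm u)^2 * K i)"
    by (rule order_trans[OF sum_abs sum_mono[OF pt]])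
   thus ?thesis by linarith
  qed
  also have "... = h n * (norm u)^2 * (\<Sum>i\<in>UNIV. K i) / 2" by (simp only: sum_distrib_left)
  also have "... <= h n * (norm u)^2 * (\<Sum>i\<in>UNIV. K i)"
  proof -
   have "0 <= h n * (norm u)^2 * (\<Sum>i\<in>UNIV. K i)"
    using hn K by (intro mult_nonneg_nonneg sum_nonneg) auto
   thus ?thesis by linarith
  qed
  finally show ?thesis unfolding K_def .
 qed
 finally show ?thesis by simp
qed

lemma target_near_zero: "cmod (target u - 1) <= norm u * (norm \<mu> + norm u * (\<Sum>i\<in>UNIV. v / (2 * \<kappa> i)))"
proof -
 define S where "S = (\<Sum>i\<in>UNIV. v / (2 * \<kappa> i) * (u $ i)^2) / 2"
 have k: "v / (2 * \<kappa> i) >= 0" for i using v \<kappa>_pos[of i] by simp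
 have nn: "0 <= (\<Sum>i\<in>UNIV. v / (2 * \<kappa> i) * (u $ i)^2)"
  by (intro sum_nonneg mult_nonneg_nonneg k) auto
 hence S: "0 <= S" unfolding S_def by linarith
 have "S <= (\<Sum>i\<in>UNIV. v / (2 * \<kappa> i) * (u $ i)^2)"
  unfolding S_def using nn by linarith
 also have "... <= (\<Sum>i\<in>UNIV. v / (2 * \<kappa> i) * (norm u)^2)"
 proof (intro sum_mono mult_left_mono k)
  fix i
  have "\<bar>u $ i\<bar>^2 <= (norm u)^2" by (intro power_mono component_le_norm_cart) auto
  thus "(u $ i)^2 <= (norm u)^2" by simp
 qed
 finally have "S <= (\<Sum>i\<in>UNIV. v / (2 * \<kappa> i) * (norm u)^2)" .
 hence Sb: "S <= norm u * (norm u * (\<Sum>i\<in>UNIV. v / (2 * \<kappa> i)))"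
 proof -
  have "(\<Sum>i\<in>UNIV. v / (2 * \<kappa> i) * (norm u)^2) = (\<Sum>i\<in>UNIV. v / (2 * \<kappa> i)) * (norm u)^2"
   by (rule sum_distrib_right[symmetric])
  also have "... = norm u * (norm u * (\<Sum>i\<in>UNIV. v / (2 * \<kappa> i)))"
   by (simp only: power2_eq_square mult_ac)
  finally have eq: "(\<Sum>i\<in>UNIV. v / (2 * \<kappa> i) * (norm u)^2) = norm u * (norm u * (\<Sum>i\<in>UNIV. v / (2 * \<kappa> i)))" .
  assume "S <= (\<Sum>i\<in>UNIV. v / (2 * \<kappa> i) * (norm u)^2)"
  thus ?thesis unfolding eq .
 qed
 have "cmod (target u - 1) = cmod (exp (\<i> * of_real (u \<bullet> \<mu>) - of_real S) - exp 0)"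
  by (simp add: target_def S_def)
 also have "... <= cmod (\<i> * of_real (u \<bullet> \<mu>) - of_real S - 0)"
  by (rule cmod_exp_diff_le) (use S in auto)
 also have "... <= \<bar>u \<bullet> \<mu>\<bar> + S"
  using norm_triangle_ineq4[of "\<i> * of_real (u \<bullet> \<mu>)" "of_real S :: complex"] S by (simp add: norm_mult)
 also have "... <= norm u * norm \<mu> + norm u * (norm u * (\<Sum>i\<in>UNIV. v / (2 * \<kappa> i)))"
  using Sb Cauchy_Schwarz_ineq2 by (intro add_mono) auto
 finally show ?thesis by (simp add: algebra_simps)
qed

lemma \<phi>_near_one:
 assumes n: "n >= N"
 shows "cmod (\<phi> n u - 1) <= norm u * (\<integral>om. norm (W n om) \<partial>M)"
proof -
 note [measurable] = meas[OF n]
 have "cmod ((\<integral>om. iexp (u \<bullet> W n om) \<partial>M) - (\<integral>om. 1 \<partial>M)) <= (\<integral>om. norm u * norm (W n om) \<partial>M)"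
 proof (rule norm_integral_le)
  show "integrable M (%om. iexp (u \<bullet> W n om))" by (rule integrable_const_bound[where B = 1]) auto
  show "integrable M (%om. norm u * norm (W n om))" using W_norm_integrable[OF n] by simp
  fix om
  have "cmod (iexp (u \<bullet> W n om) - iexp 0) <= \<bar>u \<bullet> W n om - 0\<bar>" by (rule cmod_iexp_diff_le)
  thus "cmod (iexp (u \<bullet> W n om) - 1) <= norm u * norm (W n om)"
   using Cauchy_Schwarz_ineq2[of u "W n om"] by simp
 qed simp
 thus ?thesis by (simp add: \<phi>_def prob_space)
qed

text \<open>Let \<open>e n\<close> bound \<open>\<bar>\<phi> n u - target u\<bar> / norm u\<close> on a ball.  As \<open>push n\<close> shrinks the norm by \<open>1 - p h\<close> and
maps the ball into itself, one step turns \<open>e\<close> into \<open>(1 - p h) e + h d\<close> with vanishing \<open>d\<close>.  The division by \<open>norm u\<close> is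
what turns the shrinking of the argument into a contraction; at 0 both functions are equal to 1.\<close>

theorem charfun_limit: "(%n. \<phi> n u0) \<longlonglongrightarrow> target u0"
proof -
 define R where "R = norm u0 + 1"
 have R: "R > 0" "norm u0 <= R" by (auto simp: R_def add_nonneg_pos)
 obtain p N1 where p: "\<theta>0 < p" "N1 >= N" "!!n i. n >= N1 ==> \<bar>B n i\<bar> <= 1 - p * h n"
   "!!n. n >= N1 ==> p * h n <= 1"
  using contraction_rate by metis
 have p0: "p > 0" using p(1) \<theta>0_nonneg by simp
 \<comment> \<open>the errors of one step divided by h n times the norm of u: replaced drift, expanded noise, factor of the step, and defect of the Gaussian\<close>
 define e1 where "e1 n = r n * ((\<integral>om. norm (q n om) \<partial>M) + (\<integral>om. norm (t n om - T) \<partial>M))" for n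
 define e2 where "e2 n = (r n)^2 * \<bar>\<epsilon> n\<bar> * R + (r n) powr (2 + \<delta>) * sqrt (h n) powr \<delta> * R powr (1 + \<delta>) * C" for n
 define e3 where "e3 n = \<bar>r n - 1\<bar> * norm T + \<bar>(r n)^2 - 1\<bar> * v * R / 2 + h n * v^2 * R ^ 3" for n
 define e4 where "e4 n = (\<Sum>i\<in>UNIV. \<bar>\<mu> $ i\<bar> * \<bar>(1 - B n i) / h n - \<kappa> i\<bar>)
  + R * (\<Sum>i\<in>UNIV. v / (2 * \<kappa> i) * \<bar>(1 - B n i) / h n * (1 + B n i) - 2 * \<kappa> i\<bar>)" for n
 define d where "d n = \<bar>e1 n + e2 n + e3 n + e4 n\<bar>" for n
 have l1: "e1 \<longlonglongrightarrow> 0"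
  unfolding e1_def using tendsto_mult[OF r_lim tendsto_add[OF perturbation_negligible bias_limit]] by simp
 have l2: "e2 \<longlonglongrightarrow> 0"
 proof -
  have "(%n. sqrt (h n) powr \<delta>) \<longlonglongrightarrow> 0"
  proof (rule tendsto_zero_powrI)
   show "(%n. sqrt (h n)) \<longlonglongrightarrow> 0" using tendsto_real_sqrt[OF h_lim] by simp
   show "\<forall>\<^sub>F n in sequentially. 0 <= sqrt (h n)"
    using eventually_ge_at_top[of N] by eventually_elim (use h_pos in \<open>auto simp: less_imp_le\<close>)
  qed (use \<delta> in auto)
  hence "e2 \<longlonglongrightarrow> 1^2 * \<bar>0\<bar> * R + 1 powr (2 + \<delta>) * 0 * R powr (1 + \<delta>) * C"
   unfolding e2_def by (intro tendsto_intros r_lim \<epsilon>_lim) auto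
  thus ?thesis by simp
 qed
 have l3: "e3 \<longlonglongrightarrow> 0"
 proof -
  have "e3 \<longlonglongrightarrow> \<bar>1 - 1\<bar> * norm T + \<bar>1^2 - 1\<bar> * v * R / 2 + 0 * v^2 * R ^ 3"
   unfolding e3_def by (intro tendsto_intros r_lim h_lim) auto
  thus ?thesis by simp
 qed
 have l4: "e4 \<longlonglongrightarrow> 0"
 proof -
  have Bl: "(%n. B n i) \<longlonglongrightarrow> 1" for i
  proof -
   have "(%n. 1 - (1 - B n i) / h n * h n) \<longlonglongrightarrow> 1 - \<kappa> i * 0"
    by (intro tendsto_intros B_lim h_lim)
   hence "(%n. 1 - (1 - B n i) / h n * h n) \<longlonglongrightarrow> 1" by simp
   thus ?thesis
   proof (rule Lim_transform_eventually)
    show "\<forall>\<^sub>F n in sequentially. 1 - (1 - B n i) / h n * h n = B n i"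
     using eventually_ge_at_top[of N] by eventually_elim (use h_pos in force)
   qed
  qed
  have "e4 \<longlonglongrightarrow> (\<Sum>i\<in>UNIV. \<bar>\<mu> $ i\<bar> * \<bar>\<kappa> i - \<kappa> i\<bar>)
   + R * (\<Sum>i\<in>UNIV. v / (2 * \<kappa> i) * \<bar>\<kappa> i * (1 + 1) - 2 * \<kappa> i\<bar>)"
   unfolding e4_def by (intro tendsto_intros B_lim Bl)
  thus ?thesis by simp
 qed
 have dl: "d \<longlonglongrightarrow> 0"
  unfolding d_def using tendsto_rabs[OF tendsto_add[OF tendsto_add[OF tendsto_add[OF l1 l2] l3] l4]] by simp
 have "(%n. (r n)^2 * h n * v * R^2) \<longlonglongrightarrow> 1^2 * 0 * v * R^2"
  by (intro tendsto_intros r_lim h_lim)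
 hence "\<forall>\<^sub>F n in sequentially. (r n)^2 * h n * v * R^2 < 2" by (intro order_tendstoD(2)) auto
 moreover have "\<forall>\<^sub>F n in sequentially. 0 < r n" using order_tendstoD[OF r_lim] by auto
 ultimately have "\<forall>\<^sub>F n in sequentially. n >= N1 \<and> (r n)^2 * h n * v * R^2 < 2 \<and> 0 < r n"
  using eventually_ge_at_top[of N1] by eventually_elim auto
 then obtain N2 where N2: "!!n. n >= N2 ==> n >= N1 \<and> (r n)^2 * h n * v * R^2 < 2 \<and> 0 < r n"
  unfolding eventually_sequentially by blast
 have key: "cmod (\<phi> (Suc n) u - target u) <= ((1 - p * h n) * e + h n * d n) * norm u"
  if n2: "n >= N2" and u: "norm u <= R" and e: "e >= 0" and
   IH: "!!u. norm u <= R ==> cmod (\<phi> n u - target u) <= e * norm u" for n u e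
 proof -
  have n1: "n >= N1" and rn: "(r n)^2 * h n * v * R^2 < 2" "0 < r n" using N2[OF n2] by auto
  have n: "n >= N" using n1 p by simp
  have hn: "h n > 0" using h_pos n by simp
  have u2: "(norm u)^2 <= norm u * R" using u by (simp add: power2_eq_square mult_left_mono)
  have "(r n)^2 * h n * v * (norm u)^2 <= (r n)^2 * h n * v * R^2"
   using u hn v by (intro mult_left_mono power_mono) auto
  with rn(1) have small: "(r n)^2 * h n * v * (norm u)^2 <= 2" by linarith
  have f1: "cmod (\<phi> (Suc n) u - \<phi> n (push n u) * one_step n u) <= h n * norm u * (e1 n + e2 n + e3 n)"
  proof (rule order_trans[OF one_step_error[OF n small rn(2)]])
   have a: "r n * h n * norm u * ((\<integral>om. norm (q n om) \<partial>M) + (\<integral>om. norm (t n om - T) \<partial>M)) = h n * norm u * e1 n"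
    by (simp add: e1_def)
   have b: "(r n)^2 * h n * \<epsilon> n * (norm u)^2 <= h n * norm u * ((r n)^2 * \<bar>\<epsilon> n\<bar> * R)"
   proof -
    have "(r n)^2 * h n * \<epsilon> n * (norm u)^2 <= (r n)^2 * h n * \<bar>\<epsilon> n\<bar> * (norm u)^2"
     using hn by (intro mult_right_mono mult_left_mono) auto
    also have "... <= (r n)^2 * h n * \<bar>\<epsilon> n\<bar> * (norm u * R)"
     using hn u2 by (intro mult_left_mono) auto
    finally have "(r n)^2 * h n * \<epsilon> n * (norm u)^2 <= (r n)^2 * h n * \<bar>\<epsilon> n\<bar> * (norm u * R)" .
    thus ?thesis by (simp add: mult_ac)
   qed
   have c: "(r n * sqrt (h n) * norm u) powr (2 + \<delta>) <=
     h n * norm u * ((r n) powr (2 + \<delta>) * sqrt (h n) powr \<delta> * R powr (1 + \<delta>))"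
   proof (cases "u = 0")
    case False
    have "(r n * sqrt (h n) * norm u) powr (2 + \<delta>) = r n powr (2 + \<delta>) * sqrt (h n) powr (2 + \<delta>) * norm u powr (2 + \<delta>)"
     using rn hn by (simp add: powr_mult)
    also have "sqrt (h n) powr (2 + \<delta>) = h n * sqrt (h n) powr \<delta>"
     using hn by (simp add: powr_add)
    also have "norm u powr (2 + \<delta>) = norm u * norm u powr (1 + \<delta>)"
     using False powr_add[of "norm u" 1 "1 + \<delta>"] by simp
    also have "r n powr (2 + \<delta>) * (h n * sqrt (h n) powr \<delta>) * (norm u * norm u powr (1 + \<delta>))
      <= r n powr (2 + \<delta>) * (h n * sqrt (h n) powr \<delta>) * (norm u * R powr (1 + \<delta>))"
     using hn u \<delta> by (intro mult_left_mono powr_mono2) auto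
    finally show ?thesis by (simp add: mult_ac)
   qed simp
   have c': "(r n * sqrt (h n) * norm u) powr (2 + \<delta>) * C <=
     h n * norm u * ((r n) powr (2 + \<delta>) * sqrt (h n) powr \<delta> * R powr (1 + \<delta>) * C)"
    using mult_right_mono[OF c C_nonneg] by (simp add: mult_ac)
   have dd: "\<bar>(r n)^2 - 1\<bar> * h n * v * (norm u)^2 / 2 <= h n * norm u * (\<bar>(r n)^2 - 1\<bar> * v * R / 2)"
    using mult_left_mono[OF u2, of "\<bar>(r n)^2 - 1\<bar> * h n * v / 2"] hn v by (simp add: mult_ac)
   have ee: "(h n * v * (norm u)^2)^2 <= h n * norm u * (h n * v^2 * R ^ 3)"
   proof -
    have "(norm u) ^ 4 <= norm u * R ^ 3"
     using mult_left_mono[OF power_mono[OF u, of 3], of "norm u"] by (simp add: power_numeral_reduce)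
    hence "(h n)^2 * v^2 * (norm u) ^ 4 <= (h n)^2 * v^2 * (norm u * R ^ 3)"
     by (rule mult_left_mono) simp
    thus ?thesis
     by (simp add: power_mult_distrib power2_eq_square power4_eq_xxxx mult_ac)
   qed
   have x: "\<bar>r n - 1\<bar> * h n * norm u * norm T = h n * norm u * (\<bar>r n - 1\<bar> * norm T)"
    by (simp only: mult_ac)
   have "r n * h n * norm u * ((\<integral>om. norm (q n om) \<partial>M) + (\<integral>om. norm (t n om - T) \<partial>M))
    + ((r n)^2 * h n * \<epsilon> n * (norm u)^2 + (r n * sqrt (h n) * norm u) powr (2 + \<delta>) * C)
    + (\<bar>r n - 1\<bar> * h n * norm u * norm T + \<bar>(r n)^2 - 1\<bar> * h n * v * (norm u)^2 / 2
      + (h n * v * (norm u)^2)^2)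
    <= h n * norm u * e1 n + (h n * norm u * ((r n)^2 * \<bar>\<epsilon> n\<bar> * R)
      + h n * norm u * ((r n) powr (2 + \<delta>) * sqrt (h n) powr \<delta> * R powr (1 + \<delta>) * C))
    + (h n * norm u * (\<bar>r n - 1\<bar> * norm T) + h n * norm u * (\<bar>(r n)^2 - 1\<bar> * v * R / 2)
      + h n * norm u * (h n * v^2 * R ^ 3))"
    by (intro add_mono b c' dd ee eq_refl[OF x] eq_refl[OF a])
   also have "... = h n * norm u * (e1 n + e2 n + e3 n)"
    unfolding e2_def e3_def by (simp only: distrib_left)
   finally show "r n * h n * norm u * ((\<integral>om. norm (q n om) \<partial>M) + (\<integral>om. norm (t n om - T) \<partial>M))
    + ((r n)^2 * h n * \<epsilon> n * (norm u)^2 + (r n * sqrt (h n) * norm u) powr (2 + \<delta>) * C)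
    + (\<bar>r n - 1\<bar> * h n * norm u * norm T + \<bar>(r n)^2 - 1\<bar> * h n * v * (norm u)^2 / 2
      + (h n * v * (norm u)^2)^2) <= h n * norm u * (e1 n + e2 n + e3 n)" .
  qed
  have B1: "\<bar>B n i\<bar> <= 1" for i
   using order_trans[OF p(3)[OF n1], of 1 i] p0 hn by simp
  have f2: "cmod (target u - target (push n u) * one_step n u) <= h n * norm u * e4 n"
  proof (rule order_trans[OF target_step_error[OF n B1]])
   have "(norm u)^2 * (\<Sum>i\<in>UNIV. v / (2 * \<kappa> i) * \<bar>(1 - B n i) / h n * (1 + B n i) - 2 * \<kappa> i\<bar>)
    <= norm u * R * (\<Sum>i\<in>UNIV. v / (2 * \<kappa> i) * \<bar>(1 - B n i) / h n * (1 + B n i) - 2 * \<kappa> i\<bar>)"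
    using u2 v \<kappa>_pos by (intro mult_right_mono sum_nonneg) (auto simp: less_imp_le)
   from mult_left_mono[OF this, of "h n"] show "h n * norm u * (\<Sum>i\<in>UNIV. \<bar>\<mu> $ i\<bar> * \<bar>(1 - B n i) / h n - \<kappa> i\<bar>)
    + h n * (norm u)^2 * (\<Sum>i\<in>UNIV. v / (2 * \<kappa> i) * \<bar>(1 - B n i) / h n * (1 + B n i) - 2 * \<kappa> i\<bar>) <= h n * norm u * e4 n"
    using hn by (simp add: e4_def distrib_left mult.assoc)
  qed
  have np: "norm (push n u) <= (1 - p * h n) * norm u"
   unfolding push_def by (rule norm_diag_le) (use p n1 in auto)
  hence "norm (push n u) <= R"
   using u p0 hn mult_left_le_one_le[of "norm u" "1 - p * h n"] p(4)[OF n1] by simp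
  hence "cmod (\<phi> n (push n u) - target (push n u)) <= e * norm (push n u)" by (rule IH)
  also have "... <= e * ((1 - p * h n) * norm u)" using np e by (rule mult_left_mono)
  finally have f3: "cmod (\<phi> n (push n u) - target (push n u)) <= e * ((1 - p * h n) * norm u)" .
  have os: "cmod (one_step n u) <= 1" using hn v by (simp add: one_step_def)
  have f4: "cmod (\<phi> n (push n u) * one_step n u - target (push n u) * one_step n u) <= e * ((1 - p * h n) * norm u)"
   unfolding left_diff_distrib[symmetric] norm_mult
   using mult_mono[OF f3 os] norm_ge_zero order_trans[OF norm_ge_zero f3] by simp
  have "cmod (\<phi> (Suc n) u - target u) <= h n * norm u * (e1 n + e2 n + e3 n) + e * ((1 - p * h n) * norm u) + h n * norm u * e4 n"
   by (rule norm_diff_triangle_le[OF norm_diff_triangle_le[OF f1 f4]]) (use f2 in \<open>simp add: norm_minus_commute\<close>)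
  also have "... = h n * norm u * (e1 n + e2 n + e3 n + e4 n) + e * ((1 - p * h n) * norm u)"
   by (simp add: algebra_simps)
  also have "... <= h n * norm u * d n + e * ((1 - p * h n) * norm u)"
   using hn unfolding d_def by (intro add_right_mono mult_left_mono) auto
  finally show ?thesis by (simp add: algebra_simps)
 qed
 define e0 where "e0 = (\<integral>om. norm (W N2 om) \<partial>M) + (norm \<mu> + R * (\<Sum>i\<in>UNIV. v / (2 * \<kappa> i)))"
 define e where "e = rec_nat e0 (%m x. (1 - p * h (N2 + m)) * x + h (N2 + m) * d (N2 + m))"
 have eS: "e (Suc m) = (1 - p * h (N2 + m)) * e m + h (N2 + m) * d (N2 + m)" and e00: "e 0 = e0" for m
  by (simp_all add: e_def)
 have ks: "0 <= (\<Sum>i\<in>UNIV. v / (2 * \<kappa> i))" using v \<kappa>_pos by (intro sum_nonneg) (auto simp: less_imp_le)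
 have hp: "0 < h (N2 + m)" "p * h (N2 + m) <= 1" for m
  using N2[of "N2 + m"] p h_pos by auto
 have epos: "e m >= 0" for m
 proof (induction m)
  case 0
  thus ?case unfolding e00 e0_def using ks R by simp
 next
  case (Suc m)
  thus ?case unfolding eS using hp[of m] by (intro add_nonneg_nonneg mult_nonneg_nonneg) (auto simp: d_def less_imp_le)
 qed
 have main: "cmod (\<phi> (N2 + m) u - target u) <= e m * norm u" if "norm u <= R" for m u
  using that
 proof (induction m arbitrary: u)
  case 0
  have n: "N2 >= N" using N2[of N2] p by simp
  have "cmod (\<phi> N2 u - target u) <= norm u * (\<integral>om. norm (W N2 om) \<partial>M)
    + norm u * (norm \<mu> + norm u * (\<Sum>i\<in>UNIV. v / (2 * \<kappa> i)))"
   by (rule norm_diff_triangle_le[OF \<phi>_near_one[OF n]])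
    (use target_near_zero[of u] in \<open>simp add: norm_minus_commute\<close>)
  also have "... <= norm u * (\<integral>om. norm (W N2 om) \<partial>M) + norm u * (norm \<mu> + R * (\<Sum>i\<in>UNIV. v / (2 * \<kappa> i)))"
   using 0 ks by (intro add_left_mono mult_left_mono mult_right_mono) auto
  also have "... = e 0 * norm u" unfolding e00 e0_def by (simp add: algebra_simps)
  finally show ?case by simp
 next
  case (Suc m)
  thus ?case using key[of "N2 + m" u "e m"] epos[of m] eS[of m] by simp
 qed
 have "e \<longlonglongrightarrow> 0"
 proof (rule contraction_limit[where p = "%m. p * h (N2 + m)" and d = "%m. d (N2 + m) / p" and N = 0])
  show "e (Suc n) <= (1 - p * h (N2 + n)) * e n + p * h (N2 + n) * (d (N2 + n) / p)" for n
   using p0 by (simp add: eS)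
  show "0 <= p * h (N2 + n) \<and> p * h (N2 + n) <= 1" for n using hp[of n] p0 by simp
  show "\<not> summable (%m. p * h (N2 + m))"
   using h_div summable_iff_shift[of h N2] p0 by (simp add: add.commute)
  show "(%m. d (N2 + m) / p) \<longlonglongrightarrow> 0"
   using LIMSEQ_ignore_initial_segment[OF dl, of N2] tendsto_divide[OF _ tendsto_const[of p], of _ 0] p0
   by (simp add: add.commute)
 qed (rule epos)
 hence "(%m. e m * norm u0) \<longlonglongrightarrow> 0" using tendsto_mult_left_zero by blast
 hence "(%m. \<phi> (N2 + m) u0 - target u0) \<longlonglongrightarrow> 0"
  by (rule Lim_null_comparison[rotated]) (use main[OF R(2)] in auto)
 hence "(%m. \<phi> (m + N2) u0) \<longlonglongrightarrow> target u0" using LIM_zero_cancel by (simp add: add.commute)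
 thus ?thesis by (rule LIMSEQ_offset)
qed

end

section \<open>The continuity theorem in euclidean space\<close>

inductive trig_polynomial :: "('a::real_inner => real) => bool" where
 wave: "trig_polynomial (%x. A * cos (u \<bullet> x + s))"
| add: "trig_polynomial f ==> trig_polynomial g ==> trig_polynomial (%x. f x + g x)"

lemma trig_polynomial_const: "trig_polynomial (%x. c)"
 using wave[of c 0 0] by simp

lemma trig_polynomial_wave_mult:
 assumes "trig_polynomial g" shows "trig_polynomial (%x. (A * cos (u \<bullet> x + s)) * g x)"
 using assms
proof induction
 case (wave B w r)
 have "(A * cos (u \<bullet> x + s)) * (B * cos (w \<bullet> x + r)) =
   (A * B / 2) * cos ((u - w) \<bullet> x + (s - r)) + (A * B / 2) * cos ((u + w) \<bullet> x + (s + r))" for x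
 proof -
  have "cos (u \<bullet> x + s) * cos (w \<bullet> x + r) =
    (cos ((u \<bullet> x + s) - (w \<bullet> x + r)) + cos ((u \<bullet> x + s) + (w \<bullet> x + r))) / 2"
   by (rule cos_times_cos)
  also have "(u \<bullet> x + s) - (w \<bullet> x + r) = (u - w) \<bullet> x + (s - r)" by (simp add: inner_diff_left)
  also have "(u \<bullet> x + s) + (w \<bullet> x + r) = (u + w) \<bullet> x + (s + r)" by (simp add: inner_add_left)
  finally show ?thesis by (simp add: field_simps)
 qed
 thus ?case
  by (simp only:) (intro trig_polynomial.intros)
next
 case (add f g)
 thus ?case by (simp only: distrib_left) (rule trig_polynomial.add)
qed

lemma trig_polynomial_mult:
 assumes "trig_polynomial f" "trig_polynomial g" shows "trig_polynomial (%x. f x * g x)"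
 using assms(1)
proof induction
 case (wave A u s)
 thus ?case by (rule trig_polynomial_wave_mult[OF assms(2)])
next
 case (add f1 f2)
 thus ?case by (simp only: distrib_right) (rule trig_polynomial.add)
qed

lemma trig_polynomial_sum:
 assumes "finite I" "!!i. i \<in> I ==> trig_polynomial (f i)"
 shows "trig_polynomial (%x. \<Sum>i\<in>I. f i x)"
 using assms by (induction I rule: finite_induct) (auto intro: trig_polynomial_const trig_polynomial.add)

text \<open>A polynomial in the sines of the scaled coordinates is a sum of exponentials, so that the convergence of
characteristic functions applies to it.\<close>

lemma trig_polynomial_of_sines:
 fixes p :: "real^'n::finite => real"
 assumes "real_polynomial_function p"
 shows "trig_polynomial (%x. p (\<chi> i. sin (x $ i / L)))"
 using assms
proof induction
 case (linear l)
 have l: "linear l" using linear by (rule bounded_linear.linear)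
 have "l y = (\<Sum>i\<in>UNIV. l (axis i 1) * y $ i)" for y
 proof -
  have "l y = l (\<Sum>i\<in>UNIV. y $ i *\<^sub>R axis i 1)"
   using basis_expansion[of y] by (simp add: scalar_mult_eq_scaleR)
  thus ?thesis using l by (simp add: linear_sum linear_scale mult.commute)
 qed
 hence eq: "(%x. l (\<chi> i. sin (x $ i / L))) =
   (%x. \<Sum>i\<in>UNIV. l (axis i 1) * cos (((1 / L) *\<^sub>R axis i 1) \<bullet> x + (- (pi / 2))))"
 proof (intro ext)
  fix x :: "real^'n"
  assume "!!y. l y = (\<Sum>i\<in>UNIV. l (axis i 1) * y $ i)"
  hence "l (\<chi> i. sin (x $ i / L)) = (\<Sum>i\<in>UNIV. l (axis i 1) * (\<chi> i. sin (x $ i / L)) $ i)" .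
  also have "... = (\<Sum>i\<in>UNIV. l (axis i 1) * cos (((1 / L) *\<^sub>R axis i 1) \<bullet> x + (- (pi / 2))))"
   by (intro sum.cong refl) (simp add: inner_axis' cos_diff)
  finally show "l (\<chi> i. sin (x $ i / L)) = (\<Sum>i\<in>UNIV. l (axis i 1) * cos (((1 / L) *\<^sub>R axis i 1) \<bullet> x + (- (pi / 2))))" .
 qed
 show ?case unfolding eq by (rule trig_polynomial_sum) (simp, rule trig_polynomial.wave)
next
 case (const c)
 show ?case by (rule trig_polynomial_const)
next
 case (add f g)
 thus ?case by (intro trig_polynomial.add)
next
 case (mult f g)
 thus ?case by (intro trig_polynomial_mult)
qed

lemma trig_polynomial_integral_limit:
 fixes W :: "nat => 's => 'a::euclidean_space"
 assumes "prob_space M" "prob_space N" "sets N = sets borel"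
  and W: "!!n. W n \<in> borel_measurable M"
  and lim: "!!u. (%n. \<integral>om. iexp (u \<bullet> W n om) \<partial>M) \<longlonglongrightarrow> (\<integral>x. iexp (u \<bullet> x) \<partial>N)"
  and p: "trig_polynomial p"
 shows "p \<in> borel_measurable borel" "!!n. integrable M (%om. p (W n om))" "integrable N p"
  "(%n. \<integral>om. p (W n om) \<partial>M) \<longlonglongrightarrow> (\<integral>x. p x \<partial>N)"
proof -
 interpret M: prob_space M by fact
 interpret N: prob_space N by fact
 have [measurable_cong]: "sets N = sets borel" by fact
 note [measurable] = W
 have "p \<in> borel_measurable borel \<and> (\<forall>n. integrable M (%om. p (W n om))) \<and> integrable N p \<and>
  (%n. \<integral>om. p (W n om) \<partial>M) \<longlonglongrightarrow> (\<integral>x. p x \<partial>N)"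
  using p
 proof induction
  case (wave A u s)
  have e: "A * cos (u \<bullet> x + s) = A * Re (iexp s * iexp (u \<bullet> x))" for x
   by (simp add: mult_exp_exp distrib_left[symmetric] Re_exp add.commute)
  have iN: "integrable N (%x. iexp s * iexp (u \<bullet> x))"
   by (rule N.integrable_const_bound[where B = 1]) (auto simp: norm_mult)
  have iM: "integrable M (%om. iexp s * iexp (u \<bullet> W n om))" for n
   by (rule M.integrable_const_bound[where B = 1]) (auto simp: norm_mult)
  have "(%n. A * Re (iexp s * (\<integral>om. iexp (u \<bullet> W n om) \<partial>M))) \<longlonglongrightarrow> A * Re (iexp s * (\<integral>x. iexp (u \<bullet> x) \<partial>N))"
   by (intro tendsto_intros lim)
  moreover have "A * Re (iexp s * (\<integral>om. iexp (u \<bullet> W n om) \<partial>M)) = (\<integral>om. A * cos (u \<bullet> W n om + s) \<partial>M)" for n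
   unfolding e by (simp only: integral_mult_right_zero integral_Re[OF iM])
  moreover have "A * Re (iexp s * (\<integral>x. iexp (u \<bullet> x) \<partial>N)) = (\<integral>x. A * cos (u \<bullet> x + s) \<partial>N)"
   unfolding e by (simp only: integral_mult_right_zero integral_Re[OF iN])
  ultimately have "(%n. \<integral>om. A * cos (u \<bullet> W n om + s) \<partial>M) \<longlonglongrightarrow> (\<integral>x. A * cos (u \<bullet> x + s) \<partial>N)"
   by (simp only:)
  moreover have "integrable N (%x. A * cos (u \<bullet> x + s))"
   unfolding e by (rule integrable_mult_right, rule integrable_Re, rule iN)
  moreover have "integrable M (%om. A * cos (u \<bullet> W n om + s))" for n
   unfolding e by (rule integrable_mult_right, rule integrable_Re, rule iM)
  moreover have "(%x. A * cos (u \<bullet> x + s)) \<in> borel_measurable borel" by measurable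
  ultimately show ?case by blast
 next
  case (add f g)
  thus ?case by (auto intro: tendsto_add)
 qed
 thus "p \<in> borel_measurable borel" "!!n. integrable M (%om. p (W n om))" "integrable N p"
  "(%n. \<integral>om. p (W n om) \<partial>M) \<longlonglongrightarrow> (\<integral>x. p x \<partial>N)" by auto
qed

lemma arcsin_cube_continuous:
 "continuous_on {s::real^'n::finite. \<forall>i. -1 <= s $ i \<and> s $ i <= 1} (%s. \<chi> i. L * arcsin (s $ i))"
proof (intro continuous_on_vec_lambda continuous_on_mult continuous_on_const)
 fix i :: 'n
 show "continuous_on {s::real^'n. \<forall>i. -1 <= s $ i \<and> s $ i <= 1} (%s. arcsin (s $ i))"
  by (rule continuous_on_arcsin) (intro continuous_on_component continuous_on_id, blast)
qed

text \<open>The coordinates of a point of the ball are recovered from their scaled sines.\<close>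

lemma arcsin_sin_vec:
 fixes x :: "real^'n::finite"
 assumes "norm x <= R" "R > 0" "L = 2 * R / pi"
 shows "(\<chi> i. L * arcsin (sin (x $ i / L))) = x"
proof -
 have L: "L > 0" using assms(2,3) by simp
 have "L * arcsin (sin (x $ i / L)) = x $ i" for i
 proof -
  define y where "y = x $ i / L"
  have "\<bar>x $ i\<bar> <= R" by (rule order_trans[OF component_le_norm_cart assms(1)])
  hence "\<bar>x $ i\<bar> / L <= R / L" using L by (intro divide_right_mono) auto
  moreover have "R / L = pi / 2" unfolding assms(3) using assms(2) by simp
  moreover have "\<bar>y\<bar> = \<bar>x $ i\<bar> / L" unfolding y_def using L by simp
  ultimately have "\<bar>y\<bar> <= pi / 2" by (simp only:)
  hence "- (pi / 2) <= y" "y <= pi / 2" by linarith+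
  hence "arcsin (sin y) = y" by (rule arcsin_sin)
  thus ?thesis unfolding y_def using L by simp
 qed
 thus ?thesis by (simp only: vec_eq_iff vec_lambda_beta) simp
qed

text \<open>On the ball of radius \<open>R\<close>, \<open>h\<close> is a continuous function of the sines of the scaled coordinates.  This function
is continuous on a cube, where Stone--Weierstrass applies; as sines stay in the cube, the approximant is bounded
on the whole space, which bounds the error outside the ball.\<close>

lemma trig_polynomial_approximation:
 fixes h :: "real^'n::finite => real"
 assumes h: "continuous_on UNIV h" and bd: "!!x. \<bar>h x\<bar> <= K" and e: "e > 0" and R: "R > 0"
 obtains p where "trig_polynomial p" "!!x. \<bar>h x - p x\<bar> <= e + (2 * K) * indicator {x. R < norm x} x"
proof -
 define L where "L = 2 * R / pi"
 define fld where "fld s = (\<chi> i. L * arcsin (s $ i))" for s :: "real^'n"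
 define Q where "Q = {s::real^'n. \<forall>i. -1 <= s $ i \<and> s $ i <= 1}"
 have "Q = cbox (\<chi> i. -1) (\<chi> i. 1)" unfolding Q_def by (auto simp: mem_box_cart)
 hence comp: "compact Q" by (simp only: compact_cbox)
 have "continuous_on Q fld" unfolding Q_def fld_def by (rule arcsin_cube_continuous)
 hence cont: "continuous_on Q (%s. h (fld s))"
  by (rule continuous_on_compose2[OF h]) (rule subset_UNIV)
 obtain g where g: "real_polynomial_function g" "!!s. s \<in> Q ==> \<bar>h (fld s) - g s\<bar> < e"
  using Stone_Weierstrass_real_polynomial_function[OF comp cont e] by blast
 define S where "S x = (\<chi> i. sin (x $ i / L))" for x :: "real^'n"
 have SQ: "S x \<in> Q" for x unfolding S_def Q_def by simp
 show ?thesis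
 proof (rule that)
  show "trig_polynomial (%x. g (S x))" unfolding S_def by (rule trig_polynomial_of_sines[OF g(1)])
  fix x
  have near: "\<bar>h (fld (S x)) - g (S x)\<bar> <= e" by (rule less_imp_le[OF g(2)[OF SQ]])
  show "\<bar>h x - g (S x)\<bar> <= e + (2 * K) * indicator {x. R < norm x} x"
  proof (cases "norm x <= R")
   case True
   have "fld (S x) = x"
    unfolding fld_def S_def vec_lambda_beta by (rule arcsin_sin_vec[OF True R L_def])
   with near have "\<bar>h x - g (S x)\<bar> <= e" by (simp only:)
   thus ?thesis using True by simp
  next
   case False
   have "\<bar>h x - g (S x)\<bar> <= \<bar>h x\<bar> + \<bar>h (fld (S x))\<bar> + \<bar>h (fld (S x)) - g (S x)\<bar>" by linarith
   also have "... <= K + K + e" by (rule add_mono[OF add_mono[OF bd bd] near])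
   finally show ?thesis using False by simp
  qed
 qed
qed

text \<open>On a large ball \<open>h\<close> is close to a trigonometric polynomial, and the integrals of the latter converge by the hypothesis on
the characteristic functions; outside the ball, tightness makes the error small.\<close>

theorem levy_continuity_vec:
 fixes W :: "nat => 's => real^'n::finite" and h :: "real^'n => real"
 assumes M: "prob_space M" and N: "prob_space N" "sets N = sets borel"
  and W: "!!n. W n \<in> borel_measurable M"
  and lim: "!!u. (%n. \<integral>om. iexp (u \<bullet> W n om) \<partial>M) \<longlonglongrightarrow> (\<integral>x. iexp (u \<bullet> x) \<partial>N)"
  and tight: "!!e. e > 0 ==> \<exists>R n0. \<forall>n\<ge>n0. measure M {om \<in> space M. R < norm (W n om)} <= e"
  and h: "continuous_on UNIV h" "bounded (range h)"
 shows "(%n. \<integral>om. h (W n om) \<partial>M) \<longlonglongrightarrow> (\<integral>x. h x \<partial>N)"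
proof -
 interpret M: prob_space M by fact
 interpret N: prob_space N by fact
 have [measurable_cong]: "sets N = sets borel" by fact
 have spN: "space N = UNIV" using sets_eq_imp_space_eq[OF N(2)] by simp
 note [measurable] = W
 have [measurable]: "h \<in> borel_measurable borel" by (rule borel_measurable_continuous_onI[OF h(1)])
 obtain K where K: "!!x. \<bar>h x\<bar> <= K" "K > 0"
  using h(2) unfolding bounded_pos by auto
 show ?thesis
 proof (rule LIMSEQ_I)
  fix e0 :: real assume "e0 > 0"
  define e where "e = e0 / (5 + 4 * K)"
  have e: "e > 0" using \<open>e0 > 0\<close> K by (simp add: e_def)
  obtain R1 n1 where R1: "!!n. n >= n1 ==> measure M {om \<in> space M. R1 < norm (W n om)} <= e"
   using tight[OF e] by blast
  have "(%k. measure N {x \<in> space N. real k < norm x}) \<longlonglongrightarrow> measure N (\<Inter>k. {x \<in> space N. real k < norm x})"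
   by (rule N.finite_Lim_measure_decseq) (auto simp: decseq_def)
  also have "(\<Inter>k. {x \<in> space N. real k < norm x}) = {}"
  proof -
   have "\<exists>k. \<not> real k < norm x" for x :: "real^'n"
    using reals_Archimedean2[of "norm x"] by (auto simp: not_less intro: less_imp_le)
   thus ?thesis by blast
  qed
  finally have "(%k. measure N {x \<in> space N. real k < norm x}) \<longlonglongrightarrow> 0" by simp
  hence "\<forall>\<^sub>F k in sequentially. measure N {x \<in> space N. real k < norm x} < e"
   using e by (intro order_tendstoD(2)) auto
  then obtain k where k: "!!j. j >= k ==> measure N {x \<in> space N. real j < norm x} < e"
   unfolding eventually_sequentially by blast
  obtain j where j: "max (max R1 1) (real k) < real j" using reals_Archimedean2 by blast
  define R where "R = real j"
  have R: "R > 0" "R1 <= R" using j by (auto simp: R_def)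
  have "measure N {x \<in> space N. real j < norm x} < e" by (rule k) (use j in simp)
  hence RN: "measure N {x. R < norm x} <= e" using spN by (simp add: R_def)
  have RM: "measure M {om \<in> space M. R < norm (W n om)} <= e" if "n >= n1" for n
   by (rule order_trans[OF M.finite_measure_mono R1[OF that]]) (use R in auto)
  obtain p where p: "trig_polynomial p" "!!x. \<bar>h x - p x\<bar> <= e + (2 * K) * indicator {x. R < norm x} x"
   using trig_polynomial_approximation[OF h(1) K(1) e R(1)] by blast
  note pl = trig_polynomial_integral_limit[OF M N W lim p(1)]
  have [measurable]: "p \<in> borel_measurable borel" by (rule pl(1))
  have hM: "integrable M (%om. h (W n om))" for n
   by (rule M.integrable_const_bound[where B = K]) (use K in auto)
  have hN: "integrable N h"
   by (rule N.integrable_const_bound[where B = K]) (use K in auto)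
  have dM: "\<bar>(\<integral>om. h (W n om) \<partial>M) - (\<integral>om. p (W n om) \<partial>M)\<bar> <= e + 2 * K * e" if n: "n >= n1" for n
  proof -
   have iM: "integrable M (%om. indicator {x. R < norm x} (W n om) :: real)"
    by (rule M.integrable_const_bound[where B = 1]) (auto simp: indicator_def)
   have "(\<integral>om. indicator {x. R < norm x} (W n om) \<partial>M) = (\<integral>om. indicator {om \<in> space M. R < norm (W n om)} om \<partial>M)"
    by (rule Bochner_Integration.integral_cong) (auto simp: indicator_def)
   also have "... = measure M {om \<in> space M. R < norm (W n om)}" by simp
   finally have m: "(\<integral>om. indicator {x. R < norm x} (W n om) \<partial>M) = measure M {om \<in> space M. R < norm (W n om)}" .
   have "\<bar>(\<integral>om. h (W n om) \<partial>M) - (\<integral>om. p (W n om) \<partial>M)\<bar> = \<bar>\<integral>om. h (W n om) - p (W n om) \<partial>M\<bar>"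
    using hM pl(2) by simp
   also have "... <= (\<integral>om. \<bar>h (W n om) - p (W n om)\<bar> \<partial>M)" by (rule integral_abs_bound)
   also have "... <= (\<integral>om. e + (2 * K) * indicator {x. R < norm x} (W n om) \<partial>M)"
    using hM pl(2) iM p(2) by (intro integral_mono) auto
   also have "... = e + 2 * K * measure M {om \<in> space M. R < norm (W n om)}"
    using iM m by (simp add: M.prob_space)
   also have "... <= e + 2 * K * e" using RM[OF n] K by (intro add_left_mono mult_left_mono) auto
   finally show ?thesis .
  qed
  have dN: "\<bar>(\<integral>x. h x \<partial>N) - (\<integral>x. p x \<partial>N)\<bar> <= e + 2 * K * e"
  proof -
   have iN: "integrable N (indicator {x. R < norm x} :: _ => real)"
    by (rule N.integrable_const_bound[where B = 1]) (auto simp: indicator_def)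
   have "\<bar>(\<integral>x. h x \<partial>N) - (\<integral>x. p x \<partial>N)\<bar> = \<bar>\<integral>x. h x - p x \<partial>N\<bar>" using hN pl(3) by simp
   also have "... <= (\<integral>x. \<bar>h x - p x\<bar> \<partial>N)" by (rule integral_abs_bound)
   also have "... <= (\<integral>x. e + (2 * K) * indicator {x. R < norm x} x \<partial>N)"
    using hN pl(3) iN p(2) by (intro integral_mono) auto
   also have "... = e + 2 * K * measure N {x. R < norm x}"
    using iN N.prob_space spN by simp
   also have "... <= e + 2 * K * e" using RN K by (intro add_left_mono mult_left_mono) auto
   finally show ?thesis .
  qed
  obtain n2 where n2: "!!n. n >= n2 ==> \<bar>(\<integral>om. p (W n om) \<partial>M) - (\<integral>x. p x \<partial>N)\<bar> < e"
   using LIMSEQ_D[OF pl(4) e] by auto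
  show "\<exists>n0. \<forall>n\<ge>n0. norm ((\<integral>om. h (W n om) \<partial>M) - (\<integral>x. h x \<partial>N)) < e0"
  proof (intro exI allI impI)
   fix n assume n: "n >= max n1 n2"
   have "\<bar>(\<integral>om. h (W n om) \<partial>M) - (\<integral>x. h x \<partial>N)\<bar> < (e + 2 * K * e) + e + (e + 2 * K * e)"
    using dM[of n] dN n2[of n] n by linarith
   also have "... = (3 + 4 * K) * e" by (simp add: algebra_simps)
   also have "... < (5 + 4 * K) * e" using e by (simp add: algebra_simps)
   also have "... = e0" using K by (simp add: e_def)
   finally show "norm ((\<integral>om. h (W n om) \<partial>M) - (\<integral>x. h x \<partial>N)) < e0" by simp
  qed
 qed
qed

section \<open>Gaussian laws\<close>

abbreviation "stdn \<equiv> std_normal_distribution"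

lemma prob_stdn: "prob_space stdn"
 using real_dist_normal_dist by (simp add: real_distribution_def)

lemma stdn_moments:
 "integrable stdn (%z. z)" "integrable stdn (%z. z^2)" "(\<integral>z. z \<partial>stdn) = 0" "(\<integral>z. z^2 \<partial>stdn) = 1"
 using integrable_std_normal_distribution_moment[of 1] integrable_std_normal_distribution_moment[of 2]
  integral_std_normal_distribution_moment_odd[of 1] std_normal_distribution_even_moments(1)[of 1]
 by (simp_all add: fact_numeral)

lemma affine_moments:
 fixes D :: "real measure"
 assumes "prob_space D" "integrable D (%z. z)" "integrable D (%z. z^2)" "(\<integral>z. z \<partial>D) = 0" "(\<integral>z. z^2 \<partial>D) = 1"
 shows "(\<integral>z. m + s * z \<partial>D) = m" "integrable D (%z. (m + s * z - m)^2)" "(\<integral>z. (m + s * z - m)^2 \<partial>D) = s^2"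
proof -
 interpret prob_space D by fact
 show "(\<integral>z. m + s * z \<partial>D) = m" "integrable D (%z. (m + s * z - m)^2)" "(\<integral>z. (m + s * z - m)^2 \<partial>D) = s^2"
  using assms by (simp_all add: prob_space power_mult_distrib)
qed

lemma affine_stdn:
 assumes "s >= 0"
 shows "distr stdn borel (%z. m + s * z) =
  (if s = 0 then return borel m else density lborel (%y. ennreal (normal_density m s y)))"
proof (cases "s = 0")
 case True
 interpret prob_space stdn by (rule prob_stdn)
 have "distr stdn borel (%z. m) = return borel m" by (rule distr_const) simp
 with True show ?thesis by simp
next
 case False
 interpret prob_space stdn by (rule prob_stdn)
 have X: "distributed stdn lborel (%x. x) std_normal_density"
  unfolding distributed_def by (intro conjI distr_id2) simp_all
 have "distributed stdn lborel (%z. m + s * z) (normal_density (m + s * 0) (\<bar>s\<bar> * 1))"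
  by (rule normal_density_affine[OF X _ False]) simp
 moreover have "m + s * 0 = m" "\<bar>s\<bar> * 1 = s" using assms by auto
 ultimately have "distributed stdn lborel (%z. m + s * z) (normal_density m s)" by (simp only:)
 hence "distr stdn lborel (%z. m + s * z) = density lborel (%y. ennreal (normal_density m s y))"
  unfolding distributed_def by blast
 moreover have "distr stdn lborel (%z. m + s * z) = distr stdn borel (%z. m + s * z)"
  by (intro distr_cong refl sets_lborel)
 ultimately show ?thesis using False by simp
qed

lemma char_affine_stdn: "(\<integral>z. iexp (t * (m + s * z)) \<partial>stdn) = exp (\<i> * of_real (t * m) - of_real ((t * s)^2 / 2))"
proof -
 have "(\<integral>z. iexp (t * (m + s * z)) \<partial>stdn) = (\<integral>z. iexp (t * m) * iexp ((t * s) * z) \<partial>stdn)"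
  by (simp add: mult_exp_exp algebra_simps)
 also have "... = iexp (t * m) * char stdn (t * s)" by (simp add: char_def)
 also have "... = exp (\<i> * of_real (t * m) - of_real ((t * s)^2 / 2))"
  unfolding char_std_normal_distribution by (simp add: exp_of_real[symmetric] mult_exp_exp)
 finally show ?thesis .
qed

lemma stdn_component_measurable: "(%z. z i) \<in> borel_measurable (Pi\<^sub>M UNIV (%i. stdn))"
proof -
 have "(%z. z i) \<in> measurable (Pi\<^sub>M UNIV (%i. stdn)) stdn"
  by (rule measurable_component_singleton) (rule UNIV_I)
 thus ?thesis by simp
qed

lemma matrix_vector_measurable:
 fixes A :: "real^'n::finite^'m::finite"
 shows "(%x. A *v x) \<in> borel_measurable borel"
 by (intro borel_measurable_continuous_onI linear_continuous_on matrix_vector_mul_bounded_linear)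

text \<open>The law of \<open>\<mu>\<close> plus \<open>transpose P\<close> applied to independent centred normal variables of variances \<open>v i\<close>; zero variances
are allowed.\<close>

definition gauss :: "real^'n::finite => real^'n^'n => ('n => real) => (real^'n) measure" where
 "gauss \<mu> P v = distr (Pi\<^sub>M UNIV (%i. stdn)) borel (%z. \<mu> + transpose P *v (\<chi> i. sqrt (v i) * z i))"

locale gaussian_parameters =
 fixes \<mu> :: "real^'n::finite" and P :: "real^'n^'n" and v :: "'n => real"
 assumes v: "!!i. v i >= 0"
begin

lemma gauss_map_measurable:
 "(%z. \<mu> + transpose P *v (\<chi> i. sqrt (v i) * z i)) \<in> borel_measurable (Pi\<^sub>M UNIV (%i. stdn))"
proof -
 have "(%z. \<chi> i. sqrt (v i) * z i) \<in> borel_measurable (Pi\<^sub>M UNIV (%i. stdn))"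
  by (intro borel_measurable_vec_lambda borel_measurable_times borel_measurable_const stdn_component_measurable)
 hence "(%z. transpose P *v (\<chi> i. sqrt (v i) * z i)) \<in> borel_measurable (Pi\<^sub>M UNIV (%i. stdn))"
  using measurable_compose[OF _ matrix_vector_measurable] by blast
 thus ?thesis by (intro borel_measurable_add borel_measurable_const)
qed

lemma prob_gauss: "prob_space (gauss \<mu> P v)"
proof -
 interpret product_prob_space "%i::'n. stdn" UNIV
  by (simp add: product_prob_space_def product_prob_space_axioms_def product_sigma_finite_def
    prob_stdn prob_space_imp_sigma_finite)
 show ?thesis unfolding gauss_def by (rule P.prob_space_distr[OF gauss_map_measurable])
qed

lemma sets_gauss: "sets (gauss \<mu> P v) = sets borel"
 by (simp add: gauss_def)

definition var where "var u = (\<Sum>i\<in>UNIV. v i * ((P *v u) $ i)^2)"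

lemma var_nonneg: "var u >= 0"
 unfolding var_def using v by (intro sum_nonneg) auto

lemma charfun_gauss: "(\<integral>x. iexp (u \<bullet> x) \<partial>gauss \<mu> P v) = exp (\<i> * of_real (u \<bullet> \<mu>) - of_real (var u / 2))"
proof -
 interpret product_prob_space "%i::'n. stdn" UNIV
  by (simp add: product_prob_space_def product_prob_space_axioms_def product_sigma_finite_def
    prob_stdn prob_space_imp_sigma_finite)
 define c where "c i = (P *v u) $ i * sqrt (v i)" for i
 have ip: "u \<bullet> (\<mu> + transpose P *v (\<chi> i. sqrt (v i) * z i)) = u \<bullet> \<mu> + (\<Sum>i\<in>UNIV. c i * z i)" for z :: "'n => real"
 proof -
  have "u \<bullet> (transpose P *v (\<chi> i. sqrt (v i) * z i)) = (P *v u) \<bullet> (\<chi> i. sqrt (v i) * z i)"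
   by (metis dot_lmul_matrix transpose_matrix_vector transpose_transpose)
  hence "u \<bullet> (\<mu> + transpose P *v (\<chi> i. sqrt (v i) * z i)) = u \<bullet> \<mu> + (P *v u) \<bullet> (\<chi> i. sqrt (v i) * z i)"
   by (simp only: inner_add_right)
  also have "(P *v u) \<bullet> (\<chi> i. sqrt (v i) * z i) = (\<Sum>i\<in>UNIV. c i * z i)"
   by (simp add: inner_vec_def c_def mult.assoc)
  finally show ?thesis .
 qed
 have pr: "iexp (u \<bullet> \<mu> + (\<Sum>i\<in>UNIV. c i * z i)) = iexp (u \<bullet> \<mu>) * (\<Prod>i\<in>UNIV. iexp (c i * z i))" for z :: "'n => real"
 proof -
  have "(\<Prod>i\<in>UNIV. iexp (c i * z i)) = exp (\<Sum>i\<in>UNIV. \<i> * of_real (c i * z i))"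
   by (rule exp_sum[symmetric]) simp
  also have "(\<Sum>i\<in>UNIV. \<i> * of_real (c i * z i)) = \<i> * of_real (\<Sum>i\<in>UNIV. c i * z i)"
   by (simp only: sum_distrib_left of_real_sum)
  finally show ?thesis by (simp only: mult_exp_exp of_real_add distrib_left)
 qed
 have "(\<integral>x. iexp (u \<bullet> x) \<partial>gauss \<mu> P v) = (\<integral>z. iexp (u \<bullet> (\<mu> + transpose P *v (\<chi> i. sqrt (v i) * z i))) \<partial>Pi\<^sub>M UNIV (%i::'n. stdn))"
  unfolding gauss_def by (rule integral_distr[OF gauss_map_measurable]) measurable
 also have "... = (\<integral>z. iexp (u \<bullet> \<mu>) * (\<Prod>i\<in>UNIV. iexp (c i * z i)) \<partial>Pi\<^sub>M UNIV (%i::'n. stdn))"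
  by (simp only: ip pr)
 also have "... = iexp (u \<bullet> \<mu>) * (\<integral>z. (\<Prod>i\<in>UNIV. iexp (c i * z i)) \<partial>Pi\<^sub>M UNIV (%i::'n. stdn))"
  by (rule integral_mult_right_zero)
 also have "(\<integral>z. (\<Prod>i\<in>UNIV. iexp (c i * z i)) \<partial>Pi\<^sub>M UNIV (%i::'n. stdn)) = (\<Prod>i\<in>UNIV. (\<integral>z. iexp (c i * z) \<partial>stdn))"
 proof (rule product_integral_prod)
  show "integrable stdn (%z. iexp (c i * z))" for i
   by (rule finite_measure.integrable_const_bound[OF prob_space.axioms(1)[OF prob_stdn], where B = 1]) auto
 qed simp
 also have "... = (\<Prod>i\<in>UNIV. exp (of_real (- ((c i)^2 / 2))))"
 proof (rule prod.cong[OF refl])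
  fix i
  show "(\<integral>z. iexp (c i * z) \<partial>stdn) = exp (of_real (- ((c i)^2 / 2)))"
   using char_affine_stdn[of "c i" 0 1] by simp
 qed
 also have "... = exp (\<Sum>i\<in>UNIV. of_real (- ((c i)^2 / 2)))"
  by (rule exp_sum[symmetric]) simp
 also have "(\<Sum>i\<in>UNIV. of_real (- ((c i)^2 / 2))) = (- of_real (var u / 2) :: complex)"
 proof -
  have "(c i)^2 = v i * ((P *v u) $ i)^2" for i using v[of i] by (simp add: c_def power_mult_distrib)
  hence "(\<Sum>i\<in>UNIV. - ((c i)^2 / 2)) = - (var u / 2)"
   by (simp add: var_def sum_negf sum_divide_distrib)
  thus ?thesis by (metis of_real_sum of_real_minus)
 qed
 finally show ?thesis by (simp add: mult_exp_exp)
qed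

lemma gauss_projection: "distr (gauss \<mu> P v) borel (%x. u \<bullet> x) = distr stdn borel (%z. u \<bullet> \<mu> + sqrt (var u) * z)"
proof (rule Levy_uniqueness)
 interpret G: prob_space "gauss \<mu> P v" by (rule prob_gauss)
 interpret S: prob_space stdn by (rule prob_stdn)
 have [measurable_cong]: "sets (gauss \<mu> P v) = sets borel" by (rule sets_gauss)
 have m1[measurable]: "(%x. u \<bullet> x) \<in> borel_measurable (gauss \<mu> P v)" by measurable
 have m2[measurable]: "(%z. u \<bullet> \<mu> + sqrt (var u) * z) \<in> borel_measurable stdn" by measurable
 show "real_distribution (distr (gauss \<mu> P v) borel (%x. u \<bullet> x))"
  by (rule G.real_distribution_distr[OF m1])
 show "real_distribution (distr stdn borel (%z. u \<bullet> \<mu> + sqrt (var u) * z))"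
  by (rule S.real_distribution_distr[OF m2])
 show "char (distr (gauss \<mu> P v) borel (%x. u \<bullet> x)) = char (distr stdn borel (%z. u \<bullet> \<mu> + sqrt (var u) * z))"
 proof
  fix t
  have "char (distr (gauss \<mu> P v) borel (%x. u \<bullet> x)) t = (\<integral>x. iexp (t * (u \<bullet> x)) \<partial>gauss \<mu> P v)"
   unfolding char_def by (rule integral_distr) measurable
  also have "... = exp (\<i> * of_real (t * (u \<bullet> \<mu>)) - of_real (t^2 * var u / 2))"
   using charfun_gauss[of "t *\<^sub>R u"]
   by (simp add: var_def matrix_vector_mult_scaleR power_mult_distrib sum_distrib_left mult_ac)
  also have "... = (\<integral>z. iexp (t * (u \<bullet> \<mu> + sqrt (var u) * z)) \<partial>stdn)"
   unfolding char_affine_stdn by (simp add: power_mult_distrib var_nonneg)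
  also have "... = char (distr stdn borel (%z. u \<bullet> \<mu> + sqrt (var u) * z)) t"
   unfolding char_def by (rule integral_distr[symmetric]) measurable
  finally show "char (distr (gauss \<mu> P v) borel (%x. u \<bullet> x)) t = char (distr stdn borel (%z. u \<bullet> \<mu> + sqrt (var u) * z)) t" .
 qed
qed

lemma gauss_integral_projection:
 fixes g :: "real => real"
 assumes [measurable]: "g \<in> borel_measurable borel"
 shows "integrable (gauss \<mu> P v) (%x. g (u \<bullet> x)) \<longleftrightarrow> integrable stdn (%z. g (u \<bullet> \<mu> + sqrt (var u) * z))"
  "(\<integral>x. g (u \<bullet> x) \<partial>gauss \<mu> P v) = (\<integral>z. g (u \<bullet> \<mu> + sqrt (var u) * z) \<partial>stdn)"
proof -
 have [measurable_cong]: "sets (gauss \<mu> P v) = sets borel" by (rule sets_gauss)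
 have "integrable (gauss \<mu> P v) (%x. g (u \<bullet> x)) \<longleftrightarrow> integrable (distr (gauss \<mu> P v) borel (%x. u \<bullet> x)) g"
  by (rule integrable_distr_eq[symmetric]) measurable
 also have "... \<longleftrightarrow> integrable stdn (%z. g (u \<bullet> \<mu> + sqrt (var u) * z))"
  unfolding gauss_projection by (rule integrable_distr_eq) measurable
 finally show "integrable (gauss \<mu> P v) (%x. g (u \<bullet> x)) \<longleftrightarrow> integrable stdn (%z. g (u \<bullet> \<mu> + sqrt (var u) * z))" .
 have "(\<integral>x. g (u \<bullet> x) \<partial>gauss \<mu> P v) = (\<integral>y. g y \<partial>distr (gauss \<mu> P v) borel (%x. u \<bullet> x))"
  by (rule integral_distr[symmetric]) measurable
 also have "... = (\<integral>z. g (u \<bullet> \<mu> + sqrt (var u) * z) \<partial>stdn)"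
  unfolding gauss_projection by (rule integral_distr) measurable
 finally show "(\<integral>x. g (u \<bullet> x) \<partial>gauss \<mu> P v) = (\<integral>z. g (u \<bullet> \<mu> + sqrt (var u) * z) \<partial>stdn)" .
qed

lemma gaussian_law_gauss: "gaussian_law (gauss \<mu> P v)"
 unfolding gaussian_law_def
proof (intro conjI allI prob_gauss sets_gauss)
 fix u
 show "\<exists>m s. s >= 0 \<and> distr (gauss \<mu> P v) borel (%x. u \<bullet> x) =
    (if s = 0 then return borel m else density lborel (%y. ennreal (normal_density m s y)))"
  unfolding gauss_projection
  by (intro exI[of _ "u \<bullet> \<mu>"] exI[of _ "sqrt (var u)"] conjI affine_stdn) (auto simp: var_nonneg)
qed

lemma mean_vector_gauss: "mean_vector (gauss \<mu> P v) = \<mu>"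
proof -
 have "(\<integral>x. x $ i \<partial>gauss \<mu> P v) = \<mu> $ i" for i
  using gauss_integral_projection(2)[of "%x. x" "axis i 1"]
  unfolding affine_moments(1)[OF prob_stdn stdn_moments] by (simp add: inner_axis')
 thus ?thesis by (simp add: mean_vector_def vec_eq_iff)
qed

lemma gauss_variance:
 "integrable (gauss \<mu> P v) (%x. (u \<bullet> x - u \<bullet> \<mu>)^2)" "(\<integral>x. (u \<bullet> x - u \<bullet> \<mu>)^2 \<partial>gauss \<mu> P v) = var u"
proof -
 have m: "(%y. (y - u \<bullet> \<mu>)^2) \<in> borel_measurable borel" by measurable
 show "integrable (gauss \<mu> P v) (%x. (u \<bullet> x - u \<bullet> \<mu>)^2)"
  unfolding gauss_integral_projection(1)[OF m] by (rule affine_moments(2)[OF prob_stdn stdn_moments])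
 have "(sqrt (var u))^2 = var u" using var_nonneg by simp
 thus "(\<integral>x. (u \<bullet> x - u \<bullet> \<mu>)^2 \<partial>gauss \<mu> P v) = var u"
  unfolding gauss_integral_projection(2)[OF m] affine_moments(3)[OF prob_stdn stdn_moments] .
qed

lemma covariance_matrix_gauss: "covariance_matrix (gauss \<mu> P v) = transpose P ** diag_matrix v ** P"
proof -
 have "(\<integral>x. (x $ i - \<mu> $ i) * (x $ j - \<mu> $ j) \<partial>gauss \<mu> P v) = (\<Sum>k\<in>UNIV. v k * (P $ k $ i * P $ k $ j))" for i j
 proof -
  let ?a = "axis i 1 :: real^'n" and ?b = "axis j 1 :: real^'n"
  have "(x $ i - \<mu> $ i) * (x $ j - \<mu> $ j) = (((?a + ?b) \<bullet> x - (?a + ?b) \<bullet> \<mu>)^2 - (?a \<bullet> x - ?a \<bullet> \<mu>)^2 - (?b \<bullet> x - ?b \<bullet> \<mu>)^2) / 2" for x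
   by (simp add: inner_add_left inner_axis' power2_eq_square algebra_simps)
  hence "(\<integral>x. (x $ i - \<mu> $ i) * (x $ j - \<mu> $ j) \<partial>gauss \<mu> P v) = (var (?a + ?b) - var ?a - var ?b) / 2"
   by (simp only:) (simp add: gauss_variance)
  also have "... = (\<Sum>k\<in>UNIV. v k * (P $ k $ i * P $ k $ j))"
  proof -
   have "(P *v axis i 1) $ k = P $ k $ i" for i k
    by (simp add: matrix_vector_mult_basis column_def)
   hence "v k * ((P *v (?a + ?b)) $ k)^2 - v k * ((P *v ?a) $ k)^2 - v k * ((P *v ?b) $ k)^2
     = 2 * (v k * (P $ k $ i * P $ k $ j))" for k
    by (simp add: matrix_vector_right_distrib power2_eq_square algebra_simps)
   thus ?thesis by (simp add: var_def sum_subtractf[symmetric] sum_distrib_left[symmetric])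
  qed
  finally show ?thesis .
 qed
 moreover have "(transpose P ** diag_matrix v ** P) $ i $ j = (\<Sum>k\<in>UNIV. v k * (P $ k $ i * P $ k $ j))" for i j
  by (simp add: matrix_matrix_mult_def transpose_def diag_matrix_def if_distrib mult_ac cong: if_cong)
 ultimately show ?thesis
  by (simp add: covariance_matrix_def mean_vector_gauss vec_eq_iff)
qed

end

section \<open>Square integrable martingales and uniform integrability\<close>

lemma finite_sigma_subalgebra:
 assumes "prob_space M" "subalgebra M F" shows "sigma_finite_subalgebra M F"
proof -
 interpret prob_space M by fact
 show ?thesis
  by (rule finite_measure_subalgebra_is_sigma_finite)
   (simp add: finite_measure_subalgebra_def finite_measure_subalgebra_axioms_def assms finite_measure_axioms)
qed

locale square_integrable_martingale = prob_space M for M :: "'s measure" +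
 fixes F :: "nat => 's measure" and D :: "nat => 's => real"
 assumes sub: "!!n. subalgebra M (F n)"
  and filtration: "!!n. sets (F n) \<subseteq> sets (F (Suc n))"
  and adapted: "!!n. D n \<in> borel_measurable (F (Suc n))"
  and square: "!!n. integrable M (%om. (D n om)^2)"
  and centred: "!!n. AE om in M. real_cond_exp M (F n) (D n) om = 0"
begin

lemma D_measurable [measurable]: "D n \<in> borel_measurable M"
 by (rule measurable_from_subalg[OF sub adapted])

lemma filtration_mono: "m <= n ==> sets (F m) \<subseteq> sets (F n)"
 by (induction n rule: dec_induct) (use filtration in auto)

lemma measurable_later: "m <= n ==> f \<in> borel_measurable (F m) ==> f \<in> borel_measurable (F n)"
 using measurable_from_subalg[of "F n" "F m"] filtration_mono[of m n] sub
 by (simp add: subalgebra_def)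

lemma orthogonal:
 assumes Y: "Y \<in> borel_measurable (F n)" and i: "integrable M (%om. (Y om)^2)"
 shows "integrable M (%om. Y om * D n om)" "(\<integral>om. Y om * D n om \<partial>M) = 0"
proof -
 interpret sigma_finite_subalgebra M "F n"
  by (rule finite_sigma_subalgebra[OF prob_space_axioms sub])
 have [measurable]: "Y \<in> borel_measurable M" by (rule measurable_from_subalg[OF sub Y])
 show int: "integrable M (%om. Y om * D n om)"
 proof (rule Bochner_Integration.integrable_bound[OF Bochner_Integration.integrable_add[OF i square[of n]]])
  have "\<bar>x * y\<bar> <= x^2 + y^2" for x y :: real
   using sum_squares_bound[of "\<bar>x\<bar>" "\<bar>y\<bar>"] abs_ge_zero[of "x * y"] unfolding abs_mult power2_abs by linarith
  thus "AE om in M. norm (Y om * D n om) <= norm ((Y om)^2 + (D n om)^2)" by simp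
 qed measurable
 have "(\<integral>om. Y om * real_cond_exp M (F n) (D n) om \<partial>M) = (\<integral>om. Y om * D n om \<partial>M)"
  by (rule real_cond_exp_intg(2)[OF int Y D_measurable])
 moreover have "(\<integral>om. Y om * real_cond_exp M (F n) (D n) om \<partial>M) = 0"
  by (rule integral_eq_zero_AE) (use centred[of n] in auto)
 ultimately show "(\<integral>om. Y om * D n om \<partial>M) = 0" by simp
qed

definition S :: "nat => nat => 's => real" where "S m j om = (\<Sum>i<j. D (m + i) om)"

lemma S_measurable: "S m j \<in> borel_measurable (F (m + j))"
proof -
 have "D (m + i) \<in> borel_measurable (F (m + j))" if "i < j" for i
  by (rule measurable_later[OF _ adapted]) (use that in simp)
 thus ?thesis unfolding S_def[abs_def] by (intro borel_measurable_sum) auto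
qed

lemma S_measurable_M [measurable]: "S m j \<in> borel_measurable M"
 by (rule measurable_from_subalg[OF sub S_measurable])

text \<open>Indicator of the event that the partial sums from \<open>m\<close> on have stayed below \<open>e\<close> up to time \<open>j\<close>; it depends on the past
only, so that multiplying increments by it keeps them orthogonal.\<close>

definition alive :: "real => nat => nat => 's => real" where
 "alive e m j om = (if \<forall>i\<le>j. \<bar>S m i om\<bar> < e then 1 else 0)"

definition stopped :: "real => nat => nat => 's => real" where
 "stopped e m j om = (\<Sum>i<j. alive e m i om * D (m + i) om)"

lemma alive_measurable: "alive e m j \<in> borel_measurable (F (m + j))"
proof -
 have [measurable]: "S m i \<in> borel_measurable (F (m + j))" if "i <= j" for i
  by (rule measurable_later[OF _ S_measurable]) (use that in simp)
 have "{om \<in> space (F (m + j)). \<forall>i\<in>{..j}. \<bar>S m i om\<bar> < e} \<in> sets (F (m + j))"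
  by (intro sets.sets_Collect_finite_All) auto
 thus ?thesis unfolding alive_def[abs_def] by (intro measurable_If) (auto simp: Ball_def)
qed

lemma stopped_measurable: "stopped e m j \<in> borel_measurable (F (m + j))"
proof -
 have "D (m + i) \<in> borel_measurable (F (m + j))" "alive e m i \<in> borel_measurable (F (m + j))" if "i < j" for i
  by (rule measurable_later[OF _ adapted], use that in simp)
   (rule measurable_later[OF _ alive_measurable], use that in simp)
 thus ?thesis unfolding stopped_def[abs_def] by (intro borel_measurable_sum borel_measurable_times) auto
qed

lemma stopped_square:
 "integrable M (%om. (stopped e m j om)^2) \<and>
  (\<integral>om. (stopped e m j om)^2 \<partial>M) <= (\<Sum>i<j. \<integral>om. (D (m + i) om)^2 \<partial>M)"
proof (induction j)
 case 0
 thus ?case by (simp add: stopped_def)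
next
 case (Suc j)
 have aM[measurable]: "alive e m j \<in> borel_measurable M" by (rule measurable_from_subalg[OF sub alive_measurable])
 have sM[measurable]: "stopped e m j \<in> borel_measurable M" by (rule measurable_from_subalg[OF sub stopped_measurable])
 have a01: "alive e m j om = 0 \<or> alive e m j om = 1" for om by (simp add: alive_def)
 define Y where "Y om = stopped e m j om * alive e m j om" for om
 have Ym: "Y \<in> borel_measurable (F (m + j))"
  unfolding Y_def[abs_def] by (intro borel_measurable_times stopped_measurable alive_measurable)
 have YM[measurable]: "Y \<in> borel_measurable M" by (rule measurable_from_subalg[OF sub Ym])
 have "(Y om)^2 <= (stopped e m j om)^2" for om using a01[of om] by (auto simp: Y_def)
 hence Yi: "integrable M (%om. (Y om)^2)"
  by (intro Bochner_Integration.integrable_bound[OF conjunct1[OF Suc]]) auto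
 note o = orthogonal[OF Ym Yi]
 have ad: "(alive e m j om * D (m + j) om)^2 <= (D (m + j) om)^2" for om using a01[of om] by auto
 have adi: "integrable M (%om. (alive e m j om * D (m + j) om)^2)"
  by (intro Bochner_Integration.integrable_bound[OF square[of "m + j"]]) (use ad in auto)
 have eq: "(stopped e m (Suc j) om)^2 = (stopped e m j om)^2 + 2 * (Y om * D (m + j) om) + (alive e m j om * D (m + j) om)^2" for om
  by (simp add: stopped_def Y_def power2_eq_square algebra_simps)
 have "(\<integral>om. (stopped e m (Suc j) om)^2 \<partial>M) = (\<integral>om. (stopped e m j om)^2 \<partial>M) + (\<integral>om. (alive e m j om * D (m + j) om)^2 \<partial>M)"
  unfolding eq using Suc o adi by simp
 also have "(\<integral>om. (alive e m j om * D (m + j) om)^2 \<partial>M) <= (\<integral>om. (D (m + j) om)^2 \<partial>M)"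
  by (rule integral_mono[OF adi square ad])
 finally have "(\<integral>om. (stopped e m (Suc j) om)^2 \<partial>M) <= (\<Sum>i<Suc j. \<integral>om. (D (m + i) om)^2 \<partial>M)"
  using Suc by simp
 moreover have "integrable M (%om. (stopped e m (Suc j) om)^2)"
  unfolding eq using Suc o adi by simp
 ultimately show ?case by simp
qed

text \<open>The stopped sum is frozen when the partial sums first leave \<open>(- e, e)\<close>.\<close>

lemma stopped_large:
 assumes "j <= n" "e <= \<bar>S m j om\<bar>"
 shows "e <= \<bar>stopped e m n om\<bar>"
proof -
 define \<tau> where "\<tau> = (LEAST j. e <= \<bar>S m j om\<bar>)"
 have t: "e <= \<bar>S m \<tau> om\<bar>" unfolding \<tau>_def by (rule LeastI[where P = "%j. e <= \<bar>S m j om\<bar>"]) fact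
 have tn: "\<tau> <= n" using Least_le[of "%j. e <= \<bar>S m j om\<bar>" j] assms by (simp add: \<tau>_def)
 have before: "alive e m i om = 1" if "i < \<tau>" for i
 proof -
  have "\<bar>S m k om\<bar> < e" if "k <= i" for k
   using not_less_Least[of k "%j. e <= \<bar>S m j om\<bar>"] that \<open>i < \<tau>\<close> by (simp add: \<tau>_def not_le)
  thus ?thesis by (simp add: alive_def)
 qed
 have after: "alive e m i om = 0" if "\<tau> <= i" for i
  unfolding alive_def using t that by (auto simp: not_less)
 have "stopped e m n om = (\<Sum>i<\<tau>. alive e m i om * D (m + i) om)"
  unfolding stopped_def by (rule sum.mono_neutral_right) (use tn after in auto)
 also have "... = S m \<tau> om" unfolding S_def by (rule sum.cong) (auto simp: before)
 finally show ?thesis using t by simp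
qed

text \<open>Kolmogorov's inequality: a large partial sum forces a large stopped sum, whose second moment is at most that of the
unstopped one.\<close>

lemma maximal_inequality:
 assumes e: "e > 0"
 shows "prob {om \<in> space M. \<exists>j\<le>n. e <= \<bar>S m j om\<bar>} <= (\<Sum>i<n. \<integral>om. (D (m + i) om)^2 \<partial>M) / e^2"
proof -
 have sM[measurable]: "stopped e m n \<in> borel_measurable M" by (rule measurable_from_subalg[OF sub stopped_measurable])
 have "{om \<in> space M. \<exists>j\<le>n. e <= \<bar>S m j om\<bar>} \<subseteq> {om \<in> space M. e^2 <= (stopped e m n om)^2}"
 proof safe
  fix om j assume "j <= n" "e <= \<bar>S m j om\<bar>"
  hence "e <= \<bar>stopped e m n om\<bar>" by (rule stopped_large)
  thus "e^2 <= (stopped e m n om)^2" using e power_mono[of e "\<bar>stopped e m n om\<bar>" 2] by simp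
 qed
 hence "prob {om \<in> space M. \<exists>j\<le>n. e <= \<bar>S m j om\<bar>} <= prob {om \<in> space M. e^2 <= (stopped e m n om)^2}"
  by (intro finite_measure_mono) measurable
 also have "... <= (\<integral>om. (stopped e m n om)^2 \<partial>M) / e^2"
  by (rule integral_Markov_inequality_measure[where A = "{}"]) (use stopped_square e in auto)
 also have "... <= (\<Sum>i<n. \<integral>om. (D (m + i) om)^2 \<partial>M) / e^2"
  using stopped_square[of e m n] by (intro divide_right_mono) auto
 finally show ?thesis .
qed

lemma escape_probability:
 assumes e: "e > 0" and sm: "summable (%n. \<integral>om. (D n om)^2 \<partial>M)"
 shows "prob {om \<in> space M. \<exists>j. e <= \<bar>S m j om\<bar>} <= (\<Sum>i. \<integral>om. (D (i + m) om)^2 \<partial>M) / e^2"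
proof -
 let ?E = "%n. {om \<in> space M. \<exists>j\<le>n. e <= \<bar>S m j om\<bar>}"
 have "(%n. prob (?E n)) \<longlonglongrightarrow> prob (\<Union>n. ?E n)"
 proof (rule finite_Lim_measure_incseq)
  show "incseq ?E"
   unfolding incseq_def
  proof (intro allI impI subsetI)
   fix k n om assume "k <= n" "om \<in> ?E k"
   thus "om \<in> ?E n" by (auto intro: order_trans)
  qed
  show "range ?E \<subseteq> sets M" by auto
 qed
 moreover have "(\<Union>n. ?E n) = {om \<in> space M. \<exists>j. e <= \<bar>S m j om\<bar>}" by auto
 moreover have "prob (?E n) <= (\<Sum>i. \<integral>om. (D (i + m) om)^2 \<partial>M) / e^2" for n
 proof (rule order_trans[OF maximal_inequality[OF e]])
  have "(\<Sum>i<n. \<integral>om. (D (i + m) om)^2 \<partial>M) <= (\<Sum>i. \<integral>om. (D (i + m) om)^2 \<partial>M)"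
   by (rule sum_le_suminf) (use sm summable_iff_shift[of "%n. \<integral>om. (D n om)^2 \<partial>M" m] in auto)
  thus "(\<Sum>i<n. \<integral>om. (D (m + i) om)^2 \<partial>M) / e^2 <= (\<Sum>i. \<integral>om. (D (i + m) om)^2 \<partial>M) / e^2"
   by (intro divide_right_mono) (auto simp: add.commute)
 qed
 ultimately show ?thesis by (intro LIMSEQ_le_const2) auto
qed

text \<open>By the maximal inequality the oscillation of the partial sums beyond \<open>m\<close> is small with probability close to 1, so that
they form a Cauchy sequence almost surely.\<close>

theorem sum_converges:
 assumes sm: "summable (%n. \<integral>om. (D n om)^2 \<partial>M)"
 shows "AE om in M. summable (%n. D n om)"
proof -
 have tail: "(%m. \<Sum>i. \<integral>om. (D (i + m) om)^2 \<partial>M) \<longlonglongrightarrow> 0"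
  by (rule suminf_exist_split2[OF sm])
 have settle: "AE om in M. \<exists>m. \<forall>j. \<bar>S m j om\<bar> < e" if e: "e > 0" for e
 proof -
  let ?B = "%m. {om \<in> space M. \<exists>j. e <= \<bar>S m j om\<bar>}"
  have Bm[measurable]: "?B m \<in> sets M" for m by measurable
  have "prob (\<Inter>m. ?B m) <= 0"
  proof (rule LIMSEQ_le_const)
   show "(%m. (\<Sum>i. \<integral>om. (D (i + m) om)^2 \<partial>M) / e^2) \<longlonglongrightarrow> 0"
    using tendsto_divide[OF tail tendsto_const[of "e^2"]] e by simp
   have "prob (\<Inter>m. ?B m) <= (\<Sum>i. \<integral>om. (D (i + m) om)^2 \<partial>M) / e^2" for m
    by (rule order_trans[OF finite_measure_mono escape_probability[OF e sm, of m]]) (use Bm in auto)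
   thus "\<exists>N. \<forall>m\<ge>N. prob (\<Inter>m. ?B m) <= (\<Sum>i. \<integral>om. (D (i + m) om)^2 \<partial>M) / e^2" by blast
  qed
  hence "prob (\<Inter>m. ?B m) = 0" by (simp add: measure_le_0_iff)
  hence "(\<Inter>m. ?B m) \<in> null_sets M" by (intro null_setsI) (auto simp: emeasure_eq_measure)
  thus ?thesis
   by (rule AE_I'[of "\<Inter>m. ?B m"]) (auto simp: not_less)
 qed
 have "AE om in M. \<forall>k. \<exists>m. \<forall>j. \<bar>S m j om\<bar> < inverse (real (Suc k))"
  unfolding AE_all_countable by (intro allI settle) simp
 thus ?thesis
 proof eventually_elim
  case (elim om)
  show "summable (%n. D n om)"
   unfolding summable_Cauchy
  proof (intro allI impI)
   fix e :: real assume "e > 0"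
   then obtain k where k: "inverse (real (Suc k)) < e / 2" using reals_Archimedean[of "e / 2"] by auto
   obtain m where m: "!!j. \<bar>S m j om\<bar> < inverse (real (Suc k))" using elim by blast
   have "norm (sum (%n. D n om) {a..<b}) < e" if a: "a >= m" for a b
   proof (cases "a <= b")
    case True
    have s: "S m (i - m) om = sum (%n. D n om) {m..<i}" if "i >= m" for i
     unfolding S_def using that
     by (intro sum.reindex_bij_witness[where i = "%n. n - m" and j = "%n. m + n"]) auto
    have "sum (%n. D n om) {m..<b} = sum (%n. D n om) {m..<a} + sum (%n. D n om) {a..<b}"
     using a True by (simp add: sum.atLeastLessThan_concat)
    hence "sum (%n. D n om) {a..<b} = S m (b - m) om - S m (a - m) om"
     using a True by (simp add: s)
    thus ?thesis using m[of "b - m"] m[of "a - m"] k by (simp add: abs_less_iff)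
   qed (use \<open>e > 0\<close> in simp)
   thus "\<exists>N. \<forall>m\<ge>N. \<forall>n. norm (sum (%n. D n om) {m..<n}) < e" by blast
  qed
 qed
qed

end

text \<open>Vitali's theorem for nonnegative variables with a constant limit: truncation at a level \<open>K\<close> that does not depend on \<open>n\<close>
reduces it to dominated convergence.\<close>

lemma (in prob_space) L1_limit_if_tails_vanish:
 fixes Z :: "nat => 'a => real"
 assumes int: "!!n. n >= n0 ==> integrable M (Z n)"
  and lim: "AE om in M. (%n. Z n om) \<longlonglongrightarrow> z"
  and pos: "!!n. n >= n0 ==> AE om in M. 0 <= Z n om"
  and tails: "!!e. e > 0 ==> \<exists>K. \<forall>n\<ge>n0. (\<integral>om. max (Z n om - K) 0 \<partial>M) <= e"
 shows "(%n. \<integral>om. \<bar>Z n om - z\<bar> \<partial>M) \<longlonglongrightarrow> 0"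
proof (rule LIMSEQ_I)
 fix e :: real assume e: "e > 0"
 obtain K0 where K0: "!!n. n >= n0 ==> (\<integral>om. max (Z n om - K0) 0 \<partial>M) <= e / 2"
  using tails[of "e / 2"] e by auto
 \<comment> \<open>a truncation level above z leaves the limit unchanged\<close>
 define K where "K = max K0 \<bar>z\<bar>"
 have mi: "integrable M (%om. max (Z n om - k) 0)" if "n >= n0" for n k
  using int[OF that] by (intro integrable_max) auto
 have K: "(\<integral>om. max (Z n om - K) 0 \<partial>M) <= e / 2" if "n >= n0" for n
  by (rule order_trans[OF integral_mono[OF mi mi] K0[OF that]]) (use that in \<open>auto simp: K_def\<close>)
 have "(%n. \<integral>om. \<bar>min (Z (n + n0) om) K - z\<bar> \<partial>M) \<longlonglongrightarrow> (\<integral>om. 0 \<partial>M)"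
 proof (rule integral_dominated_convergence[where w = "%_. K + \<bar>z\<bar>"])
  show "AE om in M. (%n. \<bar>min (Z (n + n0) om) K - z\<bar>) \<longlonglongrightarrow> 0"
   using lim
  proof eventually_elim
   case (elim om)
   have "(%n. \<bar>min (Z (n + n0) om) K - z\<bar>) \<longlonglongrightarrow> \<bar>min z K - z\<bar>"
    by (intro tendsto_intros LIMSEQ_ignore_initial_segment[OF elim])
   moreover have "min z K = z" by (auto simp: K_def)
   ultimately show ?case by simp
  qed
  fix n
  show "AE om in M. norm \<bar>min (Z (n + n0) om) K - z\<bar> <= K + \<bar>z\<bar>"
   using pos[of "n + n0", OF le_add2] by eventually_elim (auto simp: K_def)
  have [measurable]: "Z (n + n0) \<in> borel_measurable M" using int[of "n + n0"] by simp
  show "(%om. \<bar>min (Z (n + n0) om) K - z\<bar>) \<in> borel_measurable M" by measurable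
 qed auto
 hence "\<forall>\<^sub>F n in sequentially. (\<integral>om. \<bar>min (Z (n + n0) om) K - z\<bar> \<partial>M) < e / 2"
  using e by (intro order_tendstoD(2)) auto
 then obtain n1 where n1: "!!n. n >= n1 ==> (\<integral>om. \<bar>min (Z (n + n0) om) K - z\<bar> \<partial>M) < e / 2"
  unfolding eventually_sequentially by blast
 show "\<exists>n2. \<forall>n\<ge>n2. norm ((\<integral>om. \<bar>Z n om - z\<bar> \<partial>M) - 0) < e"
 proof (intro exI allI impI)
  fix n assume "n >= n0 + n1"
  hence n: "n >= n0" and s: "(\<integral>om. \<bar>min (Z n om) K - z\<bar> \<partial>M) < e / 2" using n1[of "n - n0"] by auto
  have ii: "integrable M (%om. \<bar>min (Z n om) K - z\<bar>)" using int[OF n] by (intro integrable_abs Bochner_Integration.integrable_diff integrable_min) auto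
  have "(\<integral>om. \<bar>Z n om - z\<bar> \<partial>M) <= (\<integral>om. \<bar>min (Z n om) K - z\<bar> + max (Z n om - K) 0 \<partial>M)"
   using int[OF n] ii mi[OF n] by (intro integral_mono) (auto simp: min_def max_def)
  also have "... = (\<integral>om. \<bar>min (Z n om) K - z\<bar> \<partial>M) + (\<integral>om. max (Z n om - K) 0 \<partial>M)"
   using ii mi[OF n] by simp
  also have "... < e" using s K[OF n] by simp
  finally show "norm ((\<integral>om. \<bar>Z n om - z\<bar> \<partial>M) - 0) < e" by simp
 qed
qed

lemma excess_le_power:
 fixes x :: real
 assumes "0 <= x" "K > 0" "p > 1"
 shows "max (x - K) 0 <= x powr p / K powr (p - 1)"
proof (cases "x <= K")
 case False
 hence x: "x > 0" using assms by simp
 have "x * K powr (p - 1) <= x * x powr (p - 1)"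
  using False assms by (intro mult_left_mono powr_mono2) auto
 also have "... = x powr p" using x powr_add[of x 1 "p - 1"] by simp
 finally have "x <= x powr p / K powr (p - 1)" using assms by (simp add: field_simps)
 thus ?thesis using assms False by simp
qed (use assms in simp)

lemma (in prob_space) tails_vanish_if_moment_bounded:
 fixes Z :: "'i => 'a => real"
 assumes p: "p > 1" and e: "e > 0" and pos: "!!n om. n \<in> I ==> 0 <= Z n om"
  and int: "!!n. n \<in> I ==> integrable M (Z n)"
  and pint: "!!n. n \<in> I ==> integrable M (%om. Z n om powr p)" "!!n. n \<in> I ==> (\<integral>om. Z n om powr p \<partial>M) <= C"
 obtains K where "K > 0" "!!n. n \<in> I ==> (\<integral>om. max (Z n om - K) 0 \<partial>M) <= e"
proof -
 define C' where "C' = max C 1"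
 define K where "K = (C' / e) powr (1 / (p - 1))"
 have C': "C' > 0" by (simp add: C'_def)
 have K: "K > 0" using e C' by (simp add: K_def)
 have Kp: "K powr (p - 1) = C' / e" using p e C' by (simp add: K_def powr_powr)
 show ?thesis
 proof (rule that[OF K])
  fix n assume n: "n \<in> I"
  have "(\<integral>om. max (Z n om - K) 0 \<partial>M) <= (\<integral>om. Z n om powr p / K powr (p - 1) \<partial>M)"
   using int[OF n] pint(1)[OF n] by (intro integral_mono integrable_max excess_le_power pos n K p) auto
  also have "... = (\<integral>om. Z n om powr p \<partial>M) / K powr (p - 1)" by simp
  also have "... <= C' / K powr (p - 1)" using pint(2)[OF n] by (intro divide_right_mono) (auto simp: C'_def)
  also have "... = e" unfolding Kp using C' e by simp
  finally show "(\<integral>om. max (Z n om - K) 0 \<partial>M) <= e" .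
 qed
qed

lemma powr_le_one_plus:
 fixes x :: real
 assumes "0 <= x" "p <= r" "0 <= p"
 shows "x powr p <= 1 + x powr r"
proof (cases "x <= 1")
 case True
 hence "x powr p <= 1" using assms by (intro powr_le1) auto
 thus ?thesis by (meson add_increasing2 powr_ge_zero)
next
 case False
 hence "x powr p <= x powr r" using assms by (intro powr_mono) auto
 thus ?thesis by simp
qed

lemma (in prob_space) moment_le_lower_power:
 fixes Y :: "'a => real"
 assumes "Y \<in> borel_measurable M" "(\<integral>\<^sup>+om. ennreal (\<bar>Y om\<bar> powr r) \<partial>M) <= ennreal b" "p <= r" "0 <= p" "0 <= b"
 shows "(\<integral>\<^sup>+om. ennreal (\<bar>Y om\<bar> powr p) \<partial>M) <= ennreal (1 + b)"
proof -
 have [measurable]: "Y \<in> borel_measurable M" by fact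
 have "(\<integral>\<^sup>+om. ennreal (\<bar>Y om\<bar> powr p) \<partial>M) <= (\<integral>\<^sup>+om. 1 + ennreal (\<bar>Y om\<bar> powr r) \<partial>M)"
 proof (rule nn_integral_mono)
  fix om
  have "ennreal (\<bar>Y om\<bar> powr p) <= ennreal (1 + \<bar>Y om\<bar> powr r)"
   using powr_le_one_plus[of "\<bar>Y om\<bar>" p r] assms by (intro ennreal_leI) auto
  thus "ennreal (\<bar>Y om\<bar> powr p) <= 1 + ennreal (\<bar>Y om\<bar> powr r)" by simp
 qed
 also have "... = 1 + (\<integral>\<^sup>+om. ennreal (\<bar>Y om\<bar> powr r) \<partial>M)"
  by (subst nn_integral_add) (auto simp: emeasure_space_1)
 also have "... <= 1 + ennreal b" using assms(2) by (rule add_left_mono)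
 also have "... = ennreal (1 + b)" using assms(5) by simp
 finally show ?thesis .
qed

section \<open>Half cubes\<close>

definition plus_set :: "real^'n::finite => 'n set" where "plus_set d = {i. d $ i = 1}"

lemma plus_set_bij: "bij_betw plus_set (cube :: (real^'n::finite) set) UNIV"
proof (rule bij_betw_byWitness[where f' = "%A. \<chi> i. if i \<in> A then 1 else -1"])
 show "\<forall>d\<in>cube. (\<chi> i. if i \<in> plus_set d then 1 else -1) = d"
  by (auto simp: cube_def plus_set_def vec_eq_iff) metis
qed (auto simp: cube_def plus_set_def)

lemma sum_coords_plus_set:
 assumes "(d :: real^'n::finite) \<in> cube"
 shows "(\<Sum>i\<in>UNIV. d $ i) = 2 * real (card (plus_set d)) - real CARD('n)"
proof -
 have "d $ i = 2 * indicator (plus_set d) i - 1" for i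
  using assms by (auto simp: cube_def plus_set_def indicator_def)
 hence "(\<Sum>i\<in>UNIV. d $ i) = (\<Sum>i\<in>UNIV. 2 * indicator (plus_set d) i - 1)" by simp
 also have "... = 2 * real (card (plus_set d)) - real CARD('n)"
  by (simp add: sum_subtractf sum_distrib_left[symmetric] indicator_def of_bool_def sum.If_cases Collect_mem_eq)
 finally show ?thesis .
qed

lemma card_cube_sets:
 fixes Q :: "'n::finite set => bool"
 shows "card {d \<in> (cube :: (real^'n) set). Q (plus_set d)} = card {A. Q A}"
proof (rule bij_betw_same_card[of plus_set])
 have "plus_set ` {d \<in> (cube :: (real^'n) set). Q (plus_set d)} = {A. Q A}"
 proof (intro equalityI subsetI)
  fix A :: "'n set" assume A: "A \<in> {A. Q A}"
  have "A \<in> plus_set ` (cube :: (real^'n) set)"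
   using plus_set_bij[where 'n = 'n] unfolding bij_betw_def by simp
  thus "A \<in> plus_set ` {d \<in> (cube :: (real^'n) set). Q (plus_set d)}" using A by auto
 qed auto
 thus "bij_betw plus_set {d \<in> (cube :: (real^'n) set). Q (plus_set d)} {A. Q A}"
  using plus_set_bij[where 'n = 'n] unfolding bij_betw_def by (auto intro: inj_on_subset)
qed

lemma card_subsets_containing:
 fixes i :: "'n::finite"
 assumes "m > 0"
 shows "card {A. i \<in> A \<and> card A = m} = (CARD('n) - 1) choose (m - 1)"
proof -
 have "bij_betw (%B. insert i B) {B. B \<subseteq> UNIV - {i} \<and> card B = m - 1} {A. i \<in> A \<and> card A = m}"
 proof (rule bij_betw_byWitness[where f' = "%A. A - {i}"])
  show "insert i ` {B. B \<subseteq> UNIV - {i} \<and> card B = m - 1} \<subseteq> {A. i \<in> A \<and> card A = m}"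
  proof
   fix A assume "A \<in> insert i ` {B. B \<subseteq> UNIV - {i} \<and> card B = m - 1}"
   then obtain B where B: "A = insert i B" "i \<notin> B" "card B = m - 1" by auto
   thus "A \<in> {A. i \<in> A \<and> card A = m}" using assms by simp
  qed
 qed auto
 from bij_betw_same_card[OF this] show ?thesis by (simp add: n_subsets)
qed

definition half_cube :: "real^'n::finite => (real^'n) set" where
 "half_cube w = {d \<in> cube. d \<bullet> w >= 0}"

definition ones :: "real^'n::finite" where "ones = (\<chi> i. 1)"

lemma inner_ones: "d \<bullet> ones = (\<Sum>i\<in>UNIV. d $ i)"
 by (simp add: ones_def inner_vec_def)

text \<open>Sign vectors correspond to subsets of the indices and the coordinate sum to the cardinality.  Complementation
exchanges the sets of more and less than half of the elements; for even dimension the middle layer is its own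
complement and is counted entirely.\<close>

lemma card_half_cube_ones:
 "real (card (half_cube (ones :: real^'n::finite))) =
  2 ^ (CARD('n) - 1) + (if even CARD('n) then real (CARD('n) choose (CARD('n) div 2)) / 2 else 0)"
proof -
 let ?n = "CARD('n)"
 let ?P = "{d \<in> (cube :: (real^'n) set). d \<bullet> ones > 0}" and ?N = "{d \<in> (cube :: (real^'n) set). d \<bullet> ones < 0}"
  and ?Z = "{d \<in> (cube :: (real^'n) set). d \<bullet> ones = 0}"
 have fin: "finite ?P" "finite ?N" "finite ?Z" using finite_cube[where 'n = 'n] by auto
 have "bij_betw uminus ?P ?N"
 proof (rule bij_betw_byWitness[where f' = uminus])
  have "- d \<in> cube" if "d \<in> cube" for d :: "real^'n"
  proof -
   have "(- d) $ i \<in> {-1, 1}" for i using that by (auto simp: cube_def dest!: spec[of _ i])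
   thus ?thesis by (simp add: cube_def)
  qed
  thus "uminus ` ?P \<subseteq> ?N" "uminus ` ?N \<subseteq> ?P" by auto
 qed auto
 hence PN: "card ?P = card ?N" by (rule bij_betw_same_card)
 have "(cube :: (real^'n) set) = ?P \<union> ?N \<union> ?Z" by auto
 hence "card (cube :: (real^'n) set) = card (?P \<union> ?N \<union> ?Z)" by simp
 also have "... = card ?P + card ?N + card ?Z"
  using fin by (subst card_Un_disjoint; auto)+
 finally have tot: "2 * card ?P + card ?Z = 2 ^ ?n" using PN by (simp add: card_cube)
 have "half_cube (ones :: real^'n) = ?P \<union> ?Z" by (auto simp: half_cube_def)
 hence "card (half_cube (ones :: real^'n)) = card ?P + card ?Z"
  using fin by (simp add: card_Un_disjoint disjoint_iff)
 moreover have Z: "card ?Z = (if even ?n then ?n choose (?n div 2) else 0)"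
 proof -
  have "?Z = {d \<in> cube. 2 * card (plus_set d) = ?n}"
   by (auto simp: inner_ones sum_coords_plus_set)
  hence "card ?Z = card {A :: 'n set. 2 * card A = ?n}"
   using card_cube_sets[of "%A :: 'n set. 2 * card A = ?n"] by simp
  also have "... = (if even ?n then ?n choose (?n div 2) else 0)"
  proof (cases "even ?n")
   case True
   hence "{A :: 'n set. 2 * card A = ?n} = {A. A \<subseteq> UNIV \<and> card A = ?n div 2}" by auto
   thus ?thesis using True using n_subsets[OF finite, of "UNIV :: 'n set" "?n div 2"] by simp
  next
   case False
   hence "{A :: 'n set. 2 * card A = ?n} = {}" by auto presburger
   thus ?thesis using False by simp
  qed
  finally show ?thesis .
 qed
 moreover have "(2::nat) ^ ?n = 2 * 2 ^ (?n - 1)" by (metis power_Suc Suc_diff_1 zero_less_card_finite)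
 ultimately have h: "card (half_cube (ones :: real^'n)) = card ?P + card ?Z"
  and Zc: "card ?Z = (if even ?n then ?n choose (?n div 2) else 0)" and pw: "(2::nat) ^ ?n = 2 * 2 ^ (?n - 1)" by blast+
 have "2 * real (card ?P) + real (card ?Z) = 2 * 2 ^ (?n - 1)"
  using arg_cong[OF tot[unfolded pw], of real] by simp
 hence "real (card (half_cube (ones :: real^'n))) = 2 ^ (?n - 1) + real (card ?Z) / 2"
  using arg_cong[OF h, of real] by simp
 thus ?thesis unfolding Zc by simp
qed

text \<open>Flipping the \<open>i\<close>-th sign from negative to positive pairs the vectors in which the coordinate is \<open>-1\<close> with those in which it is
\<open>1\<close> and the coordinate sum is at least 2.  What is left are the vectors with coordinate \<open>1\<close> and sum 0 or 1, which one binomial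
coefficient counts.\<close>

lemma half_cube_ones_coord_sum:
 "(\<Sum>d\<in>half_cube (ones :: real^'n::finite). d $ i) =
  real ((CARD('n) - 1) choose (if even CARD('n) then CARD('n) div 2 else (CARD('n) - 1) div 2))"
proof -
 let ?n = "CARD('n)"
 let ?s = "%d :: real^'n. d \<bullet> ones"
 let ?P = "{d \<in> cube. ?s d >= 0 \<and> d $ i = 1}" and ?M = "{d \<in> cube. ?s d >= 0 \<and> d $ i = -1}"
  and ?P2 = "{d \<in> cube. ?s d >= 2 \<and> d $ i = 1}"
 have fin: "finite ?P" "finite ?M" "finite ?P2" using finite_cube[where 'n = 'n] by auto
 have "half_cube (ones :: real^'n) = ?P \<union> ?M" by (auto simp: half_cube_def cube_def)
 hence "(\<Sum>d\<in>half_cube (ones :: real^'n). d $ i) = (\<Sum>d\<in>?P. d $ i) + (\<Sum>d\<in>?M. d $ i)"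
  using fin by (simp only:) (rule sum.union_disjoint, auto)
 also have "... = real (card ?P) - real (card ?M)" by simp
 also have "card ?M = card ?P2"
 proof (rule bij_betw_same_card[of "flip i"])
  have s: "?s (flip i d) = ?s d - 2 * d $ i" for d
  proof -
   have "?s (flip i d) = (\<Sum>j\<in>UNIV. d $ j - (if j = i then 2 * d $ i else 0))"
    unfolding inner_ones by (intro sum.cong) (auto simp: flip_nth)
   thus ?thesis by (simp add: inner_ones sum_subtractf)
  qed
  show "bij_betw (flip i) ?M ?P2"
   by (rule bij_betw_byWitness[where f' = "flip i"]) (auto simp: s, auto simp: flip_nth cube_def vec_eq_iff)
 qed
 also have "real (card ?P) - real (card ?P2) = real (card (?P - ?P2))"
 proof -
  have sub: "?P2 \<subseteq> ?P" by auto
  show ?thesis using card_Diff_subset[OF fin(3) sub] card_mono[OF fin(1) sub] by (simp add: of_nat_diff)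
 qed
 also have "?P - ?P2 = {d \<in> cube. i \<in> plus_set d \<and> card (plus_set d) = (if even ?n then ?n div 2 else (?n + 1) div 2)}"
 proof -
  have iff: "(0 <= ?s d \<and> \<not> 2 <= ?s d) \<longleftrightarrow> card (plus_set d) = (if even ?n then ?n div 2 else (?n + 1) div 2)"
   if "d \<in> cube" for d
  proof -
   have "(0 <= ?s d \<and> \<not> 2 <= ?s d) \<longleftrightarrow> (?n <= 2 * card (plus_set d) \<and> 2 * card (plus_set d) < ?n + 2)"
    unfolding inner_ones sum_coords_plus_set[OF that] by linarith
   also have "... \<longleftrightarrow> card (plus_set d) = (if even ?n then ?n div 2 else (?n + 1) div 2)"
    by (auto elim!: evenE oddE)
   finally show ?thesis .
  qed
  have mem: "i \<in> plus_set d \<longleftrightarrow> d $ i = 1" for d by (simp add: plus_set_def)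
  show ?thesis using iff mem by blast
 qed
 also have "card ... = card {A. i \<in> A \<and> card A = (if even ?n then ?n div 2 else (?n + 1) div 2)}"
  using card_cube_sets[of "%A. i \<in> A \<and> card A = (if even ?n then ?n div 2 else (?n + 1) div 2)"] by simp
 also have "... = (?n - 1) choose ((if even ?n then ?n div 2 else (?n + 1) div 2) - 1)"
 proof (rule card_subsets_containing)
  have "?n > 0" by simp
  thus "(if even ?n then ?n div 2 else (?n + 1) div 2) > 0" by presburger
 qed
 also have "... = (?n - 1) choose (if even ?n then ?n div 2 else (?n - 1) div 2)"
 proof (cases "even ?n")
  case True
  then obtain m where m: "?n = 2 * m" by (elim evenE)
  hence "m > 0" using zero_less_card_finite[where 'a = 'n] by (cases m) auto
  hence "(2 * m - 1) choose (m - 1) = (2 * m - 1) choose m"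
   using binomial_symmetric[of m "2 * m - 1"] by (simp add: mult_2)
  thus ?thesis using m by simp
 next
  case False
  thus ?thesis by (auto elim!: oddE)
 qed
 finally show ?thesis .
qed

lemma spsa_rho_nonneg: "0 <= spsa_rho n"
 by (simp add: spsa_rho_def)

lemma half_cube_ones_mean:
 "(\<Sum>d\<in>half_cube (ones :: real^'n::finite). d $ i) = spsa_rho CARD('n) * real (card (half_cube (ones :: real^'n)))"
proof -
 have "0 < real (card (half_cube (ones :: real^'n)))"
  unfolding card_half_cube_ones by (simp add: add_pos_nonneg)
 moreover have "spsa_rho CARD('n) = real ((CARD('n) - 1) choose (if even CARD('n) then CARD('n) div 2 else (CARD('n) - 1) div 2))
   / real (card (half_cube (ones :: real^'n)))"
  unfolding spsa_rho_def card_half_cube_ones by simp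
 ultimately show ?thesis unfolding half_cube_ones_coord_sum by simp
qed

text \<open>Multiplication by the coordinates of \<open>w\<close> maps the half cube of the all-ones vector to that of \<open>w\<close>.  Together with the two
counts above this is where the number \<open>spsa_rho\<close> comes from.\<close>

lemma half_cube_mean:
 fixes w :: "real^'n::finite"
 assumes w: "w \<in> cube"
 shows "(\<Sum>d\<in>half_cube w. d $ i) = spsa_rho CARD('n) * w $ i * real (card (half_cube w))" "card (half_cube w) > 0"
proof -
 define m where "m d = (\<chi> j. d $ j * w $ j)" for d :: "real^'n"
 have ww: "w $ j * w $ j = 1" for j using w by (rule cube_sq)
 have mm: "m (m d) = d" for d by (simp add: m_def vec_eq_iff mult.assoc ww)
 have mc: "m d \<in> cube" if "d \<in> cube" for d 
 proof -
  have "m d $ j \<in> {-1, 1}" for j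
   using that w unfolding cube_def m_def by (auto dest!: spec[of _ j])
  thus ?thesis by (simp add: cube_def)
 qed
 have mi: "m d \<bullet> w = d \<bullet> ones" "m d \<bullet> ones = d \<bullet> w" for d
  by (simp_all add: m_def inner_vec_def ones_def mult.assoc ww)
 have bij: "bij_betw m (half_cube ones) (half_cube w)"
  by (rule bij_betw_byWitness[where f' = m]) (auto simp: mm half_cube_def mi mc)
 hence card: "card (half_cube w) = card (half_cube (ones :: real^'n))"
  using bij_betw_same_card by metis
 have "(\<Sum>d\<in>half_cube w. d $ i) = (\<Sum>d\<in>half_cube ones. m d $ i)"
  using sum.reindex_bij_betw[OF bij, of "%d. d $ i"] by simp
 also have "... = (\<Sum>d\<in>half_cube ones. d $ i) * w $ i" by (simp add: m_def sum_distrib_right)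
 finally show "(\<Sum>d\<in>half_cube w. d $ i) = spsa_rho CARD('n) * w $ i * real (card (half_cube w))"
  unfolding half_cube_ones_mean card by simp
 have "0 < real (card (half_cube (ones :: real^'n)))"
  unfolding card_half_cube_ones by (simp add: add_pos_nonneg)
 thus "card (half_cube w) > 0" unfolding card by simp
qed

lemma half_cube_scale:
 assumes "s \<noteq> 0" shows "{d \<in> cube. 0 <= d \<bullet> (s *\<^sub>R w)} = half_cube (sgn s *\<^sub>R w)"
 unfolding half_cube_def using assms by (auto simp: sgn_if zero_le_mult_iff)

text \<open>Since the estimate is a multiple of a sign vector, its maximum norm is the modulus of the multiple.\<close>

lemma infnorm_cube:
 fixes w :: "real^'n::finite"
 assumes "w \<in> cube" shows "infnorm w = 1"
proof -
 have "\<bar>w $ i\<bar> = 1" for i using assms by (auto simp: cube_def dest!: spec[of _ i])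
 hence "{\<bar>w $ i\<bar> | i. i \<in> UNIV} = {1}" by auto
 thus ?thesis by (simp add: infnorm_cart)
qed

section \<open>The algorithm: conditioning and moments\<close>

lemma subalgebra_vimage_algebra:
 assumes "g \<in> measurable M N" shows "subalgebra M (vimage_algebra (space M) g N)"
 unfolding subalgebra_def using sets_image_in_sets[OF refl assms] by simp

lemma finite_sum_powr_le:
 fixes x :: "'i => real"
 assumes I: "finite I" "I \<noteq> {}" and x: "!!i. i \<in> I ==> 0 <= x i" and p: "p > 0"
 shows "(\<Sum>i\<in>I. x i) powr p <= real (card I) powr p * (\<Sum>i\<in>I. x i powr p)"
proof -
 define m where "m = Max (x ` I)"
 have "m \<in> x ` I" unfolding m_def using I by (intro Max_in) auto
 then obtain j where j: "j \<in> I" "m = x j" by auto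
 have le: "x i <= m" if "i \<in> I" for i unfolding m_def using I that by (intro Max_ge) auto
 have m0: "0 <= m" using j x by simp
 have "(\<Sum>i\<in>I. x i) <= real (card I) * m" using sum_bounded_above[of I x m] le by simp
 hence "(\<Sum>i\<in>I. x i) powr p <= (real (card I) * m) powr p"
  using x p by (intro powr_mono2 sum_nonneg) auto
 also have "... = real (card I) powr p * x j powr p" using m0 j by (simp add: powr_mult)
 also have "x j powr p <= (\<Sum>i\<in>I. x i powr p)" using I j by (intro member_le_sum) auto
 finally show ?thesis by (simp add: mult_left_mono)
qed

text \<open>The moment conditions are kept for one order \<open>p > 2\<close> and one bound \<open>L\<close>.\<close>

locale spsa_noise = spsa1a M f a c X \<xi> ep em \<xi>'
 for M :: "'s measure" and f :: "real^'n::finite => real" and a c X \<xi> ep em \<xi>' +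
 fixes p L :: real
 assumes f_cont: "continuous_on UNIV f"
  and noise: "!!k. AE om in M. real_cond_exp M (sigma_iter_dir M X \<xi> k) (%om. ep k om - em k om) om = 0"
  and p: "p > 2" and L: "L > 0"
  and moments: "!!k. (\<integral>\<^sup>+ om. ennreal (\<bar>ep k om\<bar> powr p) \<partial>M) <= ennreal L"
   "!!k. (\<integral>\<^sup>+ om. ennreal (\<bar>em k om\<bar> powr p) \<partial>M) <= ennreal L"
   "!!k. (\<integral>\<^sup>+ om. ennreal (\<bar>f (X k om + c k *\<^sub>R \<xi> k om)\<bar> powr p) \<partial>M) <= ennreal L"
begin

abbreviation "F \<equiv> sigma_iter M X"
abbreviation "G \<equiv> sigma_iter_dir M X \<xi>"
abbreviation "H \<equiv> sigma_past M X \<xi> ep em \<xi>'"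

declare rv [measurable]

lemma f_meas [measurable]: "f \<in> borel_measurable borel"
 by (rule borel_measurable_continuous_onI[OF f_cont])

lemma space_FGH [simp]: "space (F k) = space M" "space (G k) = space M" "space (H k) = space M"
 by (simp_all add: sigma_iter_def sigma_iter_dir_def sigma_past_def)

lemma sub_F: "subalgebra M (F k)"
 unfolding sigma_iter_def by (rule subalgebra_vimage_algebra) measurable

lemma sub_G: "subalgebra M (G k)"
 unfolding sigma_iter_dir_def by (rule subalgebra_vimage_algebra) measurable

lemma sub_H: "subalgebra M (H k)"
 unfolding sigma_past_def by (rule subalgebra_vimage_algebra) measurable

lemma X_meas_F: "j <= k ==> X j \<in> borel_measurable (F k)"
proof -
 assume j: "j <= k"
 have "(%om. \<lambda>j\<in>{..k}. X j om) \<in> measurable (F k) (\<Pi>\<^sub>M j\<in>{..k}. borel)"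
  unfolding sigma_iter_def by (rule measurable_vimage_algebra1) (auto simp: space_PiM)
 from measurable_compose[OF this measurable_component_singleton[of j "{..k}"]] j
 show ?thesis by simp
qed

lemma pair_meas_G: "(%om. (\<lambda>j\<in>{..k}. X j om, \<xi> k om)) \<in> measurable (G k) ((\<Pi>\<^sub>M j\<in>{..k}. borel) \<Otimes>\<^sub>M borel)"
 unfolding sigma_iter_dir_def by (rule measurable_vimage_algebra1) (auto simp: space_PiM space_pair_measure)

lemma X_meas_G: "j <= k ==> X j \<in> borel_measurable (G k)"
 using measurable_compose[OF measurable_compose[OF pair_meas_G measurable_fst] measurable_component_singleton[of j "{..k}"]] by simp

lemma \<xi>_meas_G: "\<xi> k \<in> borel_measurable (G k)"
 using measurable_compose[OF pair_meas_G measurable_snd] by simp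

lemma past_meas_H: "(%om. (\<lambda>j\<in>{..k}. X j om, \<lambda>j\<in>{..k}. \<xi> j om,
      \<lambda>j\<in>{..k}. ep j om, \<lambda>j\<in>{..k}. em j om, \<lambda>j\<in>{..<k}. \<xi>' j om))
  \<in> measurable (H k) ((\<Pi>\<^sub>M j\<in>{..k}. borel) \<Otimes>\<^sub>M (\<Pi>\<^sub>M j\<in>{..k}. borel) \<Otimes>\<^sub>M (\<Pi>\<^sub>M j\<in>{..k}. borel) \<Otimes>\<^sub>M
    (\<Pi>\<^sub>M j\<in>{..k}. borel) \<Otimes>\<^sub>M (\<Pi>\<^sub>M j\<in>{..<k}. borel))"
 unfolding sigma_past_def by (rule measurable_vimage_algebra1) (auto simp: space_PiM space_pair_measure)

lemma meas_H:
 assumes "j <= k"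
 shows "X j \<in> borel_measurable (H k)" "\<xi> j \<in> borel_measurable (H k)"
  "ep j \<in> borel_measurable (H k)" "em j \<in> borel_measurable (H k)"
proof -
 note s = measurable_compose[OF past_meas_H measurable_snd]
 note s2 = measurable_compose[OF s measurable_snd]
 note s3 = measurable_compose[OF s2 measurable_snd]
 note c = measurable_component_singleton[of j "{..k}"]
 show "X j \<in> borel_measurable (H k)"
  using measurable_compose[OF measurable_compose[OF past_meas_H measurable_fst] c] assms by simp
 show "\<xi> j \<in> borel_measurable (H k)"
  using measurable_compose[OF measurable_compose[OF s measurable_fst] c] assms by simp
 show "ep j \<in> borel_measurable (H k)"
  using measurable_compose[OF measurable_compose[OF s2 measurable_fst] c] assms by simp
 show "em j \<in> borel_measurable (H k)"
  using measurable_compose[OF measurable_compose[OF s3 measurable_fst] c] assms by simp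
qed

lemma F_mono: "sets (F k) \<subseteq> sets (F (Suc k))"
proof -
 have "(%om. \<lambda>j\<in>{..k}. X j om) \<in> measurable (F (Suc k)) (\<Pi>\<^sub>M j\<in>{..k}. borel)"
  by (rule measurable_restrict) (simp add: X_meas_F)
 from sets_image_in_sets[OF _ this] show ?thesis by (simp add: sigma_iter_def)
qed

lemma F_sub_G: "sets (F k) \<subseteq> sets (G k)"
proof -
 have "(%om. \<lambda>j\<in>{..k}. X j om) \<in> measurable (G k) (\<Pi>\<^sub>M j\<in>{..k}. borel)"
  by (rule measurable_restrict) (simp add: X_meas_G)
 from sets_image_in_sets[OF _ this] show ?thesis by (simp add: sigma_iter_def)
qed

lemma F_sub_H: "sets (F k) \<subseteq> sets (H k)"
proof -
 have "(%om. \<lambda>j\<in>{..k}. X j om) \<in> measurable (H k) (\<Pi>\<^sub>M j\<in>{..k}. borel)"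
  by (rule measurable_restrict) (simp add: meas_H)
 from sets_image_in_sets[OF _ this] show ?thesis by (simp add: sigma_iter_def)
qed

lemma F_meas_lift:
 assumes "Y \<in> borel_measurable (F k)"
 shows "Y \<in> borel_measurable M" "Y \<in> borel_measurable (G k)" "Y \<in> borel_measurable (H k)"
proof -
 show "Y \<in> borel_measurable M" by (rule measurable_from_subalg[OF sub_F assms])
 show "Y \<in> borel_measurable (G k)"
  by (rule measurable_from_subalg[OF _ assms]) (simp add: subalgebra_def F_sub_G)
 show "Y \<in> borel_measurable (H k)"
  by (rule measurable_from_subalg[OF _ assms]) (simp add: subalgebra_def F_sub_H)
qed

text \<open>Indicator of the event that the first direction at \<open>k\<close> is \<open>v\<close>.  As the directions range over a finite set, conditioning on
\<open>\<xi> k\<close> is carried out by summing over these indicators.\<close>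

definition dir :: "nat => real^'n => 's => real" where
 "dir k v om = indicator {om \<in> space M. \<xi> k om = v} om"

lemma dir_01: "dir k v om = 0 \<or> dir k v om = 1" "0 <= dir k v om" "\<bar>dir k v om\<bar> <= 1"
 by (auto simp: dir_def indicator_def)

lemma dir_meas [measurable]: "dir k v \<in> borel_measurable M"
 unfolding dir_def[abs_def] by measurable

lemma dir_meas_G: "dir k v \<in> borel_measurable (G k)"
proof -
 have [measurable]: "\<xi> k \<in> borel_measurable (G k)" by (rule \<xi>_meas_G)
 have "{om \<in> space (G k). \<xi> k om = v} \<in> sets (G k)" by measurable
 thus ?thesis unfolding dir_def[abs_def] by simp
qed

lemma \<xi>_in_cube: "AE om in M. \<xi> k om \<in> cube"
proof -
 have "prob (\<Union>v\<in>cube. {om \<in> space M. \<xi> k om = v}) = (\<Sum>v\<in>cube. prob {om \<in> space M. \<xi> k om = v})"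
  by (rule finite_measure_finite_Union) (auto simp: finite_cube disjoint_family_on_def)
 also have "... = 1" by (simp add: direction_uniform card_cube)
 finally have "prob (\<Union>v\<in>cube. {om \<in> space M. \<xi> k om = v}) = 1" .
 moreover have "(\<Union>v\<in>cube. {om \<in> space M. \<xi> k om = v}) \<in> sets M" using finite_cube by auto
 ultimately have "AE om in M. om \<in> (\<Union>v\<in>cube. {om \<in> space M. \<xi> k om = v})"
  using prob_eq_1 by blast
 thus ?thesis by eventually_elim auto
qed

lemma sum_dir:
 assumes "om \<in> space M" "\<xi> k om \<in> cube"
 shows "(\<Sum>v\<in>cube. g v * dir k v om) = g (\<xi> k om)"
 using assms finite_cube[where 'n = 'n] by (simp add: dir_def indicator_def if_distrib cong: if_cong)

lemma cond_dir:
 assumes v: "v \<in> cube"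
 shows "AE om in M. real_cond_exp M (F k) (dir k v) om = 1 / 2 ^ CARD('n)"
proof -
 interpret sigma_finite_subalgebra M "F k" by (rule finite_sigma_subalgebra[OF prob_space_axioms sub_F])
 show ?thesis
 proof (rule real_cond_exp_charact)
  fix A assume A: "A \<in> sets (F k)"
  let ?E = "{om \<in> space M. \<xi> k om = v}"
  have AM: "A \<in> sets M" using A sub_F[of k] unfolding subalgebra_def by blast
  have EM: "?E \<in> sets M" by measurable
  have "\<xi> k -` {v} \<inter> space M \<in> sets (vimage_algebra (space M) (\<xi> k) borel)"
   by (rule in_vimage_algebra) simp
  moreover have "\<xi> k -` {v} \<inter> space M = ?E" by auto
  ultimately have "prob (A \<inter> ?E) = prob A * prob ?E"
   using indep_setD[OF direction_indep A] by simp
  hence "prob (A \<inter> ?E) = prob A / 2 ^ CARD('n)" by (simp add: direction_uniform[OF v] card_cube)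
  moreover have "(\<integral>om\<in>A. dir k v om \<partial>M) = prob (A \<inter> ?E)"
  proof -
   have "(\<integral>om\<in>A. dir k v om \<partial>M) = (\<integral>om. indicator (A \<inter> ?E) om \<partial>M)"
    unfolding set_lebesgue_integral_def dir_def by (rule Bochner_Integration.integral_cong) (auto simp: indicator_def)
   also have "... = prob (A \<inter> ?E)" using AM EM by (simp add: Int_absorb2 sets.sets_into_space le_infI1)
   finally show ?thesis .
  qed
  moreover have "(\<integral>om\<in>A. 1 / 2 ^ CARD('n) \<partial>M) = prob A / 2 ^ CARD('n)"
   using AM unfolding set_lebesgue_integral_def by simp
  ultimately show "(\<integral>om\<in>A. dir k v om \<partial>M) = (\<integral>om\<in>A. 1 / 2 ^ CARD('n) \<partial>M)" by simp
 next
  show "integrable M (dir k v)" by (rule integrable_const_bound[where B = 1]) (use dir_01 in auto)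
 qed simp_all
qed

text \<open>Independence of the direction and the iterates: the indicator may be replaced by its mean.  Integrability of the whole
variable follows from that on the event since the event has positive probability.\<close>

lemma dir_independent:
 assumes v: "v \<in> cube" and Z: "Z \<in> borel_measurable (F k)" and int: "integrable M (%om. Z om * dir k v om)"
 shows "integrable M Z" "(\<integral>om. Z om * dir k v om \<partial>M) = (\<integral>om. Z om \<partial>M) / 2 ^ CARD('n)"
proof -
 interpret sigma_finite_subalgebra M "F k" by (rule finite_sigma_subalgebra[OF prob_space_axioms sub_F])
 have [measurable]: "Z \<in> borel_measurable M" by (rule F_meas_lift(1)[OF Z])
 note r = real_cond_exp_intg[OF int Z dir_meas]
 have ae: "AE om in M. Z om * real_cond_exp M (F k) (dir k v) om = Z om / 2 ^ CARD('n)"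
  using cond_dir[OF v, of k] by eventually_elim simp
 have m: "(%om. Z om * real_cond_exp M (F k) (dir k v) om) \<in> borel_measurable M"
  using r(1) by (rule borel_measurable_integrable)
 have "integrable M (%om. Z om / 2 ^ CARD('n))"
  using r(1) integrable_cong_AE[OF m _ ae] by simp
 from integrable_mult_right[OF this, of "2 ^ CARD('n)"]
 show "integrable M Z" by simp
 have "(\<integral>om. Z om * real_cond_exp M (F k) (dir k v) om \<partial>M) = (\<integral>om. Z om / 2 ^ CARD('n) \<partial>M)"
  by (rule integral_cong_AE[OF m _ ae]) measurable
 with r(2) show "(\<integral>om. Z om * dir k v om \<partial>M) = (\<integral>om. Z om \<partial>M) / 2 ^ CARD('n)" by simp
qed

lemma dir_integrable: "integrable M Z ==> integrable M (%om. Z om * dir k v om)"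
proof (rule Bochner_Integration.integrable_bound[of M Z])
 have "\<bar>Z om * dir k v om\<bar> <= \<bar>Z om\<bar> * 1" for om
  unfolding abs_mult by (intro mult_left_mono dir_01) auto
 thus "AE om in M. norm (Z om * dir k v om) <= norm (Z om)" by simp
qed auto

definition fv :: "nat => real^'n => 's => real" where "fv k v om = f (X k om + c k *\<^sub>R v)"

lemma fv_meas_F: "fv k v \<in> borel_measurable (F k)"
proof -
 have [measurable]: "X k \<in> borel_measurable (F k)" by (rule X_meas_F) simp
 show ?thesis unfolding fv_def[abs_def] by measurable
qed

lemma fv_meas [measurable]: "fv k v \<in> borel_measurable M"
 by (rule F_meas_lift(1)[OF fv_meas_F])

lemma integrable_from_nn:
 assumes [measurable]: "g \<in> borel_measurable M" and "(\<integral>\<^sup>+ om. ennreal (\<bar>g om\<bar> powr p) \<partial>M) <= ennreal L"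
 shows "integrable M (%om. \<bar>g om\<bar> powr p)" "(\<integral>om. \<bar>g om\<bar> powr p \<partial>M) <= L"
proof -
 show i: "integrable M (%om. \<bar>g om\<bar> powr p)"
  by (rule integrableI_nonneg) (use assms(2) in \<open>auto intro: le_less_trans\<close>)
 have "ennreal (\<integral>om. \<bar>g om\<bar> powr p \<partial>M) <= ennreal L"
  using nn_integral_eq_integral[OF i] assms(2) by simp
 thus "(\<integral>om. \<bar>g om\<bar> powr p \<partial>M) <= L" using L by simp
qed

text \<open>The hypothesis bounds the value of \<open>f\<close> at a random vertex.  Every vertex is chosen with probability \<open>2^(-n)\<close>
independently of \<open>X k\<close>, so that the values at all vertices have bounded moments.\<close>

lemma fv_moment:
 assumes v: "v \<in> cube"
 shows "integrable M (%om. \<bar>fv k v om\<bar> powr p)" "(\<integral>om. \<bar>fv k v om\<bar> powr p \<partial>M) <= 2 ^ CARD('n) * L"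
proof -
 note m = integrable_from_nn[OF _ moments(3)[of k]]
 have eq: "\<bar>fv k v om\<bar> powr p * dir k v om = \<bar>f (X k om + c k *\<^sub>R \<xi> k om)\<bar> powr p * dir k v om" for om
  by (auto simp: fv_def dir_def indicator_def)
 have m1: "integrable M (%om. \<bar>f (X k om + c k *\<^sub>R \<xi> k om)\<bar> powr p)" by (rule m(1)) measurable
 have m2: "(\<integral>om. \<bar>f (X k om + c k *\<^sub>R \<xi> k om)\<bar> powr p \<partial>M) <= L" by (rule m(2)) measurable
 have i: "integrable M (%om. \<bar>fv k v om\<bar> powr p * dir k v om)"
  unfolding eq by (rule dir_integrable[OF m1])
 have Zm: "(%om. \<bar>fv k v om\<bar> powr p) \<in> borel_measurable (F k)"
  using fv_meas_F[of k v] by measurable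
 note d = dir_independent[OF v Zm i]
 show "integrable M (%om. \<bar>fv k v om\<bar> powr p)" by (rule d(1))
 have "(\<integral>om. \<bar>fv k v om\<bar> powr p * dir k v om \<partial>M) <= (\<integral>om. \<bar>f (X k om + c k *\<^sub>R \<xi> k om)\<bar> powr p \<partial>M)"
 proof (rule integral_mono[OF i m1])
  fix om
  show "\<bar>fv k v om\<bar> powr p * dir k v om <= \<bar>f (X k om + c k *\<^sub>R \<xi> k om)\<bar> powr p"
   unfolding eq using dir_01(3)[of k v om] dir_01(2)[of k v om] by (intro mult_left_le) auto
 qed
 also note m2
 finally have "2 ^ CARD('n) * (\<integral>om. \<bar>fv k v om\<bar> powr p * dir k v om \<partial>M) <= 2 ^ CARD('n) * L"
  by (rule mult_left_mono) simp
 thus "(\<integral>om. \<bar>fv k v om\<bar> powr p \<partial>M) <= 2 ^ CARD('n) * L"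
  using d(2) by simp
qed

text \<open>A dominating variable for all that enters one step.\<close>

definition size :: "nat => 's => real" where
 "size k om = \<bar>ep k om\<bar> + \<bar>em k om\<bar> + (\<Sum>v\<in>cube. \<bar>fv k v om\<bar>)"

lemma size_meas [measurable]: "size k \<in> borel_measurable M"
 unfolding size_def[abs_def] by measurable

lemma size_nonneg: "0 <= size k om"
 unfolding size_def by (intro add_nonneg_nonneg sum_nonneg) auto

definition "size_bound = (2 + 2 ^ CARD('n)) powr p * (L + L + 2 ^ CARD('n) * (2 ^ CARD('n) * L))"

lemma size_moment: "integrable M (%om. size k om powr p)" "(\<integral>om. size k om powr p \<partial>M) <= size_bound"
proof -
 let ?I = "(UNIV :: bool set) <+> (cube :: (real^'n) set)"
 let ?g = "%om i. case i of Inl b => (if b then \<bar>ep k om\<bar> else \<bar>em k om\<bar>) | Inr v => \<bar>fv k v om\<bar>"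
 let ?S = "%om. \<bar>ep k om\<bar> powr p + \<bar>em k om\<bar> powr p + (\<Sum>v\<in>cube. \<bar>fv k v om\<bar> powr p)"
 have fin: "finite ?I" using finite_cube[where 'n = 'n] by simp
 have card: "real (card ?I) = 2 + 2 ^ CARD('n)" using finite_cube[where 'n = 'n] by (simp add: card_Plus card_cube)
 have b: "size k om powr p <= (2 + 2 ^ CARD('n)) powr p * ?S om" for om
 proof -
  have "(\<Sum>i\<in>?I. ?g om i) powr p <= real (card ?I) powr p * (\<Sum>i\<in>?I. ?g om i powr p)"
   by (rule finite_sum_powr_le[OF fin]) (use p in \<open>auto split: sum.splits\<close>)
  moreover have "(\<Sum>i\<in>?I. ?g om i) = size k om"
   using finite_cube[where 'n = 'n] by (simp add: sum.Plus size_def UNIV_bool)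
  moreover have "(\<Sum>i\<in>?I. ?g om i powr p) = ?S om"
   using finite_cube[where 'n = 'n] by (simp add: sum.Plus UNIV_bool)
  ultimately show ?thesis unfolding card by simp
 qed
 note e = integrable_from_nn[OF rv(3) moments(1)] integrable_from_nn[OF rv(4) moments(2)]
 have i: "integrable M (%om. (2 + 2 ^ CARD('n)) powr p * ?S om)"
  using e fv_moment(1) by simp
 show 1: "integrable M (%om. size k om powr p)"
  by (rule Bochner_Integration.integrable_bound[OF i]) (use b in \<open>auto intro!: AE_I2 order_trans[OF _ abs_ge_self]\<close>)
 have "(\<integral>om. size k om powr p \<partial>M) <= (\<integral>om. (2 + 2 ^ CARD('n)) powr p * ?S om \<partial>M)"
  by (rule integral_mono[OF 1 i b])
 also have "... = (2 + 2 ^ CARD('n)) powr p * ((\<integral>om. \<bar>ep k om\<bar> powr p \<partial>M) + (\<integral>om. \<bar>em k om\<bar> powr p \<partial>M)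
   + (\<Sum>v\<in>cube. \<integral>om. \<bar>fv k v om\<bar> powr p \<partial>M))"
  using e fv_moment(1) by simp
 also have "... <= (2 + 2 ^ CARD('n)) powr p * (L + L + (\<Sum>v\<in>(cube :: (real^'n) set). 2 ^ CARD('n) * L))"
  using e fv_moment(2) by (intro mult_left_mono add_mono sum_mono) auto
 also have "... = size_bound" by (simp add: size_bound_def card_cube)
 finally show "(\<integral>om. size k om powr p \<partial>M) <= size_bound" .
qed

end

context spsa_noise
begin

abbreviation "\<epsilon> k om \<equiv> ep k om - em k om"
abbreviation "ghat \<equiv> grad_estimate f c X \<xi> ep em"

definition df :: "nat => real^'n => 's => real" where "df k v om = f (X k om + c k *\<^sub>R v) - f (X k om - c k *\<^sub>R v)"

definition spread :: "nat => 's => real" where "spread k om = (\<Sum>v\<in>cube. \<bar>df k v om\<bar>)"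

definition slope :: "nat => 's => real" where
 "slope k om = (df k (\<xi> k om) om + \<epsilon> k om) / (2 * c k)"

definition mean_step :: "nat => 's => real^'n" where "mean_step k om = spsa_mean f (c k) (X k om)"

text \<open>Defined by the update itself, so that \<open>X (Suc k) = X k - a k (mean_step k + err k)\<close> holds for every sample point.\<close>

definition err :: "nat => 's => real^'n" where
 "err k om = (1 / a k) *\<^sub>R (X k om - X (Suc k) om) - mean_step k om"

lemma c_pos: "0 < c k" and a_pos: "0 < a k" using gains_pos by auto

lemma uminus_cube: "- v \<in> cube \<longleftrightarrow> (v :: real^'n) \<in> cube"
proof -
 have "- w \<in> cube" if "w \<in> cube" for w :: "real^'n"
 proof -
  have "(- w) $ i \<in> {-1, 1}" for i using that by (auto simp: cube_def dest!: spec[of _ i])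
  thus ?thesis by (simp add: cube_def)
 qed
 from this[of v] this[of "- v"] show ?thesis by auto
qed

lemma df_eq: "df k v om = fv k v om - fv k (- v) om"
 by (simp add: df_def fv_def)

lemma df_meas_F: "df k v \<in> borel_measurable (F k)"
 unfolding df_eq[abs_def] using fv_meas_F by measurable

lemma df_meas [measurable]: "df k v \<in> borel_measurable M"
 by (rule F_meas_lift(1)[OF df_meas_F])

lemma spread_le_size: "spread k om <= 2 * size k om"
proof -
 have bij: "bij_betw uminus (cube :: (real^'n) set) cube"
  by (rule bij_betw_byWitness[where f' = uminus]) (auto simp: uminus_cube)
 have "spread k om <= (\<Sum>v\<in>cube. \<bar>fv k v om\<bar> + \<bar>fv k (- v) om\<bar>)"
  unfolding spread_def df_eq by (intro sum_mono abs_triangle_ineq4)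
 also have "... = (\<Sum>v\<in>cube. \<bar>fv k v om\<bar>) + (\<Sum>v\<in>cube. \<bar>fv k (- v) om\<bar>)" by (rule sum.distrib)
 also have "(\<Sum>v\<in>cube. \<bar>fv k (- v) om\<bar>) = (\<Sum>v\<in>cube. \<bar>fv k v om\<bar>)"
  using sum.reindex_bij_betw[OF bij, of "%v. \<bar>fv k v om\<bar>"] .
 finally show ?thesis by (simp add: size_def)
qed

lemma spread_nonneg: "0 <= spread k om" unfolding spread_def by (intro sum_nonneg) auto

lemma spread_meas [measurable]: "spread k \<in> borel_measurable M"
 unfolding spread_def[abs_def] by measurable

lemma df_le_spread: "v \<in> cube ==> \<bar>df k v om\<bar> <= spread k om"
 unfolding spread_def by (rule member_le_sum) (auto simp: finite_cube)

lemma \<epsilon>_le_size: "\<bar>\<epsilon> k om\<bar> <= size k om"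
proof -
 have "0 <= (\<Sum>v\<in>cube. \<bar>fv k v om\<bar>)" by (intro sum_nonneg) auto
 thus ?thesis unfolding size_def by linarith
qed

lemma size_sq: "integrable M (%om. (size k om)^2)" "(\<integral>om. (size k om)^2 \<partial>M) <= 1 + size_bound"
proof -
 have le: "x^2 <= 1 + x powr p" if "0 <= x" for x :: real
 proof (cases "x <= 1")
  case True
  hence "x^2 <= 1" using that by (simp add: power_le_one)
  thus ?thesis by (simp add: add_increasing2)
 next
  case False
  hence "x^2 = x powr 2" by simp
  also have "... <= x powr p" using False p by (intro powr_mono) auto
  finally show ?thesis by simp
 qed
 have i: "integrable M (%om. 1 + size k om powr p)" using size_moment(1) by simp
 show 1: "integrable M (%om. (size k om)^2)"
  by (rule Bochner_Integration.integrable_bound[OF i]) (use le size_nonneg in \<open>auto intro!: AE_I2\<close>)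
 have "(\<integral>om. (size k om)^2 \<partial>M) <= (\<integral>om. 1 + size k om powr p \<partial>M)"
  by (rule integral_mono[OF 1 i]) (use le size_nonneg in auto)
 also have "... <= 1 + size_bound" using size_moment by (simp add: prob_space)
 finally show "(\<integral>om. (size k om)^2 \<partial>M) <= 1 + size_bound" .
qed

lemma size_integrable: "integrable M (size k)"
proof (rule Bochner_Integration.integrable_bound)
 show "integrable M (%om. 1 + (size k om)^2)" using size_sq(1) by simp
 have "x <= 1 + x^2" for x :: real using sum_squares_bound[of x 1] by simp (smt (verit) zero_le_power2)
 thus "AE om in M. norm (size k om) <= norm (1 + (size k om)^2)" using size_nonneg by simp
qed simp

lemma integrable_le_size:
 assumes "g \<in> borel_measurable M" "AE om in M. \<bar>g om\<bar> <= C * size k om + D"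
 shows "integrable M g"
proof (rule Bochner_Integration.integrable_bound)
 show "integrable M (%om. C * size k om + D)" using size_integrable by simp
 show "AE om in M. norm (g om) <= norm (C * size k om + D)" using assms(2) by eventually_elim simp
qed fact

lemma ghat_eq:
 assumes "\<xi> k om \<in> cube" shows "ghat k om = slope k om *\<^sub>R \<xi> k om"
proof -
 have "inverse (\<xi> k om $ i) = \<xi> k om $ i" for i using assms by (auto simp: cube_def dest!: spec[of _ i])
 hence "(\<chi> i. inverse (\<xi> k om $ i)) = \<xi> k om" by (simp add: vec_eq_iff)
 thus ?thesis
  by (simp add: grad_estimate_def slope_def df_def algebra_simps add_divide_distrib diff_divide_distrib)
qed

lemma slope_nonzero: "AE om in M. slope k om \<noteq> 0"
 using estimate_nonzero[of k] \<xi>_in_cube[of k]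
proof eventually_elim
 case (elim om)
 thus ?case using ghat_eq[of k om] by auto
qed

lemma slope_meas_H: "slope k \<in> borel_measurable (H k)"
proof -
 have [measurable]: "X k \<in> borel_measurable (H k)" "\<xi> k \<in> borel_measurable (H k)"
  "ep k \<in> borel_measurable (H k)" "em k \<in> borel_measurable (H k)" by (simp_all add: meas_H)
 show ?thesis unfolding slope_def[abs_def] df_def by measurable
qed

lemma slope_meas [measurable]: "slope k \<in> borel_measurable M"
 by (rule measurable_from_subalg[OF sub_H slope_meas_H])

text \<open>The sign vector of the estimate; the half space of the second direction depends on the estimate through it only.\<close>

definition sdir :: "nat => 's => real^'n" where "sdir k om = sgn (slope k om) *\<^sub>R \<xi> k om"

lemma sdir_cube:
 assumes "\<xi> k om \<in> cube" "slope k om \<noteq> 0" shows "sdir k om \<in> cube"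
 using assms by (cases "slope k om > 0") (auto simp: sdir_def sgn_if uminus_cube)

definition second_prob :: "nat => real^'n => 's => real" where
 "second_prob k d om = (if d \<in> half_cube (sdir k om) then 1 / real (card (half_cube (sdir k om))) else 0)"

lemma second_cond:
 "AE om in M. real_cond_exp M (H k) (indicator {om \<in> space M. \<xi>' k om = d}) om = second_prob k d om"
 using second_direction_uniform[of k d] \<xi>_in_cube[of k] slope_nonzero[of k]
proof eventually_elim
 case (elim om)
 have "{v \<in> cube. v \<bullet> ghat k om >= 0} = half_cube (sdir k om)"
  unfolding ghat_eq[OF elim(2)] sdir_def by (rule half_cube_scale[OF elim(3)])
 thus ?case using elim(1) by (simp add: second_prob_def Let_def)
qed

lemma second_prob_sum:
 assumes "\<xi> k om \<in> cube" "slope k om \<noteq> 0"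
 shows "(\<Sum>d\<in>cube. second_prob k d om) = 1"
  "(\<Sum>d\<in>cube. d $ i * second_prob k d om) = spsa_rho CARD('n) * sdir k om $ i"
proof -
 let ?A = "half_cube (sdir k om)"
 have A: "card ?A > 0" "(\<Sum>d\<in>?A. d $ i) = spsa_rho CARD('n) * sdir k om $ i * real (card ?A)"
  using half_cube_mean[OF sdir_cube[OF assms]] by auto
 have sub: "?A \<subseteq> cube" by (auto simp: half_cube_def)
 have "(\<Sum>d\<in>cube. g d * second_prob k d om) = (\<Sum>d\<in>?A. g d) / real (card ?A)" for g :: "real^'n => real"
 proof -
  have "(\<Sum>d\<in>cube. g d * second_prob k d om) = (\<Sum>d\<in>?A. g d * second_prob k d om)"
   by (rule sum.mono_neutral_right[OF finite_cube sub]) (auto simp: second_prob_def)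
  also have "... = (\<Sum>d\<in>?A. g d / real (card ?A))" by (rule sum.cong) (auto simp: second_prob_def)
  finally show ?thesis by (simp add: sum_divide_distrib)
 qed
 from this[of "%d. 1"] this[of "%d. d $ i"] A
 show "(\<Sum>d\<in>cube. second_prob k d om) = 1"
  "(\<Sum>d\<in>cube. d $ i * second_prob k d om) = spsa_rho CARD('n) * sdir k om $ i" by auto
qed

definition sec :: "nat => real^'n => 's => real" where
 "sec k d = indicator {om \<in> space M. \<xi>' k om = d}"

lemma sec_meas [measurable]: "sec k d \<in> borel_measurable M"
 unfolding sec_def by measurable

text \<open>The conditional law of the second direction, given all that was drawn before, in integrated form.\<close>

lemma second_integral:
 assumes Y: "Y \<in> borel_measurable (H k)" and b: "!!om. \<bar>Y om\<bar> <= 1"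
 shows "integrable M (%om. Y om * sec k d om)" "integrable M (%om. Y om * second_prob k d om)"
  "(\<integral>om. Y om * sec k d om \<partial>M) = (\<integral>om. Y om * second_prob k d om \<partial>M)"
proof -
 interpret sigma_finite_subalgebra M "H k" by (rule finite_sigma_subalgebra[OF prob_space_axioms sub_H])
 have [measurable]: "Y \<in> borel_measurable M" by (rule measurable_from_subalg[OF sub_H Y])
 show i: "integrable M (%om. Y om * sec k d om)"
 proof (rule integrable_const_bound[where B = 1])
  have "\<bar>Y om * sec k d om\<bar> <= 1 * 1" for om
   unfolding abs_mult by (intro mult_mono b) (auto simp: sec_def indicator_def)
  thus "AE om in M. norm (Y om * sec k d om) <= 1" by simp
 qed measurable
 note r = real_cond_exp_intg[OF i Y sec_meas]
 have ae: "AE om in M. Y om * real_cond_exp M (H k) (sec k d) om = Y om * second_prob k d om"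
  using second_cond[of k d] unfolding sec_def by eventually_elim simp
 have half_meas: "(%om. second_prob k d om) \<in> borel_measurable M"
 proof -
  have [measurable]: "sdir k \<in> borel_measurable M" unfolding sdir_def[abs_def] by measurable
  have "{om \<in> space M. e \<in> half_cube (sdir k om)} \<in> sets M" for e
  proof (cases "e \<in> cube")
   case True
   hence "{om \<in> space M. e \<in> half_cube (sdir k om)} = {om \<in> space M. 0 <= e \<bullet> sdir k om}"
    by (auto simp: half_cube_def)
   also have "... \<in> sets M" by measurable
   finally show ?thesis .
  qed (simp add: half_cube_def)
  note hm = this
  have ce: "real (card (half_cube (sdir k om))) = (\<Sum>e\<in>cube. if e \<in> half_cube (sdir k om) then 1 else 0)" for om
  proof -
   have "half_cube (sdir k om) = {e \<in> cube. e \<in> half_cube (sdir k om)}" by (auto simp: half_cube_def)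
   hence "real (card (half_cube (sdir k om))) = (\<Sum>e\<in>{e \<in> cube. e \<in> half_cube (sdir k om)}. 1)" by simp
   also have "... = (\<Sum>e\<in>cube. if e \<in> half_cube (sdir k om) then 1 else 0)"
    by (rule sum.inter_filter[OF finite_cube])
   finally show ?thesis .
  qed
  have ifm: "(%om. if e \<in> half_cube (sdir k om) then 1 else 0 :: real) \<in> borel_measurable M" for e
   by (rule measurable_If[OF _ _ hm]) simp_all
  hence "(%om. real (card (half_cube (sdir k om)))) \<in> borel_measurable M"
   unfolding ce by (intro borel_measurable_sum)
  thus ?thesis
   unfolding second_prob_def by (intro measurable_If[OF _ _ hm] borel_measurable_divide borel_measurable_const)
 qed
 have Ym: "(%om. Y om * second_prob k d om) \<in> borel_measurable M" using half_meas by measurable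
 note m = borel_measurable_integrable[OF r(1)]
 show "integrable M (%om. Y om * second_prob k d om)"
  using integrable_cong_AE[OF m Ym ae] r(1) by blast
 show "(\<integral>om. Y om * sec k d om \<partial>M) = (\<integral>om. Y om * second_prob k d om \<partial>M)"
  using integral_cong_AE[OF m Ym ae] r(2) by simp
qed

lemma second_in_cube: "AE om in M. \<xi>' k om \<in> cube"
proof -
 note s = second_integral[of "%_. 1" k]
 have "(\<Sum>d\<in>cube. prob {om \<in> space M. \<xi>' k om = d}) = (\<Sum>d\<in>cube. \<integral>om. second_prob k d om \<partial>M)"
 proof (rule sum.cong[OF refl])
  fix d
  have "(\<integral>om. sec k d om \<partial>M) = prob {om \<in> space M. \<xi>' k om = d}" unfolding sec_def by simp
  thus "prob {om \<in> space M. \<xi>' k om = d} = (\<integral>om. second_prob k d om \<partial>M)" using s(3)[of d] by simp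
 qed
 also have "... = (\<integral>om. (\<Sum>d\<in>cube. second_prob k d om) \<partial>M)"
  using s(2) by (intro Bochner_Integration.integral_sum[symmetric]) simp
 also have "... = (\<integral>om. 1 \<partial>M)"
 proof (rule integral_cong_AE)
  show "AE om in M. (\<Sum>d\<in>cube. second_prob k d om) = 1"
   using \<xi>_in_cube[of k] slope_nonzero[of k] by eventually_elim (rule second_prob_sum(1))
  have "(%om. second_prob k d om) \<in> borel_measurable M" for d
   using borel_measurable_integrable[OF s(2)[of d]] by simp
  thus "(%om. \<Sum>d\<in>cube. second_prob k d om) \<in> borel_measurable M" by measurable
 qed simp
 finally have one: "(\<Sum>d\<in>cube. prob {om \<in> space M. \<xi>' k om = d}) = 1" by (simp add: prob_space)
 have "prob (\<Union>v\<in>cube. {om \<in> space M. \<xi>' k om = v}) = (\<Sum>v\<in>cube. prob {om \<in> space M. \<xi>' k om = v})"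
  by (rule finite_measure_finite_Union) (auto simp: finite_cube disjoint_family_on_def)
 hence "prob (\<Union>v\<in>cube. {om \<in> space M. \<xi>' k om = v}) = 1" using one by simp
 moreover have "(\<Union>v\<in>cube. {om \<in> space M. \<xi>' k om = v}) \<in> sets M" using finite_cube by auto
 ultimately have "AE om in M. om \<in> (\<Union>v\<in>cube. {om \<in> space M. \<xi>' k om = v})"
  using prob_eq_1 by blast
 thus ?thesis by eventually_elim auto
qed

lemma second_mean:
 assumes Y: "Y \<in> borel_measurable (H k)" and b: "!!om. \<bar>Y om\<bar> <= 1"
 shows "(\<integral>om. Y om * \<xi>' k om $ i \<partial>M) = (\<integral>om. Y om * (spsa_rho CARD('n) * sdir k om $ i) \<partial>M)"
proof -
 have [measurable]: "Y \<in> borel_measurable M" by (rule measurable_from_subalg[OF sub_H Y])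
 have [measurable]: "sdir k \<in> borel_measurable M" unfolding sdir_def[abs_def] by measurable
 note s = second_integral[OF Y b]
 have "(\<integral>om. Y om * \<xi>' k om $ i \<partial>M) = (\<integral>om. (\<Sum>d\<in>cube. d $ i * (Y om * sec k d om)) \<partial>M)"
 proof (rule integral_cong_AE)
  show "AE om in M. Y om * \<xi>' k om $ i = (\<Sum>d\<in>cube. d $ i * (Y om * sec k d om))"
   using second_in_cube[of k] AE_space
  proof eventually_elim
   case (elim om)
   have "(\<Sum>d\<in>cube. d $ i * (Y om * sec k d om)) = (\<Sum>d\<in>cube. if d = \<xi>' k om then d $ i * Y om else 0)"
    using elim(2) by (intro sum.cong) (auto simp: sec_def)
   thus ?case using elim finite_cube[where 'n = 'n] by simp
  qed
 qed measurable
 also have "... = (\<Sum>d\<in>cube. d $ i * (\<integral>om. Y om * sec k d om \<partial>M))" using s(1) by simp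
 also have "... = (\<Sum>d\<in>cube. d $ i * (\<integral>om. Y om * second_prob k d om \<partial>M))" by (simp only: s(3))
 also have "... = (\<integral>om. (\<Sum>d\<in>cube. d $ i * (Y om * second_prob k d om)) \<partial>M)" using s(2) by simp
 also have "... = (\<integral>om. Y om * (spsa_rho CARD('n) * sdir k om $ i) \<partial>M)"
 proof (rule integral_cong_AE)
  show "AE om in M. (\<Sum>d\<in>cube. d $ i * (Y om * second_prob k d om)) = Y om * (spsa_rho CARD('n) * sdir k om $ i)"
   using \<xi>_in_cube[of k] slope_nonzero[of k]
  proof eventually_elim
   case (elim om)
   have "(\<Sum>d\<in>cube. d $ i * (Y om * second_prob k d om)) = Y om * (\<Sum>d\<in>cube. d $ i * second_prob k d om)"
    by (simp add: sum_distrib_left mult_ac)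
   thus ?case using second_prob_sum(2)[OF elim] by simp
  qed
  show "(%om. \<Sum>d\<in>cube. d $ i * (Y om * second_prob k d om)) \<in> borel_measurable M"
   using borel_measurable_integrable[OF s(2)] by measurable
 qed measurable
 finally show ?thesis .
qed

text \<open>The factor by which the denominator in the update scales the step.\<close>

definition shrink :: "nat => 's => real" where "shrink k om = 1 / (1 + spsa_rho CARD('n) / \<bar>slope k om\<bar>)"

lemma shrink_bounds: "0 < shrink k om" "shrink k om <= 1"
 using spsa_rho_nonneg[of "CARD('n)"] by (simp_all add: shrink_def add_pos_nonneg)

text \<open>The purpose of the denominator: it removes precisely the mean that the second direction adds.\<close>

lemma shrink_slope:
 assumes "slope k om \<noteq> 0"
 shows "shrink k om * (slope k om + spsa_rho CARD('n) * sgn (slope k om)) = slope k om"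
proof -
 have "slope k om + spsa_rho CARD('n) * sgn (slope k om) = (1 + spsa_rho CARD('n) / \<bar>slope k om\<bar>) * slope k om"
  using assms by (simp add: sgn_div_norm field_simps)
 moreover have "1 + spsa_rho CARD('n) / \<bar>slope k om\<bar> \<noteq> 0"
  using spsa_rho_nonneg[of "CARD('n)"] by (smt (verit) divide_nonneg_nonneg abs_ge_zero)
 ultimately show ?thesis by (simp add: shrink_def)
qed

text \<open>The estimate itself, plus a bounded vector that is centred given the past of the second direction.\<close>

lemma increment:
 "AE om in M. (1 / a k) *\<^sub>R (X k om - X (Suc k) om) = slope k om *\<^sub>R \<xi> k om + shrink k om *\<^sub>R (\<xi>' k om - spsa_rho CARD('n) *\<^sub>R sdir k om)"
 using update[of k] \<xi>_in_cube[of k] slope_nonzero[of k]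
proof eventually_elim
 case (elim om)
 have "infnorm (ghat k om) = \<bar>slope k om\<bar>"
  unfolding ghat_eq[OF elim(2)] by (simp add: infnorm_mul infnorm_cube[OF elim(2)])
 hence "X k om - X (Suc k) om = (a k * shrink k om) *\<^sub>R (slope k om *\<^sub>R \<xi> k om + \<xi>' k om)"
  using elim(1) unfolding ghat_eq[OF elim(2)] by (simp add: shrink_def)
 hence "(1 / a k) *\<^sub>R (X k om - X (Suc k) om) = shrink k om *\<^sub>R (slope k om *\<^sub>R \<xi> k om + \<xi>' k om)"
  using a_pos[of k] by simp
 also have "... = (shrink k om * (slope k om + spsa_rho CARD('n) * sgn (slope k om))) *\<^sub>R \<xi> k om + shrink k om *\<^sub>R (\<xi>' k om - spsa_rho CARD('n) *\<^sub>R sdir k om)"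
  by (simp add: sdir_def algebra_simps)
 finally show ?case unfolding shrink_slope[OF elim(3)] .
qed

end

section \<open>The error is centred\<close>

context spsa_noise
begin

definition extra :: "nat => 's => real^'n" where
 "extra k om = shrink k om *\<^sub>R (\<xi>' k om - spsa_rho CARD('n) *\<^sub>R sdir k om)"

lemma extra_bound: "AE om in M. norm (extra k om) <= sqrt (real CARD('n)) * (1 + spsa_rho CARD('n))"
 using second_in_cube[of k] \<xi>_in_cube[of k] slope_nonzero[of k]
proof eventually_elim
 case (elim om)
 have "norm (extra k om) <= 1 * norm (\<xi>' k om - spsa_rho CARD('n) *\<^sub>R sdir k om)"
  unfolding extra_def norm_scaleR using shrink_bounds[of k om] by (intro mult_right_mono) auto
 also have "... <= norm (\<xi>' k om) + spsa_rho CARD('n) * norm (sdir k om)"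
  using norm_triangle_ineq4[of "\<xi>' k om" "spsa_rho CARD('n) *\<^sub>R sdir k om"] spsa_rho_nonneg[of "CARD('n)"] by simp
 also have "... = sqrt (real CARD('n)) * (1 + spsa_rho CARD('n))"
  unfolding cube_norm[OF elim(1)] cube_norm[OF sdir_cube[OF elim(2,3)]] by (simp add: algebra_simps)
 finally show ?case .
qed

lemma mean_step_eq: "mean_step k om = (1 / 2 ^ CARD('n)) *\<^sub>R (\<Sum>v\<in>cube. (df k v om / (2 * c k)) *\<^sub>R v)"
 by (simp add: mean_step_def spsa_mean_def df_def)

lemma mean_step_bound: "c k * norm (mean_step k om) <= sqrt (real CARD('n)) * spread k om"
proof -
 have "norm (\<Sum>v\<in>cube. (df k v om / (2 * c k)) *\<^sub>R v) <= (\<Sum>v\<in>(cube::(real^'n) set). sqrt (real CARD('n)) * (\<bar>df k v om\<bar> / (2 * c k)))"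
  by (rule sum_norm_le) (use c_pos[of k] in \<open>simp add: cube_norm mult.commute\<close>)
 also have "... = sqrt (real CARD('n)) * spread k om / (2 * c k)"
  by (simp add: spread_def sum_distrib_left sum_divide_distrib)
 finally have b: "norm (\<Sum>v\<in>cube. (df k v om / (2 * c k)) *\<^sub>R v) <= sqrt (real CARD('n)) * spread k om / (2 * c k)" .
 have "norm (mean_step k om) <= 1 * norm (\<Sum>v\<in>cube. (df k v om / (2 * c k)) *\<^sub>R v)"
  unfolding mean_step_eq norm_scaleR by (intro mult_right_mono) auto
 with b have "norm (mean_step k om) <= sqrt (real CARD('n)) * spread k om / (2 * c k)" by simp
 hence "c k * norm (mean_step k om) <= c k * (sqrt (real CARD('n)) * spread k om / (2 * c k))"
  using c_pos[of k] by (intro mult_left_mono) auto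
 also have "... = sqrt (real CARD('n)) * spread k om / 2" using c_pos[of k] by simp
 also have "... <= sqrt (real CARD('n)) * spread k om" using spread_nonneg[of k om] by simp
 finally show ?thesis .
qed

definition rest_bound :: "nat => 's => real" where
 "rest_bound k om = sqrt (real CARD('n)) * (2 * spread k om + c k * (1 + spsa_rho CARD('n)))"

lemma rest_bound_nonneg: "0 <= rest_bound k om"
 unfolding rest_bound_def using spread_nonneg[of k om] c_pos[of k] spsa_rho_nonneg[of "CARD('n)"] by simp

lemma rest_bound_meas [measurable]: "rest_bound k \<in> borel_measurable M"
 unfolding rest_bound_def[abs_def] by measurable

lemma err_meas_F: "err k \<in> borel_measurable (F (Suc k))"
proof -
 have [measurable]: "X k \<in> borel_measurable (F (Suc k))" "X (Suc k) \<in> borel_measurable (F (Suc k))"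
  by (rule X_meas_F, simp)+
 have "(%om. df k v om) \<in> borel_measurable (F (Suc k))" for v
  unfolding df_def by measurable
 hence "mean_step k \<in> borel_measurable (F (Suc k))"
  unfolding mean_step_eq[abs_def] by measurable
 thus ?thesis unfolding err_def[abs_def] by measurable
qed

lemma err_meas [measurable]: "err k \<in> borel_measurable M"
 by (rule F_meas_lift(1)[OF err_meas_F])

text \<open>Multiplied by \<open>c k\<close>, everything except the measurement noise is small: the difference of the function values as soon
as \<open>X k\<close> converges, and the randomness of the second direction because it is bounded.\<close>

lemma err_decomposition:
 "AE om in M. norm (c k *\<^sub>R err k om - (\<epsilon> k om / 2) *\<^sub>R \<xi> k om) <= rest_bound k om"
 using increment[of k] extra_bound[of k] \<xi>_in_cube[of k]
proof eventually_elim
 case (elim om)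
 let ?n = "sqrt (real CARD('n))"
 have "c k *\<^sub>R err k om - (\<epsilon> k om / 2) *\<^sub>R \<xi> k om =
   (c k * slope k om - \<epsilon> k om / 2) *\<^sub>R \<xi> k om + c k *\<^sub>R extra k om - c k *\<^sub>R mean_step k om"
  unfolding err_def elim(1) extra_def[symmetric] by (simp add: algebra_simps)
 also have "c k * slope k om - \<epsilon> k om / 2 = df k (\<xi> k om) om / 2"
  using c_pos[of k] by (simp add: slope_def field_simps)
 finally have eq: "c k *\<^sub>R err k om - (\<epsilon> k om / 2) *\<^sub>R \<xi> k om =
   (df k (\<xi> k om) om / 2) *\<^sub>R \<xi> k om + c k *\<^sub>R extra k om - c k *\<^sub>R mean_step k om" .
 have "norm (c k *\<^sub>R err k om - (\<epsilon> k om / 2) *\<^sub>R \<xi> k om) <=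
   norm ((df k (\<xi> k om) om / 2) *\<^sub>R \<xi> k om) + norm (c k *\<^sub>R extra k om) + norm (c k *\<^sub>R mean_step k om)"
  unfolding eq using norm_triangle_ineq4[of "(df k (\<xi> k om) om / 2) *\<^sub>R \<xi> k om + c k *\<^sub>R extra k om" "c k *\<^sub>R mean_step k om"]
   norm_triangle_ineq[of "(df k (\<xi> k om) om / 2) *\<^sub>R \<xi> k om" "c k *\<^sub>R extra k om"] by linarith
 also have "... <= ?n * spread k om + c k * (?n * (1 + spsa_rho CARD('n))) + ?n * spread k om"
 proof (intro add_mono)
  have "norm ((df k (\<xi> k om) om / 2) *\<^sub>R \<xi> k om) = \<bar>df k (\<xi> k om) om\<bar> / 2 * ?n"
   by (simp add: cube_norm[OF elim(3)])
  also have "... <= spread k om * ?n"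
   using df_le_spread[OF elim(3), of k om] spread_nonneg[of k om] by (intro mult_right_mono) auto
  finally show "norm ((df k (\<xi> k om) om / 2) *\<^sub>R \<xi> k om) <= ?n * spread k om" by (simp add: mult.commute)
  show "norm (c k *\<^sub>R extra k om) <= c k * (?n * (1 + spsa_rho CARD('n)))"
   using elim(2) c_pos[of k] by (simp add: mult_left_mono)
  show "norm (c k *\<^sub>R mean_step k om) <= ?n * spread k om"
   using mean_step_bound[of k om] c_pos[of k] by simp
 qed
 also have "... = rest_bound k om" by (simp add: rest_bound_def algebra_simps)
 finally show ?case .
qed

lemma err_bound: "AE om in M. c k * norm (err k om) <= sqrt (real CARD('n)) * (5 * size k om + c k * (1 + spsa_rho CARD('n)))"
 using err_decomposition[of k] \<xi>_in_cube[of k]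
proof eventually_elim
 case (elim om)
 let ?n = "sqrt (real CARD('n))"
 have "c k * norm (err k om) = norm (c k *\<^sub>R err k om)" using c_pos[of k] by simp
 also have "... <= norm (c k *\<^sub>R err k om - (\<epsilon> k om / 2) *\<^sub>R \<xi> k om) + norm ((\<epsilon> k om / 2) *\<^sub>R \<xi> k om)"
  by (rule order_trans[OF _ norm_triangle_ineq]) simp
 also have "... <= rest_bound k om + ?n * size k om"
 proof (intro add_mono elim(1))
  have "norm ((\<epsilon> k om / 2) *\<^sub>R \<xi> k om) = ?n * (\<bar>\<epsilon> k om\<bar> / 2)" by (simp add: cube_norm[OF elim(2)])
  also have "... <= ?n * size k om" using \<epsilon>_le_size[of k om] size_nonneg[of k om] by (intro mult_left_mono) auto
  finally show "norm ((\<epsilon> k om / 2) *\<^sub>R \<xi> k om) <= ?n * size k om" .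
 qed
 also have "... <= ?n * (2 * (2 * size k om) + c k * (1 + spsa_rho CARD('n))) + ?n * size k om"
  unfolding rest_bound_def using spread_le_size[of k om]
  by (intro add_right_mono mult_left_mono) auto
 also have "... = ?n * (5 * size k om + c k * (1 + spsa_rho CARD('n)))" by (simp add: algebra_simps)
 finally show ?case .
qed

lemma err_integrable: "integrable M (%om. err k om $ i)"
proof (rule integrable_le_size)
 let ?n = "sqrt (real CARD('n))"
 show "AE om in M. \<bar>err k om $ i\<bar> <= (?n * 5 / c k) * size k om + ?n * (1 + spsa_rho CARD('n))"
  using err_bound[of k]
 proof eventually_elim
  case (elim om)
  have "\<bar>err k om $ i\<bar> <= norm (err k om)" by (rule component_le_norm_cart)
  also have "... <= (?n * (5 * size k om + c k * (1 + spsa_rho CARD('n)))) / c k"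
   using elim c_pos[of k] by (simp add: pos_le_divide_eq mult.commute)
  also have "... = (?n * 5 / c k) * size k om + ?n * (1 + spsa_rho CARD('n))"
   using c_pos[of k] by (simp add: field_simps)
  finally show ?case .
 qed
qed measurable

lemma sum_dir_AE: "AE om in M. g om (\<xi> k om) = (\<Sum>v\<in>cube. g om v * dir k v om)"
 using \<xi>_in_cube[of k] AE_space by eventually_elim (simp add: sum_dir)

text \<open>Three sources of randomness are averaged out in turn: the second direction, the measurement noise given the first
direction, and the first direction.\<close>

lemma err_centred: "AE om in M. real_cond_exp M (F k) (%om. err k om $ i) om = 0"
proof -
 interpret sigma_finite_subalgebra M "F k" by (rule finite_sigma_subalgebra[OF prob_space_axioms sub_F])
 show ?thesis
 proof (rule real_cond_exp_charact)
  fix A assume A: "A \<in> sets (F k)"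
  define Y :: "'s => real" where "Y = indicator A"
  have Ym: "Y \<in> borel_measurable (F k)" unfolding Y_def using A by simp
  have [measurable]: "Y \<in> borel_measurable M" by (rule F_meas_lift(1)[OF Ym])
  have Yb: "\<bar>Y om\<bar> <= 1" "0 <= Y om" for om by (auto simp: Y_def indicator_def)
  have [measurable]: "sdir k \<in> borel_measurable M" unfolding sdir_def[abs_def] by measurable
  have shM[measurable]: "shrink k \<in> borel_measurable M" unfolding shrink_def[abs_def] by measurable
  \<comment> \<open>the second direction averages out\<close>
  have yint: "integrable M (%om. Y om * g om)" if "integrable M g" for g :: "'s => real"
  proof (rule Bochner_Integration.integrable_bound[OF that])
   show "AE om in M. norm (Y om * g om) <= norm (g om)"
    using Yb by (intro AE_I2) (simp add: abs_mult mult_left_le_one_le)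
   show "(%om. Y om * g om) \<in> borel_measurable M" using borel_measurable_integrable[OF that] by measurable
  qed
  have shH: "(%om. Y om * shrink k om) \<in> borel_measurable (H k)"
  proof -
   have [measurable]: "slope k \<in> borel_measurable (H k)" "Y \<in> borel_measurable (H k)"
    by (rule slope_meas_H, rule F_meas_lift(3)[OF Ym])
   show ?thesis unfolding shrink_def by measurable
  qed
  have shb: "\<bar>Y om * shrink k om\<bar> <= 1" for om
   using Yb[of om] shrink_bounds[of k om] mult_le_one[of "Y om" "shrink k om"] by (simp add: abs_mult)
  have cb: "\<bar>v $ i\<bar> <= 1" if "v \<in> cube" for v :: "real^'n" using that by (auto simp: cube_def dest!: spec[of _ i])
  have i1: "integrable M (%om. Y om * shrink k om * \<xi>' k om $ i)"
  proof (rule integrable_const_bound[where B = 1])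
   show "AE om in M. norm (Y om * shrink k om * \<xi>' k om $ i) <= 1"
    using second_in_cube[of k]
    by eventually_elim (use shb cb in \<open>simp add: abs_mult[of "_ * _"] mult_le_one\<close>)
  qed measurable
  have i2: "integrable M (%om. Y om * shrink k om * (spsa_rho CARD('n) * sdir k om $ i))"
  proof (rule integrable_const_bound[where B = "1 * (spsa_rho CARD('n) * 1)"])
   show "AE om in M. norm (Y om * shrink k om * (spsa_rho CARD('n) * sdir k om $ i)) <= 1 * (spsa_rho CARD('n) * 1)"
    using \<xi>_in_cube[of k] slope_nonzero[of k]
   proof eventually_elim
    case (elim om)
    show ?case unfolding real_norm_def abs_mult[of "Y om * shrink k om"] abs_mult[of "spsa_rho CARD('n)"]
     using shb[of om] cb[OF sdir_cube[OF elim]] spsa_rho_nonneg[of "CARD('n)"] by (intro mult_mono) auto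
   qed
  qed measurable
  have e0: "(\<integral>om. Y om * extra k om $ i \<partial>M) = 0" and ei: "integrable M (%om. Y om * extra k om $ i)"
  proof -
   have eq: "Y om * extra k om $ i = Y om * shrink k om * \<xi>' k om $ i - Y om * shrink k om * (spsa_rho CARD('n) * sdir k om $ i)" for om
    by (simp add: extra_def algebra_simps)
   show "integrable M (%om. Y om * extra k om $ i)" unfolding eq using i1 i2 by simp
   show "(\<integral>om. Y om * extra k om $ i \<partial>M) = 0" unfolding eq using i1 i2 second_mean[OF shH shb] by simp
  qed
  \<comment> \<open>the measurement noise averages out\<close>
  have \<epsilon>i: "integrable M (\<epsilon> k)"
   by (rule integrable_le_size[where C = 1 and D = 0]) (use \<epsilon>_le_size in auto)
  define Z where "Z om = Y om * (\<Sum>v\<in>cube. v $ i * dir k v om)" for om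
  have Zm: "Z \<in> borel_measurable (G k)"
   unfolding Z_def[abs_def] using dir_meas_G F_meas_lift(2)[OF Ym] by measurable
  have [measurable]: "Z \<in> borel_measurable M" by (rule measurable_from_subalg[OF sub_G Zm])
  have Zx: "AE om in M. Z om = Y om * \<xi> k om $ i"
   using sum_dir_AE[of "%_ v. v $ i" k] by eventually_elim (simp add: Z_def)
  have Z\<epsilon>: "integrable M (%om. Z om * \<epsilon> k om)"
  proof (rule integrable_le_size[where C = 1 and D = 0])
   show "AE om in M. \<bar>Z om * \<epsilon> k om\<bar> <= 1 * size k om + 0"
    using Zx \<xi>_in_cube[of k]
   proof eventually_elim
    case (elim om)
    have "\<bar>Z om\<bar> <= 1" unfolding elim(1) abs_mult using Yb[of om] cb[OF elim(2)] by (intro mult_le_one) auto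
    hence "\<bar>Z om\<bar> * \<bar>\<epsilon> k om\<bar> <= 1 * size k om" using \<epsilon>_le_size by (intro mult_mono) auto
    thus ?case by (simp only: abs_mult add_0_right)
   qed
  qed measurable
  have Z0: "(\<integral>om. Z om * \<epsilon> k om \<partial>M) = 0"
  proof -
   interpret GG: sigma_finite_subalgebra M "G k" by (rule finite_sigma_subalgebra[OF prob_space_axioms sub_G])
   have "(\<integral>om. Z om * real_cond_exp M (G k) (\<epsilon> k) om \<partial>M) = (\<integral>om. Z om * \<epsilon> k om \<partial>M)"
    by (rule GG.real_cond_exp_intg(2)[OF Z\<epsilon> Zm]) measurable
   moreover have "(\<integral>om. Z om * real_cond_exp M (G k) (\<epsilon> k) om \<partial>M) = 0"
    by (rule integral_eq_zero_AE) (use noise[of k] in auto)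
   ultimately show ?thesis by simp
  qed
  \<comment> \<open>the function differences average to the mean step\<close>
  have dfi: "integrable M (%om. Y om * df k v om)" if v: "v \<in> cube" for v
  proof (rule yint, rule integrable_le_size[where C = 2 and D = 0])
   show "AE om in M. \<bar>df k v om\<bar> <= 2 * size k om + 0"
    using order_trans[OF df_le_spread[OF v] spread_le_size] by simp
  qed measurable
  have dfF: "(%om. Y om * df k v om) \<in> borel_measurable (F k)" for v
   using Ym df_meas_F by measurable
  have dd: "(\<integral>om. Y om * df k v om * dir k v om \<partial>M) = (\<integral>om. Y om * df k v om \<partial>M) / 2 ^ CARD('n)" if v: "v \<in> cube" for v
   by (rule dir_independent(2)[OF v dfF dir_integrable[OF dfi[OF v]]])
  have ddi: "integrable M (%om. Y om * df k v om * dir k v om)" if v: "v \<in> cube" for v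
   by (rule dir_integrable[OF dfi[OF v]])
  have ms: "Y om * mean_step k om $ i = (\<Sum>v\<in>cube. (v $ i / (2 * c k * 2 ^ CARD('n))) * (Y om * df k v om))" for om
   unfolding mean_step_eq by (simp add: sum_component sum_distrib_left field_simps)
  have msi: "integrable M (%om. Y om * mean_step k om $ i)" unfolding ms using dfi by simp
  have msv: "(\<integral>om. Y om * mean_step k om $ i \<partial>M) = (\<Sum>v\<in>cube. (v $ i / (2 * c k * 2 ^ CARD('n))) * (\<integral>om. Y om * df k v om \<partial>M))"
   unfolding ms using dfi by simp
  let ?R = "%om. (\<Sum>v\<in>cube. (v $ i / (2 * c k)) * (Y om * df k v om * dir k v om)) + (1 / (2 * c k)) * (Z om * \<epsilon> k om)
    + Y om * extra k om $ i - Y om * mean_step k om $ i"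
  have Ri: "integrable M ?R" using ddi Z\<epsilon> ei msi by simp
  have "(\<integral>om. Y om * err k om $ i \<partial>M) = (\<integral>om. ?R om \<partial>M)"
  proof (rule integral_cong_AE)
   show "AE om in M. Y om * err k om $ i = ?R om"
    using increment[of k] Zx sum_dir_AE[of "%om v. v $ i * df k v om" k]
   proof eventually_elim
    case (elim om)
    have "Y om * err k om $ i = Y om * (slope k om * \<xi> k om $ i) + Y om * extra k om $ i - Y om * mean_step k om $ i"
     unfolding err_def elim(1) extra_def[symmetric] by (simp add: algebra_simps)
    also have "Y om * (slope k om * \<xi> k om $ i) =
      (Y om / (2 * c k)) * (\<xi> k om $ i * df k (\<xi> k om) om) + (1 / (2 * c k)) * (Y om * \<xi> k om $ i * \<epsilon> k om)"
     unfolding slope_def using c_pos[of k] by (simp add: field_simps)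
    also have "(Y om / (2 * c k)) * (\<xi> k om $ i * df k (\<xi> k om) om)
      = (\<Sum>v\<in>cube. (v $ i / (2 * c k)) * (Y om * df k v om * dir k v om))"
     unfolding elim(3) by (simp add: sum_distrib_left field_simps)
    finally show ?case unfolding elim(2) .
   qed
   show "(%om. Y om * err k om $ i) \<in> borel_measurable M" by measurable
   show "?R \<in> borel_measurable M" using Ri by (rule borel_measurable_integrable)
  qed
  also have "... = (\<Sum>v\<in>cube. (v $ i / (2 * c k)) * (\<integral>om. Y om * df k v om * dir k v om \<partial>M))
    + (1 / (2 * c k)) * (\<integral>om. Z om * \<epsilon> k om \<partial>M) + (\<integral>om. Y om * extra k om $ i \<partial>M) - (\<integral>om. Y om * mean_step k om $ i \<partial>M)"
   using ddi Z\<epsilon> ei msi by simp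
  also have "(\<Sum>v\<in>cube. (v $ i / (2 * c k)) * (\<integral>om. Y om * df k v om * dir k v om \<partial>M)) = (\<integral>om. Y om * mean_step k om $ i \<partial>M)"
   unfolding msv by (intro sum.cong refl) (simp add: dd)
  finally have "(\<integral>om. Y om * err k om $ i \<partial>M) = 0" using Z0 e0 by simp
  thus "(\<integral>om\<in>A. err k om $ i \<partial>M) = (\<integral>om\<in>A. 0 \<partial>M)"
   unfolding set_lebesgue_integral_def Y_def by simp
 qed (use err_integrable in simp_all)
qed

end

section \<open>Moments and asymptotic covariance of the error\<close>

text \<open>By the inequality between arithmetic and geometric means with a large weight on the vanishing factor.\<close>

lemma (in prob_space) product_integral_vanishes:
 fixes A B :: "nat => 'a => real"
 assumes [measurable]: "!!n. A n \<in> borel_measurable M" "!!n. B n \<in> borel_measurable M"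
  and A: "!!n. integrable M (%om. (A n om)^2)" "!!n. (\<integral>om. (A n om)^2 \<partial>M) <= C"
  and B: "!!n. integrable M (%om. (B n om)^2)" "(%n. \<integral>om. (B n om)^2 \<partial>M) \<longlonglongrightarrow> 0"
 shows "!!n. integrable M (%om. \<bar>A n om\<bar> * \<bar>B n om\<bar>)" "(%n. \<integral>om. \<bar>A n om\<bar> * \<bar>B n om\<bar> \<partial>M) \<longlonglongrightarrow> 0"
proof -
 have am: "\<bar>x\<bar> * \<bar>y\<bar> <= (m * x^2 + y^2 / m) / 2" if "m > 0" for x y m :: real
 proof -
  have "0 <= (m * \<bar>x\<bar> - \<bar>y\<bar>)^2 / m" using that by simp
  also have "... = m * x^2 + y^2 / m - 2 * (\<bar>x\<bar> * \<bar>y\<bar>)"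
   using that by (simp add: power2_diff field_simps) (simp add: power2_eq_square)
  finally show ?thesis by simp
 qed
 have i: "integrable M (%om. \<bar>A n om\<bar> * \<bar>B n om\<bar>)" for n
 proof (rule Bochner_Integration.integrable_bound)
  show "integrable M (%om. (1 * (A n om)^2 + (B n om)^2 / 1) / 2)" using A(1) B(1) by simp
  show "AE om in M. norm (\<bar>A n om\<bar> * \<bar>B n om\<bar>) <= norm ((1 * (A n om)^2 + (B n om)^2 / 1) / 2)"
  proof (rule AE_I2)
   fix om show "norm (\<bar>A n om\<bar> * \<bar>B n om\<bar>) <= norm ((1 * (A n om)^2 + (B n om)^2 / 1) / 2)"
    using am[of 1 "A n om" "B n om"] by (simp add: abs_mult)
  qed
 qed measurable
 thus "!!n. integrable M (%om. \<bar>A n om\<bar> * \<bar>B n om\<bar>)" .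
 have C: "0 <= C" by (rule order_trans[OF _ A(2)[of 0]]) simp
 show "(%n. \<integral>om. \<bar>A n om\<bar> * \<bar>B n om\<bar> \<partial>M) \<longlonglongrightarrow> 0"
 proof (rule LIMSEQ_I)
  fix e :: real assume e: "e > 0"
  define m where "m = e / (C + 1)"
  have m: "m > 0" using e C by (simp add: m_def)
  have mC: "m * C <= e" using e C by (simp add: m_def field_simps)
  have "\<forall>\<^sub>F n in sequentially. (\<integral>om. (B n om)^2 \<partial>M) < e * m"
   using e m by (intro order_tendstoD(2)[OF B(2)]) auto
  then obtain n0 where n0: "!!n. n >= n0 ==> (\<integral>om. (B n om)^2 \<partial>M) < e * m"
   unfolding eventually_sequentially by blast
  show "\<exists>n0. \<forall>n\<ge>n0. norm ((\<integral>om. \<bar>A n om\<bar> * \<bar>B n om\<bar> \<partial>M) - 0) < e"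
  proof (intro exI allI impI)
   fix n assume n: "n >= n0"
   have "(\<integral>om. \<bar>A n om\<bar> * \<bar>B n om\<bar> \<partial>M) <= (\<integral>om. (m * (A n om)^2 + (B n om)^2 / m) / 2 \<partial>M)"
    using A(1) B(1) by (intro integral_mono[OF i] am[OF m]) simp
   also have "... = (m * (\<integral>om. (A n om)^2 \<partial>M) + (\<integral>om. (B n om)^2 \<partial>M) / m) / 2"
    using A(1) B(1) by simp
   also have "... < (e + e) / 2"
   proof -
    have "m * (\<integral>om. (A n om)^2 \<partial>M) <= m * C" using A(2) m by (intro mult_left_mono) auto
    moreover have "(\<integral>om. (B n om)^2 \<partial>M) / m < e" using n0[OF n] m by (simp add: field_simps)
    ultimately show ?thesis using mC by simp
   qed
   finally show "norm ((\<integral>om. \<bar>A n om\<bar> * \<bar>B n om\<bar> \<partial>M) - 0) < e" by simp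
  qed
 qed
qed

context spsa_noise
begin

definition "err_const cb = sqrt (real CARD('n)) powr p * (2 powr p * (5 powr p * size_bound + (cb * (1 + spsa_rho CARD('n))) powr p))"

lemma err_moment:
 assumes cb: "c k <= cb"
 shows "integrable M (%om. norm (c k *\<^sub>R err k om) powr p)" "(\<integral>om. norm (c k *\<^sub>R err k om) powr p \<partial>M) <= err_const cb"
proof -
 let ?n = "sqrt (real CARD('n))"
 let ?d = "cb * (1 + spsa_rho CARD('n))"
 have d: "c k * (1 + spsa_rho CARD('n)) <= ?d" "0 <= ?d"
  using cb c_pos[of k] spsa_rho_nonneg[of "CARD('n)"] by (auto intro!: mult_right_mono mult_nonneg_nonneg)
 have p0: "0 <= p" using p by simp
 let ?U = "%om. ?n powr p * (2 powr p * (5 powr p * size k om powr p + ?d powr p))"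
 have Ui: "integrable M ?U" using size_moment(1) by simp
 have b: "AE om in M. norm (c k *\<^sub>R err k om) powr p <= ?U om"
  using err_bound[of k]
 proof eventually_elim
  case (elim om)
  have two: "(x + y) powr p <= 2 powr p * (x powr p + y powr p)" if "0 <= x" "0 <= y" for x y :: real
  proof -
   have "(x + y) powr p <= (2 * max x y) powr p" using that p0 by (intro powr_mono2) auto
   also have "... = 2 powr p * max x y powr p" using that by (simp add: powr_mult)
   also have "max x y powr p <= x powr p + y powr p" by (simp add: max_def)
   finally show ?thesis by simp
  qed
  have "norm (c k *\<^sub>R err k om) <= ?n * (5 * size k om + ?d)"
   using elim d(1) c_pos[of k] by (simp del: real_sqrt_ge_0_iff) (meson add_left_mono mult_left_mono order_trans real_sqrt_ge_zero of_nat_0_le_iff)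
  hence "norm (c k *\<^sub>R err k om) powr p <= (?n * (5 * size k om + ?d)) powr p"
   using p0 by (intro powr_mono2) auto
  also have "... = ?n powr p * (5 * size k om + ?d) powr p"
   using size_nonneg[of k om] d(2) by (simp add: powr_mult)
  also have "(5 * size k om + ?d) powr p <= 2 powr p * ((5 * size k om) powr p + ?d powr p)"
   using size_nonneg[of k om] d(2) by (intro two) auto
  also have "(5 * size k om) powr p = 5 powr p * size k om powr p"
   using size_nonneg[of k om] by (simp add: powr_mult)
  finally show ?case by (simp add: mult_left_mono)
 qed
 show i: "integrable M (%om. norm (c k *\<^sub>R err k om) powr p)"
  by (rule Bochner_Integration.integrable_bound[OF Ui]) (measurable, use b in \<open>eventually_elim, simp\<close>)
 have "(\<integral>om. norm (c k *\<^sub>R err k om) powr p \<partial>M) <= (\<integral>om. ?U om \<partial>M)"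
  by (rule integral_mono_AE[OF i Ui b])
 also have "... = ?n powr p * (2 powr p * (5 powr p * (\<integral>om. size k om powr p \<partial>M) + ?d powr p))"
  using size_moment(1) by (simp add: prob_space)
 also have "... <= err_const cb"
  unfolding err_const_def using size_moment(2)[of k] by (intro mult_left_mono add_mono) auto
 finally show "(\<integral>om. norm (c k *\<^sub>R err k om) powr p \<partial>M) <= err_const cb" .
qed

text \<open>The differences of function values tend to 0 along a convergent path; the moments of order \<open>p > 2\<close> make their squares
uniformly integrable.\<close>

lemma rest_sq_vanishes:
 assumes X: "AE om in M. (%k. X k om) \<longlonglongrightarrow> z" and c: "c \<longlonglongrightarrow> 0"
 shows "!!k. integrable M (%om. (rest_bound k om)^2)" "(%k. \<integral>om. (rest_bound k om)^2 \<partial>M) \<longlonglongrightarrow> 0"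
proof -
 let ?n = "real CARD('n)" and ?r = "1 + spsa_rho CARD('n)"
 have sz: "(spread k om)^2 <= 4 * (size k om)^2" for k om
  using power_mono[OF spread_le_size[of k om] spread_nonneg, of 2] by (simp add: power_mult_distrib)
 have si: "integrable M (%om. (spread k om)^2)" for k
 proof (rule Bochner_Integration.integrable_bound)
  show "integrable M (%om. 4 * (size k om)^2)" using size_sq(1) by simp
 qed (use sz in auto)
 have tails: "\<exists>K. \<forall>k\<ge>0. (\<integral>om. max ((spread k om)^2 - K) 0 \<partial>M) <= e" if e: "e > 0" for e
 proof -
  have pw: "((spread k om)^2) powr (p / 2) <= 2 powr p * size k om powr p" for k om
  proof -
   have "((spread k om)^2) powr (p / 2) = spread k om powr p"
   proof (cases "spread k om = 0")
    case False
    hence "(spread k om)^2 = spread k om powr 2" using spread_nonneg[of k om] by simp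
    thus ?thesis by (simp add: powr_powr)
   qed simp
   also have "... <= (2 * size k om) powr p"
    using spread_nonneg[of k om] spread_le_size[of k om] p by (intro powr_mono2) auto
   also have "... = 2 powr p * size k om powr p" using size_nonneg[of k om] by (simp add: powr_mult)
   finally show ?thesis .
  qed
  have ui: "integrable M (%om. 2 powr p * size k om powr p)" for k using size_moment(1) by simp
  have pi: "integrable M (%om. ((spread k om)^2) powr (p / 2))" for k
   by (rule Bochner_Integration.integrable_bound[OF ui[of k]])
    (measurable, use pw in \<open>auto intro!: AE_I2\<close>)
  have pb: "(\<integral>om. ((spread k om)^2) powr (p / 2) \<partial>M) <= 2 powr p * size_bound" for k
  proof -
   have "(\<integral>om. ((spread k om)^2) powr (p / 2) \<partial>M) <= (\<integral>om. 2 powr p * size k om powr p \<partial>M)"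
    by (rule integral_mono[OF pi ui pw])
   also have "... <= 2 powr p * size_bound" using size_moment(2)[of k] by simp
   finally show ?thesis .
  qed
  obtain K where "!!k. k \<in> (UNIV :: nat set) ==> (\<integral>om. max ((spread k om)^2 - K) 0 \<partial>M) <= e"
   by (rule tails_vanish_if_moment_bounded[of "p / 2" e UNIV "%k om. (spread k om)^2" "2 powr p * size_bound"])
    (use p e si pi pb in auto)
  thus ?thesis by auto
 qed
 have lim: "AE om in M. (%k. (spread k om)^2) \<longlonglongrightarrow> 0"
  using X
 proof eventually_elim
  case (elim om)
  have fc: "isCont f z" using f_cont by (simp add: continuous_on_eq_continuous_at)
  have "(%k. df k v om) \<longlonglongrightarrow> f z - f z" for v
   unfolding df_def
  proof (intro tendsto_diff isCont_tendsto_compose[OF fc])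
   show "(%k. X k om + c k *\<^sub>R v) \<longlonglongrightarrow> z"
    using tendsto_add[OF elim tendsto_scaleR[OF c tendsto_const[of v]]] by simp
   show "(%k. X k om - c k *\<^sub>R v) \<longlonglongrightarrow> z"
    using tendsto_diff[OF elim tendsto_scaleR[OF c tendsto_const[of v]]] by simp
  qed
  hence "(%k. (spread k om)^2) \<longlonglongrightarrow> (\<Sum>v\<in>(cube :: (real^'n) set). \<bar>f z - f z\<bar>)^2"
   unfolding spread_def by (intro tendsto_intros)
  thus ?case by simp
 qed
 have L: "(%k. \<integral>om. \<bar>(spread k om)^2 - 0\<bar> \<partial>M) \<longlonglongrightarrow> 0"
  by (rule L1_limit_if_tails_vanish[OF si lim _ tails]) auto
 let ?U = "%k om. 8 * ?n * (spread k om)^2 + 2 * ?n * (c k * ?r)^2"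
 have le: "(rest_bound k om)^2 <= ?U k om" for k om
 proof -
  have "(2 * spread k om + c k * ?r)^2 <= 8 * (spread k om)^2 + 2 * (c k * ?r)^2"
   using sum_squares_bound[of "2 * spread k om" "c k * ?r"] by (simp add: power2_sum power_mult_distrib)
  hence "?n * (2 * spread k om + c k * ?r)^2 <= ?n * (8 * (spread k om)^2 + 2 * (c k * ?r)^2)"
   by (rule mult_left_mono) simp
  moreover have "(rest_bound k om)^2 = ?n * (2 * spread k om + c k * ?r)^2"
   unfolding rest_bound_def power_mult_distrib by simp
  ultimately show ?thesis by (simp only: distrib_left mult_ac)
 qed
 have Ui: "integrable M (?U k)" for k using si by simp
 show ri: "!!k. integrable M (%om. (rest_bound k om)^2)"
  by (rule Bochner_Integration.integrable_bound[OF Ui]) (measurable, use le in \<open>auto intro!: AE_I2 order_trans[OF _ abs_ge_self]\<close>)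
 have UL: "(%k. \<integral>om. ?U k om \<partial>M) \<longlonglongrightarrow> 0"
 proof -
  have "(%k. 8 * ?n * (\<integral>om. \<bar>(spread k om)^2 - 0\<bar> \<partial>M) + 2 * ?n * (c k * ?r)^2) \<longlonglongrightarrow> 8 * ?n * 0 + 2 * ?n * (0 * ?r)^2"
   by (intro tendsto_intros L c)
  thus ?thesis using si by (simp add: prob_space)
 qed
 show "(%k. \<integral>om. (rest_bound k om)^2 \<partial>M) \<longlonglongrightarrow> 0"
  by (rule tendsto_sandwich[OF _ _ tendsto_const UL])
   (auto intro!: always_eventually integral_mono ri Ui le)
qed

lemma \<epsilon>_sq: "integrable M (%om. (\<epsilon> k om)^2)" "(\<integral>om. (\<epsilon> k om)^2 \<partial>M) <= 1 + size_bound"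
proof -
 have le: "(\<epsilon> k om)^2 <= (size k om)^2" for om
  using power_mono[OF \<epsilon>_le_size abs_ge_zero, of k om 2] by simp
 show 1: "integrable M (%om. (\<epsilon> k om)^2)"
  by (rule Bochner_Integration.integrable_bound[OF size_sq(1)[of k]]) (measurable, use le in auto)
 show "(\<integral>om. (\<epsilon> k om)^2 \<partial>M) <= 1 + size_bound"
  by (rule order_trans[OF integral_mono[OF 1 size_sq(1) le] size_sq(2)])
qed

lemma \<epsilon>_sq_tails:
 assumes "e > 0"
 obtains K where "K > 0" "!!k. (\<integral>om. max ((\<epsilon> k om)^2 - K) 0 \<partial>M) <= e"
proof -
 have pw: "((\<epsilon> k om)^2) powr (p / 2) <= size k om powr p" for k om
 proof -
  have "((\<epsilon> k om)^2) powr (p / 2) = \<bar>\<epsilon> k om\<bar> powr p"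
  proof (cases "\<epsilon> k om = 0")
   case False
   hence "(\<epsilon> k om)^2 = \<bar>\<epsilon> k om\<bar> powr 2" by simp
   thus ?thesis by (simp only: powr_powr) simp
  qed simp
  also have "... <= size k om powr p" using \<epsilon>_le_size p by (intro powr_mono2) auto
  finally show ?thesis .
 qed
 have pi: "integrable M (%om. ((\<epsilon> k om)^2) powr (p / 2))" for k
  by (rule Bochner_Integration.integrable_bound[OF size_moment(1)[of k]]) (measurable, use pw in \<open>auto intro!: AE_I2\<close>)
 have pb: "(\<integral>om. ((\<epsilon> k om)^2) powr (p / 2) \<partial>M) <= size_bound" for k
  by (rule order_trans[OF integral_mono[OF pi size_moment(1) pw] size_moment(2)])
 obtain K where "K > 0" "!!k. k \<in> (UNIV :: nat set) ==> (\<integral>om. max ((\<epsilon> k om)^2 - K) 0 \<partial>M) <= e"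
  by (rule tails_vanish_if_moment_bounded[of "p / 2" e UNIV "%k om. (\<epsilon> k om)^2" size_bound])
   (use p assms \<epsilon>_sq(1) pi pb in auto)
 thus ?thesis using that by blast
qed

end

locale spsa_noise_variance = spsa_noise M f a c X \<xi> ep em \<xi>' p L
 for M :: "'s measure" and f :: "real^'n::finite => real" and a c X \<xi> ep em \<xi>' p L +
 fixes h :: "nat => 's => real^'n => real" and K :: nat and \<sigma> :: real and z :: "real^'n"
 assumes c_lim: "c \<longlonglongrightarrow> 0"
  and X_lim: "AE om in M. (%k. X k om) \<longlonglongrightarrow> z"
  and var_lim: "AE om in M. (%k. real_cond_exp M (sigma_iter M X k) (%om. (ep k om - em k om)^2) om) \<longlonglongrightarrow> \<sigma>^2"
  and h_meas: "!!k \<eta>. k >= K ==> (%om. h k om \<eta>) \<in> borel_measurable (sigma_iter M X k)"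
  and h_version: "!!k. k >= K ==> AE om in M.
   real_cond_exp M (sigma_iter_dir M X \<xi> k) (%om. (ep k om - em k om)^2) om = h k om (c k *\<^sub>R \<xi> k om)"
  and h_equicontinuous: "AE om in M. \<forall>e>0. \<exists>d>0. \<forall>k\<ge>K. \<forall>\<eta>. norm \<eta> < d --> \<bar>h k om \<eta> - h k om 0\<bar> < e"
begin

text \<open>The conditional variance of the noise given the iterates and the direction \<open>v\<close>.\<close>

definition hv :: "nat => real^'n => 's => real" where "hv k v om = h k om (c k *\<^sub>R v)"

lemma hv_meas_F: "k >= K ==> hv k v \<in> borel_measurable (F k)"
 unfolding hv_def[abs_def] by (rule h_meas)

lemma hv_integral:
 assumes k: "k >= K" and v: "v \<in> cube"
 shows "integrable M (hv k v)"
  "!!Y :: 's => real. Y \<in> borel_measurable (F k) ==> (!!om. \<bar>Y om\<bar> <= 1) ==>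
   integrable M (%om. Y om * (\<epsilon> k om)^2 * dir k v om) \<and> integrable M (%om. Y om * hv k v om) \<and>
   (\<integral>om. Y om * (\<epsilon> k om)^2 * dir k v om \<partial>M) = (\<integral>om. Y om * hv k v om \<partial>M) / 2 ^ CARD('n)"
proof -
 interpret GG: sigma_finite_subalgebra M "G k" by (rule finite_sigma_subalgebra[OF prob_space_axioms sub_G])
 let ?C = "real_cond_exp M (G k) (%om. (\<epsilon> k om)^2)"
 have hF: "hv k v \<in> borel_measurable (F k)" by (rule hv_meas_F[OF k])
 have hM[measurable]: "hv k v \<in> borel_measurable M" by (rule F_meas_lift(1)[OF hF])
 have C_h: "AE om in M. ?C om * dir k v om = hv k v om * dir k v om"
  using h_version[OF k]
 proof eventually_elim
  case (elim om)
  show ?case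
  proof (cases "dir k v om = 0")
   case False
   hence "\<xi> k om = v" by (auto simp: dir_def indicator_def split: if_splits)
   thus ?thesis using elim by (simp add: hv_def)
  qed simp
 qed
 have Ci: "integrable M ?C" by (rule GG.real_cond_exp_int(1)[OF \<epsilon>_sq(1)])
 have [measurable]: "?C \<in> borel_measurable M" using Ci by (rule borel_measurable_integrable)
 have hdi: "integrable M (%om. hv k v om * dir k v om)"
 proof -
  have "integrable M (%om. ?C om * dir k v om) \<longleftrightarrow> integrable M (%om. hv k v om * dir k v om)"
   by (rule integrable_cong_AE[OF _ _ C_h]) measurable
  thus ?thesis using dir_integrable[OF Ci] by blast
 qed
 show hi: "integrable M (hv k v)" by (rule dir_independent(1)[OF v hF hdi])
 fix Y :: "'s => real" assume Ym: "Y \<in> borel_measurable (F k)" and Yb: "!!om. \<bar>Y om\<bar> <= 1"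
 have [measurable]: "Y \<in> borel_measurable M" by (rule F_meas_lift(1)[OF Ym])
 have bi: "integrable M (%om. Y om * g om)" if "integrable M g" for g :: "'s => real"
 proof (rule Bochner_Integration.integrable_bound[OF that])
  show "AE om in M. norm (Y om * g om) <= norm (g om)"
   using Yb by (intro AE_I2) (simp add: abs_mult mult_left_le_one_le)
  show "(%om. Y om * g om) \<in> borel_measurable M" using borel_measurable_integrable[OF that] by measurable
 qed
 have i1: "integrable M (%om. Y om * (\<epsilon> k om)^2 * dir k v om)"
  by (rule dir_integrable[OF bi[OF \<epsilon>_sq(1)]])
 have i1': "integrable M (%om. (Y om * dir k v om) * (\<epsilon> k om)^2)" using i1 by (simp add: mult_ac)
 have YG: "(%om. Y om * dir k v om) \<in> borel_measurable (G k)"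
  using F_meas_lift(2)[OF Ym] dir_meas_G by measurable
 have "(\<integral>om. Y om * (\<epsilon> k om)^2 * dir k v om \<partial>M) = (\<integral>om. (Y om * dir k v om) * (\<epsilon> k om)^2 \<partial>M)"
  by (simp add: mult_ac)
 also have "... = (\<integral>om. (Y om * dir k v om) * ?C om \<partial>M)"
  by (rule GG.real_cond_exp_intg(2)[OF i1' YG, symmetric]) measurable
 also have "... = (\<integral>om. (Y om * hv k v om) * dir k v om \<partial>M)"
 proof (rule integral_cong_AE)
  show "AE om in M. Y om * dir k v om * ?C om = Y om * hv k v om * dir k v om"
   using C_h by eventually_elim (simp add: mult_ac)
 qed measurable
 also have "... = (\<integral>om. Y om * hv k v om \<partial>M) / 2 ^ CARD('n)"
  by (rule dir_independent(2)[OF v _ dir_integrable[OF bi[OF hi]]]) (use Ym hF in measurable)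
 finally show "integrable M (%om. Y om * (\<epsilon> k om)^2 * dir k v om) \<and> integrable M (%om. Y om * hv k v om) \<and>
   (\<integral>om. Y om * (\<epsilon> k om)^2 * dir k v om \<partial>M) = (\<integral>om. Y om * hv k v om \<partial>M) / 2 ^ CARD('n)"
  using i1 bi[OF hi] by blast
qed

lemma hv_cond:
 assumes k: "k >= K" and v: "v \<in> cube"
 shows "AE om in M. real_cond_exp M (F k) (%om. 2 ^ CARD('n) * ((\<epsilon> k om)^2 * dir k v om)) om = hv k v om"
proof -
 interpret sigma_finite_subalgebra M "F k" by (rule finite_sigma_subalgebra[OF prob_space_axioms sub_F])
 show ?thesis
 proof (rule real_cond_exp_charact)
  fix A assume A: "A \<in> sets (F k)"
  have Y: "indicator A \<in> borel_measurable (F k)" using A by simp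
  have "\<bar>indicator A om :: real\<bar> <= 1" for om by (simp add: indicator_def)
  note hi = hv_integral(2)[OF k v Y this]
  show "(\<integral>om\<in>A. 2 ^ CARD('n) * ((\<epsilon> k om)^2 * dir k v om) \<partial>M) = (\<integral>om\<in>A. hv k v om \<partial>M)"
  proof -
   have "(\<integral>om\<in>A. 2 ^ CARD('n) * ((\<epsilon> k om)^2 * dir k v om) \<partial>M)
     = (\<integral>om. 2 ^ CARD('n) * (indicator A om * (\<epsilon> k om)^2 * dir k v om) \<partial>M)"
    unfolding set_lebesgue_integral_def by (simp add: mult_ac)
   also have "... = 2 ^ CARD('n) * (\<integral>om. indicator A om * (\<epsilon> k om)^2 * dir k v om \<partial>M)" by (rule integral_mult_right_zero)
   also have "... = (\<integral>om. indicator A om * hv k v om \<partial>M)" using hi by simp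
   finally show ?thesis unfolding set_lebesgue_integral_def by simp
  qed
 next
  show "integrable M (%om. 2 ^ CARD('n) * ((\<epsilon> k om)^2 * dir k v om))"
   using dir_integrable[OF \<epsilon>_sq(1)] by simp
 qed (use hv_integral(1)[OF k v] hv_meas_F[OF k] in auto)
qed

lemma hv_nonneg:
 assumes k: "k >= K" and v: "v \<in> cube"
 shows "AE om in M. 0 <= hv k v om"
proof -
 interpret sigma_finite_subalgebra M "F k" by (rule finite_sigma_subalgebra[OF prob_space_axioms sub_F])
 have "AE om in M. 0 <= real_cond_exp M (F k) (%om. 2 ^ CARD('n) * ((\<epsilon> k om)^2 * dir k v om)) om"
  by (rule real_cond_exp_pos) (use dir_01 in simp, measurable)
 with hv_cond[OF k v] show ?thesis by eventually_elim simp
qed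

text \<open>Averaging over the direction gives the conditional variance given the iterates alone, whose limit is known.\<close>

lemma average_hv:
 assumes k: "k >= K"
 shows "AE om in M. real_cond_exp M (F k) (%om. (\<epsilon> k om)^2) om = (\<Sum>v\<in>cube. hv k v om) / 2 ^ CARD('n)"
proof -
 interpret sigma_finite_subalgebra M "F k" by (rule finite_sigma_subalgebra[OF prob_space_axioms sub_F])
 show ?thesis
 proof (rule real_cond_exp_charact)
  fix A assume A: "A \<in> sets (F k)"
  have Y: "indicator A \<in> borel_measurable (F k)" using A by simp
  have AM[measurable]: "A \<in> sets M" using A sub_F[of k] unfolding subalgebra_def by blast
  have "\<bar>indicator A om :: real\<bar> <= 1" for om by (simp add: indicator_def)
  note hi = hv_integral(2)[OF k _ Y this]
  have "(\<integral>om\<in>A. (\<epsilon> k om)^2 \<partial>M) = (\<integral>om. (\<Sum>v\<in>cube. indicator A om * (\<epsilon> k om)^2 * dir k v om) \<partial>M)"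
   unfolding set_lebesgue_integral_def
  proof (rule integral_cong_AE)
   show "AE om in M. indicator A om *\<^sub>R (\<epsilon> k om)^2 = (\<Sum>v\<in>cube. indicator A om * (\<epsilon> k om)^2 * dir k v om)"
    using sum_dir_AE[of "%om v. indicator A om * (\<epsilon> k om)^2" k] by eventually_elim simp
  qed measurable
  also have "... = (\<Sum>v\<in>cube. \<integral>om. indicator A om * (\<epsilon> k om)^2 * dir k v om \<partial>M)"
   using hi by (intro Bochner_Integration.integral_sum) auto
  also have "... = (\<Sum>v\<in>cube. (\<integral>om. indicator A om * hv k v om \<partial>M) / 2 ^ CARD('n))"
   using hi by (intro sum.cong) auto
  also have "... = (\<integral>om. (\<Sum>v\<in>cube. indicator A om * hv k v om / 2 ^ CARD('n)) \<partial>M)"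
   using hi by (subst Bochner_Integration.integral_sum) auto
  also have "... = (\<integral>om\<in>A. (\<Sum>v\<in>cube. hv k v om) / 2 ^ CARD('n) \<partial>M)"
   unfolding set_lebesgue_integral_def by (simp add: sum_distrib_left sum_divide_distrib)
  finally show "(\<integral>om\<in>A. (\<epsilon> k om)^2 \<partial>M) = (\<integral>om\<in>A. (\<Sum>v\<in>cube. hv k v om) / 2 ^ CARD('n) \<partial>M)" .
 next
  show "integrable M (%om. (\<Sum>v\<in>cube. hv k v om) / 2 ^ CARD('n))" using hv_integral(1)[OF k] by simp
  show "(%om. (\<Sum>v\<in>cube. hv k v om) / 2 ^ CARD('n)) \<in> borel_measurable (F k)"
   using hv_meas_F[OF k] by measurable
 qed (rule \<epsilon>_sq(1))
qed

text \<open>Equicontinuity at 0 makes the variances for the finitely many directions asymptotically equal to each other, hence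
equal to their average.\<close>

lemma hv_limit:
 assumes v: "v \<in> cube"
 shows "AE om in M. (%k. hv k v om) \<longlonglongrightarrow> \<sigma>^2"
proof -
 have "AE om in M. \<forall>k\<ge>K. real_cond_exp M (F k) (%om. (\<epsilon> k om)^2) om = (\<Sum>v\<in>cube. hv k v om) / 2 ^ CARD('n)"
  unfolding AE_all_countable using average_hv by auto
 with var_lim h_equicontinuous show ?thesis
 proof eventually_elim
  case (elim om)
  show ?case
  proof (rule LIMSEQ_I)
   fix e :: real assume e: "e > 0"
   obtain d where d: "d > 0" "!!k \<eta>. k >= K ==> norm \<eta> < d ==> \<bar>h k om \<eta> - h k om 0\<bar> < e / 4"
    using elim(2)[rule_format, of "e / 4"] e by auto
   have "(%k. c k * sqrt (real CARD('n))) \<longlonglongrightarrow> 0 * sqrt (real CARD('n))" by (intro tendsto_intros c_lim)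
   hence "\<forall>\<^sub>F k in sequentially. c k * sqrt (real CARD('n)) < d" using d by (intro order_tendstoD(2)) auto
   moreover have "\<forall>\<^sub>F k in sequentially. \<bar>real_cond_exp M (F k) (%om. (\<epsilon> k om)^2) om - \<sigma>^2\<bar> < e / 4"
    using elim(1) e unfolding tendsto_iff dist_real_def by (meson divide_pos_pos zero_less_numeral)
   ultimately have "\<forall>\<^sub>F k in sequentially. norm (hv k v om - \<sigma>^2) < e"
    using eventually_ge_at_top[of K]
   proof eventually_elim
    case (elim k)
    have near: "\<bar>hv k w om - h k om 0\<bar> <= e / 4" if "w \<in> cube" for w
     unfolding hv_def using d(2)[OF elim(3), of "c k *\<^sub>R w"] elim(1) c_pos[of k] by (simp add: cube_norm[OF that])
    let ?N = "2 ^ CARD('n) :: real"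
    let ?avg = "(\<Sum>v\<in>cube. hv k v om) / ?N"
    have "?avg - h k om 0 = (\<Sum>w\<in>(cube :: (real^'n) set). (hv k w om - h k om 0)) / ?N"
     by (simp add: sum_subtractf card_cube diff_divide_distrib)
    also have "\<bar>...\<bar> <= (\<Sum>w\<in>(cube :: (real^'n) set). e / 4) / ?N"
     unfolding abs_divide using near by (simp only: abs_of_pos zero_less_power zero_less_numeral)
      (intro divide_right_mono order_trans[OF sum_abs sum_mono], auto)
    also have "... = e / 4" by (simp add: card_cube)
    finally have "\<bar>?avg - h k om 0\<bar> <= e / 4" .
    moreover have "\<bar>?avg - \<sigma>^2\<bar> < e / 4"
     using elim(2) \<open>\<forall>k\<ge>K. real_cond_exp M (F k) (%om. (\<epsilon> k om)^2) om = (\<Sum>v\<in>cube. hv k v om) / 2 ^ CARD('n)\<close> elim(3) by simp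
    ultimately have "\<bar>hv k v om - \<sigma>^2\<bar> < e" using near[OF v] e by linarith
    thus ?case by simp
   qed
   thus "\<exists>n0. \<forall>k\<ge>n0. norm (hv k v om - \<sigma>^2) < e" unfolding eventually_sequentially .
  qed
 qed
qed

text \<open>Tested against the indicator of the event that \<open>hv\<close> exceeds \<open>B\<close>, the tails of \<open>hv\<close> are bounded by a multiple of those of the
squared noise, which are uniformly small.\<close>

lemma hv_L1:
 assumes v: "v \<in> cube"
 shows "(%k. \<integral>om. \<bar>hv k v om - \<sigma>^2\<bar> \<partial>M) \<longlonglongrightarrow> 0"
proof (rule L1_limit_if_tails_vanish[where ?n0.0 = K])
 show "integrable M (hv k v)" if "k >= K" for k by (rule hv_integral(1)[OF that v])
 show "AE om in M. 0 <= hv k v om" if "k >= K" for k by (rule hv_nonneg[OF that v])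
 show "AE om in M. (%k. hv k v om) \<longlonglongrightarrow> \<sigma>^2" by (rule hv_limit[OF v])
 fix e :: real assume e: "e > 0"
 let ?N = "2 ^ CARD('n) :: real"
 obtain B where B: "B > 0" "!!k. (\<integral>om. max ((\<epsilon> k om)^2 - B) 0 \<partial>M) <= e / ?N"
  using \<epsilon>_sq_tails[of "e / ?N"] e by auto
 have "(\<integral>om. max (hv k v om - B) 0 \<partial>M) <= e" if k: "k >= K" for k
 proof -
  have hF[measurable]: "hv k v \<in> borel_measurable (F k)" by (rule hv_meas_F[OF k])
  define Y :: "'s => real" where "Y om = (if B < hv k v om then 1 else 0)" for om
  have Ym: "Y \<in> borel_measurable (F k)" unfolding Y_def[abs_def] by measurable
  have [measurable]: "Y \<in> borel_measurable M" by (rule F_meas_lift(1)[OF Ym])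
  have Yb: "\<bar>Y om\<bar> <= 1" "0 <= Y om" "Y om <= 1" for om by (simp_all add: Y_def)
  have Yi: "integrable M Y" by (rule integrable_const_bound[where B = 1]) (use Yb in auto)
  note hi = hv_integral(2)[OF k v Ym Yb(1)]
  have "(\<integral>om. max (hv k v om - B) 0 \<partial>M) = (\<integral>om. Y om * hv k v om - B * Y om \<partial>M)"
   by (intro Bochner_Integration.integral_cong) (auto simp: Y_def max_def)
  also have "... = (\<integral>om. Y om * hv k v om \<partial>M) - B * (\<integral>om. Y om \<partial>M)" using hi Yi by simp
  also have "... = ?N * (\<integral>om. Y om * (\<epsilon> k om)^2 * dir k v om \<partial>M) - B * (?N * (\<integral>om. Y om * dir k v om \<partial>M))"
   using hi dir_independent(2)[OF v Ym dir_integrable[OF Yi]] by simp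
  also have "... = ?N * (\<integral>om. Y om * (\<epsilon> k om)^2 * dir k v om - B * (Y om * dir k v om) \<partial>M)"
   using hi dir_integrable[OF Yi] by (simp add: algebra_simps)
  also have "... <= ?N * (\<integral>om. max ((\<epsilon> k om)^2 - B) 0 \<partial>M)"
  proof (intro mult_left_mono integral_mono)
   show "integrable M (%om. Y om * (\<epsilon> k om)^2 * dir k v om - B * (Y om * dir k v om))"
    using hi dir_integrable[OF Yi] by simp
   show "integrable M (%om. max ((\<epsilon> k om)^2 - B) 0)" using \<epsilon>_sq(1) by (intro integrable_max) auto
   fix om
   have "Y om * (\<epsilon> k om)^2 * dir k v om - B * (Y om * dir k v om) = (Y om * dir k v om) * ((\<epsilon> k om)^2 - B)"
    by (simp add: algebra_simps)
   also have "... <= max ((\<epsilon> k om)^2 - B) 0"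
    using dir_01(1)[of k v om] by (auto simp: Y_def)
   finally show "Y om * (\<epsilon> k om)^2 * dir k v om - B * (Y om * dir k v om) <= max ((\<epsilon> k om)^2 - B) 0" .
  qed simp
  also have "... <= ?N * (e / ?N)" using B(2) by (intro mult_left_mono) auto
  finally show ?thesis by simp
 qed
 thus "\<exists>B. \<forall>k\<ge>K. (\<integral>om. max (hv k v om - B) 0 \<partial>M) <= e" by blast
qed

definition var_error :: "nat => real" where
 "var_error k = sqrt (real CARD('n)) * (\<integral>om. \<bar>\<epsilon> k om\<bar> * \<bar>rest_bound k om\<bar> \<partial>M) + (\<integral>om. (rest_bound k om)^2 \<partial>M)
  + real CARD('n) / (4 * 2 ^ CARD('n)) * (\<Sum>v\<in>cube. \<integral>om. \<bar>hv k v om - \<sigma>^2\<bar> \<partial>M)"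

lemmas rest_vanish = rest_sq_vanishes[OF X_lim c_lim]

lemma cross_vanish:
 "!!k. integrable M (%om. \<bar>\<epsilon> k om\<bar> * \<bar>rest_bound k om\<bar>)" "(%k. \<integral>om. \<bar>\<epsilon> k om\<bar> * \<bar>rest_bound k om\<bar> \<partial>M) \<longlonglongrightarrow> 0"
proof -
 note pv = product_integral_vanishes[of "%k. \<epsilon> k" rest_bound "1 + size_bound", OF _ _ \<epsilon>_sq rest_vanish]
 show "!!k. integrable M (%om. \<bar>\<epsilon> k om\<bar> * \<bar>rest_bound k om\<bar>)" by (rule pv(1)) measurable
 show "(%k. \<integral>om. \<bar>\<epsilon> k om\<bar> * \<bar>rest_bound k om\<bar> \<partial>M) \<longlonglongrightarrow> 0" by (rule pv(2)) measurable
qed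

lemma var_error_limit: "var_error \<longlonglongrightarrow> 0"
proof -
 have "var_error \<longlonglongrightarrow> sqrt (real CARD('n)) * 0 + 0 + real CARD('n) / (4 * 2 ^ CARD('n)) * (\<Sum>v\<in>(cube :: (real^'n) set). 0)"
  unfolding var_error_def[abs_def] by (intro tendsto_intros cross_vanish(2) rest_vanish(2) hv_L1) auto
 thus ?thesis by simp
qed

text \<open>By the decomposition of the error only \<open>\<epsilon>/2\<close> times the direction matters.  Given the direction \<open>v\<close>, its contribution is
\<open>(u \<bullet> v)^2 hv / 4\<close>, and the average of \<open>(u \<bullet> v)^2\<close> over the cube is the squared norm of \<open>u\<close>.\<close>

lemma err_variance:
 assumes k: "k >= K" and Ym: "Y \<in> borel_measurable (F k)" and Yb: "!!om. \<bar>Y om\<bar> <= 1"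
 shows "\<bar>\<integral>om. Y om * ((u \<bullet> (c k *\<^sub>R err k om))^2 - \<sigma>^2 / 4 * (norm u)^2) \<partial>M\<bar> <= var_error k * (norm u)^2"
proof -
 let ?n = "sqrt (real CARD('n))" and ?N = "2 ^ CARD('n) :: real"
 have [measurable]: "Y \<in> borel_measurable M" by (rule F_meas_lift(1)[OF Ym])
 define q where "q om = (\<Sum>v\<in>cube. (u \<bullet> v)^2 / 4 * (Y om * (\<epsilon> k om)^2 * dir k v om))" for om
 define w where "w om = (u \<bullet> (c k *\<^sub>R err k om))^2" for om
 have [measurable]: "q \<in> borel_measurable M" "w \<in> borel_measurable M"
  unfolding q_def[abs_def] w_def[abs_def] by measurable
 note hi = hv_integral(2)[OF k _ Ym Yb]
 have qi: "integrable M q" unfolding q_def using hi by simp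
 let ?U = "%om. (norm u)^2 * (?n * (\<bar>\<epsilon> k om\<bar> * \<bar>rest_bound k om\<bar>) + (rest_bound k om)^2)"
 have Ui: "integrable M ?U" using cross_vanish(1) rest_vanish(1) by simp
 have close: "AE om in M. \<bar>Y om * w om - q om\<bar> <= ?U om"
  using err_decomposition[of k] \<xi>_in_cube[of k] sum_dir_AE[of "%om v. (u \<bullet> v)^2 / 4 * (Y om * (\<epsilon> k om)^2)" k]
 proof eventually_elim
  case (elim om)
  define A where "A = u \<bullet> ((\<epsilon> k om / 2) *\<^sub>R \<xi> k om)"
  define R where "R = u \<bullet> (c k *\<^sub>R err k om - (\<epsilon> k om / 2) *\<^sub>R \<xi> k om)"
  have rb: "\<bar>rest_bound k om\<bar> = rest_bound k om" using rest_bound_nonneg by simp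
  have R: "\<bar>R\<bar> <= norm u * rest_bound k om"
   unfolding R_def by (rule order_trans[OF Cauchy_Schwarz_ineq2 mult_left_mono[OF elim(1)]]) simp
  have A: "\<bar>A\<bar> <= norm u * (\<bar>\<epsilon> k om\<bar> / 2 * ?n)"
   unfolding A_def by (rule order_trans[OF Cauchy_Schwarz_ineq2]) (simp add: cube_norm[OF elim(2)])
  have "q om = Y om * A^2"
  proof -
   have "q om = (\<Sum>v\<in>cube. (u \<bullet> v)^2 / 4 * (Y om * (\<epsilon> k om)^2) * dir k v om)" unfolding q_def by (simp add: mult.assoc)
   also have "... = (u \<bullet> \<xi> k om)^2 / 4 * (Y om * (\<epsilon> k om)^2)" using elim(3) by simp
   also have "... = Y om * A^2" by (simp add: A_def power_mult_distrib power_divide)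
   finally show ?thesis .
  qed
  moreover have "w om = (A + R)^2" by (simp add: w_def A_def R_def inner_diff_right)
  ultimately have "Y om * w om - q om = Y om * (2 * A * R + R^2)" by (simp add: power2_eq_square algebra_simps)
  hence "\<bar>Y om * w om - q om\<bar> = \<bar>Y om\<bar> * \<bar>2 * A * R + R^2\<bar>" by (simp only: abs_mult)
  also have "... <= 1 * (2 * \<bar>A\<bar> * \<bar>R\<bar> + \<bar>R\<bar>^2)"
  proof (rule mult_mono[OF Yb])
   show "\<bar>2 * A * R + R^2\<bar> <= 2 * \<bar>A\<bar> * \<bar>R\<bar> + \<bar>R\<bar>^2"
    by (rule order_trans[OF abs_triangle_ineq]) (simp add: abs_mult)
  qed auto
  also have "... <= 2 * (norm u * (\<bar>\<epsilon> k om\<bar> / 2 * ?n)) * (norm u * rest_bound k om) + (norm u * rest_bound k om)^2"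
   using A R rest_bound_nonneg[of k om]
   by (simp only: mult_1) (intro add_mono mult_mono power_mono, auto)
  also have "... = ?U om" unfolding rb by (simp add: power2_eq_square algebra_simps)
  finally show ?case .
 qed
 have wi: "integrable M (%om. Y om * w om)"
 proof (rule Bochner_Integration.integrable_bound)
  show "integrable M (%om. \<bar>q om\<bar> + ?U om)" using qi Ui by simp
  show "AE om in M. norm (Y om * w om) <= norm (\<bar>q om\<bar> + ?U om)"
   using close by eventually_elim (unfold real_norm_def, linarith)
 qed measurable
 have Yi: "integrable M Y" by (rule integrable_const_bound[where B = 1]) (use Yb in auto)
 have qv: "(\<integral>om. q om \<partial>M) = (\<Sum>v\<in>cube. (u \<bullet> v)^2 / (4 * ?N) * (\<integral>om. Y om * hv k v om \<partial>M))"
 proof -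
  have "(\<integral>om. q om \<partial>M) = (\<Sum>v\<in>cube. \<integral>om. (u \<bullet> v)^2 / 4 * (Y om * (\<epsilon> k om)^2 * dir k v om) \<partial>M)"
   unfolding q_def by (rule Bochner_Integration.integral_sum) (use hi in simp)
  also have "... = (\<Sum>v\<in>cube. (u \<bullet> v)^2 / (4 * ?N) * (\<integral>om. Y om * hv k v om \<partial>M))"
  proof (rule sum.cong[OF refl])
   fix v :: "real^'n" assume v: "v \<in> cube"
   have "(\<integral>om. (u \<bullet> v)^2 / 4 * (Y om * (\<epsilon> k om)^2 * dir k v om) \<partial>M)
     = (u \<bullet> v)^2 / 4 * (\<integral>om. Y om * (\<epsilon> k om)^2 * dir k v om \<partial>M)"
    by (rule integral_mult_right_zero)
   also have "... = (u \<bullet> v)^2 / 4 * ((\<integral>om. Y om * hv k v om \<partial>M) / ?N)" using hi[OF v] by simp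
   finally show "(\<integral>om. (u \<bullet> v)^2 / 4 * (Y om * (\<epsilon> k om)^2 * dir k v om) \<partial>M)
     = (u \<bullet> v)^2 / (4 * ?N) * (\<integral>om. Y om * hv k v om \<partial>M)" by simp
  qed
  finally show ?thesis .
 qed
 have nu: "(\<Sum>v\<in>cube. (u \<bullet> v)^2) = ?N * (norm u)^2"
 proof -
  have "(\<Sum>v\<in>cube. (u \<bullet> v)^2) = (\<Sum>v\<in>cube. u \<bullet> ((u \<bullet> v) *\<^sub>R v))" by (simp add: power2_eq_square)
  also have "... = u \<bullet> (\<Sum>v\<in>cube. (u \<bullet> v) *\<^sub>R v)" by (rule inner_sum_right[symmetric])
  finally show ?thesis unfolding cube_mean_inner by (simp add: power2_norm_eq_inner)
 qed
 have vterm: "\<sigma>^2 / 4 * (norm u)^2 * (\<integral>om. Y om \<partial>M) = (\<Sum>v\<in>cube. (u \<bullet> v)^2 / (4 * ?N) * (\<sigma>^2 * (\<integral>om. Y om \<partial>M)))"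
  unfolding sum_distrib_right[symmetric] sum_divide_distrib[symmetric] nu by (simp add: field_simps)
 have "(\<integral>om. Y om * ((u \<bullet> (c k *\<^sub>R err k om))^2 - \<sigma>^2 / 4 * (norm u)^2) \<partial>M) =
   (\<integral>om. Y om * w om - \<sigma>^2 / 4 * (norm u)^2 * Y om \<partial>M)" by (simp add: w_def algebra_simps)
 also have "... = (\<integral>om. Y om * w om \<partial>M) - \<sigma>^2 / 4 * (norm u)^2 * (\<integral>om. Y om \<partial>M)" using wi Yi by simp
 also have "... = (\<integral>om. Y om * w om - q om \<partial>M) + ((\<integral>om. q om \<partial>M) - \<sigma>^2 / 4 * (norm u)^2 * (\<integral>om. Y om \<partial>M))"
  using wi qi by simp
 finally have split: "(\<integral>om. Y om * ((u \<bullet> (c k *\<^sub>R err k om))^2 - \<sigma>^2 / 4 * (norm u)^2) \<partial>M) =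
   (\<integral>om. Y om * w om - q om \<partial>M) + ((\<integral>om. q om \<partial>M) - \<sigma>^2 / 4 * (norm u)^2 * (\<integral>om. Y om \<partial>M))" .
 have p1: "\<bar>\<integral>om. Y om * w om - q om \<partial>M\<bar> <= (norm u)^2 * (?n * (\<integral>om. \<bar>\<epsilon> k om\<bar> * \<bar>rest_bound k om\<bar> \<partial>M) + (\<integral>om. (rest_bound k om)^2 \<partial>M))"
 proof -
  have "\<bar>\<integral>om. Y om * w om - q om \<partial>M\<bar> <= (\<integral>om. \<bar>Y om * w om - q om\<bar> \<partial>M)" by (rule integral_abs_bound)
  also have "... <= (\<integral>om. ?U om \<partial>M)" using wi qi close by (intro integral_mono_AE Ui integrable_abs) auto
  also have "... = (norm u)^2 * (?n * (\<integral>om. \<bar>\<epsilon> k om\<bar> * \<bar>rest_bound k om\<bar> \<partial>M) + (\<integral>om. (rest_bound k om)^2 \<partial>M))"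
   using cross_vanish(1) rest_vanish(1) by simp
  finally show ?thesis .
 qed
 have p2: "\<bar>(\<integral>om. q om \<partial>M) - \<sigma>^2 / 4 * (norm u)^2 * (\<integral>om. Y om \<partial>M)\<bar>
   <= (norm u)^2 * (real CARD('n) / (4 * ?N) * (\<Sum>v\<in>cube. \<integral>om. \<bar>hv k v om - \<sigma>^2\<bar> \<partial>M))"
 proof -
  have one: "\<bar>(u \<bullet> v)^2 / (4 * ?N) * ((\<integral>om. Y om * hv k v om \<partial>M) - \<sigma>^2 * (\<integral>om. Y om \<partial>M))\<bar>
    <= (norm u)^2 * real CARD('n) / (4 * ?N) * (\<integral>om. \<bar>hv k v om - \<sigma>^2\<bar> \<partial>M)" if v: "v \<in> cube" for v
  proof -
   have hvi: "integrable M (%om. \<bar>hv k v om - \<sigma>^2\<bar>)" using hv_integral(1)[OF k v] by simp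
   have "(\<integral>om. Y om * hv k v om \<partial>M) - \<sigma>^2 * (\<integral>om. Y om \<partial>M) = (\<integral>om. Y om * hv k v om - \<sigma>^2 * Y om \<partial>M)"
    using hi[OF v] Yi by simp
   also have "\<bar>...\<bar> <= (\<integral>om. \<bar>Y om * hv k v om - \<sigma>^2 * Y om\<bar> \<partial>M)" by (rule integral_abs_bound)
   also have "... <= (\<integral>om. \<bar>hv k v om - \<sigma>^2\<bar> \<partial>M)"
   proof (rule integral_mono[OF _ hvi])
    show "integrable M (%om. \<bar>Y om * hv k v om - \<sigma>^2 * Y om\<bar>)" using hi[OF v] Yi by simp
    fix om
    have "\<bar>Y om * hv k v om - \<sigma>^2 * Y om\<bar> = \<bar>Y om\<bar> * \<bar>hv k v om - \<sigma>^2\<bar>"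
     by (simp add: abs_mult[symmetric] algebra_simps)
    also have "... <= 1 * \<bar>hv k v om - \<sigma>^2\<bar>" by (rule mult_right_mono[OF Yb]) simp
    finally show "\<bar>Y om * hv k v om - \<sigma>^2 * Y om\<bar> <= \<bar>hv k v om - \<sigma>^2\<bar>" by simp
   qed
   finally have b: "\<bar>(\<integral>om. Y om * hv k v om \<partial>M) - \<sigma>^2 * (\<integral>om. Y om \<partial>M)\<bar> <= (\<integral>om. \<bar>hv k v om - \<sigma>^2\<bar> \<partial>M)" .
   have "\<bar>u \<bullet> v\<bar> <= norm u * ?n" using Cauchy_Schwarz_ineq2[of u v] by (simp add: cube_norm[OF v])
   from power_mono[OF this, of 2] have s: "(u \<bullet> v)^2 <= (norm u)^2 * real CARD('n)" by (simp add: power_mult_distrib)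
   have "\<bar>(u \<bullet> v)^2 / (4 * ?N) * ((\<integral>om. Y om * hv k v om \<partial>M) - \<sigma>^2 * (\<integral>om. Y om \<partial>M))\<bar>
    = (u \<bullet> v)^2 / (4 * ?N) * \<bar>(\<integral>om. Y om * hv k v om \<partial>M) - \<sigma>^2 * (\<integral>om. Y om \<partial>M)\<bar>" by (simp add: abs_mult)
   also have "... <= (norm u)^2 * real CARD('n) / (4 * ?N) * (\<integral>om. \<bar>hv k v om - \<sigma>^2\<bar> \<partial>M)"
    by (intro mult_mono b divide_right_mono s) auto
   finally show ?thesis .
  qed
  have "(\<integral>om. q om \<partial>M) - \<sigma>^2 / 4 * (norm u)^2 * (\<integral>om. Y om \<partial>M) =
    (\<Sum>v\<in>cube. (u \<bullet> v)^2 / (4 * ?N) * ((\<integral>om. Y om * hv k v om \<partial>M) - \<sigma>^2 * (\<integral>om. Y om \<partial>M)))"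
   unfolding qv vterm by (simp only: sum_subtractf right_diff_distrib)
  also have "\<bar>...\<bar> <= (\<Sum>v\<in>cube. (norm u)^2 * real CARD('n) / (4 * ?N) * (\<integral>om. \<bar>hv k v om - \<sigma>^2\<bar> \<partial>M))"
   by (rule order_trans[OF sum_abs sum_mono[OF one]])
  also have "... = (norm u)^2 * (real CARD('n) / (4 * ?N) * (\<Sum>v\<in>cube. \<integral>om. \<bar>hv k v om - \<sigma>^2\<bar> \<partial>M))"
   by (simp add: sum_distrib_left mult_ac)
  finally show ?thesis .
 qed
 show ?thesis
  unfolding split var_error_def
  using order_trans[OF abs_triangle_ineq add_mono[OF p1 p2]] by (simp add: algebra_simps)
qed

end

section \<open>Gradient schemes near a stable equilibrium\<close>

lemma gradient_has_derivative_hessian: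
 assumes "gradient f differentiable (at x)"
 shows "(gradient f has_derivative (%u. hessian f x *v u)) (at x)"
proof -
 obtain D where D: "(gradient f has_derivative D) (at x)" using assms unfolding differentiable_def by blast
 have "D u = hessian f x *v u" for u
 proof (rule iffD2[OF vec_eq_iff], rule allI)
  fix i
  have "((%y. gradient f y $ i) has_derivative (%u. D u $ i)) (at x)"
   by (rule bounded_linear.has_derivative[OF bounded_linear_vec_nth D])
  hence "(partial i f has_derivative (%u. D u $ i)) (at x)" by (simp add: gradient_def)
  moreover have "(partial i f has_derivative (%u. gradient (partial i f) x \<bullet> u)) (at x)"
   by (rule has_derivative_gradient[OF partial_differentiable_if_gradient_differentiable[OF assms]])
  ultimately have "(%u. D u $ i) = (%u. gradient (partial i f) x \<bullet> u)" by (rule has_derivative_unique)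
  hence "D u $ i = gradient (partial i f) x \<bullet> u" by meson
  also have "... = (hessian f x *v u) $ i"
   by (simp add: hessian_def gradient_def matrix_vector_mult_def inner_vec_def)
  finally show "D u $ i = (hessian f x *v u) $ i" .
 qed
 hence "D = (%u. hessian f x *v u)" by blast
 with D show ?thesis by simp
qed

text \<open>Along the flow \<open>f\<close> decreases towards \<open>f z\<close>.\<close>

lemma attracted_value_ge:
 assumes f: "!!x. f differentiable (at x)" and p: "p \<in> attraction_domain (%x. - gradient f x) z"
 shows "f z <= f p"
proof -
 obtain \<phi> where sol: "ode_solution (%x. - gradient f x) {0..} \<phi>" "\<phi> 0 = p" and lim: "(\<phi> \<longlongrightarrow> z) at_top"
  using p unfolding attraction_domain_def by blast
 have d: "((%t. f (\<phi> t)) has_real_derivative (- ((norm (gradient f (\<phi> t)))^2))) (at t within {0..})" if "t >= 0" for t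
 proof -
  have "(\<phi> has_derivative (%s. s *\<^sub>R (- gradient f (\<phi> t)))) (at t within {0..})"
   using sol(1) that by (simp add: ode_solution_def has_vector_derivative_def)
  from has_derivative_compose[OF this has_derivative_gradient[OF f]]
  have "((%t. f (\<phi> t)) has_derivative (%s. gradient f (\<phi> t) \<bullet> (s *\<^sub>R (- gradient f (\<phi> t))))) (at t within {0..})" .
  moreover have "(%s. gradient f (\<phi> t) \<bullet> (s *\<^sub>R (- gradient f (\<phi> t)))) = (*) (- ((norm (gradient f (\<phi> t)))^2))"
   by (simp add: fun_eq_iff power2_norm_eq_inner)
  ultimately show ?thesis by (simp add: has_field_derivative_def)
 qed
 have le: "f (\<phi> t) <= f p" if "t > 0" for t
 proof -
  have "f (\<phi> t) <= f (\<phi> 0)"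
  proof (rule DERIV_nonpos_imp_decreasing_open[of 0 t])
   show "0 <= t" using that by simp
  next
   fix s assume s: "0 < s" "s < t"
   have "at s within {0..} = at s" using s by (intro at_within_interior) (simp add: interior_Ici[of 0 "-1"])
   with d[of s] s show "\<exists>y. ((%t. f (\<phi> t)) has_real_derivative y) (at s) \<and> y <= 0"
    by (intro exI[of _ "- ((norm (gradient f (\<phi> s)))^2)"]) simp
  next
   show "continuous_on {0..t} (%t. f (\<phi> t))"
    unfolding continuous_on_eq_continuous_within
   proof
    fix s assume "s \<in> {0..t}"
    hence "((%t. f (\<phi> t)) has_real_derivative (- ((norm (gradient f (\<phi> s)))^2))) (at s within {0..t})"
     by (intro DERIV_subset[OF d]) auto
    thus "continuous (at s within {0..t}) (%t. f (\<phi> t))" by (rule DERIV_continuous)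
   qed
  qed
  thus ?thesis using sol(2) by simp
 qed
 have "isCont f z" using f by (simp add: differentiable_imp_continuous_within)
 hence "((%t. f (\<phi> t)) \<longlongrightarrow> f z) at_top" using lim by (rule isCont_tendsto_compose)
 thus ?thesis
  by (rule tendsto_upperbound) (use le in \<open>auto intro: eventually_mono[OF eventually_gt_at_top[of 0]]\<close>)
qed

lemma stable_equilibrium_gradient_zero:
 assumes "asymptotically_stable (%x. - gradient f x) z"
 shows "gradient f z = 0"
proof -
 have "((%t::real. z) has_vector_derivative - gradient f z) (at 0)"
  using assms unfolding asymptotically_stable_def ode_solution_def by auto
 hence "- gradient f z = 0"
  by (rule vector_derivative_unique_at) (rule has_vector_derivative_const)
 thus ?thesis by simp
qed

text \<open>As all points near \<open>z\<close> are attracted, \<open>z\<close> is a local minimum; on a line along which the second derivative is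
negative \<open>f\<close> would fall below its value at \<open>z\<close>.\<close>

lemma stable_equilibrium_hessian_nonneg:
 assumes f: "!!x. f differentiable (at x)" and g: "gradient f differentiable (at z)"
  and stable: "asymptotically_stable (%x. - gradient f x) z"
 shows "0 <= (hessian f z *v u) \<bullet> u"
proof (rule ccontr)
 assume "\<not> ?thesis"
 hence neg: "(hessian f z *v u) \<bullet> u < 0" by simp
 hence u: "u \<noteq> 0" by auto
 obtain d where d: "d > 0" "ball z d \<subseteq> attraction_domain (%x. - gradient f x) z"
  using stable unfolding asymptotically_stable_def by blast
 let ?p = "%t. gradient f (z + t *\<^sub>R u) \<bullet> u"
 have "((%y. gradient f y \<bullet> u) has_derivative (%h. (hessian f z *v h) \<bullet> u)) (at (z + 0 *\<^sub>R u))"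
  using gradient_has_derivative_hessian[OF g] by (auto intro!: has_derivative_inner_left)
 from line_has_derivative[OF this]
 have "(?p has_real_derivative (hessian f z *v u) \<bullet> u) (at 0)" .
 moreover have "?p 0 = 0" using stable_equilibrium_gradient_zero[OF stable] by simp
 ultimately obtain e where e: "e > 0" "!!h. 0 < h ==> h < e ==> ?p h < 0"
  using DERIV_neg_dec_right[of ?p _ 0] neg by force
 define s where "s = min (e / 2) (d / (2 * norm u))"
 have s: "0 < s" "s < e" "s * norm u < d"
 proof -
  show "0 < s" "s < e" using e d u by (auto simp: s_def)
  have "s * norm u <= d / (2 * norm u) * norm u" by (rule mult_right_mono) (simp_all add: s_def)
  also have "... = d / 2" using u by simp
  also have "... < d" using d by simp
  finally show "s * norm u < d" .
 qed
 have "f (z + s *\<^sub>R u) < f (z + 0 *\<^sub>R u)"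
 proof (rule DERIV_neg_imp_decreasing_open[OF s(1)])
  fix t assume "0 < t" "t < s"
  thus "\<exists>y. ((%t. f (z + t *\<^sub>R u)) has_real_derivative y) (at t) \<and> y < 0"
   using line_has_derivative_gradient[OF f, where x = z and t = t and v = u] e(2)[of t] s by (intro exI[of _ "?p t"]) auto
 next
  show "continuous_on {0..s} (%t. f (z + t *\<^sub>R u))"
   using line_has_derivative_gradient[OF f, where x = z and v = u]
   by (intro continuous_at_imp_continuous_on ballI) (rule DERIV_isCont)
 qed
 moreover have "f z <= f (z + s *\<^sub>R u)"
  by (rule attracted_value_ge[OF f]) (use d s in \<open>auto simp: dist_norm\<close>)
 ultimately show False by simp
qed

lemma gradient_strongly_monotone_near:
 assumes g: "gradient f differentiable (at z)" "gradient f z = 0"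
  and \<kappa>: "\<kappa> > 0" "!!u. \<kappa> * (norm u)^2 <= (hessian f z *v u) \<bullet> u"
 obtains \<rho> where "\<rho> > 0" "!!x. dist x z <= \<rho> ==> \<kappa> / 2 * (norm (x - z))^2 <= gradient f x \<bullet> (x - z)"
proof -
 have "\<exists>d>0. \<forall>y. norm (y - z) < d --> norm (gradient f y - gradient f z - hessian f z *v (y - z)) <= \<kappa> / 2 * norm (y - z)"
  using gradient_has_derivative_hessian[OF g(1)] half_gt_zero[OF \<kappa>(1)] unfolding has_derivative_at_alt by blast
 then obtain d where d: "d > 0" "!!y. norm (y - z) < d ==> norm (gradient f y - hessian f z *v (y - z)) <= \<kappa> / 2 * norm (y - z)"
  using g(2) by auto
 have "\<kappa> / 2 * (norm (x - z))^2 <= gradient f x \<bullet> (x - z)" if "dist x z <= d / 2" for x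
 proof -
  let ?r = "gradient f x - hessian f z *v (x - z)"
  have "\<bar>?r \<bullet> (x - z)\<bar> <= norm ?r * norm (x - z)" by (rule Cauchy_Schwarz_ineq2)
  also have "... <= \<kappa> / 2 * norm (x - z) * norm (x - z)"
   by (intro mult_right_mono d(2)) (use that d in \<open>auto simp: dist_norm\<close>)
  finally have "\<bar>?r \<bullet> (x - z)\<bar> <= \<kappa> / 2 * (norm (x - z))^2" by (simp add: power2_eq_square)
  moreover have "gradient f x \<bullet> (x - z) = (hessian f z *v (x - z)) \<bullet> (x - z) + ?r \<bullet> (x - z)"
   by (simp add: inner_diff_left)
  ultimately show ?thesis using \<kappa>(2)[of "x - z"] by linarith
 qed
 with d(1) show ?thesis by (intro that[of "d / 2"]) auto
qed

text \<open>The second partials are continuous near the iterates since the third ones are.  Bounded iterates stay within a compact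
set whose points are all closer than \<open>r\<close> to some iterate, which bounds the second partials uniformly.\<close>

lemma gradient_uniformly_lipschitz_along:
 fixes f :: "real^'n::finite => real" and x :: "nat => real^'n"
 assumes g: "!!x. gradient f differentiable (at x)" and bdd: "bounded (range x)" and r: "r > 0"
  and smooth: "!!k i j l y. k >= K ==> y \<in> ball (x k) r ==> partial_differentiable l (partial j (partial i f)) y"
   "!!k i j l. k >= K ==> continuous_on (ball (x k) r) (third_partial f i j l)"
 shows "\<exists>L. \<forall>k\<ge>K. L-lipschitz_on (cball (x k) (r / 2)) (gradient f)"
proof -
 define V where "V = {v + w | v w. v \<in> closure (range (%k. x (K + k))) \<and> w \<in> cball 0 (r / 2)}"
 have V: "compact V"
  unfolding V_def
 proof (rule compact_sums)
  have "bounded (range (%k. x (K + k)))" by (rule bounded_subset[OF bdd]) auto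
  thus "compact (closure (range (%k. x (K + k))))" by (simp add: compact_closure)
 qed simp
 have cont: "continuous_on V (partial j (partial i f))" for i j
 proof (rule continuous_at_imp_continuous_on, rule ballI)
  fix y assume "y \<in> V"
  then obtain v where v: "v \<in> closure (range (%k. x (K + k)))" "dist v y <= r / 2"
   unfolding V_def by (auto simp: dist_norm)
  obtain k where k: "dist (x (K + k)) v < r / 2"
   using v(1) r unfolding closure_approachable by (metis half_gt_zero rangeE)
  have y: "y \<in> ball (x (K + k)) r" using dist_triangle[of "x (K + k)" y v] k v(2) by (simp add: dist_commute)
  have "partial j (partial i f) differentiable (at y)"
   by (rule differentiable_if_continuous_partials[OF open_ball y])
    (use smooth[of "K + k"] in \<open>auto simp: third_partial_def[abs_def]\<close>)
  thus "isCont (partial j (partial i f)) y" by (simp add: differentiable_imp_continuous_within)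
 qed
 have "continuous_on V (%y. \<Sum>i\<in>UNIV. \<Sum>j\<in>UNIV. \<bar>partial j (partial i f) y\<bar>)"
  by (intro continuous_intros cont)
 hence "bounded ((%y. \<Sum>i\<in>UNIV. \<Sum>j\<in>UNIV. \<bar>partial j (partial i f) y\<bar>) ` V)"
  by (rule compact_imp_bounded[OF compact_continuous_image[OF _ V]])
 then obtain B where B: "B > 0" "!!y. y \<in> V ==> norm (\<Sum>i\<in>UNIV. \<Sum>j\<in>UNIV. \<bar>partial j (partial i f) y\<bar>) <= B"
  unfolding bounded_pos by auto
 have "B-lipschitz_on (cball (x k) (r / 2)) (gradient f)" if k: "k >= K" for k
 proof (rule lipschitz_onI)
  fix y z assume yz: "y \<in> cball (x k) (r / 2)" "z \<in> cball (x k) (r / 2)"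
  have sub: "w \<in> V" if "w \<in> cball (x k) (r / 2)" for w
  proof -
   have "x k \<in> range (%m. x (K + m))" using k by (intro image_eqI[of _ _ "k - K"]) auto
   hence "x k \<in> closure (range (%m. x (K + m)))" by (rule subsetD[OF closure_subset])
   moreover have "w - x k \<in> cball 0 (r / 2)" using that by (simp add: dist_norm norm_minus_commute)
   ultimately show ?thesis unfolding V_def mem_Collect_eq
    by (intro exI[of _ "x k"] exI[of _ "w - x k"]) simp
  qed
  have "norm (gradient f y - gradient f z) <= B * norm (y - z)"
  proof (rule differentiable_bound[of "cball (x k) (r / 2)" "gradient f" "%w u. hessian f w *v u"])
   fix w assume w: "w \<in> cball (x k) (r / 2)"
   show "(gradient f has_derivative (%u. hessian f w *v u)) (at w within cball (x k) (r / 2))"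
    by (rule has_derivative_at_withinI[OF gradient_has_derivative_hessian[OF g]])
   show "onorm (%u. hessian f w *v u) <= B"
   proof (rule onorm_bound)
    fix u :: "real^'n"
    have "norm (hessian f w *v u) <= (\<Sum>i\<in>UNIV. \<bar>(hessian f w *v u) $ i\<bar>)" by (rule norm_le_l1_cart)
    also have "... <= (\<Sum>i\<in>UNIV. \<Sum>j\<in>UNIV. \<bar>partial j (partial i f) w\<bar> * norm u)"
    proof (rule sum_mono)
     fix i :: 'n
     have "\<bar>(hessian f w *v u) $ i\<bar> <= (\<Sum>j\<in>UNIV. \<bar>partial j (partial i f) w * u $ j\<bar>)"
      by (simp add: hessian_def matrix_vector_mult_def sum_abs)
     also have "... <= (\<Sum>j\<in>UNIV. \<bar>partial j (partial i f) w\<bar> * norm u)"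
      unfolding abs_mult by (intro sum_mono mult_left_mono component_le_norm_cart) simp
     finally show "\<bar>(hessian f w *v u) $ i\<bar> <= (\<Sum>j\<in>UNIV. \<bar>partial j (partial i f) w\<bar> * norm u)" .
    qed
    also have "... = (\<Sum>i\<in>UNIV. \<Sum>j\<in>UNIV. \<bar>partial j (partial i f) w\<bar>) * norm u"
     by (simp only: sum_distrib_right)
    also have "... <= B * norm u"
     using B(2)[OF sub[OF w]] by (intro mult_right_mono) auto
    finally show "norm (hessian f w *v u) <= B * norm u" .
   qed (use B in simp)
  qed (use yz in auto)
  thus "dist (gradient f y) (gradient f z) <= B * dist y z" by (simp add: dist_norm)
 qed (use B in simp)
 thus ?thesis by blast
qed

text \<open>Shifting the path by the tail of the convergent noise series turns the noise into a vanishing perturbation of the field.\<close>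

lemma perturbed_gradient_scheme_converges:
 fixes f :: "real^'n::finite => real" and x e :: "nat => real^'n"
 assumes f: "!!x. f differentiable (at x)" and g: "!!x. gradient f differentiable (at x)"
  and step: "!!k. x (Suc k) = x k - a k *\<^sub>R (spsa_mean f (c k) (x k) + e k)"
  and a: "!!k. a k > 0" "a \<longlonglongrightarrow> 0" "\<not> summable a" and c: "!!k. c k > 0" "c \<longlonglongrightarrow> 0"
  and noise: "summable (%k. a k *\<^sub>R e k)" and bdd: "bounded (range x)"
  and zero: "gradient f z = 0"
  and pos: "\<kappa> > 0" "!!u. \<kappa> * (norm u)^2 <= (hessian f z *v u) \<bullet> u"
  and S: "compact S" "S \<subseteq> attraction_domain (%x. - gradient f x) z" "\<exists>\<^sub>\<infinity>k. x k \<in> S"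
  and r: "r > 0"
  and smooth: "!!k i j l y. k >= K ==> y \<in> ball (x k) r ==> partial_differentiable l (partial j (partial i f)) y"
   "!!k i j l. k >= K ==> continuous_on (ball (x k) r) (third_partial f i j l)"
 shows "x \<longlonglongrightarrow> z"
proof -
 let ?g = "gradient f"
 obtain L where L: "!!k. k >= K ==> L-lipschitz_on (cball (x k) (r / 2)) ?g"
  using gradient_uniformly_lipschitz_along[OF g bdd r, of K] smooth by blast
 define d where "d n = (\<Sum>k<n. a k *\<^sub>R e k) - (\<Sum>k. a k *\<^sub>R e k)" for n
 have d: "d \<longlonglongrightarrow> 0"
  unfolding d_def[abs_def] by (rule LIM_zero[OF summable_LIMSEQ[OF noise]])
 define y where "y n = x n + d n" for n
 define b where "b n = spsa_mean f (c n) (x n) - ?g (y n)" for n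
 have ystep: "y (Suc n) = y n - a n *\<^sub>R (?g (y n) + b n)" for n
  by (simp add: y_def b_def d_def step algebra_simps)
 let ?n = "real CARD('n)"
 have "\<forall>\<^sub>F n in sequentially. c n * sqrt ?n < r / 2"
  by (rule order_tendstoD(2)[OF tendsto_mult_left_zero[OF c(2)]]) (use r in simp)
 moreover have "\<forall>\<^sub>F n in sequentially. norm (d n) < r / 4"
  by (rule order_tendstoD(2)[OF tendsto_norm_zero[OF d]]) (use r in simp)
 ultimately have "\<forall>\<^sub>F n in sequentially. c n * sqrt ?n < r / 2 \<and> norm (d n) < r / 4 \<and> n >= K"
  using eventually_ge_at_top[of K] by eventually_elim simp
 then obtain K' where K': "!!n. n >= K' ==> c n * sqrt ?n < r / 2" "!!n. n >= K' ==> norm (d n) < r / 4" "!!n. n >= K' ==> n >= K"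
  unfolding eventually_sequentially by blast
 have sub: "cball (y n) (r / 4) \<subseteq> cball (x n) (r / 2)" if "n >= K'" for n
 proof
  fix w assume "w \<in> cball (y n) (r / 4)"
  moreover have "dist (x n) (y n) < r / 4" using K'(2)[OF that] by (simp add: y_def dist_norm)
  ultimately show "w \<in> cball (x n) (r / 2)" using dist_triangle[of "x n" w "y n"] by simp
 qed
 have lip: "L-lipschitz_on (cball (y n) (r / 4)) ?g" if "n >= K'" for n
  by (rule lipschitz_on_subset[OF L[OF K'(3)[OF that]] sub[OF that]])
 have b: "b \<longlonglongrightarrow> 0"
 proof (rule Lim_null_comparison)
  have "norm (b n) <= L * c n * ?n * sqrt ?n + L * norm (d n)" if n: "n >= K'" for n
  proof -
   have "norm (spsa_mean f (c n) (x n) - ?g (x n)) <= L * c n * ?n * sqrt ?n"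
    by (rule spsa_mean_error_lipschitz[OF f c(1) L[OF K'(3)[OF n]]]) (use K'(1)[OF n] in simp)
   moreover have "dist (?g (x n)) (?g (y n)) <= L * dist (x n) (y n)"
    by (rule lipschitz_onD[OF L[OF K'(3)[OF n]]]) (use r subsetD[OF sub[OF n], of "y n"] in simp_all)
   moreover have "norm (b n) <= norm (spsa_mean f (c n) (x n) - ?g (x n)) + norm (?g (x n) - ?g (y n))"
    unfolding b_def
    using norm_triangle_ineq[of "spsa_mean f (c n) (x n) - ?g (x n)" "?g (x n) - ?g (y n)"] by simp
   ultimately show ?thesis by (simp add: dist_norm y_def)
  qed
  thus "\<forall>\<^sub>F n in sequentially. norm (b n) <= L * c n * ?n * sqrt ?n + L * norm (d n)"
   unfolding eventually_sequentially by blast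
  have "(%n. L * c n * ?n * sqrt ?n + L * norm (d n)) \<longlonglongrightarrow> L * 0 * ?n * sqrt ?n + L * norm (0 :: real^'n)"
   by (intro tendsto_intros c d)
  thus "(%n. L * c n * ?n * sqrt ?n + L * norm (d n)) \<longlonglongrightarrow> 0" by simp
 qed
 have gc: "continuous_on UNIV ?g"
  using g by (simp add: continuous_on_eq_continuous_at differentiable_imp_continuous_within)
 have "infinite {k. x k \<in> S}" using S(3) by (simp add: INFM_iff_infinite)
 from infinite_enumerate[OF this] obtain s :: "nat => nat" where s: "strict_mono s" and "\<forall>n. s n \<in> {k. x k \<in> S}" by blast
 hence xs: "!!n. x (s n) \<in> S" by blast
 from S(1)[unfolded compact_def, rule_format, of "x \<circ> s"] xs
 obtain p t where p: "p \<in> S" "strict_mono t" "((x \<circ> s) \<circ> t) \<longlonglongrightarrow> p" by auto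
 have st: "strict_mono (s \<circ> t)" by (rule strict_mono_o[OF s p(2)])
 have ylim: "(y \<circ> (s \<circ> t)) \<longlonglongrightarrow> p"
 proof -
  have "(%n. ((x \<circ> s) \<circ> t) n + (d \<circ> (s \<circ> t)) n) \<longlonglongrightarrow> p + 0"
   by (intro tendsto_add p(3) LIMSEQ_subseq_LIMSEQ[OF d st])
  thus ?thesis by (simp add: y_def[abs_def] comp_def)
 qed
 have near: "\<exists>\<^sub>\<infinity>k. dist (y k) p < e" if "e > 0" for e
  unfolding INFM_nat
 proof
  fix m
  have "\<forall>\<^sub>F n in sequentially. dist ((y \<circ> (s \<circ> t)) n) p < e" using ylim that by (rule tendstoD)
  then obtain n where n: "n >= Suc m" "dist (y ((s \<circ> t) n)) p < e"
   using eventually_conj[OF _ eventually_ge_at_top[of "Suc m"]] by (metis (mono_tags, lifting) comp_apply eventually_happens sequentially_bot)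
  thus "\<exists>k>m. dist (y k) p < e" using seq_suble[OF st, of n] by (intro exI[of _ "(s \<circ> t) n"]) auto
 qed
 obtain \<phi> where \<phi>: "ode_solution (%x. - ?g x) {0..} \<phi>" "\<phi> 0 = p" "(\<phi> \<longlongrightarrow> z) at_top"
  using p(1) S(2) unfolding attraction_domain_def by blast
 have near_z: "\<exists>\<^sub>\<infinity>k. dist (y k) z < e" if e: "e > 0" for e
 proof -
  have "\<forall>\<^sub>F T in at_top. dist (\<phi> T) z < e / 2" using \<phi>(3) e by (intro tendstoD) auto
  then obtain T where T: "T >= 0" "dist (\<phi> T) z < e / 2"
   using eventually_conj[OF _ eventually_ge_at_top[of "0::real"]] by (metis (mono_tags, lifting) eventually_happens trivial_limit_at_top_linorder)
  have "\<exists>\<^sub>\<infinity>k. dist (y k) (\<phi> T) < e / 2"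
  proof (rule euler_scheme_tracks_solution[where g = ?g and b = b and a = a and K = K' and L = L and r = "r / 4"])
   show "(\<phi> has_vector_derivative - ?g (\<phi> t)) (at t within {0..})" if "t >= 0" for t
    using \<phi>(1) that unfolding ode_solution_def by simp
   show "\<exists>\<^sub>\<infinity>k. dist (y k) (\<phi> 0) < e'" if "e' > 0" for e' using near[OF that] \<phi>(2) by simp
  qed (use ystep a b r lip gc T e in auto)
  thus ?thesis
  proof (rule INFM_mono)
   fix k assume "dist (y k) (\<phi> T) < e / 2"
   thus "dist (y k) z < e" using T(2) dist_triangle[of "y k" z "\<phi> T"] by linarith
  qed
 qed
 obtain \<rho> where \<rho>: "\<rho> > 0" "!!x. dist x z <= \<rho> ==> \<kappa> / 2 * (norm (x - z))^2 <= ?g x \<bullet> (x - z)"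
  using gradient_strongly_monotone_near[OF g zero pos] by blast
 have "y \<longlonglongrightarrow> z"
  by (rule euler_scheme_absorbed[where g = ?g and b = b and a = a and K = 0 and \<kappa> = "\<kappa> / 2" and \<rho> = \<rho>])
   (use ystep a b gc pos \<rho> near_z in auto)
 from tendsto_diff[OF this d] show ?thesis by (simp add: y_def[abs_def])
qed

section \<open>Summability of the scaled errors\<close>

context spsa_noise begin

text \<open>In each coordinate this is a martingale whose increments have second moments of order \<open>(a k / c k)^2\<close>.\<close>

lemma noise_sum_converges:
 assumes c: "!!k. k >= 1 ==> c k <= cb" and sq: "summable (%k. (a k / c k)^2)"
 shows "AE om in M. summable (%k. a k *\<^sub>R err k om)"
proof -
 define cm where "cm = max cb (c 0)"
 have cm: "c k <= cm" for k using c[of k] by (cases "k = 0") (auto simp: cm_def)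
 have sq_le: "x^2 <= 1 + x powr p" if "0 <= x" for x :: real
  using powr_le_one_plus[of x 2 p] that p by simp
 have comp: "AE om in M. summable (%k. a k * err k om $ i)" for i
 proof -
  have bound: "(a k * err k om $ i)^2 <= (a k / c k)^2 * (1 + norm (c k *\<^sub>R err k om) powr p)" for k om
  proof -
   have "a k * err k om $ i = a k / c k * ((c k *\<^sub>R err k om) $ i)" using c_pos[of k] by simp
   moreover have "((c k *\<^sub>R err k om) $ i)^2 <= (norm (c k *\<^sub>R err k om))^2"
    using component_le_norm_cart[of "c k *\<^sub>R err k om" i] by (metis abs_ge_zero power2_abs power_mono)
   moreover have "(norm (c k *\<^sub>R err k om))^2 <= 1 + norm (c k *\<^sub>R err k om) powr p" by (rule sq_le) simp
   ultimately show ?thesis by (simp only: power_mult_distrib) (intro mult_left_mono, auto)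
  qed
  have bi: "integrable M (%om. (a k / c k)^2 * (1 + norm (c k *\<^sub>R err k om) powr p))" for k
   using err_moment(1)[OF cm[of k]] by (intro integrable_mult_right Bochner_Integration.integrable_add) auto
  have int: "integrable M (%om. (a k * err k om $ i)^2)" for k
   by (rule Bochner_Integration.integrable_bound[OF bi[of k]]) (measurable, use bound[of k] in \<open>auto intro!: AE_I2 order_trans[OF _ abs_ge_self]\<close>)
  interpret square_integrable_martingale M F "%k om. a k * err k om $ i"
  proof
   show "(%om. a n * err n om $ i) \<in> borel_measurable (F (Suc n))" for n
    using err_meas_F[of n] by measurable
   show "AE om in M. real_cond_exp M (F n) (%om. a n * err n om $ i) om = 0" for n
   proof -
    interpret S: sigma_finite_subalgebra M "F n" by (rule finite_sigma_subalgebra[OF prob_space_axioms sub_F])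
    show ?thesis
     using S.real_cond_exp_cmult[OF err_integrable[of n i], of "a n"] err_centred[of n i]
     by eventually_elim simp
   qed
  qed (rule sub_F F_mono int)+
  show ?thesis
  proof (rule sum_converges, rule summable_comparison_test_ev)
   show "summable (%n. (a n / c n)^2 * (1 + err_const cm))" by (rule summable_mult2[OF sq])
   show "\<forall>\<^sub>F n in sequentially. norm (\<integral>om. (a n * err n om $ i)^2 \<partial>M) <= (a n / c n)^2 * (1 + err_const cm)"
   proof (rule always_eventually, rule allI)
    fix n
    have "(\<integral>om. (a n * err n om $ i)^2 \<partial>M) <= (\<integral>om. (a n / c n)^2 * (1 + norm (c n *\<^sub>R err n om) powr p) \<partial>M)"
     by (rule integral_mono[OF int bi bound])
    also have "... = (a n / c n)^2 * (1 + (\<integral>om. norm (c n *\<^sub>R err n om) powr p \<partial>M))"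
     using err_moment(1)[OF cm[of n]] by (simp add: prob_space)
    also have "... <= (a n / c n)^2 * (1 + err_const cm)"
     using err_moment(2)[OF cm[of n]] by (intro mult_left_mono) auto
    finally show "norm (\<integral>om. (a n * err n om $ i)^2 \<partial>M) <= (a n / c n)^2 * (1 + err_const cm)" by simp
   qed
  qed
 qed
 have "AE om in M. \<forall>i\<in>UNIV. summable (%k. a k * err k om $ i)" by (rule AE_finite_allI) (use comp in auto)
 thus ?thesis
 proof eventually_elim
  case (elim om)
  have "(%k. a k *\<^sub>R err k om) sums (\<chi> i. \<Sum>k. a k * err k om $ i)"
   unfolding sums_def
  proof (rule vec_tendstoI)
   fix i
   show "(%n. (\<Sum>k<n. a k *\<^sub>R err k om) $ i) \<longlonglongrightarrow> (\<chi> i. \<Sum>k. a k * err k om $ i) $ i"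
    using summable_LIMSEQ[OF bspec[OF elim UNIV_I, of i]] by (simp add: sum_component)
  qed
  thus ?case by (rule sums_summable)
 qed
qed

end

section \<open>The localised recursion\<close>

lemma orthogonal_matrix_inner:
 fixes P :: "real^'n::finite^'n"
 assumes "orthogonal_matrix P"
 shows "(P *v x) \<bullet> (P *v y) = x \<bullet> y"
proof -
 have "(P *v x) \<bullet> (P *v y) = (transpose P *v (P *v x)) \<bullet> y"
  by (simp only: dot_lmul_matrix transpose_matrix_vector)
 thus ?thesis using assms by (simp add: matrix_vector_mul_assoc orthogonal_matrix)
qed

lemma orthogonal_matrix_norm:
 fixes P :: "real^'n::finite^'n"
 assumes "orthogonal_matrix P"
 shows "norm (P *v x) = norm x"
 unfolding norm_eq_sqrt_inner by (simp add: orthogonal_matrix_inner[OF assms])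

lemma diag_matrix_mult: "diag_matrix d *v x = (\<chi> i. d i * x $ i)"
proof -
 have "(\<Sum>j\<in>UNIV. (if i = j then d i else 0) * x $ j) = (\<Sum>j\<in>UNIV. if i = j then d i * x $ j else 0)" for i
  by (intro sum.cong) auto
 thus ?thesis by (simp add: diag_matrix_def matrix_vector_mult_def vec_eq_iff)
qed

locale spsa_normality =
 spsa_noise_variance M f a c X \<xi> ep em \<xi>' p L h K \<sigma> z + C3_near f z \<rho>
 for M :: "'s measure" and f :: "real^'n::finite => real" and a c X \<xi> ep em \<xi>' p L h K \<sigma> z \<rho> +
 fixes a0 c0 \<alpha> \<gamma> \<beta> :: real and P :: "real^'n^'n" and lam \<kappa> :: "'n => real"
 assumes p_le: "p <= 3"
  and positive: "a0 > 0" "c0 > 0" "\<alpha> > 0" "\<alpha> <= 1" "\<gamma> > 0"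
  and gains: "!!k. k >= 1 ==> a k = a0 / real k powr \<alpha>" "!!k. k >= 1 ==> c k = c0 / real k powr \<gamma>"
  and \<beta>: "\<beta> = \<alpha> - 2 * \<gamma>" "3 * \<gamma> - \<alpha> / 2 >= 0"
  and zero: "gradient f z = 0"
  and P: "orthogonal_matrix P" "P ** hessian f z ** transpose P = (1 / a0) *\<^sub>R diag_matrix lam"
  and \<kappa>: "!!i. \<kappa> i = lam i - (if \<alpha> = 1 then \<beta> / 2 else 0)" "!!i. \<kappa> i > 0"
begin

abbreviation "D \<equiv> hessian f z"

lemma c_le: "k >= 1 ==> c k <= c0"
 using positive by (simp add: gains(2) divide_le_eq ge_one_powr_ge_zero)

lemma P_hessian: "a0 *\<^sub>R (P *v (D *v u)) = (\<chi> i. lam i * (P *v u) $ i)"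
proof -
 have "P ** D = (1 / a0) *\<^sub>R diag_matrix lam ** P"
  using P by (metis matrix_mul_assoc matrix_mul_rid orthogonal_matrix)
 hence "P *v (D *v u) = (1 / a0) *\<^sub>R diag_matrix lam *v (P *v u)"
  by (metis matrix_vector_mul_assoc)
 hence "a0 *\<^sub>R (P *v (D *v u)) = diag_matrix lam *v (P *v u)"
  using positive by (simp add: scaleR_matrix_vector_assoc[symmetric])
 thus ?thesis by (simp add: diag_matrix_mult)
qed

text \<open>The linearisation error of the gradient.\<close>

definition remainder :: "nat => 's => real^'n" where
 "remainder k om = gradient f (X k om) - D *v (X k om - z)"

text \<open>The bias of the estimate, of order \<open>(c k)^2\<close>.\<close>

definition offset :: "nat => 's => real^'n" where
 "offset k om = mean_step k om - gradient f (X k om)"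

lemma X_step: "X (Suc k) om = X k om - a k *\<^sub>R (D *v (X k om - z) + remainder k om + offset k om + err k om)"
 using a_pos[of k] by (simp add: remainder_def offset_def err_def)

lemma gradient_continuous: "continuous_on UNIV (gradient f)"
 using grad_diff by (simp add: continuous_on_eq_continuous_at differentiable_imp_continuous_within)

lemma matrix_vector_meas [measurable (raw)]:
 "g \<in> borel_measurable N ==> (%om. A *v (g om :: real^'n)) \<in> borel_measurable N" for A :: "real^'n^'n"
 by (rule measurable_compose[of g N borel], assumption)
  (intro borel_measurable_continuous_onI linear_continuous_on matrix_vector_mul_bounded_linear)

lemma remainder_meas: "remainder k \<in> borel_measurable (F k)"
proof -
 have [measurable]: "X k \<in> borel_measurable (F k)" by (rule X_meas_F) simp
 have [measurable]: "gradient f \<in> borel_measurable borel"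
  by (rule borel_measurable_continuous_onI[OF gradient_continuous])
 show ?thesis unfolding remainder_def[abs_def] by measurable
qed

lemma offset_meas: "offset k \<in> borel_measurable (F k)"
proof -
 have [measurable]: "X k \<in> borel_measurable (F k)" by (rule X_meas_F) simp
 have [measurable]: "gradient f \<in> borel_measurable borel"
  by (rule borel_measurable_continuous_onI[OF gradient_continuous])
 have "(%om. df k v om) \<in> borel_measurable (F k)" for v unfolding df_def by measurable
 thus ?thesis unfolding offset_def[abs_def] mean_step_eq by measurable
qed

lemma remainder_small:
 assumes "e > 0"
 obtains d where "d > 0" "!!k om. dist (X k om) z < d ==> norm (remainder k om) <= e * norm (X k om - z)"
proof -
 have "\<exists>d>0. \<forall>y. norm (y - z) < d --> norm (gradient f y - gradient f z - D *v (y - z)) <= e * norm (y - z)"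
  using gradient_has_derivative_hessian[OF grad_diff] assms unfolding has_derivative_at_alt by blast
 thus ?thesis using that zero unfolding remainder_def dist_norm by (metis diff_zero)
qed

text \<open>The ratio that dominates the linearisation error by the deviation; at \<open>X k = z\<close> division by zero gives the value 0,
which is right because the linearisation error vanishes there.\<close>

definition slack :: "nat => 's => real" where
 "slack k om = a0 * (norm (remainder k om) / norm (X k om - z))"

lemma remainder_at_limit: "X k om = z ==> remainder k om = 0"
 using zero by (simp add: remainder_def matrix_vector_mult_0_right)

lemma slack_le:
 assumes e: "e > 0" and le: "norm (remainder k om) <= e / a0 * norm (X k om - z)"
 shows "slack k om <= e"
proof (cases "X k om = z")
 case True
 thus ?thesis using remainder_at_limit[OF True] e by (simp add: slack_def)
next
 case False
 hence "norm (remainder k om) / norm (X k om - z) <= e / a0" using le by (simp add: divide_le_eq)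
 from mult_left_mono[OF this, of a0] positive show ?thesis by (simp add: slack_def)
qed

lemma slack_lim: "AE om in M. (%k. slack k om) \<longlonglongrightarrow> 0"
 using X_lim
proof eventually_elim
 case (elim om)
 show ?case
 proof (rule LIMSEQ_I)
  fix e :: real assume "e > 0"
  hence e: "e / 2 > 0" "e / 2 / a0 > 0" using positive by auto
  obtain d where d: "d > 0" "!!k om. dist (X k om) z < d ==> norm (remainder k om) <= e / 2 / a0 * norm (X k om - z)"
   using remainder_small[OF e(2)] by blast
  obtain n0 where n0: "!!k. k >= n0 ==> dist (X k om) z < d" using metric_LIMSEQ_D[OF elim d(1)] by blast
  have "norm (slack k om - 0) < e" if "k >= n0" for k
  proof -
   have "0 <= slack k om" using positive by (simp add: slack_def)
   moreover have "slack k om <= e / 2" by (rule slack_le[OF e(1) d(2)[OF n0[OF that]]])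
   ultimately show ?thesis using e by simp
  qed
  thus "\<exists>n0. \<forall>k\<ge>n0. norm (slack k om - 0) < e" by blast
 qed
qed

text \<open>The limit of the scaled drift: the bias is visible at the scale \<open>k^(\<beta>/2)\<close> only if \<open>3 \<gamma> = \<alpha> / 2\<close>.\<close>

definition shift :: "real^'n" where
 "shift = (if 3 * \<gamma> - \<alpha> / 2 > 0 then 0 else - (a0 * c0^2) *\<^sub>R bias)"

lemma c_sq_rate: "k >= 1 ==> real k powr (\<beta> / 2) * (c k)^2 = c0^2 * real k powr (- (3 * \<gamma> - \<alpha> / 2))"
proof -
 assume k: "k >= 1"
 have "(real k powr \<gamma>)^2 = real k powr (2 * \<gamma>)" by (simp add: power2_eq_square powr_add[symmetric])
 hence "(c k)^2 = c0^2 * real k powr (- (2 * \<gamma>))"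
  using k by (simp only: gains(2) powr_minus divide_inverse power_mult_distrib power_inverse)
 hence "real k powr (\<beta> / 2) * (c k)^2 = c0^2 * (real k powr (\<beta> / 2) * real k powr (- (2 * \<gamma>)))" by simp
 also have "real k powr (\<beta> / 2) * real k powr (- (2 * \<gamma>)) = real k powr (\<beta> / 2 + - (2 * \<gamma>))"
  by (rule powr_add[symmetric])
 also have "\<beta> / 2 + - (2 * \<gamma>) = - (3 * \<gamma> - \<alpha> / 2)" using \<beta> by (simp add: field_simps)
 finally show ?thesis .
qed

lemma offset_lim:
 "AE om in M. (%k. - (a0 * real k powr (\<beta> / 2)) *\<^sub>R offset k om) \<longlonglongrightarrow> shift"
 using X_lim
proof eventually_elim
 case (elim om)
 have b: "(%k. (1 / (c k)^2) *\<^sub>R offset k om) \<longlonglongrightarrow> bias"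
  unfolding offset_def mean_step_def by (rule spsa_mean_bias_limit[OF elim c_lim c_pos])
 have r: "(%k. - (a0 * c0^2 * real k powr (- (3 * \<gamma> - \<alpha> / 2))))
   \<longlonglongrightarrow> (if 3 * \<gamma> - \<alpha> / 2 > 0 then 0 else - (a0 * c0^2))"
 proof (cases "3 * \<gamma> - \<alpha> / 2 > 0")
  case True
  have "(%k. - (a0 * c0^2 * real k powr (- (3 * \<gamma> - \<alpha> / 2)))) \<longlonglongrightarrow> - (a0 * c0^2 * 0)"
   by (intro tendsto_intros tendsto_neg_powr) (use True in \<open>auto intro: filterlim_real_sequentially\<close>)
  thus ?thesis using True by simp
 next
  case False
  hence z: "3 * \<gamma> - \<alpha> / 2 = 0" using \<beta>(2) by simp
  have "\<forall>\<^sub>F k in sequentially. - (a0 * c0^2) = - (a0 * c0^2 * real k powr (- (3 * \<gamma> - \<alpha> / 2)))"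
   using eventually_ge_at_top[of 1] by eventually_elim (simp add: z)
  with tendsto_const have "(%k. - (a0 * c0^2 * real k powr (- (3 * \<gamma> - \<alpha> / 2)))) \<longlonglongrightarrow> - (a0 * c0^2)"
   by (rule Lim_transform_eventually)
  thus ?thesis using False by simp
 qed
 have "(%k. - (a0 * c0^2 * real k powr (- (3 * \<gamma> - \<alpha> / 2))) *\<^sub>R ((1 / (c k)^2) *\<^sub>R offset k om)) \<longlonglongrightarrow> shift"
 proof -
  have "(if 3 * \<gamma> - \<alpha> / 2 > 0 then 0 else - (a0 * c0^2)) *\<^sub>R bias = shift" by (simp add: shift_def)
  with tendsto_scaleR[OF r b] show ?thesis by (simp only:)
 qed
 moreover have "\<forall>\<^sub>F k in sequentially. - (a0 * c0^2 * real k powr (- (3 * \<gamma> - \<alpha> / 2))) *\<^sub>R ((1 / (c k)^2) *\<^sub>R offset k om)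
   = - (a0 * real k powr (\<beta> / 2)) *\<^sub>R offset k om"
  using eventually_ge_at_top[of 1]
 proof eventually_elim
  case (elim k)
  have "- (a0 * c0^2 * real k powr (- (3 * \<gamma> - \<alpha> / 2))) * (1 / (c k)^2) = - (a0 * (real k powr (\<beta> / 2) * (c k)^2)) * (1 / (c k)^2)"
   unfolding c_sq_rate[OF elim] by simp
  also have "... = - (a0 * real k powr (\<beta> / 2))" using c_pos[of k] by simp
  finally show ?case by (metis scaleR_scaleR)
 qed
 ultimately show ?case by (rule Lim_transform_eventually)
qed

definition \<mu>lim :: "real^'n" where "\<mu>lim = transpose P *v (\<chi> i. (P *v shift) $ i / \<kappa> i)"

definition vlim :: "'n => real" where "vlim i = (a0 / c0)^2 * (\<sigma>^2 / 4) / (2 * \<kappa> i)"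

end

text \<open>The radius \<open>d\<close> is so small that the linearisation error cannot destroy the contraction.\<close>

locale spsa_localised = spsa_normality M f a c X \<xi> ep em \<xi>' p L h K \<sigma> z \<rho> a0 c0 \<alpha> \<gamma> \<beta> P lam \<kappa>
 for M :: "'s measure" and f :: "real^'n::finite => real" and a c X \<xi> ep em \<xi>' p L h K \<sigma> z \<rho> a0 c0 \<alpha> \<gamma> \<beta> P lam \<kappa> +
 fixes m :: nat and d \<theta>0 b0 :: real
 assumes m: "m >= 1" "m >= K" and d: "d > 0" and \<theta>0: "\<theta>0 > 0" "!!i. \<theta>0 < \<kappa> i" and b0: "b0 > 0"
  and near: "!!k om. dist (X k om) z <= d ==> norm (remainder k om) <= \<theta>0 / a0 * norm (X k om - z)"
   "!!k om. k >= m ==> dist (X k om) z <= d ==> norm (offset k om) <= b0 * (c k)^2"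
begin

definition stays :: "nat => 's => bool" where "stays k om \<longleftrightarrow> (\<forall>j\<in>{m..k}. dist (X j om) z <= d)"

text \<open>The deviation from \<open>z\<close> after time \<open>m\<close>, with the linearisation error switched off for ever when the iterates first leave
the ball, but the noise kept.  The bias is switched off only at the times when the iterate is outside: in this form its
scaled limit is the same on almost all paths.\<close>

primrec dev :: "nat => 's => real^'n" where
 "dev 0 om = of_bool (stays m om) *\<^sub>R (X m om - z)"
| "dev (Suc i) om = dev i om - a (m + i) *\<^sub>R (D *v dev i om + of_bool (stays (m + i) om) *\<^sub>R remainder (m + i) om
   + of_bool (dist (X (m + i) om) z <= d) *\<^sub>R offset (m + i) om + err (m + i) om)"

definition U :: "nat => 's => real^'n" where "U k = dev (k - m)"

lemma U_start: "U m om = of_bool (stays m om) *\<^sub>R (X m om - z)" by (simp add: U_def)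

lemma U_step: "k >= m ==> U (Suc k) om = U k om - a k *\<^sub>R (D *v U k om + of_bool (stays k om) *\<^sub>R remainder k om
   + of_bool (dist (X k om) z <= d) *\<^sub>R offset k om + err k om)"
 by (simp add: U_def Suc_diff_le)

lemma U_eq: "k >= m ==> stays k om ==> U k om = X k om - z"
proof (induction k rule: dec_induct)
 case base thus ?case by (simp add: U_start)
next
 case (step k)
 hence s: "stays k om" "dist (X k om) z <= d" by (auto simp: stays_def)
 have "U (Suc k) om = U k om - a k *\<^sub>R (D *v U k om + remainder k om + offset k om + err k om)"
  using U_step[OF step(1), of om] s by simp
 thus ?case unfolding X_step[of k om] step(3)[OF s(1)] by simp
qed

lemma stays_meas: "Measurable.pred (F k) (stays k)"
proof -
 have "Measurable.pred (F k) (%om. dist (X j om) z <= d)" if "j <= k" for j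
 proof -
  have [measurable]: "X j \<in> borel_measurable (F k)" by (rule X_meas_F[OF that])
  show ?thesis by measurable
 qed
 thus ?thesis unfolding stays_def[abs_def] by (intro pred_intros_finite) auto
qed

lemma of_bool_meas: "Measurable.pred N Q ==> (%om. of_bool (Q om) :: real) \<in> borel_measurable N"
 unfolding of_bool_def by measurable

lemma active_meas: "(%om. of_bool (stays k om) *\<^sub>R remainder k om) \<in> borel_measurable (F k)"
  "(%om. of_bool (dist (X k om) z <= d) *\<^sub>R offset k om) \<in> borel_measurable (F k)"
proof -
 have [measurable]: "X k \<in> borel_measurable (F k)" by (rule X_meas_F) simp
 have [measurable]: "remainder k \<in> borel_measurable (F k)" "offset k \<in> borel_measurable (F k)"
  by (rule remainder_meas offset_meas)+
 have [measurable]: "(%om. of_bool (stays k om) :: real) \<in> borel_measurable (F k)"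
  "(%om. of_bool (dist (X k om) z <= d) :: real) \<in> borel_measurable (F k)"
  by (rule of_bool_meas[OF stays_meas]) (rule of_bool_meas, measurable)
 show "(%om. of_bool (stays k om) *\<^sub>R remainder k om) \<in> borel_measurable (F k)"
  "(%om. of_bool (dist (X k om) z <= d) *\<^sub>R offset k om) \<in> borel_measurable (F k)" by measurable
qed

lemma F_meas_Suc: "Y \<in> borel_measurable (F k) ==> Y \<in> borel_measurable (F (Suc k))"
 by (rule measurable_from_subalg[of "F (Suc k)" "F k"]) (use F_mono[of k] sub_F in \<open>auto simp: subalgebra_def\<close>)

lemma U_meas_F: "k >= m ==> U k \<in> borel_measurable (F k)"
proof (induction k rule: dec_induct)
 case base
 have [measurable]: "X m \<in> borel_measurable (F m)" by (rule X_meas_F) simp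
 have [measurable]: "(%om. of_bool (stays m om) :: real) \<in> borel_measurable (F m)" by (rule of_bool_meas[OF stays_meas])
 show ?case unfolding U_start[abs_def] by measurable
next
 case (step k)
 note [measurable] = F_meas_Suc[OF step(3)] F_meas_Suc[OF active_meas(1)[of k]] F_meas_Suc[OF active_meas(2)[of k]] err_meas_F[of k]
 show ?case unfolding U_step[OF step(1), abs_def] by measurable
qed

lemma U_meas [measurable]: "U k \<in> borel_measurable M"
proof (cases "k >= m")
 case True thus ?thesis using F_meas_lift(1)[OF U_meas_F] by blast
next
 case False
 hence "U k = U m" by (simp add: U_def)
 thus ?thesis using F_meas_lift(1)[OF U_meas_F[of m]] by simp
qed

abbreviation rate :: "nat => real" where "rate k \<equiv> real k powr (\<beta> / 2)"

definition W :: "nat => 's => real^'n" where "W k om = rate k *\<^sub>R (P *v U k om)"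

definition q :: "nat => 's => real^'n" where
 "q k om = - (a0 * rate k) *\<^sub>R (P *v (of_bool (stays k om) *\<^sub>R remainder k om))"

definition t :: "nat => 's => real^'n" where
 "t k om = P *v (- (a0 * rate k) *\<^sub>R (of_bool (dist (X k om) z <= d) *\<^sub>R offset k om))"

definition \<zeta> :: "nat => 's => real^'n" where
 "\<zeta> k om = - (a0 / c0) *\<^sub>R (P *v (c k *\<^sub>R err k om))"

definition \<theta> :: "nat => 's => real" where "\<theta> k om = of_bool (stays k om) * slack k om"

definition growth :: "nat => real" where "growth k = (real (Suc k) / real k) powr (\<beta> / 2)"

definition B :: "nat => 'n => real" where "B k i = growth k * (1 - lam i * real k powr (- \<alpha>))"

lemma rate_Suc: "k >= 1 ==> rate (Suc k) = growth k * rate k"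
 by (simp add: growth_def powr_divide)

lemma noise_rate: "k >= 1 ==> rate k * real k powr (- \<alpha>) = sqrt (real k powr (- \<alpha>)) * c k / c0"
proof -
 assume k: "k >= 1"
 have s: "sqrt (real k powr (- \<alpha>)) = real k powr (- \<alpha> / 2)"
  using k by (simp add: powr_half_sqrt[symmetric] powr_powr)
 have "rate k * real k powr (- \<alpha>) = real k powr (\<beta> / 2 + - \<alpha>)" by (rule powr_add[symmetric])
 also have "\<beta> / 2 + - \<alpha> = - \<alpha> / 2 + - \<gamma>" using \<beta> by (simp add: field_simps)
 also have "real k powr (- \<alpha> / 2 + - \<gamma>) = real k powr (- \<alpha> / 2) * real k powr (- \<gamma>)" by (rule powr_add)
 also have "real k powr (- \<gamma>) = c k / c0" using positive k by (simp add: gains(2) powr_minus divide_inverse)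
 finally show ?thesis unfolding s by simp
qed

text \<open>The exponents fit since \<open>\<beta>/2 - \<alpha> = - \<alpha>/2 - \<gamma>\<close>: the factor \<open>k^(-\<gamma>)\<close> is absorbed by \<open>c k err k\<close>, whose variance has a
limit, and the square root of the step size is left.\<close>

lemma W_step:
 assumes k: "k >= m"
 shows "W (Suc k) om = (\<chi> i. B k i * W k om $ i) + (growth k * real k powr (- \<alpha>)) *\<^sub>R (q k om + t k om)
  + (growth k * sqrt (real k powr (- \<alpha>))) *\<^sub>R \<zeta> k om"
proof -
 have k1: "k >= 1" using k m by simp
 define s where "s = real k powr (- \<alpha>)"
 define R where "R = of_bool (stays k om) *\<^sub>R remainder k om"
 define O' where "O' = of_bool (dist (X k om) z <= d) *\<^sub>R offset k om"
 have ak: "a k = a0 * s" using k1 by (simp add: gains(1) s_def powr_minus divide_inverse)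
 have PU: "P *v U (Suc k) om = P *v U k om - s *\<^sub>R ((\<chi> i. lam i * (P *v U k om) $ i) + a0 *\<^sub>R (P *v R) + a0 *\<^sub>R (P *v O') + a0 *\<^sub>R (P *v err k om))"
  unfolding U_step[OF k] ak R_def[symmetric] O'_def[symmetric] P_hessian[symmetric]
  by (simp add: matrix_vector_mult_diff_distrib matrix_vector_right_distrib matrix_vector_mult_scaleR scaleR_add_right mult.commute)
 have lin: "(\<chi> i. B k i * W k om $ i) = (growth k * rate k) *\<^sub>R (P *v U k om - s *\<^sub>R (\<chi> i. lam i * (P *v U k om) $ i))"
  by (simp add: vec_eq_iff B_def W_def s_def algebra_simps)
 have tk: "t k om = - (a0 * rate k) *\<^sub>R (P *v O')"
  unfolding t_def O'_def[symmetric] by (rule matrix_vector_mult_scaleR)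
 have qt: "(growth k * s) *\<^sub>R (q k om + t k om) = - (growth k * rate k * s) *\<^sub>R (a0 *\<^sub>R (P *v R) + a0 *\<^sub>R (P *v O'))"
  unfolding q_def tk R_def[symmetric]
  by (simp add: scaleR_add_right scaleR_diff_right mult_ac)
 have ze: "(growth k * sqrt s) *\<^sub>R \<zeta> k om = - (growth k * rate k * s) *\<^sub>R (a0 *\<^sub>R (P *v err k om))"
 proof -
  have "(growth k * sqrt s) *\<^sub>R \<zeta> k om = - (growth k * (sqrt s * c k / c0) * a0) *\<^sub>R (P *v err k om)"
   unfolding \<zeta>_def by (simp add: matrix_vector_mult_scaleR)
  also have "sqrt s * c k / c0 = rate k * s" unfolding s_def by (rule noise_rate[OF k1, symmetric])
  finally show ?thesis by (simp add: mult_ac)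
 qed
 show ?thesis
  unfolding W_def[of "Suc k"] rate_Suc[OF k1] PU lin s_def[symmetric] qt ze
  by (simp add: scaleR_diff_right scaleR_add_right mult_ac)
qed

lemma P_norm: "norm (P *v x) = norm x"
 by (rule orthogonal_matrix_norm[OF P(1)])

lemma q_bound: "k >= m ==> norm (q k om) <= \<theta> k om * norm (W k om)"
proof (cases "stays k om")
 case True
 assume k: "k >= m"
 have "norm (remainder k om) * norm (X k om - z) / norm (X k om - z) = norm (remainder k om)"
  using remainder_at_limit[of k om] by (cases "X k om = z") auto
 hence r: "norm (remainder k om) / norm (X k om - z) * norm (X k om - z) = norm (remainder k om)" by simp
 have W: "norm (W k om) = rate k * norm (X k om - z)" by (simp add: W_def P_norm U_eq[OF k True])
 have \<theta>: "\<theta> k om = a0 * (norm (remainder k om) / norm (X k om - z))" using True by (simp add: \<theta>_def slack_def)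
 have "\<theta> k om * norm (W k om) = a0 * rate k * (norm (remainder k om) / norm (X k om - z) * norm (X k om - z))"
  unfolding W \<theta> by (simp only: mult_ac)
 moreover have "norm (q k om) = a0 * rate k * norm (remainder k om)"
  using True positive(1) by (simp add: q_def P_norm)
 ultimately have "\<theta> k om * norm (W k om) = norm (q k om)" unfolding r by simp
 thus ?thesis by simp
next
 case False
 thus ?thesis by (simp add: q_def \<theta>_def matrix_vector_mult_0_right)
qed

lemma \<theta>_bound: "k >= m ==> 0 <= \<theta> k om \<and> \<theta> k om <= \<theta>0"
proof (cases "stays k om")
 case True
 assume k: "k >= m"
 have "dist (X k om) z <= d" using True k by (simp add: stays_def)
 from slack_le[OF \<theta>0(1) near(1)[OF this]] show ?thesis
  using True positive(1) by (simp add: \<theta>_def) (simp add: slack_def)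
next
 case False
 thus ?thesis using \<theta>0(1) by (simp add: \<theta>_def)
qed

lemma t_bound: "k >= m ==> norm (t k om) <= a0 * b0 * c0^2"
proof (cases "dist (X k om) z <= d")
 case True
 assume k: "k >= m"
 hence k1: "k >= 1" using m by simp
 have "norm (t k om) = a0 * (rate k * norm (offset k om))"
  using True positive(1) by (simp add: t_def P_norm)
 also have "... <= a0 * (rate k * (b0 * (c k)^2))"
  using near(2)[OF k True] positive(1) by (intro mult_left_mono) auto
 also have "... = a0 * b0 * (rate k * (c k)^2)" by simp
 also have "... = a0 * b0 * (c0^2 * real k powr (- (3 * \<gamma> - \<alpha> / 2)))" by (simp only: c_sq_rate[OF k1])
 also have "... <= a0 * b0 * (c0^2 * 1)"
 proof -
  have "real k powr (- (3 * \<gamma> - \<alpha> / 2)) <= real k powr 0"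
   using k1 \<beta>(2) by (intro powr_mono) auto
  thus ?thesis using k1 positive(1) b0 by (intro mult_left_mono) auto
 qed
 finally show ?thesis by simp
next
 case False
 thus ?thesis using positive(1) b0 by (simp add: t_def matrix_vector_mult_0_right)
qed

lemma t_lim: "AE om in M. (%k. t k om) \<longlonglongrightarrow> P *v shift"
 using X_lim offset_lim
proof eventually_elim
 case (elim om)
 have "(%k. P *v (- (a0 * rate k) *\<^sub>R offset k om)) \<longlonglongrightarrow> P *v shift"
  by (rule isCont_tendsto_compose[OF _ elim(2)])
   (rule linear_continuous_at[OF matrix_vector_mul_bounded_linear])
 moreover have "\<forall>\<^sub>F k in sequentially. P *v (- (a0 * rate k) *\<^sub>R offset k om) = t k om"
  using tendstoD[OF elim(1) d] by eventually_elim (simp add: t_def)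
 ultimately show ?case by (rule Lim_transform_eventually)
qed

lemma \<zeta>_norm: "norm (\<zeta> k om) = (a0 / c0) * norm (c k *\<^sub>R err k om)"
 using positive by (simp add: \<zeta>_def P_norm)

lemma \<zeta>_moment:
 assumes "k >= m"
 shows "integrable M (%om. norm (\<zeta> k om) powr p)"
  "(\<integral>om. norm (\<zeta> k om) powr p \<partial>M) <= (a0 / c0) powr p * err_const c0"
proof -
 have c: "c k <= c0" by (rule c_le) (use assms m in simp)
 have eq: "norm (\<zeta> k om) powr p = (a0 / c0) powr p * norm (c k *\<^sub>R err k om) powr p" for om
  unfolding \<zeta>_norm by (rule powr_mult)
 show "integrable M (%om. norm (\<zeta> k om) powr p)"
  unfolding eq by (rule integrable_mult_right) (rule err_moment(1)[OF c])
 show "(\<integral>om. norm (\<zeta> k om) powr p \<partial>M) <= (a0 / c0) powr p * err_const c0"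
  unfolding eq integral_mult_right_zero by (rule mult_left_mono[OF err_moment(2)[OF c]]) simp
qed

lemma \<zeta>_centred: "AE om in M. real_cond_exp M (F k) (%om. \<zeta> k om $ i) om = 0"
proof -
 interpret sigma_finite_subalgebra M "F k" by (rule finite_sigma_subalgebra[OF prob_space_axioms sub_F])
 have eq: "\<zeta> k om $ i = (\<Sum>j\<in>UNIV. (- (a0 / c0) * c k * P $ i $ j) * err k om $ j)" for om
  by (simp add: \<zeta>_def matrix_vector_mult_def sum_distrib_left sum_negf mult_ac)
 have int: "integrable M (%om. (- (a0 / c0) * c k * P $ i $ j) * err k om $ j)" for j
  by (rule integrable_mult_right) (rule err_integrable)
 have "AE om in M. real_cond_exp M (F k) (%om. \<Sum>j\<in>UNIV. (- (a0 / c0) * c k * P $ i $ j) * err k om $ j) om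
   = (\<Sum>j\<in>UNIV. real_cond_exp M (F k) (%om. (- (a0 / c0) * c k * P $ i $ j) * err k om $ j) om)"
  by (rule real_cond_exp_sum) (rule int)
 moreover have "AE om in M. \<forall>j\<in>UNIV. real_cond_exp M (F k) (%om. (- (a0 / c0) * c k * P $ i $ j) * err k om $ j) om = 0"
 proof (rule AE_finite_allI)
  fix j
  show "AE om in M. real_cond_exp M (F k) (%om. (- (a0 / c0) * c k * P $ i $ j) * err k om $ j) om = 0"
   using real_cond_exp_cmult[OF err_integrable[of k j], of "- (a0 / c0) * c k * P $ i $ j"] err_centred[of k j]
   by eventually_elim simp
 qed simp
 ultimately show ?thesis unfolding eq by eventually_elim simp
qed

lemma \<zeta>_variance:
 assumes k: "k >= m" and Y: "Y \<in> borel_measurable (F k)" "!!om. \<bar>Y om\<bar> <= 1"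
 shows "\<bar>\<integral>om. Y om * ((u \<bullet> \<zeta> k om)^2 - (a0 / c0)^2 * (\<sigma>^2 / 4) * (norm u)^2) \<partial>M\<bar> <= (a0 / c0)^2 * var_error k * (norm u)^2"
proof -
 define w where "w = transpose P *v u"
 have w: "norm w = norm u"
  unfolding w_def by (rule orthogonal_matrix_norm) (use P(1) in \<open>simp add: orthogonal_matrix_transpose\<close>)
 have u: "u \<bullet> \<zeta> k om = - (a0 / c0) * (w \<bullet> (c k *\<^sub>R err k om))" for om
  unfolding \<zeta>_def w_def transpose_matrix_vector dot_lmul_matrix by simp
 have "(\<integral>om. Y om * ((u \<bullet> \<zeta> k om)^2 - (a0 / c0)^2 * (\<sigma>^2 / 4) * (norm u)^2) \<partial>M)
   = (\<integral>om. (a0 / c0)^2 * (Y om * ((w \<bullet> (c k *\<^sub>R err k om))^2 - \<sigma>^2 / 4 * (norm w)^2)) \<partial>M)"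
  unfolding u w power_mult_distrib by (intro Bochner_Integration.integral_cong) (simp_all only: power2_minus right_diff_distrib mult_ac)
 also have "... = (a0 / c0)^2 * (\<integral>om. Y om * ((w \<bullet> (c k *\<^sub>R err k om))^2 - \<sigma>^2 / 4 * (norm w)^2) \<partial>M)"
  by (rule integral_mult_right_zero)
 also have "\<bar>...\<bar> = (a0 / c0)^2 * \<bar>\<integral>om. Y om * ((w \<bullet> (c k *\<^sub>R err k om))^2 - \<sigma>^2 / 4 * (norm w)^2) \<partial>M\<bar>"
  unfolding abs_mult by simp
 also have "... <= (a0 / c0)^2 * (var_error k * (norm w)^2)"
  by (intro mult_left_mono err_variance Y) (use k m in auto)
 finally show ?thesis unfolding w by (simp only: mult.assoc)
qed

lemma W_meas_F: "k >= m ==> W k \<in> borel_measurable (F k)"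
proof -
 assume "k >= m"
 hence [measurable]: "U k \<in> borel_measurable (F k)" by (rule U_meas_F)
 show ?thesis unfolding W_def[abs_def] by measurable
qed

lemma qt_meas: "q k \<in> borel_measurable (F k)" "t k \<in> borel_measurable (F k)"
proof -
 note [measurable] = active_meas[of k]
 show "q k \<in> borel_measurable (F k)" unfolding q_def[abs_def] by measurable
 show "t k \<in> borel_measurable (F k)" unfolding t_def[abs_def] by measurable
qed

lemma \<theta>_meas: "\<theta> k \<in> borel_measurable M"
proof -
 have [measurable]: "(%om. of_bool (stays k om) :: real) \<in> borel_measurable M" "remainder k \<in> borel_measurable M"
  by (rule F_meas_lift(1)[OF of_bool_meas[OF stays_meas]] F_meas_lift(1)[OF remainder_meas])+
 show ?thesis unfolding \<theta>_def[abs_def] slack_def by measurable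
qed

sublocale rec: linear_recursion M F W q t \<zeta> \<theta> B "%k. real k powr (- \<alpha>)" growth "%k. (a0 / c0)^2 * var_error k"
 \<kappa> \<theta>0 "a0 * b0 * c0^2" "(a0 / c0) powr p * err_const c0" "p - 2" "(a0 / c0)^2 * (\<sigma>^2 / 4)" "P *v shift" m
proof
 show "\<zeta> n \<in> borel_measurable M" for n unfolding \<zeta>_def[abs_def] by measurable
 show "integrable M (%om. (norm (W m om))^2)"
 proof (rule integrable_const_bound)
  show "AE om in M. norm ((norm (W m om))^2) <= (rate m * d)^2"
  proof (intro AE_I2)
   fix om
   have "norm (U m om) <= d" using d by (auto simp: U_start stays_def dist_norm)
   hence "norm (W m om) <= rate m * d" by (simp add: W_def P_norm mult_left_mono)
   thus "norm ((norm (W m om))^2) <= (rate m * d)^2" by (simp add: power_mono)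
  qed
  show "(%om. (norm (W m om))^2) \<in> borel_measurable M" unfolding W_def by measurable
 qed
 show "(%k. real k powr (- \<alpha>)) \<longlonglongrightarrow> 0"
  by (rule tendsto_neg_powr) (use positive in \<open>auto intro: filterlim_real_sequentially\<close>)
 show "\<not> summable (%k. real k powr (- \<alpha>))" using powr_not_summable[OF positive(4), of 1] by simp
 show "growth \<longlonglongrightarrow> 1" unfolding growth_def[abs_def] by (rule ratio_asymptotics)
 show "(%n. (1 - B n i) / real n powr (- \<alpha>)) \<longlonglongrightarrow> \<kappa> i" for i
 proof -
  have "(%n. real n powr \<alpha> * (1 - B n i)) \<longlonglongrightarrow> lam i - (if \<alpha> = 1 then \<beta> / 2 else 0)"
   unfolding B_def growth_def by (rule step_factor_asymptotics) (use positive in auto)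
  thus ?thesis by (simp add: \<kappa>(1) powr_minus divide_inverse mult.commute)
 qed
 show "AE om in M. (%n. \<theta> n om) \<longlonglongrightarrow> 0"
  using slack_lim
 proof eventually_elim
  case (elim om)
  show ?case
   by (rule Lim_null_comparison[OF always_eventually elim]) (use positive in \<open>auto simp: \<theta>_def slack_def\<close>)
 qed
 show "(%k. (a0 / c0)^2 * var_error k) \<longlonglongrightarrow> 0" by (rule tendsto_mult_right_zero[OF var_error_limit])
qed (use sub_F W_meas_F qt_meas \<theta>_meas W_step m q_bound \<theta>_bound \<theta>0 t_bound t_lim p p_le \<zeta>_moment \<zeta>_centred \<zeta>_variance in auto)

lemma var_gauss_eq: "gaussian_parameters vlim"
 by standard (use \<kappa>(2) in \<open>simp add: vlim_def less_imp_le\<close>)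

text \<open>As \<open>P\<close> is orthogonal, the characteristic function of the scaled \<open>U\<close> at \<open>u\<close> is that of \<open>W\<close> at \<open>P u\<close>; Chebyshev's inequality gives
tightness.\<close>

lemma scaled_weak_limit:
 fixes g :: "real^'n => real"
 assumes h: "continuous_on UNIV g" "bounded (range g)"
 shows "(%k. \<integral>om. g (rate k *\<^sub>R U k om) \<partial>M) \<longlonglongrightarrow> (\<integral>x. g x \<partial>gauss \<mu>lim P vlim)"
proof -
 interpret N: gaussian_parameters \<mu>lim P vlim by (rule var_gauss_eq)
 show ?thesis
 proof (rule levy_continuity_vec[where W = "%k om. rate k *\<^sub>R U k om" and h = g])
  show "prob_space M" "prob_space (gauss \<mu>lim P vlim)" "sets (gauss \<mu>lim P vlim) = sets borel"
   by (rule prob_space_axioms N.prob_gauss N.sets_gauss)+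
  show "continuous_on UNIV g" "bounded (range g)" by (rule h)+
  show "(%om. rate k *\<^sub>R U k om) \<in> borel_measurable M" for k by measurable
  have PW: "(P *v u) \<bullet> W k om = u \<bullet> (rate k *\<^sub>R U k om)" for u k om
   unfolding W_def by (simp add: orthogonal_matrix_inner[OF P(1)])
  show "(%k. \<integral>om. iexp (u \<bullet> (rate k *\<^sub>R U k om)) \<partial>M) \<longlonglongrightarrow> (\<integral>x. iexp (u \<bullet> x) \<partial>gauss \<mu>lim P vlim)" for u
  proof -
   have m: "(P *v u) \<bullet> rec.\<mu> = u \<bullet> \<mu>lim"
    unfolding rec.\<mu>_def \<mu>lim_def by (metis dot_lmul_matrix transpose_matrix_vector transpose_transpose)
   have "rec.target (P *v u) = (\<integral>x. iexp (u \<bullet> x) \<partial>gauss \<mu>lim P vlim)"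
    unfolding rec.target_def m N.charfun_gauss N.var_def vlim_def by simp
   with rec.charfun_limit[of "P *v u"] show ?thesis unfolding rec.\<phi>_def PW by simp
  qed
  fix e :: real assume e: "e > 0"
  obtain C where C: "C > 0" "!!n. n >= m ==> (\<integral>om. (norm (W n om))^2 \<partial>M) <= C"
   using rec.second_moment_bounded by blast
  define R where "R = sqrt (C / e)"
  have R: "R > 0" "R^2 = C / e" using C(1) e by (auto simp: R_def)
  have "measure M {om \<in> space M. R < norm (rate n *\<^sub>R U n om)} <= e" if n: "n >= m" for n
  proof -
   have nW: "norm (rate n *\<^sub>R U n om) = norm (W n om)" for om by (simp add: W_def P_norm)
   have [measurable]: "W n \<in> borel_measurable M" by (rule F_meas_lift(1)[OF W_meas_F[OF n]])
   have "measure M {om \<in> space M. R < norm (W n om)} <= measure M {om \<in> space M. R^2 <= (norm (W n om))^2}"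
    using R(1) by (intro finite_measure_mono) (auto intro!: power_mono)
   also have "... <= (\<integral>om. (norm (W n om))^2 \<partial>M) / R^2"
    by (rule integral_Markov_inequality_measure[where A = "{}"]) (use rec.W_sq_integrable[OF n] R(1) in auto)
   also have "... <= C / R^2" using C(2)[OF n] by (rule divide_right_mono) simp
   also have "... = e" using C(1) e R(2) by simp
   finally show ?thesis unfolding nW .
  qed
  thus "\<exists>R n0. \<forall>n\<ge>n0. measure M {om \<in> space M. R < norm (rate n *\<^sub>R U n om)} <= e" by blast
 qed
qed

end

context spsa_normality begin

text \<open>The ball does not depend on the starting time \<open>m\<close>, so that \<open>m\<close> can be increased afterwards.\<close>

lemma localisation_parameters:
 obtains m0 d \<theta>0 b0 where "!!m. m >= m0 ==> spsa_localised M f a c X \<xi> ep em \<xi>' p L h K \<sigma> z \<rho> a0 c0 \<alpha> \<gamma> \<beta> P lam \<kappa> m d \<theta>0 b0"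
  "d > 0"
proof -
 define \<theta>0 where "\<theta>0 = Min (range \<kappa>) / 2"
 have Mp: "Min (range \<kappa>) > 0" using \<kappa>(2) by (subst Min_gr_iff) auto
 have \<theta>0: "\<theta>0 > 0" "\<theta>0 < \<kappa> i" for i
 proof -
  show "\<theta>0 > 0" using Mp by (simp add: \<theta>0_def)
  have "Min (range \<kappa>) <= \<kappa> i" by (rule Min_le) auto
  thus "\<theta>0 < \<kappa> i" using Mp unfolding \<theta>0_def by linarith
 qed
 have "\<theta>0 / a0 > 0" using \<theta>0 positive by simp
 then obtain d1 where d1: "d1 > 0"
   "!!k om. dist (X k om) z < d1 ==> norm (remainder k om) <= \<theta>0 / a0 * norm (X k om - z)"
  using remainder_small by blast
 obtain b0 d2 where d2: "b0 > 0" "d2 > 0"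
   "!!x c. dist x z <= d2 ==> 0 < c ==> c <= d2 ==> norm (spsa_mean f c x - gradient f x) <= b0 * c^2"
  using spsa_mean_bias_bound by blast
 obtain m1 where m1: "!!k. k >= m1 ==> c k < d2"
  using order_tendstoD(2)[OF c_lim d2(2)] unfolding eventually_sequentially by blast
 define d where "d = min (d1 / 2) d2"
 have d: "d > 0" "d < d1" "d <= d2" using d1(1) d2(2) by (auto simp: d_def)
 have "spsa_localised M f a c X \<xi> ep em \<xi>' p L h K \<sigma> z \<rho> a0 c0 \<alpha> \<gamma> \<beta> P lam \<kappa> m d \<theta>0 b0"
  if m: "m >= max (max 1 K) m1" for m
 proof
  show "m >= 1" "m >= K" using m by auto
  show "0 < d" "\<theta>0 > 0" "\<theta>0 < \<kappa> i" "b0 > 0" for i using d \<theta>0 d2 by auto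
  show "norm (remainder k om) <= \<theta>0 / a0 * norm (X k om - z)" if "dist (X k om) z <= d" for k om
   by (rule d1(2)) (use that d in simp)
  show "norm (offset k om) <= b0 * (c k)^2" if "k >= m" "dist (X k om) z <= d" for k om
   unfolding offset_def mean_step_def
   by (rule d2(3)) (use that m m1[of k] c_pos[of k] d in auto)
 qed
 thus ?thesis using d(1) by (rule that)
qed

lemma prob_stays_near:
 assumes d: "d > 0"
 shows "(%m. prob {om \<in> space M. \<not> (\<forall>j\<ge>m. dist (X j om) z <= d)}) \<longlonglongrightarrow> 0"
proof -
 let ?A = "%m. {om \<in> space M. \<not> (\<forall>j\<ge>m. dist (X j om) z <= d)}"
 have ms: "?A m \<in> sets M" for m by measurable
 have "decseq ?A" unfolding decseq_def by (auto intro: order_trans)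
 hence "(%m. prob (?A m)) \<longlonglongrightarrow> prob (\<Inter>m. ?A m)"
  by (intro finite_Lim_measure_decseq) (use ms in auto)
 also have "prob (\<Inter>m. ?A m) = 0"
 proof -
  have "AE om in M. om \<notin> (\<Inter>m. ?A m)"
   using X_lim
  proof eventually_elim
   case (elim om)
   obtain m where "!!j. j >= m ==> dist (X j om) z < d" using metric_LIMSEQ_D[OF elim d] by blast
   thus ?case by (auto intro!: exI[of _ m] less_imp_le)
  qed
  thus ?thesis using ms by (subst prob_eq_0) auto
 qed
 finally show ?thesis .
qed

text \<open>On the event that the iterates stay in the ball from time \<open>m\<close> on, the localised process is the true deviation.  The
probability of the complement is small for large \<open>m\<close>, while the limit law does not depend on \<open>m\<close>.\<close>

theorem asymptotic_law:
 fixes g :: "real^'n => real"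
 assumes g: "continuous_on UNIV g" "bounded (range g)"
 shows "(%k. \<integral>om. g (real k powr (\<beta> / 2) *\<^sub>R (X k om - z)) \<partial>M) \<longlonglongrightarrow> (\<integral>x. g x \<partial>gauss \<mu>lim P vlim)"
proof (rule LIMSEQ_I)
 let ?s = "%k. real k powr (\<beta> / 2)"
 let ?Z = "\<integral>x. g x \<partial>gauss \<mu>lim P vlim"
 fix e :: real assume e: "e > 0"
 obtain m0 d \<theta>0 b0 where loc: "!!m. m >= m0 ==> spsa_localised M f a c X \<xi> ep em \<xi>' p L h K \<sigma> z \<rho> a0 c0 \<alpha> \<gamma> \<beta> P lam \<kappa> m d \<theta>0 b0"
  and d: "d > 0" using localisation_parameters by blast
 obtain C where C: "C > 0" "!!x. \<bar>g x\<bar> <= C" using g(2) unfolding bounded_pos by auto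
 let ?A = "%m. {om \<in> space M. \<not> (\<forall>j\<ge>m. dist (X j om) z <= d)}"
 have "\<forall>\<^sub>F m in sequentially. prob (?A m) < e / (4 * C)"
  by (rule order_tendstoD(2)[OF prob_stays_near[OF d]]) (use e C in simp)
 then obtain m1 where m1: "!!m. m >= m1 ==> prob (?A m) < e / (4 * C)" unfolding eventually_sequentially by blast
 define m where "m = max m0 m1"
 interpret L: spsa_localised M f a c X \<xi> ep em \<xi>' p L h K \<sigma> z \<rho> a0 c0 \<alpha> \<gamma> \<beta> P lam \<kappa> m d \<theta>0 b0
  by (rule loc) (simp add: m_def)
 have pA: "prob (?A m) < e / (4 * C)" by (rule m1) (simp add: m_def)
 have gm[measurable]: "g \<in> borel_measurable borel" by (rule borel_measurable_continuous_onI[OF g(1)])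
 have [measurable]: "?A m \<in> sets M" by measurable
 have close: "\<bar>(\<integral>om. g (?s k *\<^sub>R (X k om - z)) \<partial>M) - (\<integral>om. g (?s k *\<^sub>R L.U k om) \<partial>M)\<bar> <= e / 2" if k: "k >= m" for k
 proof -
  have i1: "integrable M (%om. g (?s k *\<^sub>R (X k om - z)))" "integrable M (%om. g (?s k *\<^sub>R L.U k om))"
   by (rule integrable_const_bound[where B = C], use C in simp, measurable)+
  have iA: "integrable M (%om. 2 * C * indicator (?A m) om)"
   by (intro integrable_mult_right integrable_real_indicator) (auto simp: emeasure_eq_measure)
  have "\<bar>\<integral>om. g (?s k *\<^sub>R (X k om - z)) - g (?s k *\<^sub>R L.U k om) \<partial>M\<bar>
    <= (\<integral>om. \<bar>g (?s k *\<^sub>R (X k om - z)) - g (?s k *\<^sub>R L.U k om)\<bar> \<partial>M)" by (rule integral_abs_bound)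
  also have "... <= (\<integral>om. 2 * C * indicator (?A m) om \<partial>M)"
  proof (rule integral_mono[OF _ iA])
   show "integrable M (%om. \<bar>g (?s k *\<^sub>R (X k om - z)) - g (?s k *\<^sub>R L.U k om)\<bar>)"
    by (intro integrable_abs Bochner_Integration.integrable_diff i1)
   fix om assume om: "om \<in> space M"
   show "\<bar>g (?s k *\<^sub>R (X k om - z)) - g (?s k *\<^sub>R L.U k om)\<bar> <= 2 * C * indicator (?A m) om"
   proof (cases "om \<in> ?A m")
    case True
    hence "indicator (?A m) om = (1 :: real)" by (rule indicator_eq_1_iff[THEN iffD2])
    thus ?thesis using C(2)[of "?s k *\<^sub>R (X k om - z)"] C(2)[of "?s k *\<^sub>R L.U k om"] by simp
   next
    case False
    hence "L.stays k om" using om by (auto simp: L.stays_def)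
    thus ?thesis using C(1) by (simp add: L.U_eq[OF k])
   qed
  qed
  also have "... = 2 * C * prob (?A m)" by simp
  also have "... <= 2 * C * (e / (4 * C))" using pA C(1) by (intro mult_left_mono) auto
  also have "... = e / 2" using C(1) by simp
  finally show ?thesis using i1 by simp
 qed
 obtain n0 where n0: "!!k. k >= n0 ==> norm ((\<integral>om. g (?s k *\<^sub>R L.U k om) \<partial>M) - ?Z) < e / 2"
  using LIMSEQ_D[OF L.scaled_weak_limit[OF g], of "e / 2"] e by auto
 have "norm ((\<integral>om. g (?s k *\<^sub>R (X k om - z)) \<partial>M) - ?Z) < e" if "k >= max m n0" for k
  using close[of k] n0[of k] that unfolding real_norm_def by linarith
 thus "\<exists>n0. \<forall>k\<ge>n0. norm ((\<integral>om. g (?s k *\<^sub>R (X k om - z)) \<partial>M) - ?Z) < e" by blast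
qed

end

section \<open>Asymptotic normality\<close>

lemma eigenvalue_eq_quadratic_form:
 fixes P A :: "real^'n::finite^'n"
 assumes P: "orthogonal_matrix P" "P ** A ** transpose P = s *\<^sub>R diag_matrix lam"
 shows "(A *v u) \<bullet> u = s * (\<Sum>i\<in>UNIV. lam i * ((P *v u) $ i)^2)"
proof -
 have "P ** A = s *\<^sub>R diag_matrix lam ** P"
  using P by (metis matrix_mul_assoc matrix_mul_rid orthogonal_matrix)
 hence "P *v (A *v u) = s *\<^sub>R (diag_matrix lam *v (P *v u))"
  by (metis matrix_vector_mul_assoc scaleR_matrix_vector_assoc)
 hence "(A *v u) \<bullet> u = (s *\<^sub>R (diag_matrix lam *v (P *v u))) \<bullet> (P *v u)"
  using orthogonal_matrix_inner[OF P(1), of "A *v u" u] by simp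
 also have "... = s * (\<Sum>i\<in>UNIV. lam i * ((P *v u) $ i)^2)"
  by (simp add: diag_matrix_mult inner_vec_def power2_eq_square mult.assoc sum_distrib_left)
 finally show ?thesis .
qed

text \<open>Identifies the mean of the limit, which is computed in the eigenbasis.\<close>

lemma matrix_inv_diagonalised:
 fixes P A :: "real^'n::finite^'n"
 assumes P: "orthogonal_matrix P" "P ** A ** transpose P = diag_matrix \<kappa>" and \<kappa>: "!!i. \<kappa> i \<noteq> 0"
 shows "matrix_inv A *v w = transpose P *v (\<chi> i. (P *v w) $ i / \<kappa> i)"
proof -
 define y where "y = transpose P *v (\<chi> i. (P *v w) $ i / \<kappa> i)"
 have tP: "transpose P ** P = mat 1" "P ** transpose P = mat 1"
  using P(1) unfolding orthogonal_matrix_def by auto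
 have A: "A = transpose P ** diag_matrix \<kappa> ** P"
  unfolding P(2)[symmetric] using tP by (metis matrix_mul_assoc matrix_mul_lid matrix_mul_rid)
 have Av: "A *v x = transpose P *v (\<chi> i. \<kappa> i * (P *v x) $ i)" for x
  unfolding A by (simp only: matrix_vector_mul_assoc[symmetric] diag_matrix_mult)
 have PT: "P *v (transpose P *v x) = x" "transpose P *v (P *v x) = x" for x
  by (simp_all only: matrix_vector_mul_assoc tP matrix_vector_mul_lid)
 have "(\<chi> i. \<kappa> i * (\<chi> i. (P *v w) $ i / \<kappa> i) $ i) = P *v w" using \<kappa> by (simp add: vec_eq_iff)
 hence Ay: "A *v y = w" unfolding Av y_def by (simp only: PT)
 have "inj ((*v) A)"
 proof (rule injI)
  fix x x' assume "A *v x = A *v x'"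
  hence "P *v (A *v x) = P *v (A *v x')" by simp
  hence "(\<chi> i. \<kappa> i * (P *v x) $ i) = (\<chi> i. \<kappa> i * (P *v x') $ i)" unfolding Av PT .
  hence "P *v x = P *v x'" using \<kappa> by (simp add: vec_eq_iff)
  thus "x = x'" by (metis PT(2))
 qed
 hence "invertible A" by (simp add: invertible_left_inverse matrix_left_invertible_injective)
 hence "A ** matrix_inv A = mat 1 \<and> matrix_inv A ** A = mat 1"
  unfolding invertible_def matrix_inv_def by (rule someI_ex)
 hence "matrix_inv A ** A = mat 1" ..
 hence "matrix_inv A *v (A *v y) = y" by (simp add: matrix_vector_mul_assoc)
 hence "matrix_inv A *v w = y" unfolding Ay .
 thus ?thesis unfolding y_def .
qed

theorem proposition2:
  fixes M :: "'s measure"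
    and f :: "real^'n::finite \<Rightarrow> real"
    and ak ck :: "nat \<Rightarrow> real"
    and X \<xi> \<xi>' :: "nat \<Rightarrow> 's \<Rightarrow> real^'n"
    and ep em :: "nat \<Rightarrow> 's \<Rightarrow> real"
    and a c \<alpha> \<gamma> \<beta> \<beta>p \<sigma> :: real
    and xs T \<mu> :: "real^'n"
    and S :: "(real^'n) set"
    and lam :: "'n \<Rightarrow> real"
    and P Q :: "real^'n^'n"
  assumes algorithm: "spsa1a M f ak ck X \<xi> ep em \<xi>'"
    and f_diff: "\<And>x. f differentiable (at x)"
    and grad_diff: "\<And>x. gradient f differentiable (at x)"
    and pos: "a > 0" "c > 0" "\<alpha> > 0" "\<gamma> > 0"
    and gains: "\<And>k. k \<ge> 1 \<Longrightarrow> ak k = a / real k powr \<alpha>"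
      "\<And>k. k \<ge> 1 \<Longrightarrow> ck k = c / real k powr \<gamma>"
    and noise: "\<And>k. AE \<omega> in M.
      real_cond_exp M (sigma_iter_dir M X \<xi> k) (\<lambda>\<omega>. ep k \<omega> - em k \<omega>) \<omega> = 0"
    and A1: "ak \<longlonglongrightarrow> 0" "ck \<longlonglongrightarrow> 0" "\<not> summable ak" "summable (\<lambda>k. (ak k / ck k)^2)"
    and A2: "\<exists>\<delta>>0. \<exists>\<alpha>\<^sub>0>0. \<exists>\<alpha>\<^sub>1>0. \<forall>k.
      (\<integral>\<^sup>+ \<omega>. ennreal (\<bar>ep k \<omega>\<bar> powr (2 + \<delta>)) \<partial>M) \<le> ennreal \<alpha>\<^sub>0 \<and>
      (\<integral>\<^sup>+ \<omega>. ennreal (\<bar>em k \<omega>\<bar> powr (2 + \<delta>)) \<partial>M) \<le> ennreal \<alpha>\<^sub>0 \<and>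
      (\<integral>\<^sup>+ \<omega>. ennreal (\<bar>f (X k \<omega> + ck k *\<^sub>R \<xi> k \<omega>)\<bar> powr (2 + \<delta>)) \<partial>M) \<le> ennreal \<alpha>\<^sub>1 \<and>
      (\<integral>\<^sup>+ \<omega>. ennreal (\<bar>f (X k \<omega> - ck k *\<^sub>R \<xi> k \<omega>)\<bar> powr (2 + \<delta>)) \<partial>M) \<le> ennreal \<alpha>\<^sub>1"
    and A3: "AE \<omega> in M. bdd_above (range (\<lambda>k. norm (X k \<omega>)))"
    and A4: "asymptotically_stable (\<lambda>x. - gradient f x) xs"
    and A5: "compact S" "S \<subseteq> attraction_domain (\<lambda>x. - gradient f x) xs"
      "AE \<omega> in M. \<exists>\<^sub>\<infinity>k. X k \<omega> \<in> S"
    and A6: "\<exists>K. \<exists>r>0. AE \<omega> in M. \<forall>k\<ge>K. \<forall>i j l.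
      (\<forall>x\<in>ball (X k \<omega>) r. partial_differentiable l (partial j (partial i f)) x) \<and>
      continuous_on (ball (X k \<omega>) r) (third_partial f i j l) \<and>
      bounded (third_partial f i j l ` ball (X k \<omega>) r)"
    and A7: "AE \<omega> in M.
      (\<lambda>k. real_cond_exp M (sigma_iter M X k) (\<lambda>\<omega>. (ep k \<omega> - em k \<omega>)^2) \<omega>) \<longlonglongrightarrow> \<sigma>^2"
    (* h k \<omega> \<eta> is a version of E[(ep k - em k)^2 | X 0, ..., X k, ck k * \<xi> k = \<eta>].  Without its
       measurability in \<omega>, taking h k \<omega> constant in \<eta> would make the condition vacuous. *)
    and A8: "\<exists>(h :: nat \<Rightarrow> 's \<Rightarrow> real^'n \<Rightarrow> real) (C :: nat \<Rightarrow> (real^'n) set) K.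
      (\<forall>k\<ge>K.
        (\<forall>\<eta>. (\<lambda>\<omega>. h k \<omega> \<eta>) \<in> borel_measurable (sigma_iter M X k)) \<and>
        (AE \<omega> in M.
          real_cond_exp M (sigma_iter_dir M X \<xi> k) (\<lambda>\<omega>. (ep k \<omega> - em k \<omega>)^2) \<omega> =
            h k \<omega> (ck k *\<^sub>R \<xi> k \<omega>)) \<and>
        compact (C k) \<and> connected (C k) \<and> (AE \<omega> in M. ck k *\<^sub>R \<xi> k \<omega> \<in> C k)) \<and>
      (AE \<omega> in M.
        (\<forall>e>0. \<exists>d>0. \<forall>k\<ge>K. \<forall>\<eta>. norm \<eta> < d \<longrightarrow> \<bar>h k \<omega> \<eta> - h k \<omega> 0\<bar> < e) \<and>
        (\<forall>k\<ge>K. continuous_on (C k) (h k \<omega>)))"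
    and A9: "\<beta> = \<alpha> - 2 * \<gamma>" "\<beta> > 0" "3 * \<gamma> - \<alpha> / 2 \<ge> 0"
    and A10: "orthogonal_matrix P"
      "P ** hessian f xs ** transpose P = (1 / a) *\<^sub>R diag_matrix lam"
      "\<beta>p = (if \<alpha> = 1 then \<beta> else 0)"
      "\<alpha> = 1 \<Longrightarrow> \<beta> < 2 * Min (range lam)"
    (* the inverses in the covariance matrix exist; for \<alpha> = 1 this follows from A10 *)
    and nondegenerate: "\<And>i. 2 * lam i - \<beta>p \<noteq> 0"
    and Q: "Q = (1/4 * a^2 * inverse (c^2) * \<sigma>^2) *\<^sub>R diag_matrix (\<lambda>i. inverse (2 * lam i - \<beta>p))"
    and T: "T = (\<chi> l. - (1/6) * a * c^2 *
      (third_partial f l l l xs + 3 * (\<Sum>i\<in>UNIV - {l}. third_partial f i i l xs)))"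
    and mu: "\<mu> = (if 3 * \<gamma> - \<alpha> / 2 > 0 then 0
      else matrix_inv (a *\<^sub>R hessian f xs - (1/2 * \<beta>p) *\<^sub>R mat 1) *v T)"
  shows "\<exists>N. gaussian_law N \<and> mean_vector N = \<mu> \<and>
    covariance_matrix N = transpose P ** Q ** P \<and>
    weak_conv_vec (\<lambda>k. distr M borel (\<lambda>\<omega>. real k powr (\<beta> / 2) *\<^sub>R (X k \<omega> - xs))) N"
proof -
 interpret A: spsa1a M f ak ck X \<xi> ep em \<xi>' by (rule algorithm)
 have fcont: "continuous_on UNIV f"
  using f_diff by (simp add: continuous_on_eq_continuous_at differentiable_imp_continuous_within)
 have fm[measurable]: "f \<in> borel_measurable borel" by (rule borel_measurable_continuous_onI[OF fcont])
 note [measurable] = A.rv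
 obtain \<delta> b1 b2 where \<delta>: "\<delta> > 0" and b: "b1 > 0" "b2 > 0"
  and mom: "!!k. (\<integral>\<^sup>+ om. ennreal (\<bar>ep k om\<bar> powr (2 + \<delta>)) \<partial>M) <= ennreal b1"
   "!!k. (\<integral>\<^sup>+ om. ennreal (\<bar>em k om\<bar> powr (2 + \<delta>)) \<partial>M) <= ennreal b1"
   "!!k. (\<integral>\<^sup>+ om. ennreal (\<bar>f (X k om + ck k *\<^sub>R \<xi> k om)\<bar> powr (2 + \<delta>)) \<partial>M) <= ennreal b2"
  using A2 by blast
 \<comment> \<open>the expansion of the noise uses an order between 2 and 3\<close>
 define p where "p = 2 + min \<delta> 1"
 define L where "L = 1 + max b1 b2"
 have p: "p > 2" "p <= 3" "p <= 2 + \<delta>" using \<delta> by (auto simp: p_def)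
 have lower: "(\<integral>\<^sup>+ om. ennreal (\<bar>Y om\<bar> powr p) \<partial>M) <= ennreal L"
  if "Y \<in> borel_measurable M" "(\<integral>\<^sup>+ om. ennreal (\<bar>Y om\<bar> powr (2 + \<delta>)) \<partial>M) <= ennreal b" "b = b1 \<or> b = b2" for Y b
 proof -
  have "b <= max b1 b2" using that(3) by auto
  with that(2) have "(\<integral>\<^sup>+ om. ennreal (\<bar>Y om\<bar> powr (2 + \<delta>)) \<partial>M) <= ennreal (max b1 b2)"
   by (meson ennreal_leI order_trans)
  from A.moment_le_lower_power[OF that(1) this p(3)] p(1) b show ?thesis by (simp add: L_def)
 qed
 interpret B: spsa_noise M f ak ck X \<xi> ep em \<xi>' p L
 proof
  show "continuous_on UNIV f" by (rule fcont)
  show "AE om in M. real_cond_exp M (sigma_iter_dir M X \<xi> k) (%om. ep k om - em k om) om = 0" for k by (rule noise)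
  show "p > 2" "L > 0" using p b by (auto simp: L_def)
  show "(\<integral>\<^sup>+ om. ennreal (\<bar>ep k om\<bar> powr p) \<partial>M) <= ennreal L" for k
   by (rule lower[OF _ mom(1)]) simp_all
  show "(\<integral>\<^sup>+ om. ennreal (\<bar>em k om\<bar> powr p) \<partial>M) <= ennreal L" for k
   by (rule lower[OF _ mom(2)]) simp_all
  show "(\<integral>\<^sup>+ om. ennreal (\<bar>f (X k om + ck k *\<^sub>R \<xi> k om)\<bar> powr p) \<partial>M) <= ennreal L" for k
   by (rule lower[OF _ mom(3)]) simp_all
 qed
 have zero: "gradient f xs = 0" by (rule stable_equilibrium_gradient_zero[OF A4])
 \<comment> \<open>eigenvectors of the Hessian test its nonnegativity\<close>
 have lam0: "lam i >= 0" for i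
 proof -
  define u where "u = transpose P *v axis i 1"
  have "P *v u = axis i 1"
   using A10(1) unfolding u_def orthogonal_matrix_def by (simp only: matrix_vector_mul_assoc matrix_vector_mul_lid)
  hence "(hessian f xs *v u) \<bullet> u = 1 / a * (\<Sum>j\<in>UNIV. lam j * (axis i 1 $ j)^2)"
   unfolding eigenvalue_eq_quadratic_form[OF A10(1,2)] by simp
  also have "(\<Sum>j\<in>UNIV. lam j * (axis i 1 $ j)^2) = (\<Sum>j\<in>UNIV. if j = i then lam j else 0)"
   by (intro sum.cong) (auto simp: axis_def)
  also have "... = lam i" by simp
  finally have "(hessian f xs *v u) \<bullet> u = lam i / a" by simp
  with stable_equilibrium_hessian_nonneg[OF f_diff grad_diff A4, of u] pos(1) show ?thesis
   by (simp add: zero_le_divide_iff)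
 qed
 define \<kappa> where "\<kappa> i = lam i - (if \<alpha> = 1 then \<beta> / 2 else 0)" for i
 have \<kappa>2: "2 * \<kappa> i = 2 * lam i - \<beta>p" for i using A10(3) by (simp add: \<kappa>_def)
 have \<kappa>: "\<kappa> i > 0" for i
 proof (cases "\<alpha> = 1")
  case True
  have "Min (range lam) <= lam i" by (rule Min_le) auto
  hence "\<beta> < 2 * lam i" using A10(4)[OF True] by linarith
  thus ?thesis using True by (simp add: \<kappa>_def)
 next
  case False
  thus ?thesis using nondegenerate[of i] lam0[of i] A10(3) by (simp add: \<kappa>_def)
 qed
 have lam: "lam i > 0" for i using \<kappa>[of i] A9(2) by (auto simp: \<kappa>_def split: if_splits)
 define l0 where "l0 = Min (range lam)"
 have l0: "l0 > 0" "l0 <= lam i" for i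
  using lam unfolding l0_def by (auto simp: Min_gr_iff)
 have coercive: "l0 / a * (norm u)^2 <= (hessian f xs *v u) \<bullet> u" for u
 proof -
  have "(norm u)^2 = (norm (P *v u))^2" by (simp only: orthogonal_matrix_norm[OF A10(1)])
  also have "... = (\<Sum>i\<in>UNIV. ((P *v u) $ i)^2)" unfolding power2_norm_eq_inner inner_vec_def by (simp add: power2_eq_square)
  finally have "l0 * (norm u)^2 = (\<Sum>i\<in>UNIV. l0 * ((P *v u) $ i)^2)" by (simp only: sum_distrib_left)
  also have "... <= (\<Sum>i\<in>UNIV. lam i * ((P *v u) $ i)^2)" by (intro sum_mono mult_right_mono l0) auto
  finally show ?thesis
   unfolding eigenvalue_eq_quadratic_form[OF A10(1,2)] using pos(1) by (simp add: divide_right_mono)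
 qed
 have ck_le: "k >= 1 ==> ck k <= c" for k
  using pos by (simp add: gains(2) divide_le_eq ge_one_powr_ge_zero)
 obtain K1 r where r: "r > 0" and smooth: "AE om in M. \<forall>k\<ge>K1. \<forall>i j l.
   (\<forall>x\<in>ball (X k om) r. partial_differentiable l (partial j (partial i f)) x) \<and>
   continuous_on (ball (X k om) r) (third_partial f i j l) \<and>
   bounded (third_partial f i j l ` ball (X k om) r)" using A6 by blast
 have noise_sum: "AE om in M. summable (%k. ak k *\<^sub>R B.err k om)"
  by (rule B.noise_sum_converges[OF ck_le A1(4)])
 have Xlim: "AE om in M. (%k. X k om) \<longlonglongrightarrow> xs"
  using noise_sum A3 A5(3) smooth
 proof eventually_elim
  case (elim om)
  show ?case
  proof (rule perturbed_gradient_scheme_converges[where f = f and a = ak and c = ck and e = "%k. B.err k om"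
     and S = S and r = r and K = K1 and \<kappa> = "l0 / a"])
   show "X (Suc k) om = X k om - ak k *\<^sub>R (spsa_mean f (ck k) (X k om) + B.err k om)" for k
    using A.gains_pos(1)[of k] by (simp add: B.err_def B.mean_step_def)
   show "bounded (range (%k. X k om))" using elim(2) by (auto simp: bdd_above_def bounded_iff)
  qed (use f_diff grad_diff A.gains_pos A1 elim zero l0(1) pos coercive A5 r in auto)
 qed
 \<comment> \<open>a single convergent path shows that f is smooth around its limit\<close>
 obtain om0 where om0: "(%k. X k om0) \<longlonglongrightarrow> xs" "\<forall>k\<ge>K1. \<forall>i j l.
   (\<forall>x\<in>ball (X k om0) r. partial_differentiable l (partial j (partial i f)) x) \<and>
   continuous_on (ball (X k om0) r) (third_partial f i j l)"
 proof -
  have "AE om in M. (%k. X k om) \<longlonglongrightarrow> xs \<and> (\<forall>k\<ge>K1. \<forall>i j l.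
   (\<forall>x\<in>ball (X k om) r. partial_differentiable l (partial j (partial i f)) x) \<and>
   continuous_on (ball (X k om) r) (third_partial f i j l))"
   using Xlim smooth by eventually_elim blast
  from eventually_happens[OF this] A.ae_filter_bot that show ?thesis by blast
 qed
 obtain k1 where k1: "k1 >= K1" "dist (X k1 om0) xs < r / 2"
  using metric_LIMSEQ_D[OF om0(1), of "r / 2"] r by (meson half_gt_zero max.cobounded1 max.cobounded2)
 have sub: "ball xs (r / 2) \<subseteq> ball (X k1 om0) r"
 proof
  fix x assume "x \<in> ball xs (r / 2)"
  thus "x \<in> ball (X k1 om0) r" using k1(2) dist_triangle[of "X k1 om0" x xs] by simp
 qed
 obtain h :: "nat => 's => real^'n => real" and Cs :: "nat => (real^'n) set" and K where
   h: "!!k \<eta>. k >= K ==> (%om. h k om \<eta>) \<in> borel_measurable (sigma_iter M X k)"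
   "!!k. k >= K ==> AE om in M. real_cond_exp M (sigma_iter_dir M X \<xi> k) (%om. (ep k om - em k om)^2) om = h k om (ck k *\<^sub>R \<xi> k om)"
  and h_eq: "AE om in M. (\<forall>e>0. \<exists>d>0. \<forall>k\<ge>K. \<forall>\<eta>. norm \<eta> < d --> \<bar>h k om \<eta> - h k om 0\<bar> < e) \<and>
    (\<forall>k\<ge>K. continuous_on (Cs k) (h k om))"
  using A8 by blast
 \<comment> \<open>otherwise the gains would be summable\<close>
 have \<alpha>: "\<alpha> <= 1"
 proof (rule ccontr)
  assume "\<not> \<alpha> <= 1"
  hence "summable (%k. a * real k powr (- \<alpha>))" by (intro summable_mult) (simp add: summable_real_powr_iff)
  moreover have "\<forall>\<^sub>F k in sequentially. norm (ak k) <= a * real k powr (- \<alpha>)"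
   using eventually_ge_at_top[of 1]
   by eventually_elim (use pos in \<open>simp add: gains(1) powr_minus divide_inverse\<close>)
  ultimately have "summable ak" by (rule summable_comparison_test_ev[rotated])
  with A1(3) show False ..
 qed
 interpret N: spsa_normality M f ak ck X \<xi> ep em \<xi>' p L h K \<sigma> xs "r / 2" a c \<alpha> \<gamma> \<beta> P lam \<kappa>
 proof
  show "AE om in M. \<forall>e>0. \<exists>d>0. \<forall>k\<ge>K. \<forall>\<eta>. norm \<eta> < d --> \<bar>h k om \<eta> - h k om 0\<bar> < e"
   using h_eq by eventually_elim blast
  show "partial_differentiable l (partial j (partial i f)) x" if "x \<in> ball xs (r / 2)" for x i j l
   using om0(2) k1(1) subsetD[OF sub that] by blast
  show "continuous_on (ball xs (r / 2)) (third_partial f i j l)" for i j l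
   using om0(2) k1(1) continuous_on_subset[OF _ sub] by blast
  show "\<kappa> i = lam i - (if \<alpha> = 1 then \<beta> / 2 else 0)" for i by (rule \<kappa>_def)
 qed (rule A1(2) Xlim A7 h f_diff grad_diff p(2) pos \<alpha> gains A9(1,3) zero A10(1,2) \<kappa> half_gt_zero[OF r] | assumption)+
 interpret G: gaussian_parameters N.\<mu>lim P N.vlim
  by standard (use \<kappa> in \<open>simp add: N.vlim_def less_imp_le\<close>)
 let ?N = "gauss N.\<mu>lim P N.vlim"
 have mean: "N.\<mu>lim = \<mu>"
 proof (cases "3 * \<gamma> - \<alpha> / 2 > 0")
  case True
  thus ?thesis by (simp add: N.\<mu>lim_def N.shift_def mu matrix_vector_mult_0_right zero_vec_def[symmetric])
 next
  case False
  have "N.shift = T"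
   using False by (simp add: N.shift_def N.bias_def T vec_eq_iff field_simps)
  moreover have "P ** (a *\<^sub>R hessian f xs - (1/2 * \<beta>p) *\<^sub>R mat 1) ** transpose P = diag_matrix \<kappa>"
  proof (rule iffD2[OF matrix_eq], rule allI)
   fix x :: "real^'n"
   define y where "y = transpose P *v x"
   have Py: "P *v y = x"
    using A10(1) unfolding y_def orthogonal_matrix_def by (simp only: matrix_vector_mul_assoc matrix_vector_mul_lid)
   have "P *v (hessian f xs *v y) = (P ** hessian f xs ** transpose P) *v x"
    unfolding y_def by (simp only: matrix_vector_mul_assoc matrix_mul_assoc)
   also have "... = (1 / a) *\<^sub>R (diag_matrix lam *v x)" unfolding A10(2) by (rule scaleR_matrix_vector_assoc[symmetric])
   finally have PH: "P *v (hessian f xs *v y) = (1 / a) *\<^sub>R (diag_matrix lam *v x)" .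
   have "(P ** (a *\<^sub>R hessian f xs - (1/2 * \<beta>p) *\<^sub>R mat 1) ** transpose P) *v x
     = P *v ((a *\<^sub>R hessian f xs - (1/2 * \<beta>p) *\<^sub>R mat 1) *v y)"
    unfolding y_def by (simp only: matrix_vector_mul_assoc matrix_mul_assoc)
   also have "(a *\<^sub>R hessian f xs - (1/2 * \<beta>p) *\<^sub>R mat 1) *v y = a *\<^sub>R (hessian f xs *v y) - (1/2 * \<beta>p) *\<^sub>R y"
    by (simp only: matrix_vector_mult_diff_rdistrib scaleR_matrix_vector_assoc[symmetric] matrix_vector_mul_lid)
   also have "P *v ... = a *\<^sub>R (P *v (hessian f xs *v y)) - (1/2 * \<beta>p) *\<^sub>R (P *v y)"
    by (simp only: matrix_vector_mult_diff_distrib matrix_vector_mult_scaleR)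
   also have "... = diag_matrix lam *v x - (1/2 * \<beta>p) *\<^sub>R x" unfolding PH Py using pos(1) by simp
   also have "... = diag_matrix \<kappa> *v x"
   proof -
    have "\<kappa> i = lam i - 1/2 * \<beta>p" for i using \<kappa>2[of i] by simp
    thus ?thesis by (simp add: diag_matrix_mult vec_eq_iff left_diff_distrib)
   qed
   finally show "(P ** (a *\<^sub>R hessian f xs - (1/2 * \<beta>p) *\<^sub>R mat 1) ** transpose P) *v x = diag_matrix \<kappa> *v x" .
  qed
  ultimately show ?thesis
   using False matrix_inv_diagonalised[OF A10(1)] \<kappa> by (simp add: N.\<mu>lim_def mu less_imp_neq[symmetric] order_less_imp_not_eq2)
 qed
 have vlim: "Q = diag_matrix N.vlim"
 proof -
  have "1/4 * a^2 * inverse (c^2) * \<sigma>^2 * inverse (2 * lam i - \<beta>p) = N.vlim i" for i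
   unfolding N.vlim_def \<kappa>2 divide_inverse power_mult_distrib power_inverse by (simp only: mult_ac mult_1_left mult_1_right)
  thus ?thesis unfolding Q by (simp add: diag_matrix_def vec_eq_iff)
 qed
 show ?thesis
 proof (intro exI[of _ ?N] conjI)
  show "gaussian_law ?N" by (rule G.gaussian_law_gauss)
  show "mean_vector ?N = \<mu>" unfolding G.mean_vector_gauss by (rule mean)
  show "covariance_matrix ?N = transpose P ** Q ** P" unfolding G.covariance_matrix_gauss vlim ..
  show "weak_conv_vec (%k. distr M borel (%om. real k powr (\<beta> / 2) *\<^sub>R (X k om - xs))) ?N"
   unfolding weak_conv_vec_def
  proof (intro allI impI)
   fix g :: "real^'n => real" assume g: "continuous_on UNIV g \<and> bounded (range g)"
   have [measurable]: "g \<in> borel_measurable borel" using g by (intro borel_measurable_continuous_onI) simp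
   have "(\<integral>x. g x \<partial>distr M borel (%om. real k powr (\<beta> / 2) *\<^sub>R (X k om - xs)))
     = (\<integral>om. g (real k powr (\<beta> / 2) *\<^sub>R (X k om - xs)) \<partial>M)" for k
    by (rule integral_distr) measurable
   thus "(%k. \<integral>x. g x \<partial>distr M borel (%om. real k powr (\<beta> / 2) *\<^sub>R (X k om - xs))) \<longlonglongrightarrow> (\<integral>x. g x \<partial>?N)"
    using N.asymptotic_law[of g] g by simp
  qed
 qed
qed

end
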